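(* If $\mathrm{ZFC}$ is consistent, then the collection of all countable computably saturated models of $\mathrm{ZFC}$ satisfies all of the multiverse axioms (1)–(8) (Realizability, Forcing Extension, Class Forcing Extension, Countability, Wellfoundedness Mirage, Reverse Ultrapower, Strong Reverse Ultrapower, and Reverse Embedding).
   Context: A model $M$ of a computable language is \emph{computably saturated} if for every finite tuple $\bar a$ in $M$, every finitely realizable computable type $p(\bar a,\bar x)$ is already realized in $M$; a type $p(\bar y,\bar x)$ is computable if the set of Gödel codes of its formulas is computable. A \emph{multiverse} is a nonempty set or class of models of $\mathrm{ZFC}$. The members of a multiverse are called universes. When it is said that one model $M$ is an element of (or a set in) another model $N$, what is meant is that there is an object in $N$ that $N$ thinks is a pair $\langle m,E\rangle$ with $E$ a binary relation on $m$, and externally the set $\{a\in N\mid N\models a\in m\}$ with the relation $\{(a,b)\mid N\models a\mathrel{E}b\}$ is isomorphic to $M$ with its membership relation. It is not required that $N$ regard $M$ as a model of $\mathrm{ZFC}$ (when $N$ has nonstandard $\omega$, its version of $\mathrm{ZFC}$ may include nonstandard axioms). Multiverse axioms for a multiverse $\mathcal M$: (1) Realizability: whenever $M\in\mathcal M$ and $N$ is a definable class of $M$ satisfying $\mathrm{ZFC}$ from the perspective of $M$ (i.e. satisfying $M$'s own version of $\mathrm{ZFC}$), then $N\in\mathcal M$. (2) Forcing Extension: whenever $M\in\mathcal M$ and $\mathbb P$ is a forcing notion in $M$, then $\mathcal M$ has a forcing extension of $M$ by $\mathbb P$, a model of the form $M[G]$, where $G$ is an $M$-generic filter for $\mathbb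 P$. (3) Class Forcing Extension: whenever $M\in\mathcal M$ and $\mathbb P$ is a $\mathrm{ZFC}$-preserving class forcing notion in $M$, then $\mathcal M$ has a forcing extension of $M$ by $\mathbb P$, a model of the form $M[G]$, where $G$ is an $M$-generic filter for $\mathbb P$. (4) Countability: for every $M\in\mathcal M$ there is another $N\in\mathcal M$ such that $M$ is a countable set in $N$. (5) Wellfoundedness Mirage: for every $M\in\mathcal M$ there is $N\in\mathcal M$ which thinks $M$ is a set with an ill-founded $\omega$. (6) Reverse Ultrapower: for every $M\in\mathcal M$ there is $N\in\mathcal M$ such that $M$ is the internal ultrapower of $N$ by an ultrafilter on $\omega$ in $N$. (7) Strong Reverse Ultrapower: for every $M_1\in\mathcal M$ and every ultrafilter $U_1$ in $M_1$ on a set $X_1$ in $M_1$, there is $M_0\in\mathcal M$, with an ultrafilter $U_0$ on a set $X_0$, such that $M_1$ is the internal ultrapower of $M_0$ by $U_0$, sending $U_0$ to $U_1$. (8) Reverse Embedding: for every $M_1\in\mathcal M$ and every embedding $j_1:M_1\to M_2$ definable in $M_1$ from parameters and thought by $M_1$ to be elementary, there is $M_0\in\mathcal M$ and similarly definable $j_0:M_0\to M_1$ in $M_0$ such that $j_1$ is the iterate of $j_0$, meaning $j_1=j_0(j_0)$; that is, if $j_0$ is definable by $\varphi(x,y,a)$ over $M_0$, then $j_1$ is definable by $\varphi(x,y,j_0(a))$ over $M_1$. *)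

theory Defs
  imports "HOL-Library.Nat_Bijection" "HOL-Library.Countable_Set"
begin

section \<open>First-order logic in the language of set theory\<close>

text \<open>Formulas use named variables (natural numbers).\<close>

datatype fm = Mem nat nat | Equ nat nat | Neg fm | Imp fm fm | All nat fm

abbreviation Con :: "fm \<Rightarrow> fm \<Rightarrow> fm" where "Con \<phi> \<psi> \<equiv> Neg (Imp \<phi> (Neg \<psi>))"
abbreviation Dis :: "fm \<Rightarrow> fm \<Rightarrow> fm" where "Dis \<phi> \<psi> \<equiv> Imp (Neg \<phi>) \<psi>"
abbreviation Iff :: "fm \<Rightarrow> fm \<Rightarrow> fm" where "Iff \<phi> \<psi> \<equiv> Con (Imp \<phi> \<psi>) (Imp \<psi> \<phi>)"
abbreviation Exi :: "nat \<Rightarrow> fm \<Rightarrow> fm" where "Exi v \<phi> \<equiv> Neg (All v (Neg \<phi>))"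

primrec fv :: "fm \<Rightarrow> nat set" where
  "fv (Mem i j) = {i, j}"
| "fv (Equ i j) = {i, j}"
| "fv (Neg \<phi>) = fv \<phi>"
| "fv (Imp \<phi> \<psi>) = fv \<phi> \<union> fv \<psi>"
| "fv (All v \<phi>) = fv \<phi> - {v}"

text \<open>\<open>subst x y \<phi>\<close> replaces the free occurrences of \<open>x\<close> by \<open>y\<close>; no bound variable is
  renamed, so it is only meaningful if \<open>free_for y x \<phi>\<close>.\<close>

primrec subst :: "nat \<Rightarrow> nat \<Rightarrow> fm \<Rightarrow> fm" where
  "subst x y (Mem i j) = Mem (if i = x then y else i) (if j = x then y else j)"
| "subst x y (Equ i j) = Equ (if i = x then y else i) (if j = x then y else j)"
| "subst x y (Neg \<phi>) = Neg (subst x y \<phi>)"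
| "subst x y (Imp \<phi> \<psi>) = Imp (subst x y \<phi>) (subst x y \<psi>)"
| "subst x y (All v \<phi>) = (if v = x then All v \<phi> else All v (subst x y \<phi>))"

primrec free_for :: "nat \<Rightarrow> nat \<Rightarrow> fm \<Rightarrow> bool" where
  "free_for y x (Mem i j) \<longleftrightarrow> True"
| "free_for y x (Equ i j) \<longleftrightarrow> True"
| "free_for y x (Neg \<phi>) \<longleftrightarrow> free_for y x \<phi>"
| "free_for y x (Imp \<phi> \<psi>) \<longleftrightarrow> free_for y x \<phi> \<and> free_for y x \<psi>"
| "free_for y x (All v \<phi>) \<longleftrightarrow> v = x \<or> (v = y \<longrightarrow> x \<notin> fv \<phi>) \<and> free_for y x \<phi>"

text \<open>A Hilbert calculus for first-order logic with equality (as in Mendelson's textbook). Because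
  of the unrestricted generalization rule, open formulas in \<open>T\<close> act as their universal
  closures.\<close>

inductive deriv :: "fm set \<Rightarrow> fm \<Rightarrow> bool" for T where
  hyp: "\<phi> \<in> T \<Longrightarrow> deriv T \<phi>"
| A1: "deriv T (Imp \<phi> (Imp \<psi> \<phi>))"
| A2: "deriv T (Imp (Imp \<phi> (Imp \<psi> \<chi>)) (Imp (Imp \<phi> \<psi>) (Imp \<phi> \<chi>)))"
| A3: "deriv T (Imp (Imp (Neg \<psi>) (Neg \<phi>)) (Imp (Imp (Neg \<psi>) \<phi>) \<psi>))"
| A4: "free_for y x \<phi> \<Longrightarrow> deriv T (Imp (All x \<phi>) (subst x y \<phi>))"
| A5: "x \<notin> fv \<phi> \<Longrightarrow> deriv T (Imp (All x (Imp \<phi> \<psi>)) (Imp \<phi> (All x \<psi>)))"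
| eq_refl: "deriv T (Equ x x)"
| eq_equ: "deriv T (Imp (Equ x y) (Imp (Equ x z) (Equ y z)))"
| eq_mem1: "deriv T (Imp (Equ x y) (Imp (Mem x z) (Mem y z)))"
| eq_mem2: "deriv T (Imp (Equ x y) (Imp (Mem z x) (Mem z y)))"
| MP: "deriv T (Imp \<phi> \<psi>) \<Longrightarrow> deriv T \<phi> \<Longrightarrow> deriv T \<psi>"
| Gen: "deriv T \<phi> \<Longrightarrow> deriv T (All x \<phi>)"

definition consistent :: "fm set \<Rightarrow> bool" where
  "consistent T \<longleftrightarrow> \<not> (\<exists>\<phi>. deriv T \<phi> \<and> deriv T (Neg \<phi>))"

record 'a struct =
  carr :: "'a set"
  mem :: "('a \<times> 'a) set"

definition is_struct :: "'a struct \<Rightarrow> bool" where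
  "is_struct M \<longleftrightarrow> carr M \<noteq> {} \<and> mem M \<subseteq> carr M \<times> carr M"

primrec sat :: "'a struct \<Rightarrow> (nat \<Rightarrow> 'a) \<Rightarrow> fm \<Rightarrow> bool" where
  "sat M e (Mem i j) \<longleftrightarrow> (e i, e j) \<in> mem M"
| "sat M e (Equ i j) \<longleftrightarrow> e i = e j"
| "sat M e (Neg \<phi>) \<longleftrightarrow> \<not> sat M e \<phi>"
| "sat M e (Imp \<phi> \<psi>) \<longleftrightarrow> (sat M e \<phi> \<longrightarrow> sat M e \<psi>)"
| "sat M e (All v \<phi>) \<longleftrightarrow> (\<forall>x \<in> carr M. sat M (e(v := x)) \<phi>)"

definition is_model :: "'a struct \<Rightarrow> fm set \<Rightarrow> bool" where
  "is_model M T \<longleftrightarrow>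
     is_struct M \<and> (\<forall>\<phi> \<in> T. \<forall>e. range e \<subseteq> carr M \<longrightarrow> sat M e \<phi>)"

definition struct_iso :: "('a \<Rightarrow> 'b) \<Rightarrow> 'a struct \<Rightarrow> 'b struct \<Rightarrow> bool" where
  "struct_iso h A B \<longleftrightarrow> bij_betw h (carr A) (carr B) \<and>
     (\<forall>x \<in> carr A. \<forall>y \<in> carr A. (x, y) \<in> mem A \<longleftrightarrow> (h x, h y) \<in> mem B)"

definition isomorphic :: "'a struct \<Rightarrow> 'b struct \<Rightarrow> bool" where
  "isomorphic A B \<longleftrightarrow> (\<exists>h. struct_iso h A B)"

text \<open>The relations defined over \<open>M\<close> by \<open>\<phi>\<close>: the arguments are the variables \<open>0\<close>, \<open>1\<close>, \<open>2\<close>, the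
  remaining variables carry parameters. A formula mentions only finitely many of them, so letting
  \<open>a\<close> be an infinite sequence amounts to finitely many parameters.\<close>

definition def1 :: "'a struct \<Rightarrow> fm \<Rightarrow> (nat \<Rightarrow> 'a) \<Rightarrow> 'a set" where
  "def1 M \<phi> a = {x \<in> carr M. sat M (a(0 := x)) \<phi>}"

definition def2 :: "'a struct \<Rightarrow> fm \<Rightarrow> (nat \<Rightarrow> 'a) \<Rightarrow> ('a \<times> 'a) set" where
  "def2 M \<phi> a = {(x, y). x \<in> carr M \<and> y \<in> carr M \<and> sat M (a(0 := x, 1 := y)) \<phi>}"

definition def3 :: "'a struct \<Rightarrow> fm \<Rightarrow> (nat \<Rightarrow> 'a) \<Rightarrow> ('a \<times> 'a \<times> 'a) set" where
  "def3 M \<phi> a = {(x, y, z). x \<in> carr M \<and> y \<in> carr M \<and> z \<in> carr M \<and>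
     sat M (a(0 := x, 1 := y, 2 := z)) \<phi>}"

definition definable1 :: "'a struct \<Rightarrow> 'a set \<Rightarrow> bool" where
  "definable1 M R \<longleftrightarrow> (\<exists>\<phi> a. range a \<subseteq> carr M \<and> R = def1 M \<phi> a)"

definition definable2 :: "'a struct \<Rightarrow> ('a \<times> 'a) set \<Rightarrow> bool" where
  "definable2 M R \<longleftrightarrow> (\<exists>\<phi> a. range a \<subseteq> carr M \<and> R = def2 M \<phi> a)"

definition definable3 :: "'a struct \<Rightarrow> ('a \<times> 'a \<times> 'a) set \<Rightarrow> bool" where
  "definable3 M R \<longleftrightarrow> (\<exists>\<phi> a. range a \<subseteq> carr M \<and> R = def3 M \<phi> a)"

definition definable_struct :: "'a struct \<Rightarrow> 'a struct \<Rightarrow> bool" where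
  "definable_struct M N \<longleftrightarrow>
     is_struct N \<and> definable1 M (carr N) \<and> definable2 M (mem N)"


section \<open>ZFC\<close>

definition ax_extensionality :: fm where
  "ax_extensionality = All 0 (All 1 (Imp (All 2 (Iff (Mem 2 0) (Mem 2 1))) (Equ 0 1)))"

definition ax_foundation :: fm where
  "ax_foundation = All 0 (Imp (Exi 1 (Mem 1 0))
     (Exi 1 (Con (Mem 1 0) (Neg (Exi 2 (Con (Mem 2 1) (Mem 2 0)))))))"

definition ax_pairing :: fm where
  "ax_pairing = All 0 (All 1 (Exi 2 (All 3 (Iff (Mem 3 2) (Dis (Equ 3 0) (Equ 3 1))))))"

definition ax_union :: fm where
  "ax_union = All 0 (Exi 1 (All 2 (Iff (Mem 2 1) (Exi 3 (Con (Mem 2 3) (Mem 3 0))))))"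

definition ax_power :: fm where
  "ax_power = All 0 (Exi 1 (All 2 (Iff (Mem 2 1) (All 3 (Imp (Mem 3 2) (Mem 3 0))))))"

definition ax_infinity :: fm where
  "ax_infinity = Exi 0 (Con
     (Exi 1 (Con (Mem 1 0) (All 2 (Neg (Mem 2 1)))))
     (All 1 (Imp (Mem 1 0)
       (Exi 2 (Con (Mem 2 0) (All 3 (Iff (Mem 3 2) (Dis (Mem 3 1) (Equ 3 1)))))))))"

text \<open>Every set of nonempty pairwise disjoint sets has a transversal.\<close>

definition ax_choice :: fm where
  "ax_choice = All 0 (Imp
     (Con (All 1 (Imp (Mem 1 0) (Exi 2 (Mem 2 1))))
          (All 1 (All 2 (Imp (Con (Mem 1 0) (Con (Mem 2 0) (Neg (Equ 1 2))))
             (Neg (Exi 3 (Con (Mem 3 1) (Mem 3 2))))))))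
     (Exi 4 (All 1 (Imp (Mem 1 0)
        (Exi 2 (All 3 (Iff (Con (Mem 3 1) (Mem 3 4)) (Equ 3 2))))))))"

definition single_axioms :: "fm set" where
  "single_axioms = {ax_extensionality, ax_foundation, ax_pairing, ax_union, ax_power,
     ax_infinity, ax_choice}"

text \<open>Schemes: variables other than the displayed ones are parameters. Separation requires
  \<open>2 \<notin> fv \<phi>\<close>; replacement (for \<open>\<phi>(0, 1)\<close> functional on the set \<open>2\<close>) requires \<open>3 \<notin> fv \<phi>\<close>.\<close>

definition separation :: "fm \<Rightarrow> fm" where
  "separation \<phi> = All 1 (Exi 2 (All 0 (Iff (Mem 0 2) (Con (Mem 0 1) \<phi>))))"

definition replacement :: "fm \<Rightarrow> fm" where
  "replacement \<phi> = All 2 (Imp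
     (All 0 (Imp (Mem 0 2) (Exi 3 (All 1 (Iff \<phi> (Equ 1 3))))))
     (Exi 3 (All 1 (Iff (Mem 1 3) (Exi 0 (Con (Mem 0 2) \<phi>))))))"

definition zfc :: "fm set" where
  "zfc = single_axioms \<union> {separation \<phi> | \<phi>. 2 \<notin> fv \<phi>} \<union> {replacement \<phi> | \<phi>. 3 \<notin> fv \<phi>}"


section \<open>Computable saturation\<close>

text \<open>Total recursive functions: the least class containing the initial functions and closed under
  composition, primitive recursion and minimization of regular functions. Only the values on
  lists whose length is the arity matter.\<close>

inductive recursive_fun :: "nat \<Rightarrow> (nat list \<Rightarrow> nat) \<Rightarrow> bool" where
  zero: "recursive_fun n (\<lambda>_. 0)"
| succ: "recursive_fun 1 (\<lambda>xs. Suc (xs ! 0))"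
| proj: "i < n \<Longrightarrow> recursive_fun n (\<lambda>xs. xs ! i)"
| comp: "recursive_fun (length gs) f \<Longrightarrow> (\<forall>g \<in> set gs. recursive_fun n g) \<Longrightarrow>
    recursive_fun n (\<lambda>xs. f (map (\<lambda>g. g xs) gs))"
| prim_rec: "recursive_fun n f \<Longrightarrow> recursive_fun (n + 2) g \<Longrightarrow>
    recursive_fun (n + 1) (\<lambda>xs. rec_nat (f (tl xs)) (\<lambda>k r. g (k # r # tl xs)) (hd xs))"
| minimize: "recursive_fun (n + 1) f \<Longrightarrow> (\<forall>xs. length xs = n \<longrightarrow> (\<exists>y. f (y # xs) = 0)) \<Longrightarrow>
    recursive_fun n (\<lambda>xs. LEAST y. f (y # xs) = 0)"

definition computable_set :: "nat set \<Rightarrow> bool" where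
  "computable_set A \<longleftrightarrow>
     (\<exists>f. recursive_fun 1 f \<and> (\<forall>x. f [x] = (if x \<in> A then 1 else 0)))"

primrec godel :: "fm \<Rightarrow> nat" where
  "godel (Mem i j) = prod_encode (0, prod_encode (i, j))"
| "godel (Equ i j) = prod_encode (1, prod_encode (i, j))"
| "godel (Neg \<phi>) = prod_encode (2, godel \<phi>)"
| "godel (Imp \<phi> \<psi>) = prod_encode (3, prod_encode (godel \<phi>, godel \<psi>))"
| "godel (All v \<phi>) = prod_encode (4, prod_encode (v, godel \<phi>))"

text \<open>In a type \<open>p\<close> the variables below \<open>k\<close> are the tuple \<open>xs\<close> to be realized, followed by the
  parameters \<open>as\<close>.\<close>

definition realizes :: "'a struct \<Rightarrow> 'a list \<Rightarrow> 'a list \<Rightarrow> fm set \<Rightarrow> bool" where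
  "realizes M as xs p \<longleftrightarrow> (\<forall>\<phi> \<in> p. sat M ((!) (xs @ as)) \<phi>)"

definition computably_saturated :: "'a struct \<Rightarrow> bool" where
  "computably_saturated M \<longleftrightarrow>
     (\<forall>as k p. set as \<subseteq> carr M \<and> (\<forall>\<phi> \<in> p. fv \<phi> \<subseteq> {..<k + length as}) \<and>
        computable_set (godel ` p) \<and>
        (\<forall>q \<subseteq> p. finite q \<longrightarrow>
           (\<exists>xs. length xs = k \<and> set xs \<subseteq> carr M \<and> realizes M as xs q)) \<longrightarrow>
        (\<exists>xs. length xs = k \<and> set xs \<subseteq> carr M \<and> realizes M as xs p))"


section \<open>Notions internal to a model of set theory\<close>

text \<open>What a model \<open>M\<close> of ZFC thinks is expressed by relativizing all quantifiers to
  \<open>carr M\<close>. The functions below are given by definite descriptions and are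
  meaningful when \<open>M\<close> is a model of ZFC.\<close>

definition ext :: "'a struct \<Rightarrow> 'a \<Rightarrow> 'a set" where
  "ext M x = {y \<in> carr M. (y, x) \<in> mem M}"

definition set_in :: "'a struct \<Rightarrow> 'a set \<Rightarrow> 'a" where
  "set_in M A = (THE x. x \<in> carr M \<and> ext M x = A)"

definition pair_in :: "'a struct \<Rightarrow> 'a \<Rightarrow> 'a \<Rightarrow> 'a" where
  "pair_in M x y = set_in M {set_in M {x}, set_in M {x, y}}"

definition empty_in :: "'a struct \<Rightarrow> 'a" where
  "empty_in M = set_in M {}"

definition succ_in :: "'a struct \<Rightarrow> 'a \<Rightarrow> 'a" where
  "succ_in M x = set_in M (insert x (ext M x))"

definition inductive_in :: "'a struct \<Rightarrow> 'a \<Rightarrow> bool" where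
  "inductive_in M w \<longleftrightarrow> w \<in> carr M \<and> empty_in M \<in> ext M w \<and> (\<forall>x \<in> ext M w. succ_in M x \<in> ext M w)"

definition omega_in :: "'a struct \<Rightarrow> 'a" where
  "omega_in M = set_in M {x \<in> carr M. \<forall>w. inductive_in M w \<longrightarrow> x \<in> ext M w}"

text \<open>The external relation coded by an element \<open>r\<close> of \<open>M\<close>.\<close>

definition rel_in :: "'a struct \<Rightarrow> 'a \<Rightarrow> ('a \<times> 'a) set" where
  "rel_in M r = {(x, y). x \<in> carr M \<and> y \<in> carr M \<and> pair_in M x y \<in> ext M r}"

definition binrel_in :: "'a struct \<Rightarrow> 'a \<Rightarrow> 'a \<Rightarrow> bool" where
  "binrel_in M m r \<longleftrightarrow> m \<in> carr M \<and> r \<in> carr M \<and>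
     (\<forall>z \<in> ext M r. \<exists>x \<in> ext M m. \<exists>y \<in> ext M m. z = pair_in M x y)"

definition fun_in :: "'a struct \<Rightarrow> 'a \<Rightarrow> 'a \<Rightarrow> bool" where
  "fun_in M X f \<longleftrightarrow> f \<in> carr M \<and>
     (\<forall>z \<in> ext M f. \<exists>x \<in> ext M X. \<exists>y \<in> carr M. z = pair_in M x y) \<and>
     (\<forall>x \<in> ext M X. \<exists>!y. (x, y) \<in> rel_in M f)"

definition app_in :: "'a struct \<Rightarrow> 'a \<Rightarrow> 'a \<Rightarrow> 'a" where
  "app_in M f x = (THE y. (x, y) \<in> rel_in M f)"

definition maps_in :: "'a struct \<Rightarrow> 'a \<Rightarrow> 'a \<Rightarrow> 'a \<Rightarrow> bool" where
  "maps_in M X Y f \<longleftrightarrow> fun_in M X f \<and> (\<forall>x \<in> ext M X. app_in M f x \<in> ext M Y)"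

text \<open>The structure \<open>\<langle>m, r\<rangle>\<close>, an element of \<open>M\<close>, seen from outside.\<close>

definition coded :: "'a struct \<Rightarrow> 'a \<Rightarrow> 'a \<Rightarrow> 'a struct" where
  "coded M m r = \<lparr>carr = ext M m, mem = rel_in M r\<rparr>"

definition codes_set_in :: "'a struct \<Rightarrow> 'a \<Rightarrow> 'a \<Rightarrow> 'b struct \<Rightarrow> bool" where
  "codes_set_in N m r M \<longleftrightarrow> binrel_in N m r \<and> isomorphic (coded N m r) M"

definition countable_in :: "'a struct \<Rightarrow> 'a \<Rightarrow> bool" where
  "countable_in M m \<longleftrightarrow>
     (\<exists>f. maps_in M m (omega_in M) f \<and> inj_on (app_in M f) (ext M m))"


subsection \<open>The version of ZFC that a model has\<close>

primrec num_in :: "'a struct \<Rightarrow> nat \<Rightarrow> 'a" where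
  "num_in M 0 = empty_in M"
| "num_in M (Suc n) = succ_in M (num_in M n)"

text \<open>Codes in \<open>M\<close> of formulas; the variables are the elements of the \<open>\<omega>\<close> of \<open>M\<close>, so both
  variables and formulas may be nonstandard.\<close>

definition mem_code :: "'a struct \<Rightarrow> 'a \<Rightarrow> 'a \<Rightarrow> 'a" where
  "mem_code M i j = pair_in M (num_in M 0) (pair_in M i j)"

definition equ_code :: "'a struct \<Rightarrow> 'a \<Rightarrow> 'a \<Rightarrow> 'a" where
  "equ_code M i j = pair_in M (num_in M 1) (pair_in M i j)"

definition neg_code :: "'a struct \<Rightarrow> 'a \<Rightarrow> 'a" where
  "neg_code M c = pair_in M (num_in M 2) c"

definition imp_code :: "'a struct \<Rightarrow> 'a \<Rightarrow> 'a \<Rightarrow> 'a" where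
  "imp_code M c d = pair_in M (num_in M 3) (pair_in M c d)"

definition all_code :: "'a struct \<Rightarrow> 'a \<Rightarrow> 'a \<Rightarrow> 'a" where
  "all_code M v c = pair_in M (num_in M 4) (pair_in M v c)"

text \<open>\<open>c\<close> is a formula iff it belongs to a set \<open>t\<close> closed under immediate subformulas all of whose
  elements have the form of a formula (\<open>M\<close> satisfies foundation). Freeness of variables
  is treated in the same way.\<close>

definition fm_in :: "'a struct \<Rightarrow> 'a \<Rightarrow> bool" where
  "fm_in M c \<longleftrightarrow> (\<exists>t \<in> carr M. c \<in> ext M t \<and> (\<forall>d \<in> ext M t.
     (\<exists>i \<in> ext M (omega_in M). \<exists>j \<in> ext M (omega_in M). d = mem_code M i j \<or> d = equ_code M i j) \<or>
     (\<exists>a \<in> ext M t. d = neg_code M a) \<or>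
     (\<exists>a \<in> ext M t. \<exists>b \<in> ext M t. d = imp_code M a b) \<or>
     (\<exists>v \<in> ext M (omega_in M). \<exists>a \<in> ext M t. d = all_code M v a)))"

definition not_free_in :: "'a struct \<Rightarrow> 'a \<Rightarrow> 'a \<Rightarrow> bool" where
  "not_free_in M v c \<longleftrightarrow> (\<exists>t \<in> carr M. c \<in> ext M t \<and> (\<forall>d \<in> ext M t.
     (\<exists>i \<in> ext M (omega_in M). \<exists>j \<in> ext M (omega_in M).
        i \<noteq> v \<and> j \<noteq> v \<and> (d = mem_code M i j \<or> d = equ_code M i j)) \<or>
     (\<exists>a \<in> ext M t. d = neg_code M a) \<or>
     (\<exists>a \<in> ext M t. \<exists>b \<in> ext M t. d = imp_code M a b) \<or>
     (\<exists>u \<in> ext M (omega_in M). \<exists>a \<in> ext M t. d = all_code M u a) \<or>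
     (\<exists>a. fm_in M a \<and> d = all_code M v a)))"

primrec quote_in :: "'a struct \<Rightarrow> fm \<Rightarrow> 'a" where
  "quote_in M (Mem i j) = mem_code M (num_in M i) (num_in M j)"
| "quote_in M (Equ i j) = equ_code M (num_in M i) (num_in M j)"
| "quote_in M (Neg \<phi>) = neg_code M (quote_in M \<phi>)"
| "quote_in M (Imp \<phi> \<psi>) = imp_code M (quote_in M \<phi>) (quote_in M \<psi>)"
| "quote_in M (All v \<phi>) = all_code M (num_in M v) (quote_in M \<phi>)"

definition con_code :: "'a struct \<Rightarrow> 'a \<Rightarrow> 'a \<Rightarrow> 'a" where
  "con_code M c d = neg_code M (imp_code M c (neg_code M d))"

definition iff_code :: "'a struct \<Rightarrow> 'a \<Rightarrow> 'a \<Rightarrow> 'a" where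
  "iff_code M c d = con_code M (imp_code M c d) (imp_code M d c)"

definition exi_code :: "'a struct \<Rightarrow> 'a \<Rightarrow> 'a \<Rightarrow> 'a" where
  "exi_code M v c = neg_code M (all_code M v (neg_code M c))"

definition separation_code :: "'a struct \<Rightarrow> 'a \<Rightarrow> 'a" where
  "separation_code M c =
     all_code M (num_in M 1) (exi_code M (num_in M 2) (all_code M (num_in M 0)
       (iff_code M (quote_in M (Mem 0 2)) (con_code M (quote_in M (Mem 0 1)) c))))"

definition replacement_code :: "'a struct \<Rightarrow> 'a \<Rightarrow> 'a" where
  "replacement_code M c = all_code M (num_in M 2) (imp_code M
     (all_code M (num_in M 0) (imp_code M (quote_in M (Mem 0 2))
        (exi_code M (num_in M 3) (all_code M (num_in M 1) (iff_code M c (quote_in M (Equ 1 3)))))))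
     (exi_code M (num_in M 3) (all_code M (num_in M 1) (iff_code M (quote_in M (Mem 1 3))
        (exi_code M (num_in M 0) (con_code M (quote_in M (Mem 0 2)) c))))))"

definition zfc_in :: "'a struct \<Rightarrow> 'a set" where
  "zfc_in M = quote_in M ` single_axioms \<union>
     {separation_code M c | c. fm_in M c \<and> not_free_in M (num_in M 2) c} \<union>
     {replacement_code M c | c. fm_in M c \<and> not_free_in M (num_in M 3) c}"

text \<open>\<open>M\<close> thinks that \<open>S\<close> is the satisfaction relation of the structure \<open>\<langle>m, r\<rangle>\<close>, a set of pairs of a
  formula and an assignment \<open>s : \<omega> \<rightarrow> m\<close>.\<close>

definition sat_rel_in :: "'a struct \<Rightarrow> 'a \<Rightarrow> 'a \<Rightarrow> 'a \<Rightarrow> bool" where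
  "sat_rel_in M m r S \<longleftrightarrow> S \<in> carr M \<and> (\<forall>s. maps_in M (omega_in M) m s \<longrightarrow>
     (\<forall>i \<in> ext M (omega_in M). \<forall>j \<in> ext M (omega_in M).
        ((mem_code M i j, s) \<in> rel_in M S \<longleftrightarrow> (app_in M s i, app_in M s j) \<in> rel_in M r) \<and>
        ((equ_code M i j, s) \<in> rel_in M S \<longleftrightarrow> app_in M s i = app_in M s j)) \<and>
     (\<forall>c. fm_in M c \<longrightarrow> ((neg_code M c, s) \<in> rel_in M S \<longleftrightarrow> (c, s) \<notin> rel_in M S)) \<and>
     (\<forall>c d. fm_in M c \<and> fm_in M d \<longrightarrow>
        ((imp_code M c d, s) \<in> rel_in M S \<longleftrightarrow>
         ((c, s) \<in> rel_in M S \<longrightarrow> (d, s) \<in> rel_in M S))) \<and>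
     (\<forall>v \<in> ext M (omega_in M). \<forall>c. fm_in M c \<longrightarrow>
        ((all_code M v c, s) \<in> rel_in M S \<longleftrightarrow>
         (\<forall>s'. maps_in M (omega_in M) m s' \<and>
            (\<forall>i \<in> ext M (omega_in M). i \<noteq> v \<longrightarrow> app_in M s' i = app_in M s i) \<longrightarrow>
            (c, s') \<in> rel_in M S))))"

definition thinks_set_model_zfc :: "'a struct \<Rightarrow> 'a \<Rightarrow> 'a \<Rightarrow> bool" where
  "thinks_set_model_zfc M m r \<longleftrightarrow> binrel_in M m r \<and> ext M m \<noteq> {} \<and>
     (\<exists>S. sat_rel_in M m r S \<and>
        (\<forall>c \<in> zfc_in M. \<forall>s. maps_in M (omega_in M) m s \<longrightarrow> (c, s) \<in> rel_in M S))"

text \<open>For a definable class structure \<open>N\<close> of \<open>M\<close>: if \<open>N\<close> is a set in \<open>M\<close>, then \<open>M\<close> has its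
  satisfaction relation and can assert that all of its own (possibly nonstandard) axioms hold.
  If \<open>N\<close> is a proper class, \<open>M\<close> has in general no truth predicate for \<open>N\<close>, and
  satisfying ZFC is the scheme saying that \<open>M\<close> satisfies the relativization to \<open>N\<close> of
  each axiom, i.e. that the axiom holds in \<open>N\<close>.\<close>

definition thinks_model_zfc :: "'a struct \<Rightarrow> 'a struct \<Rightarrow> bool" where
  "thinks_model_zfc M N \<longleftrightarrow>
     (if \<exists>m \<in> carr M. ext M m = carr N
      then \<exists>m r. coded M m r = N \<and> thinks_set_model_zfc M m r
      else is_model N zfc)"


subsection \<open>Forcing\<close>

definition forcing_notion :: "'a set \<Rightarrow> ('a \<times> 'a) set \<Rightarrow> bool" where
  "forcing_notion P le \<longleftrightarrow> P \<noteq> {} \<and> le \<subseteq> P \<times> P \<and> refl_on P le \<and> trans le"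

definition dense_in :: "'a set \<Rightarrow> ('a \<times> 'a) set \<Rightarrow> 'a set \<Rightarrow> bool" where
  "dense_in P le D \<longleftrightarrow> D \<subseteq> P \<and> (\<forall>p \<in> P. \<exists>d \<in> D. (d, p) \<in> le)"

text \<open>\<open>\<D>\<close> is the family of sets or classes available in the ground model.\<close>

definition generic_filter :: "'a set \<Rightarrow> ('a \<times> 'a) set \<Rightarrow> 'a set set \<Rightarrow> 'a set \<Rightarrow> bool" where
  "generic_filter P le \<D> G \<longleftrightarrow> G \<subseteq> P \<and> G \<noteq> {} \<and>
     (\<forall>p \<in> G. \<forall>q \<in> P. (p, q) \<in> le \<longrightarrow> q \<in> G) \<and>
     (\<forall>p \<in> G. \<forall>q \<in> G. \<exists>r \<in> G. (r, p) \<in> le \<and> (r, q) \<in> le) \<and>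
     (\<forall>D \<in> \<D>. dense_in P le D \<longrightarrow> D \<inter> G \<noteq> {})"

definition sets_of :: "'a struct \<Rightarrow> 'a set set" where
  "sets_of M = ext M ` carr M"

definition classes_of :: "'a struct \<Rightarrow> 'a set set" where
  "classes_of M = {D. definable1 M D}"

text \<open>\<open>P\<close>-names of \<open>M\<close>: hereditarily, sets of pairs of a name and a condition.\<close>

definition names :: "'a struct \<Rightarrow> 'a set \<Rightarrow> 'a set" where
  "names M P = {\<sigma>. \<exists>t \<in> carr M. \<sigma> \<in> ext M t \<and>
     (\<forall>y \<in> ext M t. \<forall>z \<in> ext M y. \<exists>\<rho> \<in> ext M t. \<exists>p \<in> P. z = pair_in M \<rho> p)}"

text \<open>The recursion for the forcing relation on atomic formulas: \<open>(p, \<sigma>, \<tau>) \<in> Feq\<close> means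
  \<open>p \<tturnstile> \<sigma> = \<tau>\<close> and \<open>(p, \<sigma>, \<tau>) \<in> Fmem\<close> means \<open>p \<tturnstile> \<sigma> \<in> \<tau>\<close>. Among classes
  definable in \<open>M\<close> the solution is unique by \<open>\<in>\<close>-induction in \<open>M\<close>.\<close>

definition atomic_forcing :: "'a struct \<Rightarrow> 'a set \<Rightarrow> ('a \<times> 'a) set \<Rightarrow>
    ('a \<times> 'a \<times> 'a) set \<Rightarrow> ('a \<times> 'a \<times> 'a) set \<Rightarrow> bool" where
  "atomic_forcing M P le Feq Fmem \<longleftrightarrow>
     definable3 M Feq \<and> definable3 M Fmem \<and>
     Feq \<subseteq> P \<times> names M P \<times> names M P \<and> Fmem \<subseteq> P \<times> names M P \<times> names M P \<and>
     (\<forall>p \<in> P. \<forall>\<sigma> \<in> names M P. \<forall>\<tau> \<in> names M P.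
        ((p, \<sigma>, \<tau>) \<in> Feq \<longleftrightarrow>
          (\<forall>\<rho> \<in> names M P. \<forall>r \<in> P. pair_in M \<rho> r \<in> ext M \<sigma> \<union> ext M \<tau> \<longrightarrow>
             (\<forall>q. (q, p) \<in> le \<longrightarrow> ((q, \<rho>, \<sigma>) \<in> Fmem \<longleftrightarrow> (q, \<rho>, \<tau>) \<in> Fmem)))) \<and>
        ((p, \<sigma>, \<tau>) \<in> Fmem \<longleftrightarrow>
          (\<forall>p'. (p', p) \<in> le \<longrightarrow> (\<exists>q. (q, p') \<in> le \<and>
             (\<exists>\<rho> \<in> names M P. \<exists>r \<in> P. pair_in M \<rho> r \<in> ext M \<tau> \<and>
                (q, r) \<in> le \<and> (q, \<sigma>, \<rho>) \<in> Feq)))))"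

text \<open>\<open>M[G]\<close> for a possibly ill-founded \<open>M\<close>: names modulo being forced equal by some condition
  in \<open>G\<close>, with the membership forced by some condition in \<open>G\<close>.\<close>

definition name_eq :: "'a struct \<Rightarrow> 'a set \<Rightarrow> ('a \<times> 'a \<times> 'a) set \<Rightarrow> 'a set \<Rightarrow> ('a \<times> 'a) set" where
  "name_eq M P Feq G =
     {(\<sigma>, \<tau>). \<sigma> \<in> names M P \<and> \<tau> \<in> names M P \<and> (\<exists>p \<in> G. (p, \<sigma>, \<tau>) \<in> Feq)}"

definition generic_ext :: "'a struct \<Rightarrow> 'a set \<Rightarrow>
    ('a \<times> 'a \<times> 'a) set \<Rightarrow> ('a \<times> 'a \<times> 'a) set \<Rightarrow> 'a set \<Rightarrow> 'a set struct" where
  "generic_ext M P Feq Fmem G =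
     \<lparr>carr = names M P // name_eq M P Feq G,
      mem = {(name_eq M P Feq G `` {\<sigma>}, name_eq M P Feq G `` {\<tau>}) | \<sigma> \<tau>.
               \<sigma> \<in> names M P \<and> \<tau> \<in> names M P \<and> (\<exists>p \<in> G. (p, \<sigma>, \<tau>) \<in> Fmem)}\<rparr>"

definition is_generic_ext :: "'a struct \<Rightarrow> 'a set \<Rightarrow> ('a \<times> 'a) set \<Rightarrow> 'a set \<Rightarrow> 'b struct \<Rightarrow> bool"
  where
  "is_generic_ext M P le G N \<longleftrightarrow>
     (\<exists>Feq Fmem. atomic_forcing M P le Feq Fmem \<and> isomorphic (generic_ext M P Feq Fmem G) N)"

text \<open>A class forcing notion has a weakest condition, so that the ground model embeds by the
  usual check names, and a definable forcing relation for atomic formulas, so that its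
  extensions make sense over ill-founded models. For set forcing the latter is automatic.\<close>

definition class_forcing_notion :: "'a struct \<Rightarrow> 'a set \<Rightarrow> ('a \<times> 'a) set \<Rightarrow> bool" where
  "class_forcing_notion M P le \<longleftrightarrow>
     definable1 M P \<and> definable2 M le \<and> forcing_notion P le \<and>
     (\<exists>top \<in> P. \<forall>p \<in> P. (p, top) \<in> le) \<and>
     (\<exists>Feq Fmem. atomic_forcing M P le Feq Fmem)"

definition zfc_preserving :: "'a struct \<Rightarrow> 'a set \<Rightarrow> ('a \<times> 'a) set \<Rightarrow> bool" where
  "zfc_preserving M P le \<longleftrightarrow>
     (\<forall>G Feq Fmem. generic_filter P le (classes_of M) G \<and> atomic_forcing M P le Feq Fmem \<longrightarrow>
        is_model (generic_ext M P Feq Fmem G) zfc)"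


subsection \<open>Internal ultrapowers\<close>

definition ultrafilter_in :: "'a struct \<Rightarrow> 'a \<Rightarrow> 'a \<Rightarrow> bool" where
  "ultrafilter_in M X U \<longleftrightarrow> X \<in> carr M \<and> U \<in> carr M \<and>
     (\<forall>u \<in> ext M U. ext M u \<subseteq> ext M X \<and> ext M u \<noteq> {}) \<and> X \<in> ext M U \<and>
     (\<forall>u \<in> ext M U. \<forall>v \<in> ext M U. \<forall>w \<in> carr M. ext M w = ext M u \<inter> ext M v \<longrightarrow> w \<in> ext M U) \<and>
     (\<forall>u \<in> ext M U. \<forall>v \<in> carr M. ext M u \<subseteq> ext M v \<and> ext M v \<subseteq> ext M X \<longrightarrow> v \<in> ext M U) \<and>
     (\<forall>u \<in> carr M. \<forall>v \<in> carr M. ext M u \<subseteq> ext M X \<and> ext M v = ext M X - ext M u \<longrightarrow>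
        u \<in> ext M U \<or> v \<in> ext M U)"

definition ult_eq :: "'a struct \<Rightarrow> 'a \<Rightarrow> 'a \<Rightarrow> ('a \<times> 'a) set" where
  "ult_eq M X U = {(f, g). fun_in M X f \<and> fun_in M X g \<and>
     (\<exists>u \<in> ext M U. ext M u = {x \<in> ext M X. app_in M f x = app_in M g x})}"

definition ultrapower :: "'a struct \<Rightarrow> 'a \<Rightarrow> 'a \<Rightarrow> 'a set struct" where
  "ultrapower M X U =
     \<lparr>carr = {f. fun_in M X f} // ult_eq M X U,
      mem = {(ult_eq M X U `` {f}, ult_eq M X U `` {g}) | f g. fun_in M X f \<and> fun_in M X g \<and>
        (\<exists>u \<in> ext M U. ext M u = {x \<in> ext M X. (app_in M f x, app_in M g x) \<in> mem M})}\<rparr>"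

definition const_in :: "'a struct \<Rightarrow> 'a \<Rightarrow> 'a \<Rightarrow> 'a" where
  "const_in M X a = (THE f. fun_in M X f \<and> (\<forall>x \<in> ext M X. app_in M f x = a))"

definition ult_emb :: "'a struct \<Rightarrow> 'a \<Rightarrow> 'a \<Rightarrow> 'a \<Rightarrow> 'a set" where
  "ult_emb M X U a = ult_eq M X U `` {const_in M X a}"


subsection \<open>Definable elementary embeddings\<close>

text \<open>A model can assert the elementarity of a definable class embedding only as a scheme, one
  assertion for each formula; this is elementarity as seen from outside.\<close>

definition elementary :: "('a \<Rightarrow> 'b) \<Rightarrow> 'a struct \<Rightarrow> 'b struct \<Rightarrow> bool" where
  "elementary j A B \<longleftrightarrow> j ` carr A \<subseteq> carr B \<and>
     (\<forall>\<phi> e. range e \<subseteq> carr A \<longrightarrow> (sat A e \<phi> \<longleftrightarrow> sat B (j \<circ> e) \<phi>))"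

definition graph_on :: "'a struct \<Rightarrow> ('a \<Rightarrow> 'b) \<Rightarrow> ('a \<times> 'b) set" where
  "graph_on M j = {(x, j x) | x. x \<in> carr M}"

definition definable_embedding :: "'a struct \<Rightarrow> ('a \<Rightarrow> 'a) \<Rightarrow> 'a struct \<Rightarrow> bool" where
  "definable_embedding M j N \<longleftrightarrow>
     definable_struct M N \<and> definable2 M (graph_on M j) \<and> elementary j M N"

text \<open>\<open>h : M0 \<rightarrow> M1\<close> takes the class embedding \<open>k : M0 \<rightarrow> N0\<close> of \<open>M0\<close> to the class embedding
  \<open>j : M1 \<rightarrow> N1\<close> of \<open>M1\<close>: any definitions of the target and of the graph over \<open>M0\<close>, with
  the parameters moved by \<open>h\<close>, define the corresponding classes over \<open>M1\<close>.\<close>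

definition sends_embedding :: "('a \<Rightarrow> 'b) \<Rightarrow> 'a struct \<Rightarrow> ('a \<Rightarrow> 'a) \<Rightarrow> 'a struct \<Rightarrow>
    'b struct \<Rightarrow> ('b \<Rightarrow> 'b) \<Rightarrow> 'b struct \<Rightarrow> bool" where
  "sends_embedding h M0 k N0 M1 j N1 \<longleftrightarrow> (\<forall>\<phi> a. range a \<subseteq> carr M0 \<longrightarrow>
     (def2 M0 \<phi> a = graph_on M0 k \<longrightarrow> def2 M1 \<phi> (h \<circ> a) = graph_on M1 j) \<and>
     (def1 M0 \<phi> a = carr N0 \<longrightarrow> def1 M1 \<phi> (h \<circ> a) = carr N1) \<and>
     (def2 M0 \<phi> a = mem N0 \<longrightarrow> def2 M1 \<phi> (h \<circ> a) = mem N1))"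


section \<open>The multiverse axioms\<close>

definition multiverse :: "'a struct set \<Rightarrow> bool" where
  "multiverse \<M> \<longleftrightarrow> \<M> \<noteq> {} \<and> (\<forall>M \<in> \<M>. is_model M zfc)"

definition realizability_axiom :: "'a struct set \<Rightarrow> bool" where
  "realizability_axiom \<M> \<longleftrightarrow>
     (\<forall>M \<in> \<M>. \<forall>N. definable_struct M N \<and> thinks_model_zfc M N \<longrightarrow> N \<in> \<M>)"

definition forcing_extension_axiom :: "'a struct set \<Rightarrow> bool" where
  "forcing_extension_axiom \<M> \<longleftrightarrow>
     (\<forall>M \<in> \<M>. \<forall>P le. binrel_in M P le \<and> forcing_notion (ext M P) (rel_in M le) \<longrightarrow>
        (\<exists>N \<in> \<M>. \<exists>G. generic_filter (ext M P) (rel_in M le) (sets_of M) G \<and>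
           is_generic_ext M (ext M P) (rel_in M le) G N))"

definition class_forcing_extension_axiom :: "'a struct set \<Rightarrow> bool" where
  "class_forcing_extension_axiom \<M> \<longleftrightarrow>
     (\<forall>M \<in> \<M>. \<forall>P le. class_forcing_notion M P le \<and> zfc_preserving M P le \<longrightarrow>
        (\<exists>N \<in> \<M>. \<exists>G. generic_filter P le (classes_of M) G \<and> is_generic_ext M P le G N))"

definition countability_axiom :: "'a struct set \<Rightarrow> bool" where
  "countability_axiom \<M> \<longleftrightarrow>
     (\<forall>M \<in> \<M>. \<exists>N \<in> \<M>. N \<noteq> M \<and> (\<exists>m r. codes_set_in N m r M \<and> countable_in N m))"

definition wellfoundedness_mirage_axiom :: "'a struct set \<Rightarrow> bool" where
  "wellfoundedness_mirage_axiom \<M> \<longleftrightarrow>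
     (\<forall>M \<in> \<M>. \<exists>N \<in> \<M>. \<exists>m r. codes_set_in N m r M \<and>
        (\<exists>s \<in> carr N. ext N s \<noteq> {} \<and> ext N s \<subseteq> ext (coded N m r) (omega_in (coded N m r)) \<and>
           (\<forall>x \<in> ext N s. \<exists>y \<in> ext N s. (y, x) \<in> rel_in N r)))"

definition reverse_ultrapower_axiom :: "'a struct set \<Rightarrow> bool" where
  "reverse_ultrapower_axiom \<M> \<longleftrightarrow>
     (\<forall>M \<in> \<M>. \<exists>N \<in> \<M>. \<exists>U. ultrafilter_in N (omega_in N) U \<and>
        isomorphic (ultrapower N (omega_in N) U) M)"

definition strong_reverse_ultrapower_axiom :: "'a struct set \<Rightarrow> bool" where
  "strong_reverse_ultrapower_axiom \<M> \<longleftrightarrow>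
     (\<forall>M1 \<in> \<M>. \<forall>X1 U1. ultrafilter_in M1 X1 U1 \<longrightarrow>
        (\<exists>M0 \<in> \<M>. \<exists>X0 U0 h. ultrafilter_in M0 X0 U0 \<and>
           struct_iso h (ultrapower M0 X0 U0) M1 \<and> h (ult_emb M0 X0 U0 U0) = U1))"

text \<open>Here \<open>M1\<close> is identified with the class structure \<open>N0\<close> of \<open>M0\<close> along the isomorphism \<open>\<pi>\<close>, so
  that the embedding \<open>j0 : M0 \<rightarrow> M1\<close> is \<open>\<pi> \<circ> k\<close> for the embedding \<open>k : M0 \<rightarrow> N0\<close> definable
  in \<open>M0\<close>.\<close>

definition reverse_embedding_axiom :: "'a struct set \<Rightarrow> bool" where
  "reverse_embedding_axiom \<M> \<longleftrightarrow>
     (\<forall>M1 \<in> \<M>. \<forall>M2 j1. definable_embedding M1 j1 M2 \<longrightarrow>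
        (\<exists>M0 \<in> \<M>. \<exists>N0 k \<pi>. definable_embedding M0 k N0 \<and> struct_iso \<pi> N0 M1 \<and>
           sends_embedding (\<pi> \<circ> k) M0 k N0 M1 j1 M2))"

text \<open>The models live on subsets of \<open>'a\<close>; if \<open>'a\<close> is infinite, every countable structure is
  isomorphic to one of this kind.\<close>

definition countable_saturated_models :: "'a struct set" where
  "countable_saturated_models =
     {M. countable (carr M) \<and> is_model M zfc \<and> computably_saturated M}"

end

theory Submission
 imports Defs "HOL-Library.Countable"
begin

text \<open>The engine is a back-and-forth argument. If a countable computably saturated model \<open>A\<close> interprets a
 structure \<open>B\<close> with the theory of \<open>A\<close> (over corresponding finite tuples), then \<open>A\<close> and \<open>B\<close> are isomorphic:
 \<open>A\<close> can compare its own truth with that of \<open>B\<close> formula by formula, so the types to be realized are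
 computable types of \<open>A\<close>. Internal ultrapowers (by the theorem of Los) and definable elementary embeddings
 give such structures \<open>B\<close>, and pulling the isomorphism back yields the three reverse axioms. For Countability
 and the Mirage, a countable set \<open>m\<close> of \<open>M\<close> with \<open>(m, \<in>)\<close> elementarily equivalent to \<open>M\<close> exists by
 Loewenheim--Skolem and saturation, so \<open>M\<close> contains a copy of itself, and then also one with an ultrapower.
 For the forcing axioms, forcing is definable, hence the conditions that decide whether a given type is
 realized are dense, and a filter meeting the countably many dense sets in question gives a saturated
 extension. Realizability is saturation of interpreted structures, and a Henkin construction that treats every
 computable type starts the multiverse.\<close>

text \<open>The models asked for by the three reverse axioms are all taken to be the given
  \<open>M\<close> itself; only an isomorphism remains to be found. Models may be ill-founded and
  need not define their own truth. Hence set theory is done inside them by a calculus of definable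
  properties \<open>df\<close> and definable terms \<open>dft\<close>, whose closure rules supply
  the formulas for Separation and Replacement, and every induction along membership concerns a
  definable property. Saturation has its price: the codes of each type must form a computable set.
  So renaming, relativization to an interpreted structure and forcing are shown to be recursive on
  Goedel codes, and a type that is only enumerated is padded until it is computable. In the opposite
  direction every number is decoded to some formula, so that "all formulas" becomes a type indexed
  by all of \<open>nat\<close>. The dense sets that make a generic extension saturated need not be
  classes of \<open>M\<close>. They are countable in number because there are only countably many
  programs, and they are dense because a condition together with a tuple of names can be sought as
  one realization of a type of \<open>M\<close>.\<close>

abbreviation (input) equivalent :: "bool => bool => bool" (infixr "<->" 25)
 where "A <-> B == A = B"

abbreviation (input) CSM :: "'a struct set" where "CSM == countable_saturated_models"

section \<open>Satisfaction, renaming of variables, isomorphic copies\<close>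

lemma sat_cong:
 "(!!i. i:fv ph ==> e i = e' i) ==> sat M e ph <-> sat M e' ph"
proof (induction ph arbitrary: e e')
 case (Neg ph)
 thus ?case by (metis fv.simps(3) sat.simps(3))
next
 case (Imp ph psi)
 have "sat M e ph = sat M e' ph" by (rule Imp.IH(1)) (simp add: Imp.prems)
 moreover have "sat M e psi = sat M e' psi" by (rule Imp.IH(2)) (simp add: Imp.prems)
 ultimately show ?case by simp
next
 case (All v ph)
 have "sat M (e(v := x)) ph = sat M (e'(v := x)) ph" for x
  by (rule All.IH) (use All.prems in auto)
 thus ?case by simp
qed simp_all

lemma finite_fv [simp]: "finite (fv ph)"
 by (induction ph) auto

lemma fv_bound: "EX n. fv ph <= {..<n}"
 by (metis finite_fv finite_nat_iff_bounded)

primrec ren :: "(nat => nat) => fm => fm" where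
 "ren f (Mem i j) = Mem (f i) (f j)"
| "ren f (Equ i j) = Equ (f i) (f j)"
| "ren f (Neg ph) = Neg (ren f ph)"
| "ren f (Imp ph psi) = Imp (ren f ph) (ren f psi)"
| "ren f (All v ph) = All (f v) (ren f ph)"

lemma sat_ren: "inj f ==> sat M e (ren f ph) <-> sat M (e o f) ph"
proof (induction ph arbitrary: e)
 case (All v ph)
 have "(e(f v := x)) o f = (e o f)(v := x)" for x
  using All.prems by (auto simp: fun_eq_iff inj_eq)
 thus ?case using All by (simp only: ren.simps sat.simps)
qed simp_all

lemma fv_ren: "inj f ==> fv (ren f ph) = f ` fv ph"
 by (induction ph) (auto simp: inj_eq)

lemma sat_iso:
 assumes "struct_iso h A B" "!!i. i:fv ph ==> e i : carr A"
 shows "sat A e ph <-> sat B (h o e) ph"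
 using assms(2)
proof (induction ph arbitrary: e)
 case (Mem i j)
 thus ?case using assms(1) by (simp add: struct_iso_def)
next
 case (Equ i j)
 thus ?case using assms(1) by (auto simp: struct_iso_def bij_betw_def inj_on_def)
next
 case (All v ph)
 have "(h o e)(v := h x) = h o e(v := x)" for x by auto
 moreover have "sat A (e(v := x)) ph = sat B (h o e(v := x)) ph" if "x:carr A" for x
  by (rule All.IH) (use All.prems that in auto)
 moreover have "carr B = h ` carr A" using assms(1) by (simp add: struct_iso_def bij_betw_def)
 ultimately show ?case by (simp only: sat.simps ball_simps cong: ball_cong)
qed auto

lemma struct_iso_sym:
 assumes "struct_iso h A B"
 shows "struct_iso (inv_into (carr A) h) B A"
proof -
 have h: "bij_betw h (carr A) (carr B)" using assms by (simp add: struct_iso_def)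
 have g: "bij_betw (inv_into (carr A) h) (carr B) (carr A)" using bij_betw_inv_into[OF h] .
 have "(x, y):mem B <-> (inv_into (carr A) h x, inv_into (carr A) h y) : mem A"
  if "x:carr B" "y:carr B" for x y
  using assms that bij_betw_inv_into_right[OF h] bij_betw_apply[OF g] by (simp add: struct_iso_def)
 thus ?thesis using g by (simp add: struct_iso_def)
qed

lemma struct_iso_comp:
 "struct_iso h A B ==> struct_iso g B C ==> struct_iso (g o h) A C"
 by (auto simp: struct_iso_def intro: bij_betw_trans) (metis bij_betw_apply)+

lemma isomorphic_trans: "isomorphic A B ==> isomorphic B C ==> isomorphic A C"
 unfolding isomorphic_def using struct_iso_comp by blast

text \<open>Elementarity and the theorem of Los speak of environments with range in the carrier. A
  default value at the remaining variables makes them applicable when only the values at free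
  variables are known to lie there.\<close>

lemma env_restrict:
 assumes "carr A ~= {}" "!!i. i:fv ph ==> e i : carr A"
 obtains e' where "range e' <= carr A" "sat A e' ph <-> sat A e ph"
  "!!i. i:fv ph ==> e' i = e i"
proof -
 obtain c where c: "c:carr A" using assms(1) by blast
 show ?thesis
  by (rule that[of "%i. if i : fv ph then e i else c"]) (use assms(2) c in "auto intro!: sat_cong")
qed

text \<open>\<open>struct_iso\<close> does not constrain pairs outside the carriers, hence the
  separate assumption on \<open>mem B\<close>.\<close>

lemma is_model_iso:
 assumes "struct_iso h A B" "is_model A T" "mem B <= carr B \<times> carr B"
 shows "is_model B T"
proof -
 let ?g = "inv_into (carr A) h"
 have g: "struct_iso ?g B A" using struct_iso_sym[OF assms(1)] .
 have bij: "bij_betw ?g (carr B) (carr A)" using g by (simp add: struct_iso_def)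
 have "carr B ~= {}" using assms bij by (auto simp: is_model_def is_struct_def bij_betw_def)
 moreover have "sat B e ph" if "ph:T" "range e <= carr B" for ph e
 proof -
  have "sat B e ph <-> sat A (?g o e) ph" by (rule sat_iso[OF g]) (use that in auto)
  moreover have "range (?g o e) <= carr A" using that bij by (fastforce simp: bij_betw_def)
  ultimately show ?thesis using assms(2) that by (simp add: is_model_def)
 qed
 ultimately show ?thesis using assms(3) by (simp add: is_model_def is_struct_def)
qed

lemma computably_saturated_iso:
 assumes "struct_iso h A B" "computably_saturated A"
 shows "computably_saturated B"
 unfolding computably_saturated_def
proof (intro allI impI; elim conjE)
 fix as k p
 let ?g = "inv_into (carr A) h"
 have g: "struct_iso ?g B A" using struct_iso_sym[OF assms(1)] .
 have hA: "h ` carr A = carr B" and gB: "?g ` carr B = carr A"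
  using assms(1) g by (auto simp: struct_iso_def bij_betw_def)
 assume as: "set as <= carr B" and p: "ALL ph:p. fv ph <= {..<k + length as}"
  and comp: "computable_set (godel ` p)"
  and fin: "ALL q<=p. finite q --> (EX xs. length xs = k & set xs <= carr B & realizes B as xs q)"
 have in_list: "(xs @ as') ! i : carr C"
  if "i < k + length as" "length xs = k" "set xs <= carr C" "length as' = length as" "set as' <= carr C"
  for i and xs as' :: "'c list" and C
  using that by (auto simp: nth_append subset_iff)
 have tr: "realizes D (map f as') (map f xs) q" if "struct_iso f C D" "realizes C as' xs q" "q <= p"
  "length xs = k" "set xs <= carr C" "length as' = length as" "set as' <= carr C"
  for f q C D and xs as' :: "'c list"
  unfolding realizes_def
 proof
  fix ph assume ph: "ph:q"
  hence fv: "fv ph <= {..<k + length as}" using p that by auto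
  have "sat C ((!) (xs @ as')) ph <-> sat D (f o (!) (xs @ as')) ph"
   by (rule sat_iso[OF that(1)]) (use fv in_list[OF _ that(4-7)] in blast)
  \<comment> \<open>Beyond the end of a list \<open>!\<close> is unspecified, so the two
    environments agree only at the variables that may occur.\<close>
  also have "... <-> sat D ((!) (map f xs @ map f as')) ph"
   by (rule sat_cong) (use fv that in "auto simp: nth_append subset_iff")
  finally show "sat D ((!) (map f xs @ map f as')) ph" using that ph by (simp add: realizes_def)
 qed
 have as': "set (map ?g as) <= carr A" using as gB by auto
 have "EX xs. length xs = k & set xs <= carr A & realizes A (map ?g as) xs q" if q: "q <= p" "finite q" for q
 proof -
  obtain xs where "length xs = k" "set xs <= carr B" "realizes B as xs q"
   using fin q by metis
  thus ?thesis using tr[OF g, of as xs q] q as gB by (intro exI[of _ "map ?g xs"]) fastforce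
 qed
 then obtain xs where xs: "length xs = k" "set xs <= carr A" "realizes A (map ?g as) xs p"
  using assms(2)[unfolded computably_saturated_def, rule_format, of "map ?g as" p k] as' p comp
  by auto
 have "map h (map ?g as) = as" using as hA by (auto intro!: map_idI simp: f_inv_into_f subset_iff)
 hence "realizes B as (map h xs) p"
  using tr[OF assms(1) xs(3)] xs as' by (metis length_map order_refl)
 thus "EX xs. length xs = k & set xs <= carr B & realizes B as xs p"
  using xs hA by (intro exI[of _ "map h xs"]) auto
qed

text \<open>Generic extensions consist of classes of names and the term model of numbers; this
  brings both into the type \<open>'a\<close> of the multiverse.\<close>

lemma countable_copy:
 assumes "infinite (UNIV :: 'a set)" "countable (carr A)"
 obtains h :: "'b => 'a" and B :: "'a struct"
 where "struct_iso h A B" "mem B <= carr B \<times> carr B" "countable (carr B)"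
proof -
 obtain f :: "nat => 'a" where f: "inj f" using assms(1) by (auto simp: infinite_iff_countable_subset)
 define h where "h = f o to_nat_on (carr A)"
 have h: "inj_on h (carr A)"
  unfolding h_def using assms(2) f by (meson comp_inj_on inj_on_subset inj_on_to_nat_on subset_UNIV)
 define B where "B = (|carr = h ` carr A, mem = {(h x, h y) | x y. x:carr A & y:carr A & (x, y):mem A}|)"
 have "struct_iso h A B"
  using h by (auto simp: struct_iso_def B_def bij_betw_def dest: inj_onD)
 thus ?thesis by (rule that) (use assms(2) in "auto simp: B_def")
qed

section \<open>Total recursive functions, identified when they agree on lists of the right
  length\<close>

definition Rec :: "nat => (nat list => nat) => bool" where
 "Rec n F <-> (EX f. recursive_fun n f & (ALL xs. length xs = n --> f xs = F xs))"

lemma RecI: "recursive_fun n F ==> Rec n F"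
 by (auto simp: Rec_def)

lemma Rec_cong: "(!!xs. length xs = n ==> F xs = G xs) ==> Rec n F <-> Rec n G"
 by (simp add: Rec_def cong: conj_cong)

lemma Rec_comp:
 assumes "Rec (length Fs) f" "!!F. F:set Fs ==> Rec n F"
 shows "Rec n (%xs. f (map (%F. F xs) Fs))"
proof -
 obtain f' where f': "recursive_fun (length Fs) f'" "!!xs. length xs = length Fs ==> f' xs = f xs"
  using assms(1) by (auto simp: Rec_def)
 obtain c where c: "recursive_fun n (c F)" "length xs = n ==> c F xs = F xs" if "F:set Fs" for F xs
  using assms(2) unfolding Rec_def by metis
 have "recursive_fun n (%xs. f' (map (%g. g xs) (map c Fs)))"
  by (rule recursive_fun.comp) (use f' c in auto)
 moreover have "f' (map (%g. g xs) (map c Fs)) = f (map (%F. F xs) Fs)" if "length xs = n" for xs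
  using f'(2) c(2) that by (auto simp: comp_def cong: map_cong)
 ultimately show ?thesis unfolding Rec_def by blast
qed

lemma Rec_proj: "i < n ==> Rec n (%xs. xs ! i)"
 by (intro RecI recursive_fun.proj)

lemma Rec_1: "Rec 1 (%xs. g (xs ! 0)) ==> Rec n F ==> Rec n (%xs. g (F xs))"
 using Rec_comp[of "[F]" "%xs. g (xs ! 0)" n] by simp

lemma Rec_2: "Rec 2 (%xs. g (xs ! 0) (xs ! 1)) ==> Rec n F ==> Rec n G ==> Rec n (%xs. g (F xs) (G xs))"
 using Rec_comp[of "[F, G]" "%xs. g (xs ! 0) (xs ! 1)" n] by (auto simp: numeral_2_eq_2)

lemma Rec_3: "Rec 3 (%xs. g (xs ! 0) (xs ! 1) (xs ! 2)) ==> Rec n F ==> Rec n G ==> Rec n H ==>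
  Rec n (%xs. g (F xs) (G xs) (H xs))"
 using Rec_comp[of "[F, G, H]" "%xs. g (xs ! 0) (xs ! 1) (xs ! 2)" n]
 by (auto simp: numeral_3_eq_3)

lemma Rec_Suc: "Rec n F ==> Rec n (%xs. Suc (F xs))"
 by (rule Rec_1[of Suc]) (intro RecI recursive_fun.succ)

lemma Rec_const: "Rec n (%xs. c)"
 by (induction c) (auto intro: RecI recursive_fun.zero Rec_Suc)

lemma Rec_prim:
 assumes "Rec n F" "Rec (n + 2) G"
 shows "Rec (n + 1) (%xs. rec_nat (F (tl xs)) (%k r. G (k # r # tl xs)) (hd xs))"
proof -
 obtain f where f: "recursive_fun n f" "!!xs. length xs = n ==> f xs = F xs"
  using assms(1) by (auto simp: Rec_def)
 obtain g where g: "recursive_fun (n + 2) g" "!!xs. length xs = n + 2 ==> g xs = G xs"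
  using assms(2) unfolding Rec_def by blast
 have "rec_nat (f (tl xs)) (%k r. g (k # r # tl xs)) m = rec_nat (F (tl xs)) (%k r. G (k # r # tl xs)) m"
  if "length xs = n + 1" for xs m
  using that by (induction m) (auto simp: f g)
 thus ?thesis using recursive_fun.prim_rec[OF f(1) g(1)] unfolding Rec_def by blast
qed

lemma Rec_prim1:
 assumes "Rec 2 (%xs. g (xs ! 0) (xs ! 1))" "f 0 = c" "!!k. f (Suc k) = g k (f k)" "Rec n F"
 shows "Rec n (%xs. f (F xs))"
proof -
 have "Rec (0 + 1) (%xs. rec_nat ((%_. c) (tl xs)) (%k r. (%xs. g (xs ! 0) (xs ! 1)) (k # r # tl xs)) (hd xs))"
  by (rule Rec_prim) (use assms(1) Rec_const in "simp_all add: numeral_2_eq_2")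
 moreover have "rec_nat c (%k r. g k r) m = f m" for m by (induction m) (auto simp: assms)
 ultimately have "Rec 1 (%xs. f (hd xs))" by simp
 hence "Rec 1 (%xs. f (xs ! 0))"
  by (subst Rec_cong[where G = "%xs. f (hd xs)"]) (auto simp: length_Suc_conv)
 thus ?thesis using assms(4) by (rule Rec_1)
qed

lemma Rec_prim2:
 assumes "Rec 1 (%xs. h (xs ! 0))" "Rec 3 (%xs. g (xs ! 0) (xs ! 1) (xs ! 2))"
  "!!y. f 0 y = h y" "!!k y. f (Suc k) y = g k (f k y) y" "Rec n F" "Rec n G"
 shows "Rec n (%xs. f (F xs) (G xs))"
proof -
 have "Rec (1 + 1) (%xs. rec_nat ((%xs. h (xs ! 0)) (tl xs))
   (%k r. (%xs. g (xs ! 0) (xs ! 1) (xs ! 2)) (k # r # tl xs)) (hd xs))"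
  by (rule Rec_prim) (use assms(1,2) in "auto simp: numeral_3_eq_3")
 moreover have "rec_nat (h y) (%k r. g k r y) m = f m y" for m y by (induction m) (auto simp: assms)
 ultimately have "Rec 2 (%xs. f (hd xs) (tl xs ! 0))" by (simp add: numeral_2_eq_2)
 hence "Rec 2 (%xs. f (xs ! 0) (xs ! 1))"
  by (subst Rec_cong[where G = "%xs. f (hd xs) (tl xs ! 0)"]) (auto simp: length_Suc_conv numeral_2_eq_2)
 thus ?thesis using assms(5,6) by (rule Rec_2)
qed

lemma Rec_pred: "Rec n F ==> Rec n (%xs. F xs - 1)"
 by (rule Rec_prim1[where f = "%x. x - 1" and g = "%k r. k" and c = 0]) (auto intro: Rec_proj)

lemma Rec_add: "Rec n F ==> Rec n G ==> Rec n (%xs. F xs + G xs)"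
 by (rule Rec_prim2[where f = "(+)" and g = "%k r y. Suc r" and h = "%y. y"])
  (auto intro!: Rec_Suc Rec_proj)

lemma Rec_diff: "Rec n F ==> Rec n G ==> Rec n (%xs. F xs - G xs)"
 by (rule Rec_prim2[where f = "%x y. y - x" and g = "%k r y. r - 1" and h = "%y. y"])
  (auto intro!: Rec_proj Rec_pred[unfolded One_nat_def])

lemma Rec_If_zero:
 assumes "Rec n C" "Rec n F" "Rec n G"
 shows "Rec n (%xs. if C xs = 0 then F xs else G xs)"
proof -
 let ?f = "%c z. if c = 0 then fst (prod_decode z) else snd (prod_decode z)"
 \<comment> \<open>A case distinction is a recursion that forgets its history: in
   \<open>k # r # tl xs\<close> the entry at \<open>3\<close> is the second branch.\<close>
 have "Rec (2 + 1) (%xs. rec_nat ((%xs. xs ! 0) (tl xs)) (%k r. (%xs. xs ! 3) (k # r # tl xs)) (hd xs))"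
  by (rule Rec_prim) (auto intro: Rec_proj)
 hence "Rec 3 (%xs. rec_nat (xs ! 1) (%k r. xs ! 2) (xs ! 0))"
  by (subst Rec_cong[where G = "%xs. rec_nat ((%xs. xs ! 0) (tl xs)) (%k r. (%xs. xs ! 3) (k # r # tl xs)) (hd xs)"])
   (auto simp: length_Suc_conv numeral_3_eq_3)
 from Rec_3[OF this assms(1,2,3)]
 have "Rec n (%xs. rec_nat (F xs) (%k r. G xs) (C xs))" .
 moreover have "rec_nat a (%k r. b) c = (if c = 0 then a else b)" for a b c :: nat by (cases c) auto
 ultimately show ?thesis by simp
qed

lemma Rec_If_eq:
 assumes "Rec n C" "Rec n D" "Rec n F" "Rec n G"
 shows "Rec n (%xs. if C xs = D xs then F xs else G xs)"
proof -
 have "Rec n (%xs. if (C xs - D xs) + (D xs - C xs) = 0 then F xs else G xs)"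
  by (intro Rec_If_zero Rec_add Rec_diff assms)
 moreover have "(a - b) + (b - a) = 0 <-> a = b" for a b :: nat by auto
 ultimately show ?thesis by simp
qed

lemma Rec_triangle: "Rec n F ==> Rec n (%xs. triangle (F xs))"
 by (rule Rec_prim1[where f = triangle and g = "%k r. r + Suc k" and c = 0])
  (auto intro!: Rec_proj Rec_Suc Rec_add)

lemma Rec_prod_encode: "Rec n F ==> Rec n G ==> Rec n (%xs. prod_encode (F xs, G xs))"
 by (auto simp: prod_encode_def intro!: Rec_add Rec_triangle)

abbreviation pfst :: "nat => nat" where "pfst z == fst (prod_decode z)"
abbreviation psnd :: "nat => nat" where "psnd z == snd (prod_decode z)"

text \<open>For \<open>z = prod_encode (a, b)\<close> this is \<open>a + b\<close>: the last
  \<open>y\<close> with \<open>triangle y\<close> at most \<open>z\<close>. The difference vanishes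
  iff \<open>z < triangle (Suc y)\<close>, which puts the search into the form of a
  minimization.\<close>

definition troot :: "nat => nat" where
 "troot z = (LEAST y. Suc z - triangle (Suc y) = 0)"

lemma troot_encode: "troot (prod_encode (a, b)) = a + b"
 unfolding troot_def
proof (rule Least_equality)
 show "Suc (prod_encode (a, b)) - triangle (Suc (a + b)) = 0" by (simp add: prod_encode_def)
next
 fix y assume "Suc (prod_encode (a, b)) - triangle (Suc y) = 0"
 hence less: "triangle (a + b) + a < triangle (Suc y)" by (simp add: prod_encode_def)
 have mono: "triangle k <= triangle m" if "k <= m" for k m
  using lift_Suc_mono_le[of triangle k m] that by simp
 show "a + b <= y"
 proof (rule ccontr)
  assume "~a + b <= y"
  hence "triangle (Suc y) <= triangle (a + b)" by (intro mono) simp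
  with less show False by simp
 qed
qed

lemma pfst_troot: "pfst z = z - triangle (troot z)" and psnd_troot: "psnd z = troot z - pfst z"
proof -
 obtain a b where z: "z = prod_encode (a, b)" by (metis prod_decode_inverse surj_pair)
 have "prod_encode (a, b) - triangle (a + b) = a" by (simp add: prod_encode_def)
 thus "pfst z = z - triangle (troot z)" "psnd z = troot z - pfst z"
  by (simp_all add: z troot_encode)
qed

lemma Rec_troot: "Rec n F ==> Rec n (%xs. troot (F xs))"
proof (rule Rec_1[of troot])
 have "Rec (1 + 1) (%xs. Suc (xs ! 1) - triangle (Suc (xs ! 0)))"
  by (intro Rec_diff Rec_Suc Rec_triangle Rec_proj) auto
 then obtain f where f: "recursive_fun (1 + 1) f"
  "!!xs. length xs = 1 + 1 ==> f xs = Suc (xs ! 1) - triangle (Suc (xs ! 0))"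
  unfolding Rec_def by blast
 have "EX y. f (y # xs) = 0" if "length xs = 1" for xs
  using that by (intro exI[of _ "xs ! 0"]) (simp add: f)
 hence "recursive_fun 1 (%xs. LEAST y. f (y # xs) = 0)"
  by (intro recursive_fun.minimize[OF f(1)]) blast
 moreover have "(LEAST y. f (y # xs) = 0) = troot (xs ! 0)" if "length xs = 1" for xs
  using that by (simp add: f troot_def)
 ultimately show "Rec 1 (%xs. troot (xs ! 0))" unfolding Rec_def by blast
qed

lemma Rec_pfst: "Rec n F ==> Rec n (%xs. pfst (F xs))"
 unfolding pfst_troot by (intro Rec_diff Rec_triangle Rec_troot)

lemma Rec_psnd: "Rec n F ==> Rec n (%xs. psnd (F xs))"
 unfolding psnd_troot by (intro Rec_diff Rec_pfst Rec_troot)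

lemmas Rec_intros = Rec_proj Rec_const Rec_Suc Rec_add Rec_diff Rec_If_eq Rec_prod_encode Rec_pfst Rec_psnd

lemma computable_set_Rec: "computable_set A <-> Rec 1 (%xs. if xs ! 0 : A then 1 else 0)"
proof
 assume "computable_set A"
 then obtain f where f: "recursive_fun 1 f" "!!x. f [x] = (if x : A then 1 else 0)"
  by (auto simp: computable_set_def)
 hence "f xs = (if xs ! 0 : A then 1 else 0)" if "length xs = 1" for xs
  using that by (auto simp: length_Suc_conv)
 with f(1) show "Rec 1 (%xs. if xs ! 0 : A then 1 else 0)" unfolding Rec_def by blast
next
 assume "Rec 1 (%xs. if xs ! 0 : A then 1 else 0)"
 thus "computable_set A" unfolding Rec_def computable_set_def by fastforce
qed

lemma computable_Un: "computable_set A ==> computable_set B ==> computable_set (A Un B)"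
proof -
 assume "computable_set A" "computable_set B"
 hence "Rec 1 (%xs. if (if xs ! 0 : A then 1 else 0) = (1 :: nat) then 1 else if xs ! 0 : B then 1 else 0)"
  unfolding computable_set_Rec by (intro Rec_If_eq Rec_const)
 thus ?thesis unfolding computable_set_Rec by (rule back_subst[of "Rec 1"]) auto
qed

lemma computable_finite: "finite A ==> computable_set A"
proof (induction rule: finite_induct)
 case empty
 thus ?case by (auto simp: computable_set_Rec intro: Rec_const)
next
 case (insert x A)
 have "computable_set {x}"
  unfolding computable_set_Rec singleton_iff by (intro Rec_If_eq Rec_const Rec_proj) simp
 thus ?case using computable_Un[of "{x}" A] insert by simp
qed

lemma computable_UNIV: "computable_set UNIV"
 by (auto simp: computable_set_Rec intro: Rec_const)

section \<open>Decoding and structural recursion on codes\<close>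

text \<open>\<open>prod_encode (a, b)\<close> is \<open>triangle (a + b) + a\<close>, and
  \<open>triangle k\<close> is at least \<open>k\<close>. Decoding recurs only under positive tags,
  so this is what its termination rests on.\<close>

lemma psnd_less: "pfst n > 0 ==> psnd n < n"
proof -
 assume *: "pfst n > 0"
 have "n = triangle (pfst n + psnd n) + pfst n"
  using prod_decode_inverse[of n] by (simp add: prod_encode_def split: prod.splits)
 moreover have "k <= triangle k" for k by (induction k) auto
 ultimately show ?thesis using * by (metis add.commute le_add2 le_trans less_add_same_cancel1 order_le_less_trans)
qed

lemma pfst_le: "pfst n <= n" and psnd_le: "psnd n <= n"
 by (metis prod_decode_inverse prod.collapse le_prod_encode_1, metis prod_decode_inverse prod.collapse le_prod_encode_2)

text \<open>Total on purpose: a number that codes no formula is decoded to some formula as well, so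
  that all of \<open>nat\<close> can serve as the index set of a type.\<close>

function dec :: "nat => fm" where
 "dec n = (let r = psnd n in
   if pfst n = 0 then Mem (pfst r) (psnd r)
   else if pfst n = 1 then Equ (pfst r) (psnd r)
   else if pfst n = 2 then Neg (dec r)
   else if pfst n = 3 then Imp (dec (pfst r)) (dec (psnd r))
   else All (pfst r) (dec (psnd r)))"
 by pat_completeness auto
termination
 by (relation "measure (%x. x)")
  (simp_all add: psnd_less le_less_trans[OF pfst_le psnd_less] le_less_trans[OF psnd_le psnd_less])

declare dec.simps [simp del]

lemma dec_godel [simp]: "dec (godel ph) = ph"
 by (induction ph) (subst dec.simps; simp add: Let_def)+

lemma fv_dec: "fv (dec n) <= {..n}"
proof (induction n rule: dec.induct)
 case (1 n)
 let ?r = "psnd n"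
 have *: "pfst ?r <= n" "psnd ?r <= n" "?r <= n" using le_trans pfst_le psnd_le by blast+
 show ?case
  by (subst dec.simps)
   (use 1 * in "auto simp: Let_def dest!: subsetD intro: order_trans")
qed

text \<open>The common scheme of the identity, of renaming, of relativization and of the forcing
  translation; their computability is reduced to that of the five clauses.\<close>

primrec fold_fm ::
 "(nat => nat => fm) => (nat => nat => fm) => (fm => fm) => (fm => fm => fm) => (nat => fm => fm) => fm => fm"
where
 "fold_fm m q t u w (Mem i j) = m i j"
| "fold_fm m q t u w (Equ i j) = q i j"
| "fold_fm m q t u w (Neg ph) = t (fold_fm m q t u w ph)"
| "fold_fm m q t u w (Imp ph psi) = u (fold_fm m q t u w ph) (fold_fm m q t u w psi)"
| "fold_fm m q t u w (All v ph) = w v (fold_fm m q t u w ph)"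

text \<open>Course-of-values recursion: the history of \<open>h\<close> is kept as a stack of nested pairs.\<close>

lemma Rec_code_recursion:
 assumes "Rec 2 (%xs. m (xs ! 0) (xs ! 1))" "Rec 2 (%xs. q (xs ! 0) (xs ! 1))"
  "Rec 1 (%xs. t (xs ! 0))" "Rec 2 (%xs. u (xs ! 0) (xs ! 1))" "Rec 2 (%xs. w (xs ! 0) (xs ! 1))"
  and h: "!!n. h n = (let r = psnd n in
   if pfst n = 0 then m (pfst r) (psnd r)
   else if pfst n = 1 then q (pfst r) (psnd r)
   else if pfst n = 2 then t (h r)
   else if pfst n = 3 then u (h (pfst r)) (h (psnd r))
   else w (pfst r) (h (psnd r)))"
  and "Rec n F"
 shows "Rec n (%xs. h (F xs))"
proof -
 define H where "H = rec_nat (prod_encode (h 0, 0)) (%k r. prod_encode (h (Suc k), r))"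
 \<comment> \<open>\<open>H k\<close> is the stack \<open>h k, ..., h 0\<close>. Looking up pops
   \<open>j\<close> entries, so the value at \<open>j\<close> is found at depth
   \<open>k - j\<close>.\<close>
 define look where "look T j = pfst (rec_nat T (%_ r. psnd r) j)" for T j
 have H: "rec_nat (H k) (%_ r. psnd r) j = H (k - j)" if "j <= k" for j k
  using that
 proof (induction j)
  case (Suc j)
  hence "k - j = Suc (k - Suc j)" by simp
  hence "H (k - j) = prod_encode (h (k - j), H (k - Suc j))" by (simp add: H_def)
  thus ?case using Suc by simp
 qed simp
 have pH: "pfst (H k) = h k" for k by (cases k) (auto simp: H_def)
 have look: "look (H k) (k - j) = h j" if "j <= k" for j k
  using that by (simp add: look_def H pH)
 have Rlook: "Rec n (%xs. look (F xs) (G xs))" if "Rec n F" "Rec n G" for n F G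
  unfolding look_def
  by (intro Rec_pfst Rec_prim2[where f = "%j T. rec_nat T (%_ r. psnd r) j" and g = "%k r y. psnd r" and h = "%y. y"])
   (auto intro!: Rec_proj Rec_psnd that)
 define step where "step k T = (let n = Suc k; r = psnd n in
   if pfst n = 0 then m (pfst r) (psnd r)
   else if pfst n = 1 then q (pfst r) (psnd r)
   else if pfst n = 2 then t (look T (k - r))
   else if pfst n = 3 then u (look T (k - pfst r)) (look T (k - psnd r))
   else w (pfst r) (look T (k - psnd r)))" for k T
 have le: "psnd (Suc k) <= k" "pfst (psnd (Suc k)) <= k" "psnd (psnd (Suc k)) <= k"
  if "pfst (Suc k) ~= 0" for k
 proof -
  show *: "psnd (Suc k) <= k" using psnd_less[of "Suc k"] that by simp
  show "pfst (psnd (Suc k)) <= k" "psnd (psnd (Suc k)) <= k"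
   using * pfst_le psnd_le le_trans by blast+
 qed
 have step: "h (Suc k) = step k (H k)" for k
  by (subst h) (simp add: step_def Let_def look le)
 have "Rec 2 (%xs. step (xs ! 0) (xs ! 1))"
  unfolding step_def Let_def
  by (intro Rec_intros Rlook Rec_1[of t, OF assms(3)] assms(1,2,4,5)[THEN Rec_2]) auto
 hence "Rec n (%xs. H (F xs))"
  by (intro Rec_prim1[where f = H and g = "%k r. prod_encode (step k r, r)" and c = "prod_encode (h 0, 0)"])
   (auto intro!: Rec_intros assms simp: step[symmetric], auto simp: H_def step[symmetric, unfolded H_def])
 thus ?thesis by (subst pH[symmetric]) (rule Rec_pfst)
qed

lemma Rec_fold_fm:
 assumes "Rec 2 (%xs. godel (m (xs ! 0) (xs ! 1)))" "Rec 2 (%xs. godel (q (xs ! 0) (xs ! 1)))"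
  "Rec 1 (%xs. t' (xs ! 0))" "Rec 2 (%xs. u' (xs ! 0) (xs ! 1))" "Rec 2 (%xs. w' (xs ! 0) (xs ! 1))"
  "!!ph. godel (t ph) = t' (godel ph)" "!!ph psi. godel (u ph psi) = u' (godel ph) (godel psi)"
  "!!v ph. godel (w v ph) = w' v (godel ph)" "Rec n F"
 shows "Rec n (%xs. godel (fold_fm m q t u w (dec (F xs))))"
 by (rule Rec_code_recursion[OF assms(1-5) _ assms(9)]) (subst dec.simps, simp add: Let_def assms)

text \<open>Prefixing \<open>All n \<dots> All (n + k - 1)\<close> bounds the free variables of a coded formula by \<open>n\<close>,
 without affecting formulas whose free variables are below \<open>n\<close> anyway.\<close>

primrec closing :: "nat => nat => fm => fm" where
 "closing n 0 ph = ph"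
| "closing n (Suc k) ph = All (n + k) (closing n k ph)"

text \<open>By \<open>fv_dec\<close> the variables of \<open>dec c\<close> are at most
  \<open>c\<close>, so \<open>Suc c\<close> quantifiers starting at \<open>n\<close> catch all those
  not below \<open>n\<close>.\<close>

definition dec_below :: "nat => nat => fm" where
 "dec_below n c = closing n (Suc c) (dec c)"

lemma fv_closing: "fv (closing n k ph) = fv ph - {n..<n + k}"
proof (induction k)
 case (Suc k)
 have "{n..<n + Suc k} = insert (n + k) {n..<n + k}" by auto
 thus ?case using Suc by auto
qed simp

lemma fv_dec_below: "fv (dec_below n c) <= {..<n}"
 using fv_dec[of c] by (auto simp: dec_below_def fv_closing simp del: closing.simps)

lemma sat_closing:
 assumes "carr M ~= {}" "fv ph <= {..<n}"
 shows "sat M e (closing n k ph) <-> sat M e ph"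
proof (induction k arbitrary: e)
 case (Suc k)
 have "sat M (e(n + k := x)) ph = sat M e ph" for x by (rule sat_cong) (use assms(2) in auto)
 thus ?case using assms(1) by (simp only: closing.simps sat.simps Suc.IH) blast
qed simp

lemma sat_dec_below:
 "carr M ~= {} ==> fv ph <= {..<n} ==> sat M e (dec_below n (godel ph)) <-> sat M e ph"
 unfolding dec_below_def using sat_closing by (simp del: closing.simps)

lemma Rec_dec_below: "Rec k F ==> Rec k (%xs. godel (dec_below n (F xs)))"
proof -
 assume F: "Rec k F"
 define f where "f j c = godel (closing n j (dec c))" for j c
 have id: "Rec 1 (%xs. godel (fold_fm Mem Equ Neg Imp All (dec (xs ! 0))))"
  by (rule Rec_fold_fm[where t' = "%x. prod_encode (2, x)" and u' = "%x y. prod_encode (3, prod_encode (x, y))"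
     and w' = "%x y. prod_encode (4, prod_encode (x, y))"])
   (simp_all, (intro Rec_intros; simp)+)
 have "fold_fm Mem Equ Neg Imp All ph = ph" for ph by (induction ph) auto
 with id have "Rec k (%xs. f (Suc (F xs)) (F xs))"
  by (intro Rec_prim2[where f = f and h = "%c. godel (dec c)"
     and g = "%j r c. prod_encode (4, prod_encode (n + j, r))"])
   (auto simp: f_def intro!: Rec_intros F)
 thus ?thesis by (simp add: f_def dec_below_def)
qed

section \<open>Saturation for recursively enumerated types\<close>

text \<open>Craig's trick: an enumerated set of formulas need not be computable, but a valid premise
  displaying the index \<open>c\<close> lets \<open>c\<close> be read off from the code, after which
  membership can be checked.\<close>

lemma computable_padded:
 assumes "Rec 1 (%xs. godel (G (xs ! 0)))" "computable_set A"
 shows "computable_set (godel ` (%c. Imp (All c (Equ c c)) (G c)) ` A)" (is "computable_set ?B")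
proof -
 define g where "g c = godel (G c)" for c
 define code where "code c = prod_encode (3, prod_encode (prod_encode (4, prod_encode (c, prod_encode (1, prod_encode (c, c)))), g c))" for c
 define ex where "ex n = pfst (psnd (pfst (psnd n)))" for n
 have "n:?B <-> ex n : A & n = code (ex n)" for n
  by (auto simp: ex_def code_def g_def image_iff)
 hence "(if n : ?B then 1 else 0) = (if n = code (ex n) then if ex n : A then 1 else 0 else 0 :: nat)" for n
  by auto
 moreover have "Rec 1 (%xs. if xs ! 0 = code (ex (xs ! 0)) then if ex (xs ! 0) : A then 1 else 0 else 0)"
  unfolding code_def ex_def
  by (intro Rec_intros assms(1)[folded g_def, THEN Rec_1[of g]]
    assms(2)[unfolded computable_set_Rec, THEN Rec_1[of "%x. if x : A then 1 else 0"]]) auto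
 ultimately show ?thesis unfolding computable_set_Rec by simp
qed

text \<open>Saturation for environments: the variables in \<open>V\<close> are sought, all others
  keep their values. The definition of saturation treats an initial segment of the variables as
  unknown, so all \<open>N\<close> variables are sought, the old values are appended as parameters,
  and the equations \<open>pins\<close> tie each variable outside \<open>V\<close> to its old
  value.\<close>

lemma saturated_env:
 fixes e :: "nat => 'a"
 assumes M: "computably_saturated M" and G: "Rec 1 (%xs. godel (G (xs ! 0)))" and A: "computable_set A"
  and fv: "!!c. c:A ==> fv (G c) <= {..<N}"
  and e: "range e <= carr M"
  and fin: "!!F. F <= A ==> finite F ==>
   EX e'. range e' <= carr M & (ALL i. i ~: V --> e' i = e i) & (ALL c : F. sat M e' (G c))"
 obtains e' where "range e' <= carr M" "!!i. i ~: V ==> e' i = e i" "!!c. c:A ==> sat M e' (G c)"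
proof -
 define pad where "pad c = Imp (All c (Equ c c)) (G c)" for c
 define pins where "pins = {Equ i (N + i) | i. i < N & i ~: V}"
 define as where "as = map e [0..<N]"
 have pins: "finite pins" unfolding pins_def by auto
 have sat_pad: "sat M e' (pad c) <-> sat M e' (G c)" for e' c by (simp add: pad_def)
 have eq: "sat M ((!) (map e' [0..<N] @ as)) ph <-> sat M e' ph" if "fv ph <= {..<N}" for e' ph
  by (rule sat_cong) (use that in "auto simp: nth_append")
 have comp: "computable_set (godel ` (pad ` A Un pins))"
  using computable_Un[OF computable_padded[OF G A] computable_finite, of "godel ` pins"] pins
  by (simp add: pad_def image_Un)
 have "EX xs. length xs = N & set xs <= carr M & realizes M as xs (pad ` A Un pins)"
 proof (rule M[unfolded computably_saturated_def, rule_format], intro conjI allI impI ballI)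
  show "set as <= carr M" using e by (auto simp: as_def)
  show "computable_set (godel ` (pad ` A Un pins))" by (rule comp)
  show "fv ph <= {..<N + length as}" if "ph:pad ` A Un pins" for ph
   using that fv by (fastforce simp: pad_def pins_def as_def)
 next
  fix q assume q: "q <= pad ` A Un pins" "finite q"
  obtain F where F: "F <= A" "finite F" "q - pins = pad ` F"
   by (metis (no_types, lifting) Diff_subset_conv Un_commute finite_Diff finite_subset_image q)
  obtain e' where e': "range e' <= carr M" "!!i. i ~: V ==> e' i = e i" "!!c. c:F ==> sat M e' (G c)"
   using fin[OF F(1,2)] by blast
  have "realizes M as (map e' [0..<N]) q"
   unfolding realizes_def
  proof
   fix ph assume "ph:q"
   then consider "ph:pins" | c where "c:F" "ph = pad c" using F(3) by blast
   thus "sat M ((!) (map e' [0..<N] @ as)) ph"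
   proof cases
    case 1
    thus ?thesis using e'(2) by (auto simp: pins_def as_def nth_append)
   next
    case 2
    hence "fv (pad c) <= {..<N}" using fv F(1) by (auto simp: pad_def)
    thus ?thesis using 2 eq[of "pad c" e'] e'(3) by (simp only: sat_pad)
   qed
  qed
  thus "EX xs. length xs = N & set xs <= carr M & realizes M as xs q"
   using e'(1) by (intro exI[of _ "map e' [0..<N]"]) auto
 qed
 then obtain xs where xs: "length xs = N" "set xs <= carr M" "realizes M as xs (pad ` A Un pins)" by blast
 define e' where "e' i = (if i < N then xs ! i else e i)" for i
 have map_e': "map e' [0..<N] = xs" using xs(1) by (intro nth_equalityI) (auto simp: e'_def)
 show ?thesis
 proof (rule that)
  show "range e' <= carr M" using xs e by (auto simp: e'_def)
  show "sat M e' (G c)" if "c:A" for c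
   using xs(3) eq[OF fv[OF that], of e'] that sat_pad unfolding realizes_def map_e'
   by (metis (no_types, lifting) UnI1 eq fv fv.simps image_eqI map_e' pad_def sat.simps(2,4,5))
  show "e' i = e i" if "i ~: V" for i
  proof (cases "i < N")
   case True
   hence "Equ i (N + i) : pins" using that by (auto simp: pins_def)
   hence "(xs @ as) ! i = (xs @ as) ! (N + i)" using xs(3) unfolding realizes_def by (metis UnI2 sat.simps(2))
   thus ?thesis using True xs(1) by (simp add: nth_append as_def e'_def)
  qed (simp add: e'_def)
 qed
qed

section \<open>Definability with parameters\<close>

text \<open>Even variables are arguments, odd variables are parameters.\<close>

definition mrg :: "(nat => 'a) => (nat => 'a) => nat => 'a" where
 "mrg e a n = (if even n then e (n div 2) else a (n div 2))"

definition dfp :: "'a struct => (nat => 'a) => ((nat => 'a) => bool) => bool" where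
 "dfp M a P <-> (EX ph. ALL e. range e <= carr M --> (P e <-> sat M (mrg e a) ph))"

definition df :: "'a struct => ((nat => 'a) => bool) => bool" where
 "df M P <-> (EX a. range a <= carr M & dfp M a P)"

text \<open>The value of the term is argument \<open>0\<close> and the arguments of \<open>f\<close>
  are shifted up by one, as with de Bruijn indices; the quantifier rules use the same shift.\<close>

definition dft :: "'a struct => ((nat => 'a) => 'a) => bool" where
 "dft M f <-> (ALL e. range e <= carr M --> f e : carr M) & df M (%e. e 0 = f (%n. e (Suc n)))"

lemma mrg_simps [simp]: "mrg e a (2 * n) = e n" "mrg e a (Suc (2 * n)) = a n"
 "mrg e a 0 = e 0" "mrg e a (Suc 0) = a 0" "mrg e a 2 = e 1" "mrg e a 4 = e 2"
 by (simp_all add: mrg_def)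

lemma range_mrg: "range e <= V ==> range a <= V ==> range (mrg e a) <= V"
 by (auto simp: mrg_def)

lemma dfp_ren:
 assumes "dfp M a P" "inj f" "!!e. mrg e b o f = mrg (g e) a" "!!e. range e <= carr M ==> range (g e) <= carr M"
 shows "dfp M b (%e. P (g e))"
proof -
 obtain ph where "!!e. range e <= carr M ==> P e <-> sat M (mrg e a) ph" using assms(1) unfolding dfp_def by blast
 hence "range e <= carr M ==> P (g e) <-> sat M (mrg e b) (ren f ph)" for e
  using assms(2-4) by (simp add: sat_ren)
 thus ?thesis unfolding dfp_def by blast
qed

definition odd_map :: "(nat => nat) => nat => nat" where
 "odd_map f n = (if even n then n else Suc (2 * f (n div 2)))"

definition even_map :: "(nat => nat) => nat => nat" where
 "even_map f n = (if even n then 2 * f (n div 2) else n)"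

lemma inj_odd_map: "inj f ==> inj (odd_map f)"
 by (rule injI) (auto simp: odd_map_def inj_eq split: if_splits elim!: oddE; presburger)

lemma inj_even_map: "inj f ==> inj (even_map f)"
 by (rule injI) (auto simp: even_map_def inj_eq split: if_splits elim!: evenE; presburger)

lemma mrg_odd_map: "mrg e b o odd_map f = mrg e (b o f)"
 by (auto simp: fun_eq_iff mrg_def odd_map_def)

lemma mrg_even_map: "mrg e b o even_map f = mrg (%n. e (f n)) b"
 by (auto simp: fun_eq_iff mrg_def even_map_def)

lemma dfp_params: "dfp M (b o f) P ==> inj f ==> dfp M b P"
 using dfp_ren[of M "b o f" P "odd_map f" b "%e. e"] inj_odd_map[of f] by (simp add: mrg_odd_map)

lemma dfp_mrg1: "dfp M a P ==> dfp M (mrg a b) P" and dfp_mrg2: "dfp M b P ==> dfp M (mrg a b) P"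
proof -
 have "mrg a b o (%n. 2 * n) = a" "mrg a b o (%n. Suc (2 * n)) = b" by (auto simp: fun_eq_iff)
 thus "dfp M a P ==> dfp M (mrg a b) P" "dfp M b P ==> dfp M (mrg a b) P"
  using dfp_params[of M "mrg a b" "%n. 2 * n" P] dfp_params[of M "mrg a b" "%n. Suc (2 * n)" P]
  by (auto simp: inj_def)
qed

lemma df_common2:
 assumes "df M P" "df M Q"
 obtains a where "range a <= carr M" "dfp M a P" "dfp M a Q"
 using assms unfolding df_def by (meson dfp_mrg1 dfp_mrg2 range_mrg)

lemma dfD: "df M P ==> EX ph a. range a <= carr M & (ALL e. range e <= carr M --> (P e <-> sat M (mrg e a) ph))"
 unfolding df_def dfp_def by blast

lemma dfI: "range a <= carr M ==> (!!e. range e <= carr M ==> P e <-> sat M (mrg e a) ph) ==> df M P"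
 unfolding df_def dfp_def by blast

lemma df_cong: "(!!e. range e <= carr M ==> P e <-> Q e) ==> df M P <-> df M Q"
 unfolding df_def dfp_def by (simp cong: conj_cong)

named_theorems dfi

lemma df_Not [dfi]: "df M P ==> df M (%e. ~P e)"
 unfolding df_def dfp_def by (metis sat.simps(3))

lemma df_imp [dfi]: "df M P ==> df M Q ==> df M (%e. P e --> Q e)"
 by (erule (1) df_common2) (auto simp: df_def dfp_def, metis sat.simps(4))

lemma df_conj [dfi]: "df M P ==> df M Q ==> df M (%e. P e & Q e)"
 using df_Not[OF df_imp[OF _ df_Not]] by (rule back_subst[of "df M"]) auto

lemma df_disj [dfi]: "df M P ==> df M Q ==> df M (%e. P e | Q e)"
 using df_imp[of M "%e. ~P e" Q] df_Not[of M P] by (simp add: disj_imp)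

lemma df_iff [dfi]: "df M P ==> df M Q ==> df M (%e. P e <-> Q e)"
 using df_conj[OF df_imp[of M P Q] df_imp[of M Q P]] by (simp add: iff_conv_conj_imp)

lemma df_ren: "df M P ==> inj f ==> df M (%e. P (%n. e (f n)))"
 unfolding df_def using dfp_ren[OF _ inj_even_map mrg_even_map] by (metis image_subset_iff range_subsetD)

lemma df_Ball [dfi]:
 assumes "df M (%e. P (e 0) (%n. e (Suc n)))"
 shows "df M (%e. ALL x : carr M. P x e)"
proof -
 obtain ph a where a: "range a <= carr M"
  and ph: "!!e. range e <= carr M ==> P (e 0) (%n. e (Suc n)) <-> sat M (mrg e a) ph"
  using dfD[OF assms] by blast
 \<comment> \<open>The quantified argument moves to the odd place \<open>1\<close>, the other
   arguments move down to close the gap at \<open>0\<close>, and the parameters move up by one slot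
   to vacate \<open>1\<close>.\<close>
 define f :: "nat => nat" where "f n = (if n = 0 then 1 else if even n then n - 2 else n + 2)" for n
 have "inj f" by (rule injI) (auto simp: f_def split: if_splits; presburger)
 define b where "b n = a (n - 1)" for n
 show ?thesis
 proof (rule dfI)
  show "range b <= carr M" using a by (auto simp: b_def)
  fix e :: "nat => 'a" assume e: "range e <= carr M"
  have "P x e <-> sat M ((mrg e b)(1 := x)) (ren f ph)" if "x:carr M" for x
  proof -
   have "P x e <-> sat M (mrg (case_nat x e) a) ph"
    using ph[of "case_nat x e"] e that by (simp add: image_subset_iff split: nat.splits)
   moreover have "mrg (case_nat x e) a = ((mrg e b)(1 := x)) o f"
   proof
    fix n show "mrg (case_nat x e) a n = (((mrg e b)(1 := x)) o f) n"
    proof (cases "even n")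
     case True
     then obtain k where "n = 2 * k" by (auto elim: evenE)
     thus ?thesis by (cases k) (auto simp: f_def mrg_def)
    next
     case False
     then obtain k where "n = Suc (2 * k)" by (auto elim: oddE)
     thus ?thesis by (auto simp: f_def mrg_def b_def)
    qed
   qed
   ultimately show ?thesis using `inj f` by (simp add: sat_ren)
  qed
  thus "(ALL x:carr M. P x e) <-> sat M (mrg e b) (All 1 (ren f ph))" by simp
 qed
qed

lemma df_Bex [dfi]:
 assumes "df M (%e. P (e 0) (%n. e (Suc n)))"
 shows "df M (%e. EX x : carr M. P x e)"
 using df_Not[OF df_Ball[where P = "%x e. ~P x e", OF df_Not[OF assms]]] by simp

lemma dft_in: "dft M f ==> range e <= carr M ==> f e : carr M"
 by (simp add: dft_def)

lemma df_subst:
 assumes "df M (%e. P (e 0) (%n. e (Suc n)))" "dft M f"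
 shows "df M (%e. P (f e) e)"
proof -
 have "df M (%e. ALL x:carr M. x = f e --> P x e)"
  using assms by (intro dfi) (simp_all add: dft_def)
 thus ?thesis by (rule df_cong[THEN iffD1, rotated]) (use assms(2) in "auto simp: dft_def")
qed

lemma df_weaken: "df M P ==> df M (%e. P (%n. e (Suc n)))"
 by (rule df_ren) auto

lemma df_weaken2: "df M (%e. P (e 0) (%n. e (Suc n))) ==> df M (%e. P (e 0) (%n. e (Suc (Suc n))))"
 using df_ren[of M "%e. P (e 0) (%n. e (Suc n))" "%n. if n = 0 then 0 else Suc n"] by (simp add: inj_def)

lemma dft_weaken: "dft M f ==> dft M (%e. f (%n. e (Suc n)))"
 unfolding dft_def using df_weaken2[of M "%x e. x = f e"] by (auto simp: image_subset_iff)

lemma df_rel1: "df M (%e. R (e 0)) ==> dft M f ==> df M (%e. R (f e))"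
 by (rule df_subst[where P = "%x e. R x"])

lemma df_rel2:
 assumes "df M (%e. R (e 0) (e 1))" "dft M f" "dft M g"
 shows "df M (%e. R (f e) (g e))"
proof (rule df_subst[where P = "%x e. R x (g e)", OF _ assms(2)])
 let ?f = "%n. case n of 0 => 1 | Suc 0 => 0 | n => (n :: nat)"
 have "inj ?f" by (rule injI) (auto split: nat.splits)
 from df_ren[OF assms(1) this] have "df M (%e. R (e 1) (e 0))" by simp
 thus "df M (%e. R (e 0) (g (%n. e (Suc n))))"
  using df_subst[where P = "%y e. R (e 0) y" and f = "%e. g (%n. e (Suc n))" and M = M] dft_weaken[OF assms(3)]
  by simp
qed

lemma df_rel3:
 assumes "df M (%e. R (e 0) (e 1) (e 2))" "dft M f" "dft M g" "dft M h"
 shows "df M (%e. R (f e) (g e) (h e))"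
proof (rule df_subst[where P = "%x e. R x (g e) (h e)", OF _ assms(2)],
  rule df_subst[where P = "%x e. R (e 0) x (h (%n. e (Suc n)))", OF _ dft_weaken[OF assms(3)]])
 let ?f = "%n :: nat. if n = 0 then 2 else if n = 2 then 0 else n"
 have "inj ?f" by (auto simp: inj_def)
 from df_ren[OF assms(1) this] have "df M (%e. R (e 2) (e 1) (e 0))" by (simp add: numeral_2_eq_2)
 thus "df M (%e. R (e (Suc 0)) (e 0) (h (%n. e (Suc (Suc n)))))"
  using df_subst[where P = "%y e. R (e 1) (e 0) y" and f = "%e. h (%n. e (Suc (Suc n)))" and M = M]
   dft_weaken[OF dft_weaken[OF assms(4)]]
  by (simp add: numeral_2_eq_2)
qed

lemma dft_var:
 assumes "carr M ~= {}"
 shows "dft M (%e. e i)"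
 unfolding dft_def
proof (intro conjI allI impI)
 obtain c where "c:carr M" using assms by blast
 thus "df M (%e. e 0 = e (Suc i))"
  by (intro dfI[of "%_. c" _ _ "Equ 0 (2 * Suc i)"]) (auto simp del: mult_Suc_right)
qed auto

lemma dft_nonempty: "dft M f ==> carr M ~= {}"
 by (auto simp: dft_def df_def)

lemma dft_const [dfi]: "c:carr M ==> dft M (%e. c)"
 unfolding dft_def by (auto intro!: dfI[of "%_. c" _ _ "Equ 0 1"])

lemma df_const: "carr M ~= {} ==> df M (%e. b)"
proof -
 assume "carr M ~= {}"
 then obtain c where "c:carr M" by blast
 thus ?thesis by (intro dfI[of "%_. c" _ _ "if b then Equ 0 0 else Neg (Equ 0 0)"]) auto
qed

lemma df_eq [dfi]: "dft M f ==> dft M g ==> df M (%e. f e = g e)"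
 by (rule df_subst[where P = "%x e. x = g e"]) (simp_all add: dft_def)

lemma df_mem [dfi]:
 assumes "dft M f" "dft M g"
 shows "df M (%e. (f e, g e):mem M)"
proof (rule df_rel2[OF _ assms])
 obtain c where "c:carr M" using dft_nonempty[OF assms(1)] by blast
 thus "df M (%e. (e 0, e 1):mem M)" by (intro dfI[of "%_. c" _ _ "Mem 0 2"]) auto
qed

lemma dft_fun1:
 assumes "dft M (%e. F (e 0))" "dft M f"
 shows "dft M (%e. F (f e))"
proof -
 have "range (%_. x) <= carr M" if "x:carr M" for x using that by auto
 hence in1: "F x : carr M" if "x:carr M" for x
  using that dft_in[OF assms(1), of "%_. x"] by auto
 have "df M (%e. e 0 = F (e 1))" using assms(1) by (simp add: dft_def)
 from df_rel2[where R = "%x y. x = F y", OF this dft_var[OF dft_nonempty[OF assms(2)]] dft_weaken[OF assms(2)]] show ?thesis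
  unfolding dft_def using in1 dft_in[OF assms(2)] by simp
qed

lemma dft_fun2:
 assumes "dft M (%e. F (e 0) (e 1))" "dft M f" "dft M g"
 shows "dft M (%e. F (f e) (g e))"
proof -
 have in2: "F x y : carr M" if "x:carr M" "y:carr M" for x y
  using dft_in[OF assms(1), of "case_nat x (%_. y)"] that by (simp add: image_subset_iff split: nat.splits)
 have "df M (%e. e 0 = F (e 1) (e 2))" using assms(1) by (simp add: dft_def numeral_2_eq_2)
 from df_rel3[where R = "%x y z. x = F y z", OF this dft_var[OF dft_nonempty[OF assms(2)]] dft_weaken[OF assms(2)] dft_weaken[OF assms(3)]]
 show ?thesis
  unfolding dft_def using in2 dft_in[OF assms(2)] dft_in[OF assms(3)] by simp
qed

lemma df_ext [dfi]: "dft M f ==> dft M g ==> df M (%e. f e : ext M (g e))"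
 unfolding ext_def by (rule df_cong[THEN iffD1, OF _ df_mem[of M f g]]) (auto simp: dft_def)

lemma df_Ball_ext [dfi]:
 assumes "df M (%e. P (e 0) (%n. e (Suc n)))" "dft M f"
 shows "df M (%e. ALL x : ext M (f e). P x e)"
proof -
 have "df M (%e. ALL x : carr M. x:ext M (f e) --> P x e)"
  by (intro dfi assms dft_weaken dft_var dft_nonempty[OF assms(2)])
 thus ?thesis by (rule back_subst[of "df M"]) (auto simp: ext_def)
qed

lemma df_Bex_ext [dfi]:
 assumes "df M (%e. P (e 0) (%n. e (Suc n)))" "dft M f"
 shows "df M (%e. EX x : ext M (f e). P x e)"
 using df_Not[OF df_Ball_ext[where P = "%x e. ~P x e", OF df_Not[OF assms(1)] assms(2)]] by simp

text \<open>Terms that are given by a definable description.\<close>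

lemma dft_descr:
 assumes "!!e. range e <= carr M ==> f e : carr M"
  "!!e x. range e <= carr M ==> x:carr M ==> x = f e <-> P x e"
  "df M (%e. P (e 0) (%n. e (Suc n)))"
 shows "dft M f"
 unfolding dft_def
proof (intro conjI)
 show "df M (%e. e 0 = f (%n. e (Suc n)))"
  by (rule df_cong[THEN iffD1, OF _ assms(3)]) (use assms(2) in "auto simp: image_subset_iff")
qed (use assms(1) in auto)

lemma definable1_df:
 assumes "D <= carr M" "carr M ~= {}"
 shows "definable1 M D <-> df M (%e. e 0 : D)"
proof
 assume "definable1 M D"
 then obtain ph a where a: "range a <= carr M" and D: "D = def1 M ph a" by (auto simp: definable1_def)
 define f :: "nat => nat" where "f n = (if n = 0 then 0 else Suc (2 * n))" for n
 have "inj f" by (auto simp: f_def inj_def)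
 moreover have "mrg e a o f = a(0 := e 0)" for e by (auto simp: f_def mrg_def fun_eq_iff)
 ultimately show "df M (%e. e 0 : D)"
  by (intro dfI[OF a, of _ "ren f ph"]) (auto simp: D def1_def sat_ren)
next
 obtain c where c: "c:carr M" using assms(2) by blast
 assume "df M (%e. e 0 : D)"
 then obtain ph a where a: "range a <= carr M"
  and ph: "!!e. range e <= carr M ==> e 0 : D <-> sat M (mrg e a) ph" using dfD by blast
 have "(mrg (%_. c) a)(0 := x) = mrg ((%_. c)(0 := x)) a" for x by (auto simp: mrg_def fun_eq_iff)
 hence "D = def1 M ph (mrg (%_. c) a)"
  using assms(1) c ph[of "(%_. c)(0 := x)" for x] by (auto simp: def1_def image_subset_iff)
 thus "definable1 M D" unfolding definable1_def using range_mrg[of "%_. c" _ a] a c by blast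
qed

lemma definable2_df:
 assumes "R <= carr M \<times> carr M" "carr M ~= {}"
 shows "definable2 M R <-> df M (%e. (e 0, e 1):R)"
proof
 assume "definable2 M R"
 then obtain ph a where a: "range a <= carr M" and R: "R = def2 M ph a" by (auto simp: definable2_def)
 define f :: "nat => nat" where "f n = (if n = 0 then 0 else if n = 1 then 2 else Suc (2 * n))" for n
 have "inj f" by (rule injI) (auto simp: f_def split: if_splits; presburger)
 moreover have "mrg e a o f = a(0 := e 0, 1 := e 1)" for e by (auto simp: f_def mrg_def fun_eq_iff)
 ultimately show "df M (%e. (e 0, e 1):R)"
  by (intro dfI[OF a, of _ "ren f ph"]) (auto simp: R def2_def sat_ren)
next
 obtain c where c: "c:carr M" using assms(2) by blast
 assume "df M (%e. (e 0, e 1):R)"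
 then obtain ph a where a: "range a <= carr M"
  and ph: "!!e. range e <= carr M ==> (e 0, e 1):R <-> sat M (mrg e a) ph" using dfD by blast
 define f :: "nat => nat" where "f n = (if n = 1 then 2 else if n = 2 then 1 else n)" for n
 have f: "inj f" by (auto simp: f_def inj_def)
 have "(mrg (%_. c) a o f)(0 := x, 1 := y) o f = mrg ((%_. c)(0 := x, 1 := y)) a" for x y
  by (auto simp: mrg_def fun_eq_iff f_def)
 hence "R = def2 M (ren f ph) (mrg (%_. c) a o f)"
  using assms(1) c ph[of "(%_. c)(0 := x, 1 := y)" for x y] f
  by (auto simp: def2_def image_subset_iff sat_ren)
 moreover have "range (mrg (%_. c) a o f) <= carr M" using a c by (auto simp: mrg_def)
 ultimately show "definable2 M R" unfolding definable2_def by blast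
qed

lemma definable3_df:
 assumes "R <= carr M \<times> carr M \<times> carr M" "carr M ~= {}"
 shows "definable3 M R <-> df M (%e. (e 0, e 1, e 2):R)"
proof
 assume "definable3 M R"
 then obtain ph a where a: "range a <= carr M" and R: "R = def3 M ph a" by (auto simp: definable3_def)
 define f :: "nat => nat" where "f n = (if n < 3 then 2 * n else Suc (2 * n))" for n
 have "inj f" by (rule injI) (auto simp: f_def split: if_splits; presburger)
 moreover have "mrg e a o f = a(0 := e 0, 1 := e 1, 2 := e 2)" for e
  by (auto simp: f_def mrg_def fun_eq_iff numeral_3_eq_3 less_Suc_eq)
 ultimately show "df M (%e. (e 0, e 1, e 2):R)"
  by (intro dfI[OF a, of _ "ren f ph"]) (auto simp: R def3_def sat_ren)
next
 obtain c where c: "c:carr M" using assms(2) by blast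
 assume "df M (%e. (e 0, e 1, e 2):R)"
 then obtain ph a where a: "range a <= carr M"
  and ph: "!!e. range e <= carr M ==> (e 0, e 1, e 2):R <-> sat M (mrg e a) ph" using dfD by blast
 \<comment> \<open>The formula has its arguments at \<open>0, 2, 4\<close>, while
   \<open>def3\<close> supplies them at \<open>0, 1, 2\<close>. The parameters \<open>a 0\<close>
   and \<open>a 1\<close>, read at \<open>1\<close> and \<open>3\<close>, are stored at
   \<open>3\<close> and \<open>4\<close> instead.\<close>
 define h :: "nat => nat" where "h n = (if n = 2 then 1 else if n = 1 then 3 else if n = 4 then 2 else if n = 3 then 4 else n)" for n
 have h: "inj h" by (auto simp: h_def inj_def)
 define b where "b n = (if n = 3 then a 0 else if n = 4 then a 1 else mrg (%_. c) a n)" for n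
 have "b(0 := x, 1 := y, 2 := z) o h = mrg ((%_. c)(0 := x, 1 := y, 2 := z)) a" for x y z
  by (auto simp: mrg_def fun_eq_iff h_def b_def)
 hence "R = def3 M (ren h ph) b"
  using assms(1) c ph[of "(%_. c)(0 := x, 1 := y, 2 := z)" for x y z] h
  by (auto simp: def3_def image_subset_iff sat_ren)
 moreover have "range b <= carr M" using range_mrg[of "%_. c" _ a] a c by (auto simp: b_def)
 ultimately show "definable3 M R" unfolding definable3_def by blast
qed

lemma df_definable1 [dfi]: "definable1 M D ==> dft M f ==> df M (%e. f e : D)"
proof (rule df_rel1)
 assume "definable1 M D"
 moreover from this have "D <= carr M" "carr M ~= {}" by (auto simp: definable1_def def1_def)
 ultimately show "df M (%e. e 0 : D)" using definable1_df by blast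
qed

lemma df_definable2 [dfi]: "definable2 M R ==> dft M f ==> dft M g ==> df M (%e. (f e, g e):R)"
proof (rule df_rel2)
 assume "definable2 M R"
 moreover from this have "R <= carr M \<times> carr M" "carr M ~= {}" by (auto simp: definable2_def def2_def)
 ultimately show "df M (%e. (e 0, e 1):R)" using definable2_df by blast
qed

lemma df_definable3 [dfi]:
 "definable3 M R ==> dft M f ==> dft M g ==> dft M h ==> df M (%e. (f e, g e, h e):R)"
proof (rule df_rel3)
 assume "definable3 M R"
 moreover from this have "R <= carr M \<times> carr M \<times> carr M" "carr M ~= {}" by (auto simp: definable3_def def3_def)
 ultimately show "df M (%e. (e 0, e 1, e 2):R)" using definable3_df by blast
qed

section \<open>Interpretations\<close>

text \<open>A one-dimensional interpretation of \<open>B\<close> in \<open>A\<close> with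
  parameters. Equality is interpreted by \<open>Q\<close>, since an element of an ultrapower is
  represented by many functions; \<open>io\<close> sends a representative to what it stands
  for.\<close>

definition interp :: "'a struct => 'a set => ('a \<times> 'a) set => ('a \<times> 'a) set => ('a => 'b) => 'b struct => bool" where
 "interp A D E Q io B <-> is_struct A & D <= carr A &
   df A (%e. e 0 : D) & df A (%e. (e 0, e 1) : E) & df A (%e. (e 0, e 1) : Q) &
   io ` D = carr B & D ~= {} &
   (ALL x : D. ALL y : D. (io x = io y <-> (x, y) : Q) & ((io x, io y) : mem B <-> (x, y) : E))"

lemma Rec_fold_hom:
 assumes "Rec 2 (%xs. godel (m (xs ! 0) (xs ! 1)))" "Rec 2 (%xs. godel (q (xs ! 0) (xs ! 1)))"
  "Rec 2 (%xs. w' (xs ! 0) (xs ! 1))" "!!v ph. godel (w v ph) = w' v (godel ph)" "Rec n F"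
 shows "Rec n (%xs. godel (fold_fm m q Neg Imp w (dec (F xs))))"
 by (rule Rec_fold_fm[where t' = "%x. prod_encode (2, x)" and u' = "%x y. prod_encode (3, prod_encode (x, y))",
    OF assms(1,2) _ _ assms(3) _ _ assms(4,5)])
  (simp_all, (intro Rec_intros; simp)+)

lemma ren_fold: "ren f = fold_fm (%i j. Mem (f i) (f j)) (%i j. Equ (f i) (f j)) Neg Imp (%v. All (f v))"
proof
 fix ph show "ren f ph = fold_fm (%i j. Mem (f i) (f j)) (%i j. Equ (f i) (f j)) Neg Imp (%v. All (f v)) ph"
  by (induction ph) auto
qed

text \<open>\<open>c + 2 i\<close>, written with sums because the closure rules for
  \<open>Rec\<close> contain addition but no multiplication.\<close>

definition dbl :: "nat => nat => nat" where "dbl c i = c + i + i"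

lemma Rec_double_sum: "Rec n F ==> Rec n (%xs. dbl c (F xs))"
 unfolding dbl_def by (intro Rec_intros)

lemma dbl_simps [simp]:
 "dbl c i = dbl c j <-> i = j" "dbl c i ~= Suc (dbl c j)"
 "Suc (dbl c i) ~= dbl c j" "k < c ==> k ~= dbl c i" "k < c ==> k ~= Suc (dbl c i)"
 "k < c ==> dbl c i ~= k" "k < c ==> Suc (dbl c i) ~= k"
 unfolding dbl_def by presburger+

lemma inj_double_sum: "inj (dbl c)"
 by (simp add: inj_def)

lemma Rec_ren_double_sum: "Rec n F ==> Rec n (%xs. godel (ren (dbl c) (dec (F xs))))"
 unfolding ren_fold
 by (rule Rec_fold_hom[where w' = "%x y. prod_encode (4, prod_encode (dbl c x, y))"])
  (simp_all, (intro Rec_intros Rec_double_sum; simp)+)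

text \<open>The variable \<open>i\<close> of the interpreted structure becomes \<open>c + 2 i + 1\<close>; the variables
 \<open>c + 2 i\<close> remain available for the interpreting structure itself. Variables below \<open>c\<close> are
 reserved for the formulas \<open>de\<close>, \<open>ep\<close>, \<open>et\<close>, whose arguments are \<open>0\<close> and \<open>2\<close>.\<close>

definition at1 :: "nat => fm => nat => fm" where
 "at1 c de i = All 0 (Imp (Equ 0 (Suc (dbl c i))) de)"

text \<open>Quantified equations replace substitution: there is no capture to avoid, and the code is
  visibly recursive in \<open>i\<close> and \<open>j\<close>.\<close>

definition at2 :: "nat => fm => nat => nat => fm" where
 "at2 c ep i j = All 0 (Imp (Equ 0 (Suc (dbl c i))) (All 2 (Imp (Equ 2 (Suc (dbl c j))) ep)))"

definition transl :: "nat => fm => fm => fm => fm => fm" where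
 "transl c de ep et = fold_fm (at2 c ep) (at2 c et) Neg Imp (%v ph. All (Suc (dbl c v)) (Imp (at1 c de v) ph))"

lemma Rec_transl: "Rec n F ==> Rec n (%xs. godel (transl c de ep et (dec (F xs))))"
 unfolding transl_def
 by (rule Rec_fold_hom[where w' = "%x y. prod_encode (4, prod_encode (Suc (dbl c x), prod_encode (3, prod_encode (godel (at1 c de x), y))))"])
  (simp_all add: at1_def at2_def, (intro Rec_intros Rec_double_sum; simp)+)

lemma fv_transl:
 assumes "fv de <= {..<c}" "fv ep <= {..<c}" "fv et <= {..<c}"
 shows "fv (transl c de ep et ph) <= {..<c} Un (%i. Suc (dbl c i)) ` fv ph"
 using assms by (induction ph) (auto simp: transl_def at1_def at2_def)

lemma fv_at1_below: "fv de <= {..<c} ==> i < m ==> fv (at1 c de i) <= {..<dbl c m}"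
 by (auto simp: at1_def dbl_def dest!: subsetD)

lemma fv_transl_below:
 assumes "fv de <= {..<c}" "fv ep <= {..<c}" "fv et <= {..<c}" "fv ph <= {..<m}"
 shows "fv (transl c de ep et ph) <= {..<dbl c m}"
proof
 fix x assume "x:fv (transl c de ep et ph)"
 hence "x < c | x:(%i. Suc (dbl c i)) ` fv ph" using fv_transl[OF assms(1-3)] by blast
 thus "x:{..<dbl c m}" using assms(4) by (fastforce simp: dbl_def)
qed

lemma fv_ren_below: "fv ph <= {..<m} ==> fv (ren (dbl c) ph) <= {..<dbl c m}"
 by (fastforce simp: fv_ren[OF inj_double_sum] dbl_def)

lemma sat_transl:
 assumes dom: "!!E x. (!!i. i < c ==> odd i ==> E i = a (i div 2)) ==> x:carr A ==> E 0 = x ==> sat A E de <-> x:D"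
  and D: "D <= carr A" "io ` D = carr B" "2 < c"
  and mem: "!!E x y. (!!i. i < c ==> odd i ==> E i = a (i div 2)) ==> x : D ==> y : D ==> E 0 = x ==> E 2 = y ==>
   sat A E ep <-> (io x, io y) : mem B"
  and eq: "!!E x y. (!!i. i < c ==> odd i ==> E i = a (i div 2)) ==> x : D ==> y : D ==> E 0 = x ==> E 2 = y ==>
   sat A E et <-> io x = io y"
  and E: "!!i. i < c ==> odd i ==> E i = a (i div 2)"
  and e: "!!i. i:fv ph ==> E (Suc (dbl c i)) = e i & e i : D"
 shows "sat A E (transl c de ep et ph) <-> sat B (io o e) ph"
 using E e
proof (induction ph arbitrary: E e)
 case (Mem i j)
 have "sat A E (at2 c ep i j) <-> sat A (E(0 := e i, 2 := e j)) ep"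
  using Mem(2) D by (auto simp: at2_def)
 also have "... <-> (io (e i), io (e j)) : mem B" by (rule mem) (use Mem in auto)
 finally show ?case by (simp add: transl_def)
next
 case (Equ i j)
 have "sat A E (at2 c et i j) <-> sat A (E(0 := e i, 2 := e j)) et"
  using Equ(2) D by (auto simp: at2_def)
 also have "... <-> io (e i) = io (e j)" by (rule eq) (use Equ in auto)
 finally show ?case by (simp add: transl_def)
next
 case (All v ph)
 let ?v = "Suc (dbl c v)"
 have 1: "sat A (E(?v := x)) (at1 c de v) <-> x:D" if "x:carr A" for x
 proof -
  have "sat A (E(?v := x)) (at1 c de v) <-> sat A (E(?v := x, 0 := x)) de"
   using that by (simp add: at1_def)
  also have "... <-> x:D" by (rule dom) (use that All.prems D(3) in auto)
  finally show ?thesis .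
 qed
 have 2: "sat A (E(?v := x)) (transl c de ep et ph) <-> sat B ((io o e)(v := io x)) ph" if "x:D" for x
 proof -
  have "sat A (E(?v := x)) (transl c de ep et ph) <-> sat B (io o (e(v := x))) ph"
   by (rule All.IH) (use that All.prems in auto)
  thus ?thesis by (simp add: fun_upd_comp)
 qed
 have "sat A E (transl c de ep et (All v ph)) <-> (ALL x:D. sat A (E(?v := x)) (transl c de ep et ph))"
  using 1 D(1) by (auto simp: transl_def)
 also have "... <-> (ALL x:io ` D. sat B ((io o e)(v := x)) ph)" using 2 by simp
 finally show ?case by (simp only: D(2) sat.simps)
next
 case (Neg ph)
 have "sat A E (transl c de ep et ph) <-> sat B (io o e) ph" by (rule Neg.IH) (use Neg.prems in auto)
 thus ?case by (simp only: transl_def fold_fm.simps sat.simps)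
next
 case (Imp ph psi)
 have "sat A E (transl c de ep et ph) <-> sat B (io o e) ph" by (rule Imp.IH(1)) (use Imp.prems in auto)
 moreover have "sat A E (transl c de ep et psi) <-> sat B (io o e) psi" by (rule Imp.IH(2)) (use Imp.prems in auto)
 ultimately show ?case by (simp only: transl_def fold_fm.simps sat.simps)
qed

text \<open>\<open>E\<close> is constrained only at the odd variables below \<open>c\<close>, which
  hold the parameters, and at the variables that represent \<open>fv ph\<close>. The bound
  \<open>6 < c\<close> reserves the places \<open>4\<close> and \<open>6\<close> for
  \<open>saturated_translation\<close>.\<close>

definition interp_by :: "'a struct => 'a set => ('a => 'b) => 'b struct => (nat => 'a) => nat => fm => fm => fm => bool" where
 "interp_by A D io B a c de ep et <-> range a <= carr A & 6 < c & fv de <= {..<c} & fv ep <= {..<c} & fv et <= {..<c} &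
  (ALL E. (ALL i<c. odd i --> E i = a (i div 2)) -->
   (ALL ph e. (ALL i:fv ph. E (Suc (dbl c i)) = e i & e i : D) -->
     (sat A E (transl c de ep et ph) <-> sat B (io o e) ph)) &
   (ALL i. E (Suc (dbl c i)) : carr A --> (sat A E (at1 c de i) <-> E (Suc (dbl c i)) : D)))"

lemma dfp_common:
 assumes "finite K" "!!k. k:K ==> df M (R k)" "carr M ~= {}"
 shows "EX a. range a <= carr M & (ALL k:K. dfp M a (R k))"
 using assms(1,2)
proof (induction K)
 case empty
 thus ?case using assms(3) by (intro exI[of _ "%_. SOME x. x:carr M"]) (auto simp: some_in_eq)
next
 case (insert k K)
 obtain a where a: "range a <= carr M" "ALL k:K. dfp M a (R k)" using insert by auto
 obtain b where b: "range b <= carr M" "dfp M b (R k)" using insert.prems[of k] by (auto simp: df_def)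
 have "dfp M (mrg b a) (R j)" if "j:insert k K" for j
  using that dfp_mrg1[OF b(2), of a] dfp_mrg2[OF bspec[OF a(2)], of j b] by blast
 thus ?case using range_mrg[OF b(1) a(1)] by blast
qed

text \<open>Formulas for finitely many definable relations, with the arguments of the \<open>k\<close>-th one at the even
 positions in \<open>S k\<close> and common parameters at the odd positions below \<open>c\<close>. The remaining even
 variables are renamed to unused odd ones with a default value, so that their values need not be
 controlled.\<close>

lemma df_templates:
 assumes K: "finite K" "!!k. k:K ==> df M (R k)" and ne: "carr M ~= {}"
  and S: "!!k n. n:S k ==> even n"
  and dep: "!!k e e'. k:K ==> (!!n. 2 * n : S k ==> e n = e' n) ==> R k e <-> R k e'"
 obtains b c ch where "range b <= carr M" "6 < c" "ALL k:K. fv (ch k) <= {..<c}"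
  "ALL k:K. ALL E. (ALL i<c. odd i --> E i = b (i div 2)) & (ALL i:S k. E i : carr M) -->
   (sat M E (ch k) <-> R k (%n. E (2 * n)))"
proof -
 obtain z where z: "z:carr M" using ne by blast
 obtain a where a: "range a <= carr M" "ALL k:K. dfp M a (R k)" using dfp_common[of K M R, OF K ne] by blast
 then obtain ph where ph: "!!k e. k:K ==> range e <= carr M ==> R k e <-> sat M (mrg e a) (ph k)"
  unfolding dfp_def by metis
 define g :: "nat set => nat => nat" where "g S n = (if n : S then n else Suc (2 * n))" for S n
 have g: "inj (g (S k))" for k
  by (rule injI) (use S[of "Suc (2 * n)" k for n] in "auto simp: g_def split: if_splits")
 define b where "b n = mrg (%_. z) a n" for n
 have b: "range b <= carr M" using a(1) z by (auto simp: b_def mrg_def)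
 have "finite (UN k:K. fv (ren (g (S k)) (ph k)))" using K(1) by simp
 then obtain c0 where c0: "(UN k:K. fv (ren (g (S k)) (ph k))) <= {..<c0}" using finite_nat_iff_bounded by blast
 have key: "sat M E (ren (g (S k)) (ph k)) <-> R k (%n. E (2 * n))"
  if *: "ALL i<c0 + 7. odd i --> E i = b (i div 2)" and EV: "ALL i:S k. E i : carr M" and k: "k:K" for E k
 proof -
  let ?e = "%n. if 2 * n : S k then E (2 * n) else z"
  have "sat M E (ren (g (S k)) (ph k)) <-> sat M (E o g (S k)) (ph k)" by (simp add: sat_ren g)
  also have "... <-> sat M (mrg ?e a) (ph k)"
  proof (rule sat_cong)
   fix i assume i: "i:fv (ph k)"
   hence "g (S k) i < c0" using c0 k by (auto simp: fv_ren[OF g] subset_iff)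
   thus "(E o g (S k)) i = mrg ?e a i"
    using *[THEN spec, of "g (S k) i"] S i by (auto simp: g_def b_def mrg_def split: if_splits)
  qed
  also have "... <-> R k ?e" by (rule ph[OF k, symmetric]) (use EV z in auto)
  also have "... <-> R k (%n. E (2 * n))" by (rule dep[OF k]) simp
  finally show ?thesis .
 qed
 show ?thesis
 proof (rule that[of b "c0 + 7" "%k. ren (g (S k)) (ph k)"])
  show "ALL k:K. fv (ren (g (S k)) (ph k)) <= {..<c0 + 7}" using c0 by fastforce
 qed (use b key in auto)
qed

lemma interp_formulas:
 assumes "interp A D E Q io B"
 shows "EX a c de ep et. interp_by A D io B a c de ep et"
proof -
 have str: "D <= carr A" "io ` D = carr B" "carr A ~= {}"
  "!!x y. x:D ==> y:D ==> (io x = io y <-> (x, y):Q) & ((io x, io y):mem B <-> (x, y):E)"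
  using assms by (auto simp: interp_def)
 define R where "R k e = (if k = 0 then e 0 : D else if k = 1 then (e 0, e 1) : E else (e 0, e 1) : Q)" for k :: nat and e :: "nat => 'a"
 define S :: "nat => nat set" where "S k = (if k = 0 then {0} else {0, 2})" for k
 have dfR: "df A (R k)" if "k:{0, 1, 2}" for k
  using assms that unfolding interp_def R_def by (elim insertE) auto
 have S: "even n" if "n:S k" for k n using that by (auto simp: S_def split: if_splits)
 have dep: "R k e <-> R k e'" if "!!n. 2 * n : S k ==> e n = e' n" for k e e'
  using that[of 0] that[of 1] by (auto simp: R_def S_def split: if_splits)
 obtain b c ch where b: "range b <= carr A" "6 < c" "ALL k:{0, 1, 2}. fv (ch k) <= {..<c}"
  "ALL k:{0, 1, 2}. ALL E. (ALL i<c. odd i --> E i = b (i div 2)) & (ALL i:S k. E i : carr A) -->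
   (sat A E (ch k) <-> R k (%n. E (2 * n)))"
  by (rule df_templates[of "{0, 1, 2}" A R S, OF _ dfR str(3) S dep]) auto
 have de: "sat A E' (ch 0) <-> E' 0 : D" if "ALL i<c. odd i --> E' i = b (i div 2)" "E' 0 : carr A" for E'
  using b(4) that by (simp add: S_def R_def)
 have two: "sat A E' (ch 1) <-> (E' 0, E' 2):E" "sat A E' (ch 2) <-> (E' 0, E' 2):Q"
  if "ALL i<c. odd i --> E' i = b (i div 2)" "E' 0 : D" "E' 2 : D" for E'
  using b(4) that str(1) by (auto simp: S_def R_def subset_iff)
 have "interp_by A D io B b c (ch 0) (ch 1) (ch 2)"
  unfolding interp_by_def
 proof (intro conjI b(1,2) allI impI)
  fix E' :: "nat => 'a"
  assume *: "ALL i<c. odd i --> E' i = b (i div 2)"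
  show "sat A E' (transl c (ch 0) (ch 1) (ch 2) ph) <-> sat B (io o e) ph"
   if e: "ALL i:fv ph. E' (Suc (dbl c i)) = e i & e i : D" for ph e
   by (rule sat_transl[where D = D and a = b]) (use * e b(2) in "simp_all add: two[unfolded One_nat_def] de str")
  fix i assume i: "E' (Suc (dbl c i)) : carr A"
  have "sat A E' (at1 c (ch 0) i) <-> sat A (E'(0 := E' (Suc (dbl c i)))) (ch 0)"
   using i by (simp add: at1_def)
  also have "... <-> E' (Suc (dbl c i)) : D" using de * i by simp
  finally show "sat A E' (at1 c (ch 0) i) <-> E' (Suc (dbl c i)) : D" .
 qed (use b(3) in auto)
 thus ?thesis by blast
qed

lemma Rec_godel_Con: "Rec n (%xs. godel (F xs)) ==> Rec n (%xs. godel (G xs)) ==> Rec n (%xs. godel (Con (F xs) (G xs)))"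
 by (simp, intro Rec_intros)

lemma Rec_godel_Iff: "Rec n (%xs. godel (F xs)) ==> Rec n (%xs. godel (G xs)) ==> Rec n (%xs. godel (Iff (F xs) (G xs)))"
 by (simp, intro Rec_intros)

lemma big_Con:
 assumes "finite F" "!!ph. ph:F ==> fv ph <= {..<Suc n}"
 shows "EX ch. fv ch <= {..<Suc n} & (ALL e. sat M e ch <-> (ALL ph:F. sat M e ph)) & (ALL e. sat N e ch <-> (ALL ph:F. sat N e ph))"
 using assms
proof (induction rule: finite_induct)
 case empty
 thus ?case by (intro exI[of _ "Equ 0 0"]) auto
next
 case (insert ph F)
 then obtain ch where "fv ch <= {..<Suc n}" "!!e. sat M e ch <-> (ALL ph:F. sat M e ph)"
  "!!e. sat N e ch <-> (ALL ph:F. sat N e ph)" by auto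
 thus ?case using insert.prems by (intro exI[of _ "Con ph ch"]) auto
qed

text \<open>The common core of saturation for interpreted structures and for forcing.
  \<open>sem u e ph\<close> is any notion of truth that \<open>A\<close> expresses through the
  computable translation \<open>TT\<close>. Besides the tuple an element \<open>u\<close> is sought,
  at variable \<open>4\<close>, relative to a parameter \<open>q\<close> at variable
  \<open>6\<close>; in forcing these are a condition and the condition it has to extend.\<close>

theorem saturated_translation:
 fixes as :: "'a list" and TT :: "fm => fm"
 assumes sat: "computably_saturated A" and q: "q:carr A" and D: "D <= carr A" "z:D"
  and b: "range b <= carr A" "6 < c"
  and TT: "!!n F. Rec n F ==> Rec n (%xs. godel (TT (dec (F xs))))"
   "!!ph m. fv ph <= {..<m} ==> fv (TT ph) <= {..<dbl c m}"
  and fvde: "fv de <= {..<c}"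
  and dom: "!!E i. (!!i. i < c ==> odd i ==> E i = b (i div 2)) ==> E (Suc (dbl c i)) : carr A ==>
   sat A E (at1 c de i) <-> E (Suc (dbl c i)) : D"
  and tr: "!!E ph e. (!!i. i < c ==> odd i ==> E i = b (i div 2)) ==> E 4 : carr A ==> E 6 = q ==>
   (!!i. i : fv ph ==> E (Suc (dbl c i)) = e i & e i : D) ==> sat A E (TT ph) <-> sem (E 4) e ph"
  and as: "set as <= D" and p: "ALL ph:p. fv ph <= {..<k + length as}" and comp: "computable_set (godel ` p)"
  and fin: "!!r. r <= p ==> finite r ==>
   EX u:carr A. EX xs. length xs = k & set xs <= D & (ALL ph:r. sem u ((!) (xs @ as)) ph)"
 shows "EX u:carr A. EX xs. length xs = k & set xs <= D & (ALL ph:p. sem u ((!) (xs @ as)) ph)"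
proof -
 define n where "n = length as"
 \<comment> \<open>The conjuncts \<open>at1\<close> confine the unknown tuple to
   \<open>D\<close>.\<close>
 define G where "G x = foldr (%i psi. Con (at1 c de i) psi) [0..<k] (TT (dec x))" for x
 have sat_G: "sat A E (G x) <-> (ALL i<k. sat A E (at1 c de i)) & sat A E (TT (dec x))" for E x
 proof -
  have "sat A E (foldr (%i psi. Con (at1 c de i) psi) xs psi) <-> (ALL i:set xs. sat A E (at1 c de i)) & sat A E psi" for xs psi
   by (induction xs) auto
  thus ?thesis by (auto simp: G_def)
 qed
 have RG: "Rec 1 (%xs. godel (G (xs ! 0)))"
 proof -
  have "Rec 1 (%xs. godel (foldr (%i psi. Con (at1 c de i) psi) ys (TT (dec (xs ! 0)))))" for ys
  proof (induction ys)
   case Nil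
   thus ?case by (simp, intro TT Rec_proj) simp
  next
   case (Cons y ys)
   thus ?case by (simp only: foldr.simps comp_apply) (intro Rec_godel_Con Rec_const)
  qed
  thus ?thesis by (simp add: G_def)
 qed
 define N where "N = dbl c (k + n)"
 have fvG: "fv (G x) <= {..<N}" if "x:godel ` p" for x
 proof -
  have "fv (foldr (%i psi. Con (at1 c de i) psi) xs psi) = (UN i:set xs. fv (at1 c de i)) Un fv psi" for xs psi
   by (induction xs) auto
  hence "fv (G x) = (\<Union>i<k. fv (at1 c de i)) Un fv (TT (dec x))"
   by (simp add: G_def atLeast0LessThan)
  moreover have "fv (dec x) <= {..<k + n}" using that p by (auto simp: n_def)
  hence "fv (TT (dec x)) <= {..<N}" unfolding N_def by (rule TT)
  moreover have "fv (at1 c de i) <= {..<N}" if "i < k" for i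
   using that unfolding N_def by (intro fv_at1_below fvde) simp
  ultimately show ?thesis using UN_least[of "{..<k}" "%i. fv (at1 c de i)" "{..<N}"] by simp
 qed
 define env where "env u xs i = (if i < c then (if odd i then b (i div 2) else if i = 6 then q else if i = 4 then u else z)
  else if even (i - c) then z else if (i - c) div 2 < length xs + n then (xs @ as) ! ((i - c) div 2) else z)" for u xs i
 have env: "i < c ==> odd i ==> env u xs i = b (i div 2)" "env u xs 6 = q" "env u xs 4 = u"
  "i < length xs + n ==> env u xs (Suc (dbl c i)) = (xs @ as) ! i" for u xs i
  using b(2) by (auto simp: env_def dbl_def)
 have env_V: "range (env u xs) <= carr A" if "u:carr A" "set xs <= D" for u xs
 proof -
  have "(xs @ as) ! i : D" if "i < length xs + n" for i
   using nth_mem[of i "xs @ as"] that `set xs <= D` as by (auto simp: n_def)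
  thus ?thesis using that(1) b(1) q D by (auto simp: env_def)
 qed
 define V where "V = insert 4 ((%i. Suc (dbl c i)) ` {..<k})"
 have notV: "i < c ==> odd i ==> i ~: V" "6 ~: V" "Suc (dbl c (k + j)) ~: V" for i j
  using b(2) by (auto simp: V_def dbl_def)
 have env_off: "env u xs i = env u' xs' i" if "i ~: V" "length xs = k" "length xs' = k" for u u' xs xs' i
 proof (cases "i < c | even (i - c)")
  case False
  define j where "j = (i - c) div 2"
  have "2 * j + 1 = i - c" using False unfolding j_def by (intro odd_two_times_div_two_succ) simp
  hence "i = Suc (dbl c j)" using False by (simp add: dbl_def)
  hence "k <= j" using that(1) by (auto simp: V_def)
  thus ?thesis using that False by (auto simp: env_def nth_append j_def)
 qed (use that in "auto simp: env_def V_def")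
 have realized: "sem (E 4) ((!) (map (%i. E (Suc (dbl c i))) [0..<k] @ as)) ph <-> sat A E (TT ph)"
  if E: "!!i. i ~: V ==> E i = env z (replicate k z) i" "E 4 : carr A" "!!i. i < k ==> E (Suc (dbl c i)) : D" and ph: "ph:p" for E ph
 proof (rule tr[symmetric])
  fix i assume "i:fv ph"
  hence i: "i < k + n" using p ph by (auto simp: n_def)
  show "E (Suc (dbl c i)) = (map (%i. E (Suc (dbl c i))) [0..<k] @ as) ! i & (map (%i. E (Suc (dbl c i))) [0..<k] @ as) ! i : D"
  proof (cases "i < k")
   case False
   then obtain j where j: "i = k + j" "j < n" using i by (metis add_less_cancel_left le_iff_add not_le)
   hence "E (Suc (dbl c i)) = as ! j" using E(1)[OF notV(3)] env(4)[of i "replicate k z"] by (simp add: nth_append)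
   thus ?thesis using j as by (auto simp: nth_append n_def)
  qed (use E(3) in "auto simp: nth_append")
 qed (use E notV env in auto)
 have E0: "range (env z (replicate k z)) <= carr A" using D by (intro env_V) (auto split: if_splits)
 obtain E1 where E1: "range E1 <= carr A" "!!i. i ~: V ==> E1 i = env z (replicate k z) i" "!!x. x:godel ` p ==> sat A E1 (G x)"
 proof (rule saturated_env[OF sat RG comp fvG E0, where V = V])
  fix F assume F: "F <= godel ` p" "finite F"
  hence decF: "dec ` F <= p" "finite (dec ` F)" by auto
  then obtain u xs where xs: "u:carr A" "length xs = k" "set xs <= D" "ALL ph:dec ` F. sem u ((!) (xs @ as)) ph" using fin by metis
  have off: "env u xs i = env z (replicate k z) i" if "i ~: V" for i using env_off[OF that xs(2)] by simp
  have xs_i: "env u xs (Suc (dbl c i)) = xs ! i" "xs ! i : D" if "i < k" for i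
   using env(4)[of i xs u] that xs(2,3) by (auto simp: nth_append)
  have map_xs: "map (%i. env u xs (Suc (dbl c i))) [0..<k] = xs"
   using xs(2) xs_i by (intro nth_equalityI) auto
  have "sat A (env u xs) (G x)" if "x:F" for x
  proof -
   have "sat A (env u xs) (TT (dec x))"
    using realized[of "env u xs" "dec x"] off env(3) xs decF xs_i that map_xs by auto
   moreover have "sat A (env u xs) (at1 c de i)" if "i < k" for i
    using dom[of "env u xs" i] env(1) xs_i[OF that] D(1) by auto
   ultimately show ?thesis by (simp add: sat_G)
  qed
  with off env_V[OF xs(1,3)] show "EX e'. range e' <= carr A & (ALL i. i ~: V --> e' i = env z (replicate k z) i) & (ALL x:F. sat A e' (G x))" by blast
 qed auto
 \<comment> \<open>If \<open>p\<close> is empty, no formula \<open>G x\<close> belongs to the type,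
   and nothing confines the unknowns to \<open>D\<close>.\<close>
 show ?thesis
 proof (cases "p = {}")
  case True
  thus ?thesis using fin[of p] by simp
 next
  case False
  then obtain ph0 where "ph0:p" by blast
  hence "ALL i<k. sat A E1 (at1 c de i)" using E1(3)[of "godel ph0"] sat_G by blast
  hence inD: "E1 (Suc (dbl c i)) : D" if "i < k" for i
   using dom[of E1 i] E1(1,2) notV(1) env(1) that by auto
  have E14: "E1 4 : carr A" using E1(1) by blast
  have "ALL ph:p. sem (E1 4) ((!) (map (%i. E1 (Suc (dbl c i))) [0..<k] @ as)) ph"
   using realized[OF E1(2) E14 inD] E1(3) sat_G by (metis dec_godel image_eqI)
  thus ?thesis using E14 inD by (intro bexI[OF _ E14] exI[of _ "map (%i. E1 (Suc (dbl c i))) [0..<k]"]) auto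
 qed
qed

text \<open>A type of \<open>B\<close> becomes a type of \<open>A\<close> about representatives. The
  additional unknown and the additional parameter of \<open>saturated_translation\<close> are filled
  with an arbitrary \<open>z\<close>.\<close>

theorem computably_saturated_interp:
 assumes "interp A D E Q io B" "computably_saturated A"
 shows "computably_saturated B"
 unfolding computably_saturated_def
proof (intro allI impI; elim conjE)
 fix as k p
 assume as: "set as <= carr B" and p: "ALL ph:p. fv ph <= {..<k + length as}"
  and comp: "computable_set (godel ` p)"
  and fin: "ALL q<=p. finite q --> (EX xs. length xs = k & set xs <= carr B & realizes B as xs q)"
 obtain a c de ep et where "interp_by A D io B a c de ep et" using interp_formulas[OF assms(1)] by blast
 hence a: "range a <= carr A" and c: "6 < c" and fvs: "fv de <= {..<c}" "fv ep <= {..<c}" "fv et <= {..<c}"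
  and tr: "!!E ph e. (!!i. i < c ==> odd i ==> E i = a (i div 2)) ==> (!!i. i : fv ph ==> E (Suc (dbl c i)) = e i & e i : D) ==>
   sat A E (transl c de ep et ph) <-> sat B (io o e) ph"
  and dom: "!!E i. (!!i. i < c ==> odd i ==> E i = a (i div 2)) ==> E (Suc (dbl c i)) : carr A ==>
   sat A E (at1 c de i) <-> E (Suc (dbl c i)) : D"
  unfolding interp_by_def by simp_all
 have D: "D <= carr A" "io ` D = carr B" "D ~= {}" using assms(1) by (auto simp: interp_def)
 obtain z where z: "z:D" using D(3) by blast
 define rep where "rep = inv_into D io"
 have rep: "rep b : D" "io (rep b) = b" if "b:carr B" for b
  using that D(2) by (auto simp: rep_def inv_into_into f_inv_into_f)
 have map: "sat B (io o (!) (xs @ map rep as)) ph <-> sat B ((!) (map io xs @ as)) ph"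
  if "ph:p" "length xs = k" for xs ph
 proof (rule sat_cong)
  fix i assume "i:fv ph"
  hence "i < k + length as" using p that by auto
  hence "(io o (!) (xs @ map rep as)) i = map io (xs @ map rep as) ! i" using that by (simp del: map_append)
  also have "map io (xs @ map rep as) = map io xs @ as" using rep(2) as by (auto intro!: map_idI)
  finally show "(io o (!) (xs @ map rep as)) i = (map io xs @ as) ! i" .
 qed
 have "EX u:carr A. EX xs. length xs = k & set xs <= D & (ALL ph:p. sat B (io o (!) (xs @ map rep as)) ph)"
 proof (rule saturated_translation[OF assms(2) _ D(1) z a c, where q = z and TT = "transl c de ep et" and de = de])
  show "fv (transl c de ep et ph) <= {..<dbl c m}" if "fv ph <= {..<m}" for ph m by (rule fv_transl_below[OF fvs that])
  show "sat A E (transl c de ep et ph) <-> sat B (io o e) ph" if "!!i. i < c ==> odd i ==> E i = a (i div 2)"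
   "!!i. i:fv ph ==> E (Suc (dbl c i)) = e i & e i : D" for E ph e by (rule tr[OF that])
  show "EX u:carr A. EX xs. length xs = k & set xs <= D & (ALL ph:r. sat B (io o (!) (xs @ map rep as)) ph)"
   if r: "r <= p" "finite r" for r
  proof -
   obtain xs where xs: "length xs = k" "set xs <= carr B" "realizes B as xs r" using fin r by blast
   have "map io (map rep xs) = xs" using rep(2) xs(2) by (auto intro!: map_idI)
   hence "ALL ph:r. sat B (io o (!) (map rep xs @ map rep as)) ph"
    using map[of _ "map rep xs"] xs(1,3) r(1) by (auto simp: realizes_def)
   thus ?thesis using xs rep(1) z D(1) by (intro bexI[of _ z] exI[of _ "map rep xs"]) auto
  qed
 qed (use z D(1) rep(1) as p comp fvs dom Rec_transl in auto)
 then obtain xs where "length xs = k" "set xs <= D" "ALL ph:p. sat B (io o (!) (xs @ map rep as)) ph" by blast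
 thus "EX xs. length xs = k & set xs <= carr B & realizes B as xs p"
  using map unfolding D(2)[symmetric] by (intro exI[of _ "map io xs"]) (auto simp: realizes_def)
qed

section \<open>Back-and-forth between a saturated model and an interpreted structure\<close>

text \<open>One step of the back-and-forth: the type of a new element over the tuple already chosen is
 expressed in \<open>A\<close> alone, by comparing truth in \<open>A\<close> with truth in the interpreted structure. So
 only the saturation of \<open>A\<close> is needed, in both directions.\<close>

definition similar :: "'a struct => ('a => 'b) => 'b struct => ('a \<times> 'a) list => bool" where
 "similar A io B zs <-> (ALL ph. fv ph <= {..<length zs} -->
   (sat A (%i. fst (zs ! i)) ph <-> sat B (%i. io (snd (zs ! i))) ph))"

text \<open>The truth values of finitely many formulas at the new element are condensed into one
  formula \<open>ch\<close>, and its existential quantification transfers by similarity. This is the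
  finite satisfiability that saturation asks for.\<close>

lemma similar_witness:
 assumes "similar A io B zs" "finite F" "!!ph. ph:F ==> fv ph <= {..<Suc (length zs)}" "io ` D = carr B" "D ~= {}" "carr A ~= {}"
 shows "u:carr A ==> EX v:D. ALL ph:F. sat A (%i. fst ((zs @ [(u, v)]) ! i)) ph <-> sat B (%i. io (snd ((zs @ [(u, v)]) ! i))) ph"
  and "v:D ==> EX u:carr A. ALL ph:F. sat A (%i. fst ((zs @ [(u, v)]) ! i)) ph <-> sat B (%i. io (snd ((zs @ [(u, v)]) ! i))) ph"
proof -
 let ?n = "length zs"
 have A: "sat A (%i. fst ((zs @ [(u, v)]) ! i)) ph <-> sat A ((%i. fst (zs ! i))(?n := u)) ph"
  and B: "sat B (%i. io (snd ((zs @ [(u, v)]) ! i))) ph <-> sat B ((%i. io (snd (zs ! i)))(?n := io v)) ph"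
  if "fv ph <= {..<Suc ?n}" for u v ph
  using that by (auto intro!: sat_cong simp: nth_append)
 define sg where "sg T = (%ph. if T ph then ph else Neg ph) ` F" for T
 have sg: "(ALL ph:sg T. sat N e ph) <-> (ALL ph:F. sat N e ph <-> T ph)" for T e and N :: "'c struct"
  unfolding sg_def ball_simps by (rule ball_cong) auto
 have sg': "finite (sg T)" "!!ph. ph:sg T ==> fv ph <= {..<Suc ?n}" for T
  using assms(2) assms(3)[THEN subsetD] by (auto simp: sg_def split: if_splits)
 have ex: "(EX u:carr A. sat A ((%i. fst (zs ! i))(?n := u)) ch) <-> (EX v:carr B. sat B ((%i. io (snd (zs ! i)))(?n := v)) ch)"
  if "fv ch <= {..<Suc ?n}" for ch
 proof -
  have "fv (Exi ?n ch) <= {..<?n}" using that by auto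
  thus ?thesis using assms(1)[unfolded similar_def, rule_format, of "Exi ?n ch"] by simp
 qed
 show "EX v:D. ALL ph:F. sat A (%i. fst ((zs @ [(u, v)]) ! i)) ph <-> sat B (%i. io (snd ((zs @ [(u, v)]) ! i))) ph"
  if u: "u:carr A"
 proof -
  define T where "T = sat A ((%i. fst (zs ! i))(?n := u))"
  obtain ch where ch: "fv ch <= {..<Suc ?n}" "!!e. sat A e ch <-> (ALL ph:sg T. sat A e ph)"
   "!!e. sat B e ch <-> (ALL ph:sg T. sat B e ph)"
   using big_Con[OF sg'(1)[of T] sg'(2)[of _ T], of A B] by blast
  have "sat A ((%i. fst (zs ! i))(?n := u)) ch" unfolding ch(2) sg by (simp add: T_def)
  then obtain b where "b:carr B" "sat B ((%i. io (snd (zs ! i)))(?n := b)) ch" using ex[OF ch(1)] u by blast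
  then obtain v where "v:D" "sat B ((%i. io (snd (zs ! i)))(?n := io v)) ch"
   using assms(4) by (metis imageE)
  thus ?thesis unfolding ch(3) sg using A B assms(3) by (auto simp: T_def intro!: bexI[of _ v])
 qed
 show "EX u:carr A. ALL ph:F. sat A (%i. fst ((zs @ [(u, v)]) ! i)) ph <-> sat B (%i. io (snd ((zs @ [(u, v)]) ! i))) ph"
  if v: "v:D"
 proof -
  define T where "T = sat B ((%i. io (snd (zs ! i)))(?n := io v))"
  obtain ch where ch: "fv ch <= {..<Suc ?n}" "!!e. sat A e ch <-> (ALL ph:sg T. sat A e ph)"
   "!!e. sat B e ch <-> (ALL ph:sg T. sat B e ph)"
   using big_Con[OF sg'(1)[of T] sg'(2)[of _ T], of A B] by blast
  have "sat B ((%i. io (snd (zs ! i)))(?n := io v)) ch" unfolding ch(3) sg by (simp add: T_def)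
  then obtain u where "u:carr A" "sat A ((%i. fst (zs ! i))(?n := u)) ch" using ex[OF ch(1)] v assms(4) by blast
  thus ?thesis unfolding ch(2) sg using A B assms(3) by (auto simp: T_def intro!: bexI[of _ u])
 qed
qed

text \<open>Forth and back at once: \<open>bu\<close> and \<open>bv\<close> tell which of the two
  new elements is sought, the other one being fixed as \<open>u0\<close> or \<open>v0\<close>. The
  type consists, for every number \<open>x\<close>, of the equivalence between the truth of
  \<open>dec_below (Suc ?n) x\<close> in \<open>A\<close> and its translated truth in
  \<open>B\<close>. Its index set is all of \<open>nat\<close>, hence computable.\<close>

lemma similar_extend:
 assumes "interp A D E Q io B" "computably_saturated A" "similar A io B zs" "set zs <= carr A \<times> D"
  and fin: "!!F. finite F ==> (!!ph. ph : F ==> fv ph <= {..<Suc (length zs)}) ==>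
   EX u v. P u v & (ALL ph:F. sat A (%i. fst ((zs @ [(u, v)]) ! i)) ph <-> sat B (%i. io (snd ((zs @ [(u, v)]) ! i))) ph)"
  and P: "!!u v. P u v <-> u:carr A & v:D & (~bu --> u = u0) & (~bv --> v = v0)"
  and uv: "u0:carr A" "v0:D"
 shows "EX u v. P u v & similar A io B (zs @ [(u, v)])"
proof -
 let ?n = "length zs"
 obtain a c de ep et where "interp_by A D io B a c de ep et" using interp_formulas[OF assms(1)] by blast
 hence a: "range a <= carr A" and c: "6 < c" and fvs: "fv de <= {..<c}" "fv ep <= {..<c}" "fv et <= {..<c}"
  and tr: "!!E ph e. (!!i. i < c ==> odd i ==> E i = a (i div 2)) ==> (!!i. i : fv ph ==> E (Suc (dbl c i)) = e i & e i : D) ==>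
   sat A E (transl c de ep et ph) <-> sat B (io o e) ph"
  and dom: "!!E i. (!!i. i < c ==> odd i ==> E i = a (i div 2)) ==> E (Suc (dbl c i)) : carr A ==>
   sat A E (at1 c de i) <-> E (Suc (dbl c i)) : D"
  unfolding interp_by_def by simp_all
 have D: "D <= carr A" "carr A ~= {}" using assms(1) by (auto simp: interp_def is_struct_def)
 define G where "G x = Con (at1 c de ?n) (Iff (ren (dbl c) (dec_below (Suc ?n) x)) (transl c de ep et (dec_below (Suc ?n) x)))" for x
 have "Rec 1 (%xs. godel (ren (dbl c) (dec (godel (dec_below (Suc ?n) (xs ! 0))))))"
  "Rec 1 (%xs. godel (transl c de ep et (dec (godel (dec_below (Suc ?n) (xs ! 0))))))"
  by (intro Rec_ren_double_sum Rec_transl Rec_dec_below Rec_proj; simp)+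
 hence RG: "Rec 1 (%xs. godel (G (xs ! 0)))"
  unfolding G_def by (intro Rec_godel_Con Rec_godel_Iff Rec_const) simp_all
 define N where "N = dbl c (Suc ?n)"
 have fvG: "fv (G x) <= {..<N}" for x
  using fv_at1_below[OF fvs(1), of ?n "Suc ?n"] fv_transl_below[OF fvs fv_dec_below[of "Suc ?n" x]]
   fv_ren_below[OF fv_dec_below[of "Suc ?n" x], of c]
  by (simp add: G_def N_def)
 \<comment> \<open>Places \<open>c + 2 i\<close> hold the tuple of \<open>A\<close> and places
   \<open>c + 2 i + 1\<close> the representatives for \<open>B\<close>. The minimum repeats the last
   entry beyond the tuple, merely to stay inside the carrier.\<close>
 define env where "env u v i = (if i < c then (if odd i then a (i div 2) else u0)
  else if even (i - c) then fst ((zs @ [(u, v)]) ! min ?n ((i - c) div 2)) else snd ((zs @ [(u, v)]) ! min ?n ((i - c) div 2)))" for u v i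
 have env_A: "env u v (dbl c i) = fst ((zs @ [(u, v)]) ! i)" "env u v (Suc (dbl c i)) = snd ((zs @ [(u, v)]) ! i)"
  if "i < Suc ?n" for u v i
 proof -
  have "dbl c i - c = 2 * i" "Suc (dbl c i) - c = Suc (2 * i)" "~dbl c i < c" "~Suc (dbl c i) < c"
   by (auto simp: dbl_def)
  thus "env u v (dbl c i) = fst ((zs @ [(u, v)]) ! i)" "env u v (Suc (dbl c i)) = snd ((zs @ [(u, v)]) ! i)"
   using that by (simp_all add: env_def min_absorb2)
 qed
 have set': "(zs @ [(u, v)]) ! i : carr A \<times> D" if "i < Suc ?n" "u:carr A" "v:D" for u v i
  using that assms(4) nth_mem[of i zs] by (auto simp: nth_append less_Suc_eq)
 have env_ran: "range (env u v) <= carr A" if "u:carr A" "v:D" for u v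
 proof
  fix y assume "y:range (env u v)"
  then obtain i where "y = env u v i" by blast
  thus "y:carr A" using a uv D(1) set'[of "min ?n ((i - c) div 2)", OF _ that] by (auto simp: env_def mem_Times_iff subset_iff)
 qed
 have env_par: "env u v i = a (i div 2)" if "i < c" "odd i" for u v i using that by (simp add: env_def)
 have sat_G: "sat A e (G x) <-> (sat A (%i. fst ((zs @ [(u, v)]) ! i)) (dec_below (Suc ?n) x) <->
   sat B (%i. io (snd ((zs @ [(u, v)]) ! i))) (dec_below (Suc ?n) x))"
  if "u:carr A" "v:D" and e: "!!i. i < c ==> odd i ==> e i = a (i div 2)"
   "!!i. i < Suc ?n ==> e (dbl c i) = fst ((zs @ [(u, v)]) ! i) & e (Suc (dbl c i)) = snd ((zs @ [(u, v)]) ! i)" for u v x e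
 proof -
  have fv: "i < Suc ?n" if "i:fv (dec_below (Suc ?n) x)" for i using fv_dec_below that by blast
  have "sat A e (ren (dbl c) (dec_below (Suc ?n) x)) <-> sat A (%i. fst ((zs @ [(u, v)]) ! i)) (dec_below (Suc ?n) x)"
   unfolding sat_ren[OF inj_double_sum] by (rule sat_cong) (use fv e in auto)
  moreover have "sat A e (transl c de ep et (dec_below (Suc ?n) x)) <-> sat B (io o (%i. snd ((zs @ [(u, v)]) ! i))) (dec_below (Suc ?n) x)"
   by (rule tr) (use fv e set'[OF _ that(1,2)] in "auto simp: mem_Times_iff")
  moreover have "sat A e (at1 c de ?n)"
   using dom[of e ?n] e(1) e(2)[of ?n] that(2) D(1) by auto
  ultimately show ?thesis by (auto simp: G_def comp_def)
 qed
 define V where "V = (if bu then {dbl c ?n} else {}) Un (if bv then {Suc (dbl c ?n)} else {})"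
 have V: "i ~: V" if "i < c" for i using that by (auto simp: V_def dbl_def)
 have Vn: "dbl c i ~: V & Suc (dbl c i) ~: V" if "i < ?n" for i using that by (auto simp: V_def)
 obtain e where e: "range e <= carr A" "!!i. i ~: V ==> e i = env u0 v0 i" "!!x. x:UNIV ==> sat A e (G x)"
 proof (rule saturated_env[OF assms(2) RG computable_UNIV fvG env_ran[OF uv], where V = V])
  fix F :: "nat set" assume "finite F"
  then obtain u v where P': "P u v" and eq: "ALL ph:dec_below (Suc ?n) ` F. sat A (%i. fst ((zs @ [(u, v)]) ! i)) ph <-> sat B (%i. io (snd ((zs @ [(u, v)]) ! i))) ph"
   using fin[of "dec_below (Suc ?n) ` F"] fv_dec_below by blast
  hence uv': "u:carr A" "v:D" using P by auto
  define e' where "e' = (env u0 v0)(dbl c ?n := u, Suc (dbl c ?n) := v)"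
  have e'n: "e' (dbl c i) = fst ((zs @ [(u, v)]) ! i) & e' (Suc (dbl c i)) = snd ((zs @ [(u, v)]) ! i)" if "i < Suc ?n" for i
   using that env_A[of i u0 v0] by (cases "i = ?n") (auto simp: e'_def nth_append)
  have "range e' <= carr A" using env_ran[OF uv] uv' D(1) by (auto simp: e'_def)
  moreover have "e' i = env u0 v0 i" if "i ~: V" for i
   using that P' env_A[of ?n u0 v0] unfolding P by (auto simp: e'_def V_def split: if_splits)
  moreover have "sat A e' (G x)" if "x:F" for x
   by (subst sat_G[OF uv' _ e'n]) (use eq that env_par in "auto simp: e'_def")
  ultimately show "EX e'. range e' <= carr A & (ALL i. i ~: V --> e' i = env u0 v0 i) & (ALL x:F. sat A e' (G x))" by blast
 qed auto
 define u v where "u = e (dbl c ?n)" and "v = e (Suc (dbl c ?n))"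
 have par: "e i = a (i div 2)" if "i < c" "odd i" for i using e(2) V env_par that by simp
 have "sat A e (at1 c de ?n)" using e(3)[of 0] by (simp add: G_def)
 hence "v:D" using dom[of e ?n] par e(1) by (auto simp: v_def)
 moreover have "u:carr A" using e(1) by (auto simp: u_def)
 moreover have "u = u0" if "~bu" using e(2)[of "dbl c ?n"] env_A[of ?n] that by (auto simp: u_def V_def)
 moreover have "v = v0" if "~bv" using e(2)[of "Suc (dbl c ?n)"] env_A[of ?n] that by (auto simp: v_def V_def)
 ultimately have Puv: "P u v" unfolding P by blast
 have en: "e (dbl c i) = fst ((zs @ [(u, v)]) ! i) & e (Suc (dbl c i)) = snd ((zs @ [(u, v)]) ! i)" if "i < Suc ?n" for i
  using that e(2) Vn[of i] env_A[of i u0 v0] by (cases "i = ?n") (auto simp: nth_append u_def v_def)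
 have "similar A io B (zs @ [(u, v)])"
  unfolding similar_def
 proof (intro allI impI)
  fix ph assume "fv ph <= {..<length (zs @ [(u, v)])}"
  hence ph: "fv ph <= {..<Suc ?n}" by simp
  have "carr B ~= {}" using assms(1) by (auto simp: interp_def)
  thus "sat A (%i. fst ((zs @ [(u, v)]) ! i)) ph <-> sat B (%i. io (snd ((zs @ [(u, v)]) ! i))) ph"
   using e(3)[of "godel ph"] sat_G[OF `u : carr A` `v : D` par en, of "godel ph"]
    sat_dec_below[OF D(2) ph] sat_dec_below[OF _ ph, of B] by simp
 qed
 with Puv show ?thesis by blast
qed

theorem back_and_forth:
 assumes int: "interp A D E Q io B" and sat: "computably_saturated A" and cnt: "countable (carr A)"
  and "similar A io B zs" "set zs <= carr A \<times> D"
 obtains h where "struct_iso h B A" "!!u v. (u, v):set zs ==> h (io v) = u"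
proof -
 have D: "D <= carr A" "io ` D = carr B" "D ~= {}" "carr A ~= {}"
  using int by (auto simp: interp_def is_struct_def)
 define Ok where "Ok zs <-> similar A io B zs & set zs <= carr A \<times> D" for zs
 have forth: "EX v. Ok (zs @ [(u, v)])" if "Ok zs" "u:carr A" for zs u
 proof -
  obtain v0 where "v0:D" using D(3) by blast
  have fin: "EX u' v. (u' = u & v : D) & (ALL ph:F. sat A (%i. fst ((zs @ [(u', v)]) ! i)) ph <->
    sat B (%i. io (snd ((zs @ [(u', v)]) ! i))) ph)"
   if "finite F" "!!ph. ph:F ==> fv ph <= {..<Suc (length zs)}" for F
   using similar_witness(1)[OF _ that D(2-4) `u : carr A`] `Ok zs` by (auto simp: Ok_def)
  have "EX u' v. (u' = u & v:D) & similar A io B (zs @ [(u', v)])"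
   by (rule similar_extend[where bu = False and bv = True and ?u0.0 = u and ?v0.0 = v0, OF int sat _ _ fin])
    (use that D(1) `v0 : D` in "auto simp: Ok_def")
  thus ?thesis using that by (auto simp: Ok_def)
 qed
 have bk: "EX u. Ok (zs @ [(u, v)])" if "Ok zs" "v:D" for zs v
 proof -
  obtain u0 where "u0:carr A" using D(4) by blast
  have fin: "EX u v'. (u : carr A & v' = v) & (ALL ph:F. sat A (%i. fst ((zs @ [(u, v')]) ! i)) ph <->
    sat B (%i. io (snd ((zs @ [(u, v')]) ! i))) ph)"
   if "finite F" "!!ph. ph:F ==> fv ph <= {..<Suc (length zs)}" for F
   using similar_witness(2)[OF _ that D(2-4) `v : D`] `Ok zs` by (auto simp: Ok_def)
  have "EX u v'. (u:carr A & v' = v) & similar A io B (zs @ [(u, v')])"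
   by (rule similar_extend[where bu = True and bv = False and ?u0.0 = u0 and ?v0.0 = v, OF int sat _ _ fin])
    (use that D(1) `u0 : carr A` in "auto simp: Ok_def")
  thus ?thesis using that by (auto simp: Ok_def)
 qed
 define al where "al = from_nat_into (carr A)"
 define bet where "bet = from_nat_into D"
 have al: "range al = carr A" and bet: "range bet = D"
  using D cnt countable_subset[OF D(1)] by (simp_all add: al_def bet_def range_from_nat_into)
 define step where "step n zs = (if even n then zs @ [(al (n div 2), SOME v. Ok (zs @ [(al (n div 2), v)]))]
  else zs @ [(SOME u. Ok (zs @ [(u, bet (n div 2))]), bet (n div 2))])" for n zs
 have Ok_step: "Ok (step n zs)" if "Ok zs" for n zs
  using someI_ex[OF forth[OF that, of "al (n div 2)"]] someI_ex[OF bk[OF that, of "bet (n div 2)"]] al bet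
  by (auto simp: step_def)
 define S where "S = rec_nat zs step"
 have S_Suc: "S (Suc n) = step n (S n)" for n by (simp add: S_def)
 have Ok_S: "Ok (S n)" for n
  by (induction n) (use assms(4,5) Ok_step in "auto simp: S_def Ok_def")
 have S_mono: "set (S n) <= set (S m)" if "n <= m" for n m
  by (rule lift_Suc_mono_le[OF _ that]) (auto simp: S_Suc step_def)
 define R where "R = (UN n. set (S n))"
 have R_sub: "R <= carr A \<times> D" using Ok_S by (auto simp: R_def Ok_def)
 have total: "EX v. (u, v):R" if "u:carr A" for u
 proof -
  obtain n where "u = al n" using `u : carr A` al by blast
  hence "EX v. (u, v):set (S (Suc (2 * n)))" by (auto simp: S_Suc step_def)
  thus ?thesis by (auto simp: R_def)
 qed
 have surj: "EX u. (u, v):R" if "v:D" for v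
 proof -
  obtain n where "v = bet n" using `v : D` bet by blast
  hence "EX u. (u, v):set (S (Suc (Suc (2 * n))))" unfolding S_Suc[of "Suc (2 * n)"] by (auto simp: step_def)
  thus ?thesis unfolding R_def by blast
 qed
 \<comment> \<open>Two pairs occur in a common stage; similarity for \<open>Equ i j\<close> makes
   the union of the stages single-valued and injective, and \<open>Mem i j\<close> makes it preserve
   membership.\<close>
 have R: "(u = u' <-> io v = io v') & ((u, u'):mem A <-> (io v, io v'):mem B)"
  if uv: "(u, v):R" "(u', v'):R" for u v u' v'
 proof -
  obtain n m where "(u, v):set (S n)" "(u', v'):set (S m)" using uv by (auto simp: R_def)
  hence "(u, v):set (S (max n m))" "(u', v'):set (S (max n m))"
   using S_mono[of n "max n m"] S_mono[of m "max n m"] by auto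
  then obtain i j where ij: "i < length (S (max n m))" "S (max n m) ! i = (u, v)" "j < length (S (max n m))" "S (max n m) ! j = (u', v')"
   by (auto simp: in_set_conv_nth)
  have "similar A io B (S (max n m))" using Ok_S by (simp add: Ok_def)
  from this[unfolded similar_def, rule_format, of "Equ i j"] this[unfolded similar_def, rule_format, of "Mem i j"]
  show ?thesis using ij by simp
 qed
 define h where "h b = (SOME u. EX v. (u, v):R & io v = b)" for b
 have h: "h (io v) = u" if uv: "(u, v):R" for u v
  unfolding h_def by (rule some_equality) (use uv R in blast)+
 have "struct_iso h B A"
  unfolding struct_iso_def
 proof (intro conjI ballI)
  show "bij_betw h (carr B) (carr A)"
   unfolding bij_betw_def
  proof
   show "inj_on h (carr B)"
    unfolding D(2)[symmetric] by (rule inj_onI) (use surj h R in "metis (no_types, lifting) imageE")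
   show "h ` carr B = carr A"
    unfolding D(2)[symmetric] using surj total h R_sub by (fastforce simp: image_iff)
  qed
  fix x y assume "x:carr B" "y:carr B"
  then obtain v w where "v:D" "x = io v" "w:D" "y = io w" using D(2) by blast
  thus "(x, y):mem B <-> (h x, h y):mem A" using surj h R by metis
 qed
 moreover have "set zs <= R" unfolding R_def S_def by (metis UN_upper UNIV_I old.nat.simps(6))
 ultimately show ?thesis using that h by blast
qed

section \<open>Set theory inside a model\<close>

lemma sat_Con: "sat M e (Con ph psi) <-> sat M e ph & sat M e psi"
 and sat_Dis: "sat M e (Dis ph psi) <-> sat M e ph | sat M e psi"
 and sat_Iff: "sat M e (Iff ph psi) <-> (sat M e ph <-> sat M e psi)"
 and sat_Exi: "sat M e (Exi v ph) <-> (EX x:carr M. sat M (e(v := x)) ph)"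
 by (simp_all only: sat.simps) blast+

locale zfc_model =
 fixes M :: "'a struct"
 assumes model: "is_model M zfc"
begin

abbreviation emp :: 'a where "emp == empty_in M"
abbreviation om :: 'a where "om == omega_in M"
abbreviation sc :: "'a => 'a" where "sc == succ_in M"

abbreviation V :: "'a set" where "V == carr M"
abbreviation E :: "'a => 'a set" where "E == ext M"

lemma nonempty [simp]: "V ~= {}" and mem_sub: "mem M <= V \<times> V" and struct: "is_struct M"
 using model by (auto simp: is_model_def is_struct_def)

lemmas [dfi] = dft_var[OF nonempty] df_const[OF nonempty]

lemma E_sub: "E x <= V" and E_in: "y:E x ==> y:V"
 by (auto simp: ext_def)

lemma mem_iff_E: "(y, x):mem M <-> y:E x"
 using mem_sub by (auto simp: ext_def)

lemma axiom: "ph:zfc ==> range e <= V ==> sat M e ph"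
 using model by (simp add: is_model_def)

lemma single_axiom: "ph:single_axioms ==> EX e. range e <= V & sat M e ph"
proof -
 assume "ph:single_axioms"
 moreover obtain c where "c:V" using nonempty by blast
 ultimately show ?thesis using axiom[of ph "%_. c"] by (intro exI[of _ "%_. c"]) (auto simp: zfc_def)
qed

lemma extensional: "x:V ==> y:V ==> E x = E y ==> x = y"
 using single_axiom[of ax_extensionality] mem_sub
 by (auto simp: single_axioms_def ax_extensionality_def mem_iff_E)

text \<open>Set theory is phrased for the external sets that have a code in \<open>M\<close>, so
  that the set operations of HOL can be used instead of names for internal ones.\<close>

definition isset :: "'a set => bool" where
 "isset A <-> (EX x : V. E x = A)"

abbreviation S :: "'a set => 'a" where "S == set_in M"

lemma S_unique: "x:V ==> E x = A ==> S A = x"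
 unfolding set_in_def by (rule the_equality) (auto intro: extensional)

lemma S_in: "isset A ==> S A : V" and E_S: "isset A ==> E (S A) = A"
 by (auto simp: isset_def S_unique)

lemma S_E: "x:V ==> S (E x) = x"
 by (simp add: S_unique)

lemma isset_E: "x:V ==> isset (E x)"
 by (auto simp: isset_def)

lemma isset_sub: "isset A ==> A <= V"
 using E_sub by (auto simp: isset_def)

lemma isset_sep:
 assumes A: "isset A" and P: "df M (%e. P (e 0))"
 shows "isset {x:A. P x}"
proof -
 obtain x where x: "x:V" "E x = A" using A by (auto simp: isset_def)
 obtain ph a where a: "range a <= V" and ph: "!!e. range e <= V ==> P (e 0) <-> sat M (mrg e a) ph"
  using dfD[OF P] by blast
 \<comment> \<open>The argument stays at \<open>0\<close> and all other variables move past
   \<open>1\<close> and \<open>2\<close>, which the axiom binds.\<close>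
 define f :: "nat => nat" where "f n = (if n = 0 then 0 else n + 2)" for n
 have f: "inj f" by (auto simp: f_def inj_def)
 have "2 ~: fv (ren f ph)" by (auto simp: fv_ren[OF f] f_def)
 hence ax: "separation (ren f ph) : zfc" by (auto simp: zfc_def)
 define e where "e n = mrg (%_. x) a (n - 2)" for n
 have "range e <= V" using a x by (auto simp: e_def mrg_def)
 from axiom[OF ax this] x(1)
 obtain y where y: "y:V" "ALL z:V. (z, y):mem M <-> (z, x):mem M & sat M (e(1 := x, 2 := y, 0 := z)) (ren f ph)"
  by (fastforce simp: separation_def)
 have "sat M (e(1 := x, 2 := y, 0 := z)) (ren f ph) <-> P z" if "z:V" for z
 proof -
  have "e(1 := x, 2 := y, 0 := z) o f = mrg ((%_. x)(0 := z)) a"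
   by (auto simp: f_def e_def fun_eq_iff mrg_def)
  moreover have "range ((%_. x)(0 := z)) <= V" using x that by auto
  from ph[OF this] have "P z <-> sat M (mrg ((%_. x)(0 := z)) a) ph" by simp
  ultimately show ?thesis by (simp only: sat_ren[OF f])
 qed
 with y x(2) have "E y = {x:A. P x}" by (auto simp: ext_def)
 thus ?thesis using y(1) by (auto simp: isset_def)
qed

lemma isset_repl:
 assumes A: "isset A" and R: "df M (%e. R (e 0) (e 1))" and fn: "!!x. x:A ==> EX! y. y:V & R x y"
 shows "isset {y:V. EX x : A. R x y}"
proof -
 obtain x where x: "x:V" "E x = A" using A by (auto simp: isset_def)
 obtain ph a where a: "range a <= V" and ph: "!!e. range e <= V ==> R (e 0) (e 1) <-> sat M (mrg e a) ph"
  using dfD[OF R] by blast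
 \<comment> \<open>\<open>mrg\<close> places the second argument at \<open>2\<close>, the axiom
   wants it at \<open>1\<close>; everything else moves past the bound variables \<open>2\<close> and
   \<open>3\<close>.\<close>
 define f :: "nat => nat" where "f n = (if n = 0 then 0 else if n = 2 then 1 else n + 3)" for n
 have f: "inj f" by (auto simp: f_def inj_def)
 have "3 ~: fv (ren f ph)" by (auto simp: fv_ren[OF f] f_def)
 hence ax: "replacement (ren f ph) : zfc" by (auto simp: zfc_def)
 define e where "e n = mrg (%_. x) a (n - 3)" for n
 have e: "range e <= V" using a x by (auto simp: e_def mrg_def)
 have 1: "sat M e' (ren f ph) <-> R u y" if "u:V" "y:V" "e' 0 = u" "e' 1 = y" "!!n. n > 3 ==> e' n = e n" for u y e'
 proof -
  have "e' o f = mrg ((%_. x)(0 := u, 1 := y)) a"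
   using that by (auto simp: f_def e_def fun_eq_iff mrg_def)
  moreover have "range ((%_. x)(0 := u, 1 := y)) <= V" using x that by auto
  from ph[OF this] have "R u y <-> sat M (mrg ((%_. x)(0 := u, 1 := y)) a) ph" by simp
  ultimately show ?thesis by (simp only: sat_ren[OF f])
 qed
 have "sat M (e(2 := x)) (All 0 (Imp (Mem 0 2) (Exi 3 (All 1 (Iff (ren f ph) (Equ 1 3))))))"
 proof -
  have "EX w:V. ALL y:V. (sat M (e(2 := x, 0 := z, 3 := w, 1 := y)) (ren f ph) --> y = w) &
    (y = w --> sat M (e(2 := x, 0 := z, 3 := w, 1 := w)) (ren f ph))" if "z : V" "(z, x) : mem M" for z
  proof -
   have "z:A" using that x(2) by (auto simp: ext_def)
   then obtain w where w: "w:V" "R z w" "!!y. y:V ==> R z y ==> y = w" using fn by blast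
   have "sat M (e(2 := x, 0 := z, 3 := w, 1 := y)) (ren f ph) <-> R z y" if "y:V" for y
    by (rule 1) (use `z : V` that in auto)
   thus ?thesis using w by blast
  qed
  thus ?thesis by simp
 qed
 hence "sat M (e(2 := x)) (Exi 3 (All 1 (Iff (Mem 1 3) (Exi 0 (Con (Mem 0 2) (ren f ph))))))"
  using axiom[OF ax e] x(1) unfolding replacement_def by (simp only: sat.simps(4,5))
 then obtain y where y: "y:V" "ALL w:V. ((w, y) : mem M --> (EX u:V. (u, x) : mem M & sat M (e(2 := x, 3 := y, 1 := w, 0 := u)) (ren f ph))) &
   ((ALL u:V. (u, x) : mem M --> ~sat M (e(2 := x, 3 := y, 1 := w, 0 := u)) (ren f ph)) | (w, y) : mem M)"
  by auto
 moreover have "sat M (e(2 := x, 3 := y, 1 := w, 0 := u)) (ren f ph) <-> R u w" if "u:V" "w:V" for u w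
  by (rule 1) (use that in auto)
 ultimately have y': "ALL w:V. (w, y):mem M <-> (EX u:V. (u, x):mem M & R u w)" by blast
 have "E y = {y:V. EX x : A. R x y}"
  using y' x by (auto simp: ext_def)
 thus ?thesis using y(1) by (auto simp: isset_def)
qed

lemma isset_image:
 assumes "isset A" "dft M (%e. F (e 0))"
 shows "isset (F ` A)"
proof -
 have FV: "F x : V" if "x:V" for x using dft_in[OF assms(2), of "%_. x"] that by auto
 have "df M (%e. e 0 = F (e 1))" using assms(2) by (simp add: dft_def)
 from df_rel2[where R = "%x y. x = F y", OF this dft_var dft_var]
 have "df M (%e. e 1 = F (e 0))" by simp
 hence "isset {y:V. EX x:A. y = F x}"
  using isset_repl[OF assms(1), of "%x y. y = F x"] FV isset_sub[OF assms(1)] by auto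
 moreover have "{y:V. EX x:A. y = F x} = F ` A" using FV isset_sub[OF assms(1)] by auto
 ultimately show ?thesis by simp
qed

lemma isset_pair:
 assumes "x:V" "y:V"
 shows "isset {x, y}"
proof -
 have "ALL x:V. ALL y:V. EX z:V. ALL w:V. (w, z):mem M <-> w = x | w = y"
  using single_axiom[of ax_pairing] by (simp add: single_axioms_def ax_pairing_def iff_conv_conj_imp disj_imp)
 then obtain z where "z:V" "!!w. w:V ==> w:E z <-> w = x | w = y" using assms unfolding mem_iff_E by metis
 hence "E z = {x, y}" using assms E_in[of _ z] by auto
 thus ?thesis using `z : V` by (auto simp: isset_def)
qed

lemma isset_Union:
 assumes "isset A"
 shows "isset (UN x:A. E x)"
proof -
 obtain x where x: "x:V" "E x = A" using assms by (auto simp: isset_def)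
 have "ALL x:V. EX y:V. ALL z:V. ((z, y) : mem M --> (EX w:V. (z, w) : mem M & (w, x) : mem M)) &
   ((ALL w:V. (z, w) : mem M --> (w, x) ~: mem M) | (z, y) : mem M)"
  using single_axiom[of ax_union] by (simp add: single_axioms_def ax_union_def)
 then obtain y where "y:V" "ALL z:V. (z : E y --> (EX w:V. z : E w & w : E x)) &
   ((ALL w:V. z : E w --> w ~: E x) | z : E y)"
  using x unfolding mem_iff_E by blast
 hence "E y = (UN x:A. E x)" using x(2) E_in by blast
 thus ?thesis using `y : V` by (auto simp: isset_def)
qed

lemma isset_Pow:
 assumes "isset A"
 shows "isset {x:V. E x <= A}"
proof -
 obtain x where x: "x:V" "E x = A" using assms by (auto simp: isset_def)
 have "ALL x:V. EX y:V. ALL z:V. ((z, y) : mem M --> (ALL w:V. (w, z) : mem M --> (w, x) : mem M)) &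
   ((EX w:V. (w, z) : mem M & (w, x) ~: mem M) | (z, y) : mem M)"
  using single_axiom[of ax_power] by (simp add: single_axioms_def ax_power_def)
 then obtain y where "y:V" "ALL z:V. (z : E y --> (ALL w:V. w : E z --> w : E x)) &
   ((EX w:V. w : E z & w ~: E x) | z : E y)"
  using x unfolding mem_iff_E by blast
 hence "E y = {x:V. E x <= A}" using x(2) E_in by blast
 thus ?thesis using `y : V` by (auto simp: isset_def)
qed

lemma isset_subset: "isset A ==> df M (%e. e 0 : B) ==> B <= A ==> isset B"
 using isset_sep[of A "%x. x:B"] by (simp add: Collect_conj_eq inf_absorb2)

lemma isset_Un: "isset A ==> isset B ==> isset (A Un B)"
 using isset_Union[OF isset_pair[OF S_in S_in, of A B]] by (simp add: E_S)

lemma isset_empty [simp]: "isset {}"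
proof -
 obtain x where "x:V" using nonempty by blast
 hence "isset {y:E x. False}" by (intro isset_sep isset_E dfi)
 thus ?thesis by simp
qed

lemma isset_insert: "x:V ==> isset A ==> isset (insert x A)"
 using isset_Un[OF isset_pair[of x x], of A] by simp

lemma df_isset: "isset A ==> dft M f ==> df M (%e. f e : A)"
 using df_ext[of M f "%e. S A"] by (simp add: E_S S_in dft_const)

lemma isset_Int: "isset A ==> isset B ==> isset (A Int B)"
 using isset_sep[of A "%x. x:B"] df_isset[of B "%e. e 0"] by (simp add: dft_var Int_def)

lemma isset_UN:
 assumes "isset A" "!!x. x:A ==> isset (F x)" "df M (%e. e 0 : F (e 1))"
 shows "isset (UN x:A. F x)"
proof -
 have "df M (%e. ALL z:V. z:E (e 1) <-> z:F (e 0))"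
  by (intro dfi df_rel2[where R = "%x y. x:F y", OF assms(3)])
 moreover have "EX! y. y:V & (ALL z:V. z:E y <-> z:F x)" if "x:A" for x
 proof (rule ex1I[of _ "S (F x)"])
  show "S (F x) : V & (ALL z:V. z:E (S (F x)) <-> z:F x)" using assms(2)[OF that] by (simp add: S_in E_S)
  show "y = S (F x)" if "y:V & (ALL z:V. z:E y <-> z:F x)" for y
   by (rule extensional) (use that assms(2)[OF `x : A`] isset_sub[OF assms(2)[OF `x : A`]] E_sub in "auto simp: S_in E_S")
 qed
 ultimately have "isset {y:V. EX x:A. ALL z:V. z:E y <-> z:F x}" (is "isset ?B") by (intro isset_repl assms(1))
 moreover have "(UN y:?B. E y) = (UN x:A. F x)"
 proof
  show "(UN y:?B. E y) <= (UN x:A. F x)" using E_sub by blast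
  show "(UN x:A. F x) <= (UN y:?B. E y)"
  proof
   fix z assume "z:(UN x:A. F x)"
   then obtain x where x: "x:A" "z:F x" by blast
   hence "S (F x) : ?B" using assms(2) by (auto simp: S_in E_S)
   thus "z:(UN y:?B. E y)" using x E_S[OF assms(2)] by blast
  qed
 qed
 ultimately show ?thesis using isset_Union[of ?B] by simp
qed

lemma df_subset [dfi]: "dft M f ==> dft M g ==> df M (%e. E (f e) <= E (g e))"
 unfolding subset_eq by (intro dfi dft_weaken)

subsection \<open>Pairs\<close>

abbreviation pr :: "'a => 'a => 'a" where "pr == pair_in M"

lemma pr_in [simp]: "x:V ==> y:V ==> pr x y : V"
 unfolding pair_in_def using isset_pair isset_pair[of x x] by (auto intro!: S_in isset_pair)

lemma pr_inj:
 assumes "x:V" "y:V" "x':V" "y':V"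
 shows "pr x y = pr x' y' <-> x = x' & y = y'"
proof
 assume "pr x y = pr x' y'"
 have E1: "isset {u}" if "u:V" for u using isset_pair[of u u] that by simp
 have "E (pr u v) = {S {u}, S {u, v}}" if "u:V" "v:V" for u v
  unfolding pair_in_def using that by (intro E_S isset_pair S_in) (auto intro: E1 isset_pair)
 with `pr x y = pr x' y'` have eq: "{S {x}, S {x, y}} = {S {x'}, S {x', y'}}" using assms by metis
 have "E ` {S {u}, S {u, v}} = {{u}, {u, v}}" if "u:V" "v:V" for u v
  using E_S[OF E1] E_S[OF isset_pair] that by simp
 hence "{{x}, {x, y}} = {{x'}, {x', y'}}" using arg_cong[OF eq, of "(`) E"] assms by simp
 thus "x = x' & y = y'" by (auto simp: doubleton_eq_iff)
qed simp

lemma eq_S_iff: "isset A ==> x:V ==> x = S A <-> (ALL z:V. z:E x <-> z:A)"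
 using extensional[of x "S A"] isset_sub[of A] E_sub[of x] by (auto simp: S_in E_S)

lemma dft_S:
 assumes "!!e. range e <= V ==> isset (F e)" "df M (%e. e 0 : F (%n. e (Suc n)))"
 shows "dft M (%e. S (F e))"
proof (rule dft_descr)
 show "S (F e) : V" if "range e <= V" for e using assms(1)[OF that] by (rule S_in)
 show "x = S (F e) <-> (ALL z:V. z:E x <-> z:F e)" if "range e <= V" "x:V" for x e
  using assms(1) that by (intro eq_S_iff)
 have "df M (%e. e 0 : F (%n. e (Suc (Suc n))))"
  using df_weaken2[where P = "%x e. x:F e", OF assms(2)] .
 thus "df M (%e. ALL z:V. z:E (e 0) <-> z:F (%n. e (Suc n)))"
  by (intro dfi)
qed

lemma dft_upair: "dft M f ==> dft M g ==> dft M (%e. S {f e, g e})"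
 by (rule dft_fun2[where F = "%x y. S {x, y}"], rule dft_S)
  (auto intro!: isset_pair dfi simp: image_subset_iff)

lemma dft_pr [dfi]: "dft M f ==> dft M g ==> dft M (%e. pr (f e) (g e))"
 unfolding pair_in_def using dft_upair[OF dft_upair[of f f] dft_upair[of f g]] by simp

abbreviation prs :: "'a set => 'a set => 'a set" where
 "prs A B == {pr x y | x y. x:A & y:B}"

lemma isset_prs:
 assumes "isset A" "isset B"
 shows "isset (prs A B)"
proof -
 have "isset (pr x ` B)" if "x:A" for x
  using isset_sub[OF assms(1)] that by (intro isset_image assms(2) dfi) auto
 moreover have "df M (%e. EX y:E (S B). e 0 = pr (e 1) y)" using assms(2) by (intro dfi S_in)
 hence "df M (%e. e 0 : pr (e 1) ` B)" using assms(2) by (simp add: E_S image_iff)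
 ultimately have "isset (UN x:A. pr x ` B)" by (intro isset_UN assms(1))
 moreover have "(UN x:A. pr x ` B) = prs A B" by blast
 ultimately show ?thesis by simp
qed

lemma isset_rel:
 assumes "isset A" "isset B" "df M (%e. R (e 0) (e 1))"
 shows "isset {pr x y | x y. x:A & y:B & R x y}"
proof (rule isset_subset[OF isset_prs[OF assms(1,2)]])
 have "df M (%e. EX x:E (S A). EX y:E (S B). R x y & e 0 = pr x y)"
  using assms by (intro dfi S_in df_rel2[OF assms(3)])
 hence "df M (%e. EX x:A. EX y:B. R x y & e 0 = pr x y)" using assms by (simp add: E_S)
 thus "df M (%e. e 0 : {pr x y | x y. x:A & y:B & R x y})"
  by (rule back_subst[of "df M"]) auto
qed auto

lemma rel_in_iff: "(x, y):rel_in M r <-> x:V & y:V & pr x y : E r"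
 by (simp add: rel_in_def)

lemma df_rel_in [dfi]:
 assumes "dft M f" "dft M g" "dft M h"
 shows "df M (%e. (f e, g e):rel_in M (h e))"
proof -
 have "df M (%e. pr (f e) (g e) : E (h e))" using assms by (intro dfi)
 thus ?thesis
  by (rule df_cong[THEN iffD1, rotated]) (use assms in "auto simp: rel_in_iff dft_def")
qed

text \<open>An external relation whose set of pairs is a set of the model.\<close>

lemma rel_ex:
 assumes "isset A" "isset B" "df M (%e. R (e 0) (e 1))"
 obtains r where "r:V" "E r = {pr x y | x y. x:A & y:B & R x y}"
  "rel_in M r = {(x, y). x:A & y:B & R x y}"
proof -
 obtain r where r: "r:V" "E r = {pr x y | x y. x:A & y:B & R x y}"
  using isset_rel[OF assms] by (auto simp: isset_def)
 have "A <= V" "B <= V" using assms isset_sub by auto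
 hence "rel_in M r = {(x, y). x:A & y:B & R x y}"
  by (auto simp: rel_in_iff r(2) pr_inj subset_iff) (use pr_inj in metis)?
 thus ?thesis using r that by blast
qed

subsection \<open>Functions\<close>

lemma fun_in_app: "fun_in M X f ==> x:E X ==> (x, y):rel_in M f <-> y = app_in M f x"
proof -
 assume "fun_in M X f" "x:E X"
 hence "EX! y. (x, y):rel_in M f" by (simp add: fun_in_def)
 from the1_equality[OF this] theI'[OF this] show ?thesis unfolding app_in_def by metis
qed

lemma app_in_V: "fun_in M X f ==> x:E X ==> app_in M f x : V"
 using fun_in_app[of X f x "app_in M f x"] by (simp add: rel_in_iff)

lemma fun_in_eq:
 assumes "fun_in M X f" "fun_in M X g" "!!x. x:E X ==> app_in M f x = app_in M g x"
 shows "f = g"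
proof (rule extensional)
 have E: "E h = (%x. pr x (app_in M h x)) ` E X" if "fun_in M X h" for h
 proof
  show "E h <= (%x. pr x (app_in M h x)) ` E X"
  proof
   fix z assume z: "z:E h"
   then obtain x y where xy: "x:E X" "y:V" "z = pr x y" using `fun_in M X h` unfolding fun_in_def by blast
   hence "y = app_in M h x" using fun_in_app[OF that xy(1), of y] z E_in by (simp add: rel_in_iff)
   thus "z:(%x. pr x (app_in M h x)) ` E X" using xy by blast
  qed
  show "(%x. pr x (app_in M h x)) ` E X <= E h"
   using fun_in_app[OF that] by (auto simp: rel_in_iff)
 qed
 show "E f = E g" unfolding E[OF assms(1)] E[OF assms(2)] using assms(3) by (intro image_cong) simp_all
qed (use assms in "auto simp: fun_in_def")

lemma fun_ex:
 assumes "X:V" "df M (%e. R (e 0) (e 1))" "!!x. x:E X ==> g x : V"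
  "!!x y. x:E X ==> y:V ==> R x y <-> y = g x"
 obtains f where "fun_in M X f" "!!x. x:E X ==> app_in M f x = g x"
proof -
 have "isset {y:V. EX x:E X. R x y}" by (rule isset_repl) (use assms in "auto intro: isset_E")
 then obtain f where f: "f:V" "E f = {pr x y | x y. x:E X & y:{y:V. EX x:E X. R x y} & R x y}"
  "rel_in M f = {(x, y). x:E X & y:{y:V. EX x:E X. R x y} & R x y}"
  by (rule rel_ex[OF isset_E[OF assms(1)] _ assms(2)])
 have rel: "(x, y):rel_in M f <-> y = g x" if "x:E X" for x y
  unfolding f(3) using that assms(3,4) by auto
 hence "fun_in M X f" unfolding fun_in_def using f(1,2) by auto
 moreover from this have "app_in M f x = g x" if "x:E X" for x
  using fun_in_app[of X f x "g x"] rel that by simp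
 ultimately show ?thesis using that by blast
qed

lemma df_fun_in [dfi]: "dft M f ==> dft M g ==> df M (%e. fun_in M (f e) (g e))"
proof (rule df_rel2[where R = "fun_in M"])
 have "df M (%e. (ALL z:E (e 1). EX x:E (e 0). EX y:V. z = pr x y) &
   (ALL x:E (e 0). (EX y:V. (x, y) : rel_in M (e 1)) &
    (ALL y:V. ALL z:V. (x, y) : rel_in M (e 1) --> (x, z) : rel_in M (e 1) --> y = z)))"
  by (intro dfi)
 thus "df M (%e. fun_in M (e 0) (e 1))"
  by (rule df_cong[THEN iffD1, rotated]) (auto simp: fun_in_def rel_in_iff image_subset_iff)
qed

lemma empty_in_V [simp]: "emp : V" and E_empty [simp]: "E (emp) = {}"
 by (simp_all add: empty_in_def S_in E_S)

lemma succ_in_V [simp]: "x:V ==> sc x : V" and E_succ: "x:V ==> E (sc x) = insert x (E x)"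
 by (simp_all add: succ_in_def S_in E_S isset_insert isset_E)

lemma dft_succ [dfi]: "dft M f ==> dft M (%e. sc (f e))"
proof (rule dft_fun1[where F = "sc"])
 have "df M (%e. e 0 = e 1 | e 0 : E (e 1))" by (intro dfi)
 thus "dft M (%e. sc (e 0))"
  unfolding succ_in_def by (intro dft_S) (auto intro: isset_insert isset_E)
qed

subsection \<open>Foundation and the natural numbers\<close>

lemma foundation:
 assumes "isset A" "A ~= {}"
 shows "EX x:A. E x Int A = {}"
proof -
 obtain a where a: "a:V" "E a = A" using assms by (auto simp: isset_def)
 have "ALL x:V. (EX y:V. (y, x):mem M) --> (EX y:V. (y, x):mem M & ~(EX z:V. (z, y):mem M & (z, x):mem M))"
  using single_axiom[of ax_foundation] by (simp add: single_axioms_def ax_foundation_def)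
 thus ?thesis using a assms(2) E_sub unfolding mem_iff_E by blast
qed

lemma no_cycle: "x:V ==> y:V ==> x:E y ==> y ~: E x"
 using foundation[OF isset_pair[of x y]] by auto

lemma succ_inj: "x:V ==> y:V ==> sc x = sc y ==> x = y"
 using E_succ no_cycle by (metis insert_iff)

lemma succ_not_empty: "x:V ==> sc x ~= emp"
 using E_succ E_empty by (metis insert_not_empty)

abbreviation W :: "'a set" where "W == E (om)"

text \<open>The matrix of \<open>ax_infinity\<close>. A formula is wanted because inductivity will
  be carried through an ultrapower by the theorem of Los.\<close>

definition inductive_fm :: fm where
 "inductive_fm = Con (Exi 1 (Con (Mem 1 0) (All 2 (Neg (Mem 2 1)))))
   (All 1 (Imp (Mem 1 0) (Exi 2 (Con (Mem 2 0) (All 3 (Iff (Mem 3 2) (Dis (Mem 3 1) (Equ 3 1))))))))"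

lemma sat_inductive_fm:
 assumes "e 0 : V"
 shows "sat M e inductive_fm <-> inductive_in M (e 0)"
proof -
 have empty: "(ALL y:V. y ~: E x) <-> x = emp" if "x:V" for x
  using extensional[OF that empty_in_V] E_in by auto
 have succ: "(ALL z:V. z:E y <-> z:E x | z = x) <-> y = sc x" if "x:V" "y:V" for x y
  using extensional[OF that(2) succ_in_V[OF that(1)]] E_succ[OF that(1)] that E_in by blast
 have "sat M e inductive_fm <-> (EX x:V. x : E (e 0) & (ALL y:V. y ~: E x)) &
   (ALL x:V. x : E (e 0) --> (EX y:V. y : E (e 0) & (ALL z:V. z : E y <-> z : E x | z = x)))"
  unfolding inductive_fm_def sat.simps by (simp add: mem_iff_E iff_conv_conj_imp disj_imp)
 also have "... <-> (EX x:V. x : E (e 0) & x = emp) &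
   (ALL x:V. x : E (e 0) --> (EX y:V. y : E (e 0) & y = sc x))"
  using empty succ by (intro arg_cong2[where f = "(&)"] bex_cong ball_cong refl imp_cong conj_cong) auto
 also have "... <-> inductive_in M (e 0)"
  using assms E_in by (auto simp: inductive_in_def)
 finally show ?thesis .
qed

lemma inductive_ex: "EX w. inductive_in M w"
proof -
 obtain e where "range e <= V" "sat M e ax_infinity" using single_axiom[of ax_infinity] by (auto simp: single_axioms_def)
 thus ?thesis
  using sat_inductive_fm[of "e(0 := x)" for x] unfolding ax_infinity_def inductive_fm_def[symmetric] sat_Exi
  by (metis fun_upd_same)
qed

lemma df_inductive: "dft M f ==> df M (%e. inductive_in M (f e))"
proof (rule df_rel1[where R = "inductive_in M"])
 have "df M (%e. emp : E (e 0) & (ALL x:E (e 0). sc x : E (e 0)))"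
  by (intro dfi empty_in_V)
 thus "df M (%e. inductive_in M (e 0))"
  by (rule df_cong[THEN iffD1, rotated]) (auto simp: inductive_in_def)
qed

lemma isset_omega: "isset {x:V. ALL w. inductive_in M w --> x:E w}"
proof -
 obtain w where w: "inductive_in M w" using inductive_ex by blast
 have "df M (%e. ALL w:V. inductive_in M w --> e 0 : E w)" by (intro dfi df_inductive)
 hence "isset {x:E w. ALL w:V. inductive_in M w --> x:E w}"
  using w by (intro isset_sep isset_E) (auto simp: inductive_in_def)
 moreover have "{x:E w. ALL w:V. inductive_in M w --> x:E w} = {x:V. ALL w. inductive_in M w --> x:E w}"
  using w E_in by (auto simp: inductive_in_def)
 ultimately show ?thesis by simp
qed

lemma omega_in_V [simp]: "om : V" and W_def: "W = {x:V. ALL w. inductive_in M w --> x:E w}"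
 unfolding omega_in_def using isset_omega by (rule S_in, rule E_S)

lemma empty_in_W [simp]: "emp : W" and succ_in_W [simp]: "n:W ==> sc n : W"
 unfolding W_def by (auto simp: inductive_in_def)

lemma W_sub: "n:W ==> n:V"
 by (rule E_in)

text \<open>\<open>W\<close> may contain nonstandard numbers, so induction is confined to definable
  properties: these cut an inductive set out of \<open>W\<close>.\<close>

lemma W_induct:
 assumes "df M (%e. P (e 0))" "P (emp)" "!!n. n:W ==> P n ==> P (sc n)" "n:W"
 shows "P n"
proof -
 obtain w where w: "w:V" "E w = {n:W. P n}" using isset_sep[OF isset_E[OF omega_in_V] assms(1)] by (auto simp: isset_def)
 hence "inductive_in M w" using assms(2,3) by (simp add: inductive_in_def)
 thus ?thesis using assms(4) w(2) unfolding W_def by blast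
qed

lemma W_cases: "n:W ==> n = emp | (EX k:W. n = sc k)"
 by (rule W_induct[where P = "%n. n = emp | (EX k:W. n = sc k)"]) (auto intro!: dfi)

subsection \<open>Iteration along the natural numbers\<close>

text \<open>\<open>iter_at F a n y\<close>: the pair of \<open>n\<close> and \<open>y\<close> has a derivation from \<open>(0, a)\<close> by the rule
 \<open>(k, u) \<mapsto> (k + 1, F u)\<close>. Derivations are mere sets of pairs, which saves a recursion theorem.\<close>

definition derivation :: "('a => 'a) => 'a => 'a => bool" where
 "derivation F a d <-> (ALL z : E d. z = pr (emp) a |
   (EX k : W. EX u : V. pr k u : E d & z = pr (sc k) (F u)))"

definition iter_at :: "('a => 'a) => 'a => 'a => 'a => bool" where
 "iter_at F a n y <-> (EX d : V. derivation F a d & pr n y : E d)"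

lemma dft_closed: "dft M (%e. F (e 0)) ==> x:V ==> F x : V"
 using dft_in[of M "%e. F (e 0)" "%_. x"] by auto

lemma recursion:
 assumes a: "a:V" and F: "dft M (%e. F (e 0))"
 obtains s where "fun_in M (om) s" "app_in M s (emp) = a"
  "!!n. n:W ==> app_in M s (sc n) = F (app_in M s n)"
proof -
 note FV = dft_closed[OF F]
 have "df M (%e. iter_at F a (e 0) (e 1))"
  unfolding iter_at_def derivation_def by (intro dfi dft_fun1[OF F] a empty_in_V omega_in_V)
 note df_it = df_rel2[where R = "iter_at F a", OF this]
 have it0: "iter_at F a (emp) a"
 proof -
  have "isset {pr (emp) a}" using isset_insert[of "pr (emp) a" "{}"] a by simp
  thus ?thesis unfolding iter_at_def derivation_def by (auto simp: E_S S_in intro!: bexI[of _ "S {pr (emp) a}"])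
 qed
 have it_succ: "iter_at F a (sc n) (F y)" if "n:W" "y:V" "iter_at F a n y" for n y
 proof -
  obtain d where d: "d:V" "derivation F a d" "pr n y : E d" using `iter_at F a n y` by (auto simp: iter_at_def)
  have "isset (insert (pr (sc n) (F y)) (E d))"
   using that d FV W_sub by (intro isset_insert isset_E pr_in) auto
  then obtain d' where d': "d':V" "E d' = insert (pr (sc n) (F y)) (E d)" by (auto simp: isset_def)
  have "derivation F a d'" using d(2,3) that(1,2) unfolding derivation_def d'(2) by blast
  thus ?thesis using d' unfolding iter_at_def by blast
 qed
 have it_0D: "y = a" if it: "iter_at F a (emp) y" "y:V" for y
 proof -
  obtain d where d: "derivation F a d" "pr (emp) y : E d" using it by (auto simp: iter_at_def)
  hence "pr (emp) y = pr (emp) a | (EX k:W. EX u:V. pr (emp) y = pr (sc k) (F u))"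
   unfolding derivation_def by blast
  moreover have "pr (emp) y ~= pr (sc k) (F u)" if "k:W" "u:V" for k u
   using that it(2) FV W_sub succ_not_empty[of k] by (auto simp: pr_inj)
  ultimately show ?thesis using a it(2) by (auto simp: pr_inj)
 qed
 have it_SucD: "EX u:V. iter_at F a n u & y = F u" if it: "iter_at F a (sc n) y" "y:V" "n:W" for n y
 proof -
  obtain d where d: "d:V" "derivation F a d" "pr (sc n) y : E d" using it by (auto simp: iter_at_def)
  have n: "n:V" using W_sub it by blast
  have "pr (sc n) y ~= pr (emp) a" using n it a succ_not_empty by (simp add: pr_inj)
  then obtain k u where ku: "k:W" "u:V" "pr k u : E d" "pr (sc n) y = pr (sc k) (F u)"
   using d unfolding derivation_def by metis
  hence "sc n = sc k" "y = F u" using n W_sub[OF ku(1)] FV it(2) by (simp_all add: pr_inj)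
  moreover from this have "k = n" using n W_sub[OF ku(1)] succ_inj by simp
  ultimately show ?thesis using d ku unfolding iter_at_def by blast
 qed
 have uniq: "ALL y:V. ALL y':V. iter_at F a n y --> iter_at F a n y' --> y = y'" if "n:W" for n
  using that
 proof (rule W_induct[rotated -1])
  show "df M (%e. ALL y:V. ALL y':V. iter_at F a (e 0) y --> iter_at F a (e 0) y' --> y = y')"
   by (intro dfi df_it)
  show "ALL y:V. ALL y':V. iter_at F a (sc n) y --> iter_at F a (sc n) y' --> y = y'"
   if "n:W" "ALL y:V. ALL y':V. iter_at F a n y --> iter_at F a n y' --> y = y'" for n
   using it_SucD that by metis
 qed (use it_0D in blast)
 have ex: "EX y:V. iter_at F a n y" if "n:W" for n
  using that
 proof (rule W_induct[rotated -1])
  show "df M (%e. EX y:V. iter_at F a (e 0) y)" by (intro dfi df_it)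
 qed (use a it0 it_succ FV in blast)+
 define g where "g n = (THE y. y:V & iter_at F a n y)" for n
 have g: "g n : V & iter_at F a n (g n)" if "n:W" for n
 proof -
  have "EX! y. y:V & iter_at F a n y" using uniq[OF that] ex[OF that] by blast
  thus ?thesis unfolding g_def by (rule theI')
 qed
 have g_eq: "iter_at F a n y <-> y = g n" if "n:W" "y:V" for n y
  using g[OF that(1)] uniq[OF that(1)] that(2) by blast
 have "df M (%e. iter_at F a (e 0) (e 1))" by (intro df_it dfi)
 with g g_eq obtain s where s: "fun_in M (om) s" "!!n. n:W ==> app_in M s n = g n"
  using fun_ex[OF omega_in_V, of "iter_at F a" g] by blast
 show ?thesis
 proof (rule that[OF s(1)])
  show "app_in M s (emp) = a" using s(2) g_eq[of "emp" a] it0 a by simp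
  show "app_in M s (sc n) = F (app_in M s n)" if "n:W" for n
   using s(2) g_eq[of "sc n" "F (g n)"] it_succ[of n "g n"] g FV that by simp
 qed
qed

lemma iteration:
 assumes a: "a:V" and F: "dft M (%e. F (e 0))"
 obtains A where "isset A" "a:A" "!!x. x:A ==> F x : A"
  "!!P x. df M (%e. P (e 0)) ==> P a ==> (!!x. x:A ==> P x ==> P (F x)) ==> x:A ==> P x"
proof -
 obtain s where s: "fun_in M (om) s" "app_in M s (emp) = a"
  "!!n. n:W ==> app_in M s (sc n) = F (app_in M s n)"
  using recursion[OF a F] by blast
 have sV: "s:V" using s(1) by (simp add: fun_in_def)
 define A where "A = app_in M s ` W"
 have A: "A = {y:V. EX n:W. (n, y):rel_in M s}"
  unfolding A_def using fun_in_app[OF s(1)] app_in_V[OF s(1)] by auto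
 show ?thesis
 proof (rule that[of A])
  show "isset A"
   unfolding A using fun_in_app[OF s(1)] app_in_V[OF s(1)] sV
   by (intro isset_repl isset_E omega_in_V dfi) auto
  show "a:A" unfolding A_def using s(2) empty_in_W by blast
  show "F x : A" if x: "x:A" for x
  proof -
   obtain n where "n:W" "x = app_in M s n" using x by (auto simp: A_def)
   thus ?thesis using s(3)[of n] succ_in_W[of n] by (auto simp: A_def intro!: rev_image_eqI[of "sc n"])
  qed
  show "P x" if P: "df M (%e. P (e 0))" "P a" "!!x. x:A ==> P x ==> P (F x)" "x:A" for P x
  proof -
   have "ALL y:V. (n, y):rel_in M s --> P y" if "n:W" for n
    using that
   proof (rule W_induct[rotated -1])
    show "df M (%e. ALL y:V. (e 0, y):rel_in M s --> P y)" by (intro dfi df_rel1[OF P(1)] sV)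
   qed (use P(2,3) s fun_in_app[OF s(1)] app_in_V[OF s(1)] in "auto simp: A_def")
   thus ?thesis using P(4) fun_in_app[OF s(1)] app_in_V[OF s(1)] by (auto simp: A_def)
  qed
 qed
qed

definition transitive :: "'a set => bool" where
 "transitive T <-> (ALL x : T. E x <= T)"

lemma transitive_closure:
 assumes "isset A"
 obtains T where "isset T" "A <= T" "transitive T"
proof -
 have F: "dft M (%e. S (UN y:E (e 0). E y))"
 proof (rule dft_S)
  have "df M (%e. EX y:E (e 1). e 0 : E y)" by (intro dfi)
  thus "df M (%e. e 0 : (UN y:E (e (Suc 0)). E y))" by simp
 qed (auto intro!: isset_Union isset_E)
 obtain B where B: "isset B" "S A : B" "!!x. x:B ==> S (UN y:E x. E y) : B"
  using iteration[OF S_in[OF assms] F] by metis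
 have E: "E (S (UN y:E x. E y)) = (UN y:E x. E y)" if "x:V" for x
  using that by (intro E_S isset_Union isset_E)
 show ?thesis
 proof (rule that)
  show "isset (UN x:B. E x)" by (rule isset_Union) fact
  show "A <= (UN x:B. E x)" using B(2) E_S[OF assms] by blast
  show "transitive (UN x:B. E x)"
   unfolding transitive_def using B(3) E isset_sub[OF B(1)] by fastforce
 qed
qed

text \<open>Membership may be ill-founded from outside. For a definable property, however, the
  counterexamples inside a transitive set form a set, to which Foundation applies.\<close>

lemma E_induct:
 assumes P: "df M (%e. P (e 0))" and step: "!!x. x:V ==> (!!y. y:E x ==> P y) ==> P x" and "x:V"
 shows "P x"
proof (rule ccontr)
 assume "~P x"
 obtain T where T: "isset T" "{x} <= T" "transitive T"
  using transitive_closure[of "{x}"] isset_pair[of x x] `x : V` by auto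
 have "isset {y:T. ~P y}" by (intro isset_sep T df_Not P)
 moreover have "{y:T. ~P y} ~= {}" using T `~P x` by auto
 ultimately obtain z where z: "z:T" "~P z" "E z Int {y:T. ~P y} = {}" using foundation[of "{y:T. ~P y}"] by blast
 moreover have "E z <= T" using T(3) z(1) by (auto simp: transitive_def)
 ultimately have "!!y. y:E z ==> P y" by blast
 thus False using step[of z] z isset_sub[OF T(1)] by blast
qed

subsection \<open>Comparison of ranks\<close>

text \<open>\<open>x\<close> has at most the rank of \<open>y\<close> iff \<open>y\<close> simulates \<open>x\<close>; no ordinals are involved.\<close>

definition rank_le :: "'a => 'a => bool" where
 "rank_le x y <-> (EX R : V. pr x y : E R & (ALL u : V. ALL v : V. pr u v : E R -->
   (ALL u' : E u. EX v' : E v. pr u' v' : E R)))"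

lemma df_rank_le [dfi]: "dft M f ==> dft M g ==> df M (%e. rank_le (f e) (g e))"
 unfolding rank_le_def by (rule df_rel2) (intro dfi)

lemma rank_le_iff:
 assumes "x:V" "y:V"
 shows "rank_le x y <-> (ALL x':E x. EX y':E y. rank_le x' y')"
proof
 assume "rank_le x y"
 then obtain R where "R:V" "pr x y : E R"
  "ALL u:V. ALL v:V. pr u v : E R --> (ALL u':E u. EX v':E v. pr u' v' : E R)"
  unfolding rank_le_def by blast
 thus "ALL x':E x. EX y':E y. rank_le x' y'" using assms unfolding rank_le_def by blast
next
 assume *: "ALL x':E x. EX y':E y. rank_le x' y'"
 obtain T where T: "isset T" "{x, y} <= T" "transitive T"
  using transitive_closure[OF isset_pair[OF assms]] by blast
 \<comment> \<open>The simulations belonging to the pairs of elements need not be chosen and glued: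
   \<open>rank_le\<close> itself, restricted to a transitive set and enlarged by the pair of
   \<open>x\<close> and \<open>y\<close>, is a simulation.\<close>
 let ?le = "%u v. rank_le u v | u = x & v = y"
 have "df M (%e. ?le (e 0) (e 1))" using assms by (intro dfi)
 from rel_ex[OF T(1) T(1) this] obtain R where R: "R:V" "E R = {pr u v | u v. u:T & v:T & ?le u v}" .
 have TV: "T <= V" using isset_sub T by blast
 have R': "pr u v : E R <-> u:T & v:T & ?le u v" if "u:V" "v:V" for u v
  using TV that pr_inj unfolding R(2) by (auto simp: subset_iff)
 show "rank_le x y"
  unfolding rank_le_def
 proof (intro bexI[OF _ R(1)] conjI ballI impI)
  show "pr x y : E R" using R' assms T by auto
  fix u v u' assume uv: "u:V" "v:V" "pr u v : E R" "u':E u"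
  hence uvT: "u:T" "v:T" "?le u v" using R' by auto
  have "EX v':E v. rank_le u' v'"
   using uvT(3)
  proof
   assume "rank_le u v"
   then obtain R' where "R':V" "pr u v : E R'"
    "ALL u:V. ALL v:V. pr u v : E R' --> (ALL u':E u. EX v':E v. pr u' v' : E R')"
    unfolding rank_le_def by blast
   thus ?thesis using uv unfolding rank_le_def by blast
  qed (use * uv in auto)
  moreover have "E u <= T" "E v <= T" using T(3) uvT by (auto simp: transitive_def)
  ultimately show "EX v':E v. pr u' v' : E R" using R' TV uv(4) by blast
 qed
qed

lemma rank_le_refl: "x:V ==> rank_le x x"
 by (rule E_induct[where P = "%x. rank_le x x"]) (intro dfi, auto simp: rank_le_iff)

lemma rank_le_trans:
 assumes "x:V" "y:V" "z:V" "rank_le x y" "rank_le y z"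
 shows "rank_le x z"
proof -
 have "ALL y:V. ALL z:V. rank_le x y --> rank_le y z --> rank_le x z" if "x:V" for x
 proof (rule E_induct[where P = "%x. ALL y:V. ALL z:V. rank_le x y --> rank_le y z --> rank_le x z"])
  fix x assume x: "x:V" "!!x'. x':E x ==> ALL y:V. ALL z:V. rank_le x' y --> rank_le y z --> rank_le x' z"
  show "ALL y:V. ALL z:V. rank_le x y --> rank_le y z --> rank_le x z"
  proof (intro ballI impI)
   fix y z assume yz: "y:V" "z:V" "rank_le x y" "rank_le y z"
   have "EX z':E z. rank_le x' z'" if x': "x':E x" for x'
   proof -
    obtain y' where y': "y':E y" "rank_le x' y'" using rank_le_iff[of x y] yz x(1) x' by blast
    then obtain z' where "z':E z" "rank_le y' z'" using rank_le_iff[of y z] yz by blast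
    thus ?thesis using x(2)[OF x'] y' E_in by blast
   qed
   thus "rank_le x z" using rank_le_iff x yz by blast
  qed
 qed (use that in "intro dfi | assumption")+
 thus ?thesis using assms by blast
qed

text \<open>Linearity of ranks. If some element \<open>x'\<close> of \<open>x\<close> is not
  dominated by an element of \<open>z\<close>, the induction hypothesis makes each element of
  \<open>z\<close> smaller than \<open>x'\<close>, so that \<open>x'\<close> dominates
  \<open>z\<close>.\<close>

lemma rank_le_or_less:
 assumes "x:V" "z:V"
 shows "rank_le x z | (EX x':E x. rank_le z x')"
proof -
 have "ALL z:V. rank_le x z | (EX x':E x. rank_le z x')" if "x:V" for x
 proof (rule E_induct[where P = "%x. ALL z:V. rank_le x z | (EX x':E x. rank_le z x')"])
  fix x assume x: "x:V" "!!x'. x':E x ==> ALL z:V. rank_le x' z | (EX x'':E x'. rank_le z x'')"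
  show "ALL z:V. rank_le x z | (EX x':E x. rank_le z x')"
  proof (intro ballI disjCI)
   fix z assume z: "z:V" "~(EX x':E x. rank_le z x')"
   have "EX z':E z. rank_le x' z'" if x': "x':E x" for x'
   proof (rule ccontr)
    assume "~?thesis"
    hence "EX x'':E x'. rank_le z' x''" if "z':E z" for z' using x(2)[OF x'] that E_in by blast
    hence "rank_le z x'" using rank_le_iff z x' E_in by blast
    thus False using z x' by blast
   qed
   thus "rank_le x z" using rank_le_iff x z by blast
  qed
 qed (use that in "intro dfi | assumption")+
 thus ?thesis using assms by blast
qed

text \<open>These are levels of the cumulative hierarchy: the level of \<open>y\<close> is the power
  set of the union of the levels of the elements of \<open>y\<close>.\<close>

lemma isset_rank_le: "y:V ==> isset {x:V. rank_le x y}"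
proof -
 have "EX s:V. ALL x:V. x:E s <-> rank_le x y" if "y:V" for y
 proof (rule E_induct[where P = "%y. EX s:V. ALL x:V. x:E s <-> rank_le x y"])
  fix y assume y: "y:V" "!!y'. y':E y ==> EX s:V. ALL x:V. x:E s <-> rank_le x y'"
  have "isset {x:V. rank_le x y'}" if y': "y':E y" for y'
  proof -
   obtain s where s: "s:V" "ALL x:V. x:E s <-> rank_le x y'" using y(2)[OF y'] by blast
   hence "E s = {x:V. rank_le x y'}" using E_sub by blast
   thus ?thesis using isset_E[OF s(1)] by simp
  qed
  moreover have "df M (%e. e 0 : {x:V. rank_le x (e 1)})"
   by (rule df_cong[THEN iffD1, OF _ df_rank_le[OF dft_var dft_var]]) auto
  ultimately have "isset (UN y':E y. {x:V. rank_le x y'})" using y(1) by (intro isset_UN isset_E)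
  hence "isset {x:V. E x <= (UN y':E y. {x:V. rank_le x y'})}" by (rule isset_Pow)
  moreover have "{x:V. E x <= (UN y':E y. {x:V. rank_le x y'})} = {x:V. rank_le x y}"
  proof (rule Collect_cong, rule conj_cong[OF refl])
   fix x assume "x:V"
   thus "E x <= (UN y':E y. {x:V. rank_le x y'}) <-> rank_le x y"
    using rank_le_iff[of x y] y(1) E_in[of _ x] by blast
  qed
  ultimately show "EX s:V. ALL x:V. x:E s <-> rank_le x y" by (auto simp: isset_def)
 qed (use that in "intro dfi | assumption")+
 moreover assume "y:V"
 ultimately obtain s where s: "s:V" "ALL x:V. x:E s <-> rank_le x y" by blast
 hence "E s = {x:V. rank_le x y}" using E_sub by blast
 thus ?thesis using isset_E[OF s(1)] by simp
qed

text \<open>Induction on a bound \<open>x\<close> for the rank of some member of \<open>C\<close>.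
  If \<open>x\<close> is not a lower bound for \<open>C\<close>, then some member of
  \<open>C\<close> is already bounded by an element of \<open>x\<close>.\<close>

lemma rank_minimal:
 assumes C: "df M (%e. C (e 0))" and c: "c:V" "C c"
 shows "EX x:V. C x & (ALL y:V. C y --> rank_le x y)"
proof -
 have "(EX y:V. C y & rank_le y x) --> (EX x:V. C x & (ALL y:V. C y --> rank_le x y))" if "x:V" for x
 proof (rule E_induct[where P = "%x. (EX y:V. C y & rank_le y x) --> (EX x:V. C x & (ALL y:V. C y --> rank_le x y))"])
  fix x assume x: "x:V" "!!x'. x':E x ==> (EX y:V. C y & rank_le y x') --> (EX x:V. C x & (ALL y:V. C y --> rank_le x y))"
  show "(EX y:V. C y & rank_le y x) --> (EX x:V. C x & (ALL y:V. C y --> rank_le x y))"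
  proof
   assume "EX y:V. C y & rank_le y x"
   then obtain y where y: "y:V" "C y" "rank_le y x" by blast
   show "EX x:V. C x & (ALL y:V. C y --> rank_le x y)"
   proof (cases "ALL z:V. C z --> rank_le x z")
    case True
    thus ?thesis using y x(1) rank_le_trans by blast
   next
    case False
    then obtain z where "z:V" "C z" "~rank_le x z" by blast
    moreover from this obtain x' where "x':E x" "rank_le z x'" using rank_le_or_less x(1) by blast
    ultimately show ?thesis using x(2) by blast
   qed
  qed
 qed (use that in "intro dfi df_rel1[OF C] | assumption")+
 thus ?thesis using c rank_le_refl by blast
qed

text \<open>Scott's trick.\<close>

definition lrank :: "('a => bool) => 'a set" where
 "lrank C = {x:V. C x & (ALL y : V. C y --> rank_le x y)}"

lemma isset_least_rank: "df M (%e. C (e 0)) ==> isset (lrank C)"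
proof (cases "EX c:V. C c")
 case True
 then obtain c where c: "c:V" "C c" by blast
 assume C: "df M (%e. C (e 0))"
 have "isset {x:{x:V. rank_le x c}. C x & (ALL y:V. C y --> rank_le x y)}"
  by (intro isset_sep isset_rank_le c dfi df_rel1[OF C])
 moreover have "{x:{x:V. rank_le x c}. C x & (ALL y:V. C y --> rank_le x y)} = lrank C"
  using c by (auto simp: lrank_def)
 ultimately show ?thesis by simp
next
 case False
 hence "lrank C = {}" by (auto simp: lrank_def)
 thus ?thesis by simp
qed

lemma lrank_ex: "df M (%e. C (e 0)) ==> EX c:V. C c ==> lrank C ~= {}"
 using rank_minimal[of C] by (auto simp: lrank_def)

lemma df_least_rank:
 assumes "df M (%e. C (e 0) (e 1))"
 shows "df M (%e. e 1 : lrank (C (e 0)))"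
proof -
 have "df M (%e. C (e 0) (e 1) & (ALL y:V. C (e 0) y --> rank_le (e 1) y))"
  by (intro dfi df_rel2[OF assms])
 thus ?thesis by (rule df_cong[THEN iffD1, rotated]) (auto simp: lrank_def)
qed

lemma df_fix1:
 assumes "df M (%e. C (e 0) (e 1))" "i:V"
 shows "df M (%e. C i (e 0))"
 using df_rel2[where R = C, OF assms(1) dft_const[OF assms(2)] dft_var] by simp

text \<open>The last conclusion keeps \<open>B\<close> free of junk; later it shows that a collected
  set of names consists of names only.\<close>

lemma collection:
 assumes "isset A" "df M (%e. C (e 0) (e 1))"
 obtains B where "isset B" "!!i. i:A ==> EX x:V. C i x ==> EX x:B. C i x"
  "!!x. x:B ==> EX i:A. C i x"
proof
 have "df M (%e. e 0 : lrank (C (e 1)))"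
  using df_rel2[where R = "%i x. x:lrank (C i)", OF df_least_rank[OF assms(2)] dft_var dft_var] by simp
 thus "isset (UN i:A. lrank (C i))"
  using assms isset_sub by (intro isset_UN isset_least_rank df_fix1[OF assms(2)]) auto
 show "EX x:(UN i:A. lrank (C i)). C i x" if "i:A" "EX x:V. C i x" for i
 proof -
  have "i:V" using that assms(1) isset_sub by blast
  hence "lrank (C i) ~= {}" using lrank_ex[OF df_fix1[OF assms(2)]] that by blast
  thus ?thesis using that by (auto simp: lrank_def)
 qed
qed (auto simp: lrank_def)

subsection \<open>Choice\<close>

lemma transversal:
 assumes "isset X" "!!y. y:X ==> E y ~= {}" "!!y z. y:X ==> z:X ==> y ~= z ==> E y Int E z = {}"
 obtains c where "c:V" "!!y. y:X ==> EX! w. w:E y & w:E c"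
proof -
 obtain x where x: "x:V" "E x = X" using assms(1) by (auto simp: isset_def)
 have "EX e. range e <= V & sat M e ax_choice" using single_axiom[of ax_choice] by (simp add: single_axioms_def)
 then obtain e where e: "sat M e ax_choice" by blast
 let ?e = "e(0 := x)"
 have "sat M ?e (All 1 (Imp (Mem 1 0) (Exi 2 (Mem 2 1))))"
  using assms(2) x(2) E_in by (simp add: mem_iff_E) blast
 moreover have "sat M ?e (All 1 (All 2 (Imp (Con (Mem 1 0) (Con (Mem 2 0) (Neg (Equ 1 2))))
       (Neg (Exi 3 (Con (Mem 3 1) (Mem 3 2)))))))"
  using assms(3) x by (auto simp: mem_iff_E)
 ultimately have "sat M ?e (Exi 4 (All 1 (Imp (Mem 1 0) (Exi 2 (All 3 (Iff (Con (Mem 3 1) (Mem 3 4)) (Equ 3 2)))))))"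
  using e x(1) unfolding ax_choice_def by (simp only: sat.simps(3,4,5)) blast
 then obtain c where c: "c:V"
  "sat M (?e(4 := c)) (All 1 (Imp (Mem 1 0) (Exi 2 (All 3 (Iff (Con (Mem 3 1) (Mem 3 4)) (Equ 3 2))))))"
  unfolding sat_Exi by blast
 have "EX! w. w:E y & w:E c" if y: "y:X" for y
 proof -
  have "y:V" "sat M (?e(4 := c, 1 := y)) (Mem 1 0)" using y x E_in by (auto simp: mem_iff_E)
  hence "sat M (?e(4 := c, 1 := y)) (Exi 2 (All 3 (Iff (Con (Mem 3 1) (Mem 3 4)) (Equ 3 2))))"
   using c(2) by (metis sat.simps(4,5))
  then obtain z where z: "z:V" "sat M (?e(4 := c, 1 := y, 2 := z)) (All 3 (Iff (Con (Mem 3 1) (Mem 3 4)) (Equ 3 2)))"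
   unfolding sat_Exi by blast
  have "w:E y & w:E c <-> w = z" if "w:V" for w
  proof -
   have "sat M (?e(4 := c, 1 := y, 2 := z, 3 := w)) (Iff (Con (Mem 3 1) (Mem 3 4)) (Equ 3 2))"
    using z(2) that by (metis sat.simps(5))
   thus ?thesis by (simp only: sat_Iff sat_Con sat.simps(1,2)) (simp add: mem_iff_E, blast)
  qed
  thus ?thesis using E_in z(1) by (intro ex1I[of _ z]) blast+
 qed
 with c(1) show ?thesis by (rule that)
qed

text \<open>\<open>ax_choice\<close> gives transversals of disjoint families of sets. Scott's trick
  cuts the classes \<open>C i\<close> down to sets, and tagging their elements with \<open>i\<close>
  makes these disjoint. Outside \<open>I\<close> the choice function is the identity, which makes it
  a total term.\<close>

lemma choice:
 assumes I: "isset I" and C: "df M (%e. C (e 0) (e 1))" and ex: "!!i. i:I ==> EX x:V. C i x"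
 obtains G where "dft M (%e. G (e 0))" "!!i. i:I ==> C i (G i)"
proof -
 define B where "B i = lrank (C i)" for i
 have IV: "I <= V" using isset_sub[OF I] .
 have BV: "B i <= V" for i by (auto simp: B_def lrank_def)
 have isB: "isset (B i)" if "i:V" for i
  unfolding B_def using that by (intro isset_least_rank df_fix1[OF C])
 have dfB: "df M (%e. e 1 : B (e 0))" unfolding B_def by (rule df_least_rank[OF C])
 note dfB' = df_rel2[where R = "%i x. x:B i", OF dfB]
 have isH: "isset (pr i ` B i)" if "i:V" for i
  using that by (intro isset_image isB dfi)
 have H: "dft M (%e. S (pr (e 0) ` B (e 0)))"
 proof (rule dft_S)
  have "df M (%e. EX x:V. x:B (e 1) & e 0 = pr (e 1) x)" by (intro dfi dfB')
  thus "df M (%e. e 0 : pr (e (Suc 0)) ` B (e (Suc 0)))"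
   by (rule back_subst[of "df M"]) (use BV in auto)
 qed (auto intro: isH)
 define X where "X = (%i. S (pr i ` B i)) ` I"
 have EX: "E (S (pr i ` B i)) = pr i ` B i" if "i:I" for i using isH that IV by (intro E_S) auto
 have "EX c:V. ALL y:X. EX! w. w:E y & w:E c"
 proof (rule transversal[of X])
  show "EX c:V. ALL y:X. EX! w. w:E y & w:E c"
   if "c:V" "!!y. y:X ==> EX! w. w:E y & w:E c" for c using that by blast
  show "isset X" unfolding X_def by (rule isset_image[OF I H])
  show "E y ~= {}" if "y:X" for y
  proof -
   obtain i where i: "i:I" "y = S (pr i ` B i)" using `y : X` by (auto simp: X_def)
   thus ?thesis using EX lrank_ex[OF df_fix1[OF C]] ex IV by (auto simp: B_def)
  qed
  show "E y Int E z = {}" if "y:X" "z:X" "y ~= z" for y z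
  proof -
   obtain i j where i: "i:I" "y = S (pr i ` B i)" and j: "j:I" "z = S (pr j ` B j)"
    using `y : X` `z : X` by (auto simp: X_def)
   hence "i ~= j" using `y ~= z` by auto
   thus ?thesis unfolding i(2) j(2) EX[OF i(1)] EX[OF j(1)] using pr_inj i j IV BV by blast
  qed
 qed
 then obtain c where c: "c:V" "!!y. y:X ==> EX! w. w:E y & w:E c" by blast
 have uniq: "EX! x. x:B i & pr i x : E c" if i: "i:I" for i
 proof -
  have "EX! w. w:pr i ` B i & w:E c" using c(2)[of "S (pr i ` B i)"] i EX[OF i] by (auto simp: X_def)
  then obtain w where w: "w:pr i ` B i" "w:E c" "!!w'. w':pr i ` B i ==> w':E c ==> w' = w" by blast
  then obtain x where x: "x:B i" "w = pr i x" by blast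
  have "x' = x" if "x':B i" "pr i x' : E c" for x'
   using w(3)[of "pr i x'"] that x BV IV i pr_inj[of i x' i x] by auto
  thus ?thesis using x w(2) by (intro ex1I[of _ x]) blast+
 qed
 define G where "G i = (if i : I then (THE x. x:B i & pr i x : E c) else i)" for i
 have G: "G i : B i & pr i (G i) : E c" if "i:I" for i
  using theI'[OF uniq[OF that]] that by (simp add: G_def)
 show ?thesis
 proof (rule that[of G])
  show "C i (G i)" if "i:I" for i using G[OF that] by (auto simp: B_def lrank_def)
  show "dft M (%e. G (e 0))"
  proof (rule dft_descr)
   show "G (e 0) : V" if "range e <= V" for e
    using G[of "e 0"] BV that by (cases "e 0 : I") (auto simp: G_def)
   show "x = G (e 0) <-> (e 0 : I & x:B (e 0) & pr (e 0) x : E c) | e 0 ~: I & x = e 0"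
    if "range e <= V" "x:V" for e x
    using G[of "e 0"] uniq[of "e 0"] by (cases "e 0 : I") (auto simp: G_def)
   show "df M (%e. (e (Suc 0) : I & e 0 : B (e (Suc 0)) & pr (e (Suc 0)) (e 0) : E c) | e (Suc 0) ~: I & e 0 = e (Suc 0))"
    by (intro dfi df_isset[OF I] dfB' c)
  qed
 qed
qed

lemma fun_of_term:
 assumes "X:V" "dft M (%e. G (e 0))"
 obtains f where "fun_in M X f" "!!x. x:E X ==> app_in M f x = G x"
proof (rule fun_ex[OF assms(1), of "%x y. y = G x" G])
 have "df M (%e. e 0 = G (e 1))" using assms(2) by (simp add: dft_def)
 from df_rel2[where R = "%x y. x = G y", OF this dft_var dft_var]
 show "df M (%e. e 1 = G (e 0))" by simp
 show "G x : V" if "x:E X" for x using dft_closed[OF assms(2)] that E_in by blast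
qed (use that in auto)

lemma choice_fun:
 assumes "X:V" "df M (%e. C (e 0) (e 1))" "!!i. i:E X ==> EX x:V. C i x"
 obtains f where "fun_in M X f" "!!i. i:E X ==> C i (app_in M f i)"
proof -
 obtain G where G: "dft M (%e. G (e 0))" "!!i. i:E X ==> C i (G i)"
  using choice[OF isset_E[OF assms(1)] assms(2,3)] by metis
 obtain f where "fun_in M X f" "!!x. x:E X ==> app_in M f x = G x"
  using fun_of_term[OF assms(1) G(1)] by metis
 thus ?thesis using G(2) that by simp
qed

subsection \<open>Zorn's lemma\<close>

text \<open>Bourbaki and Witt: in the smallest family containing \<open>x0\<close> and closed under an
 inflationary map and unions of chains, every element \<open>c\<close> is extreme, that is, \<open>x \<subset> c\<close> implies
 \<open>g x \<subseteq> c\<close>. Hence that family is a chain, and its union is a fixed point of the map.\<close>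

lemma zorn:
 assumes Q: "isset Q" and x0: "x0:Q"
  and chains: "!!c. isset c ==> c <= Q ==> c ~= {} ==> (!!x y. x : c ==> y : c ==> E x <= E y | E y <= E x) ==>
   S (UN y:c. E y) : Q"
 shows "EX m:Q. ALL y:Q. E m <= E y --> y = m"
proof -
 have QV: "Q <= V" using isset_sub[OF Q] .
 \<comment> \<open>The inflationary map may return its argument only at a maximal element, so any
   fixed point is a maximal element.\<close>
 have "EX y:V. y:Q & E x <= E y & (y = x --> (ALL z:Q. E x <= E z --> z = x))" if "x:Q" for x
  using that QV by blast
 moreover have "df M (%e. e 1 : Q & E (e 0) <= E (e 1) & (e 1 = e 0 --> (ALL z:E (S Q). E (e 0) <= E z --> z = e 0)))"
  by (intro dfi df_isset[OF Q] S_in[OF Q])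
 hence "df M (%e. e 1 : Q & E (e 0) <= E (e 1) & (e 1 = e 0 --> (ALL z:Q. E (e 0) <= E z --> z = e 0)))"
  by (simp add: E_S[OF Q])
 ultimately obtain g where g_t: "dft M (%e. g (e 0))"
  and g: "!!x. x:Q ==> g x : Q & E x <= E (g x) & (g x = x --> (ALL z:Q. E x <= E z --> z = x))"
  using choice[OF Q, of "%x y. y:Q & E x <= E y & (y = x --> (ALL z:Q. E x <= E z --> z = x))"] by blast
 define chain where "chain c <-> (ALL x:E c. ALL y:E c. E x <= E y | E y <= E x)" for c
 define isU where "isU c u <-> (ALL z:V. z:E u <-> (EX y:E c. z:E y))" for c u
 have isU: "E u = (UN y:E c. E y)" if "isU c u" "u:V" for c u using that E_in unfolding isU_def by blast
 define tower where "tower t <-> E t <= Q & x0 : E t & (ALL x:E t. g x : E t) &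
  (ALL c:V. E c <= E t --> (EX x:V. x : E c) --> chain c --> (ALL u:V. isU c u --> u : E t))" for t
 have "df M (%e. E (e 0) <= E (S Q) & x0 : E (e 0) & (ALL x:E (e 0). g x : E (e 0)) &
  (ALL c:V. E c <= E (e 0) --> (EX x:V. x : E c) --> chain c --> (ALL u:V. isU c u --> u : E (e 0))))"
  unfolding chain_def isU_def using x0 QV by (intro dfi dft_fun1[OF g_t] S_in[OF Q]) auto
 hence df_tower: "df M (%e. tower (e 0))" by (simp add: tower_def E_S[OF Q])
 have Q_tower: "tower (S Q)"
  unfolding tower_def E_S[OF Q]
 proof (intro conjI ballI impI)
  fix c u assume c: "c:V" "E c <= Q" "EX x:V. x:E c" "chain c" and u: "u:V" "isU c u"
  have "S (UN y:E c. E y) : Q" by (rule chains) (use c in "auto simp: isset_E chain_def")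
  moreover have "u = S (UN y:E c. E y)" using isU[OF u(2,1)] S_unique[OF u(1)] by simp
  ultimately show "u:Q" by simp
 qed (use g x0 in auto)
 define T where "T = {x:Q. ALL t:V. tower t --> x:E t}"
 have isT: "isset T" unfolding T_def by (intro isset_sep Q dfi df_rel1[where R = tower, OF df_tower])
 have TQ: "T <= Q" and TV: "T <= V" using QV by (auto simp: T_def)
 have gT: "g x : T" if "x:T" for x using that g by (auto simp: T_def tower_def)
 have UT: "u:T" if "c:V" "E c <= T" "E c ~= {}" "chain c" "u:V" "isU c u" for c u
 proof -
  have "EX x:V. x:E c" using that E_in by blast
  hence *: "u:E t" if "tower t" "E c <= E t" "t:V" for t
   using that `c : V` `chain c` `u : V` `isU c u` unfolding tower_def by blast
  have "u:Q" using *[OF Q_tower] that TQ by (simp add: E_S[OF Q] S_in[OF Q])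
  thus ?thesis using * that(2) by (auto simp: T_def)
 qed
 have T_induct: "P x" if P: "df M (%e. P (e 0))" "P x0" "!!x. x:T ==> P x ==> P (g x)"
  "!!c u. c:V ==> E c <= T ==> E c ~= {} ==> (!!x. x:E c ==> P x) ==> u:T ==> E u = (UN y:E c. E y) ==> P u"
  and x: "x:T" for P x
 proof -
  have is_P: "isset {x:T. P x}" by (intro isset_sep isT P)
  have "tower (S {x:T. P x})"
   unfolding tower_def E_S[OF is_P]
  proof (intro conjI ballI impI)
   show "x0:{x:T. P x}" using P(2) x0 by (auto simp: T_def tower_def)
   fix c u assume c: "c:V" "E c <= {x:T. P x}" "EX x:V. x:E c" "chain c" "u:V" "isU c u"
   hence "u:T" using UT[of c u] by auto
   moreover from this have "P u" using P(4)[of c u] c isU by auto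
   ultimately show "u:{x:T. P x}" by blast
  qed (use TQ gT P(3) in auto)
  thus ?thesis using x S_in[OF is_P] E_S[OF is_P] unfolding T_def by blast
 qed
 have T_eq: "x = y" if "x:T" "y:T" "E x <= E y" "E y <= E x" for x y
  using that TV extensional[of x y] by blast
 have x0T: "x0:T" using x0 by (auto simp: T_def tower_def)
 have least: "E x0 <= E x" if "x:T" for x
 proof (rule T_induct[where P = "%x. E x0 <= E x", OF _ _ _ _ that])
  show "df M (%e. E x0 <= E (e 0))" using x0 QV by (intro dfi) auto
 qed (use g TQ in blast)+
 define extreme where "extreme c <-> (ALL x:T. E x <= E c --> x ~= c --> E (g x) <= E c)" for c
 have "df M (%e. ALL x:E (S T). E x <= E (e 0) --> x ~= e 0 --> E (g x) <= E (e 0))"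
  by (intro dfi dft_fun1[OF g_t] S_in[OF isT])
 hence df_ext: "df M (%e. extreme (e 0))" by (simp add: E_S[OF isT] extreme_def)
 have split: "E x <= E c | E (g c) <= E x" if c: "c:T" "extreme c" and x: "x:T" for c x
 proof (rule T_induct[where P = "%x. E x <= E c | E (g c) <= E x", OF _ _ _ _ x])
  show "df M (%e. E (e 0) <= E c | E (g c) <= E (e 0))"
   using c TV gT by (intro dfi) auto
  show "E x0 <= E c | E (g c) <= E x0" using least c by blast
  show "E (g x) <= E c | E (g c) <= E (g x)" if "x:T" "E x <= E c | E (g c) <= E x" for x
   using that c(2) g TQ unfolding extreme_def by blast
  show "E u <= E c | E (g c) <= E u" if "!!x. x:E k ==> E x <= E c | E (g c) <= E x" "E u = (UN y:E k. E y)" for k u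
   using that by blast
 qed
 have ext: "extreme c" if c: "c:T" for c
 proof (rule T_induct[where P = extreme, OF df_ext _ _ _ c])
  show "extreme x0" unfolding extreme_def using least T_eq[OF _ x0T] by blast
  show "extreme (g c)" if c: "c:T" "extreme c" for c
   unfolding extreme_def
  proof (intro ballI impI)
   fix x assume x: "x:T" "E x <= E (g c)" "x ~= g c"
   hence "E x <= E c" using split[OF c x(1)] T_eq gT c by blast
   thus "E (g x) <= E (g c)"
    using c x g TQ unfolding extreme_def by (cases "x = c") blast+
  qed
  show "extreme u" if k: "E k <= T" "!!x. x:E k ==> extreme x" and u: "u:T" "E u = (UN y:E k. E y)" for k u
   unfolding extreme_def
  proof (intro ballI impI)
   fix x assume x: "x:T" "E x <= E u" "x ~= u"
   then obtain c where c: "c:E k" "~E c <= E x" using u T_eq[of x u] by blast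
   hence "c:T" "extreme c" using k by auto
   moreover have "E c <= E (g c)" using g `c : T` TQ by blast
   ultimately have "E x <= E c" "x ~= c" using split[of c x] x(1) c by blast+
   hence "E (g x) <= E c" using `extreme c` x(1) unfolding extreme_def by blast
   thus "E (g x) <= E u" using u c by blast
  qed
 qed
 have "chain (S T)"
  unfolding chain_def E_S[OF isT]
 proof (intro ballI)
  fix x y assume "x:T" "y:T"
  thus "E x <= E y | E y <= E x" using split[of y x] ext g[of y] TQ by blast
 qed
 moreover note x0T
 moreover define u where "u = S (UN y:T. E y)"
 have u: "u:V" "E u = (UN y:T. E y)" unfolding u_def using isset_Union[OF isT] by (rule S_in, rule E_S)
 moreover from this have "isU (S T) u" by (auto simp: isU_def E_S[OF isT])
 ultimately have "u:T" using UT[of "S T" u] by (auto simp: S_in[OF isT] E_S[OF isT])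
 moreover from this have "g u : T" by (rule gT)
 ultimately have "E (g u) <= E u" using u(2) by blast
 hence "g u = u" using T_eq `u : T` `g u : T` g TQ by blast
 thus ?thesis using g[of u] `u : T` TQ by blast
qed

end

subsection \<open>Satisfaction in definable structures\<close>

lemma df_case_nat: "df M P ==> dft M t ==> df M (%e. P (case_nat (t e) e))"
proof (rule df_subst[where P = "%x e. P (case_nat x e)"])
 assume "df M P"
 moreover have "case_nat (e 0) (%n. e (Suc n)) = e" for e :: "nat => 'a" by (auto split: nat.splits)
 ultimately show "df M (%e. P (case_nat (e 0) (%n. e (Suc n))))" by simp
qed

text \<open>\<open>df_subst\<close> replaces a single argument; the first \<open>N\<close> are
  replaced one after the other, and a formula depends on no more than finitely many.\<close>

lemma df_multi_aux:
 "df M P ==> (!!i. dft M (t i)) ==> df M (%e. P (%n. if n < N then t n e else e (n - N)))"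
proof (induction N arbitrary: t)
 case (Suc N)
 have "df M (%e. P (%n. if n < N then t n (%n. e (Suc n)) else e (n - N)))"
  using Suc.prems by (intro Suc.IH[of "%i e. t i (%n. e (Suc n))"] dft_weaken)
 from df_case_nat[OF this Suc.prems(2)[of N]]
 have "df M (%e. P (%n. if n < N then t n e else case_nat (t N e) e (n - N)))" by (simp only: nat.case)
 moreover have "(%n. if n < N then t n e else case_nat (t N e) e (n - N)) = (%n. if n < Suc N then t n e else e (n - Suc N))" for e
  by (auto simp: fun_eq_iff less_Suc_eq diff_Suc split: nat.splits) 
 ultimately show ?case by simp
qed simp

lemma df_multi:
 assumes "df M P" "!!i. dft M (t i)" "!!e e'. (!!i. i < N ==> e i = e' i) ==> P e = P e'"
 shows "df M (%e. P (%i. t i e))"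
proof -
 have "P (%n. if n < N then t n e else e (n - N)) = P (%i. t i e)" for e by (rule assms(3)) simp
 thus ?thesis using df_multi_aux[OF assms(1), of t N] assms(2) by simp
qed

text \<open>The recursion on \<open>ph\<close> takes place outside \<open>M\<close>: each formula
  gets its own definition, and no definition uniform in \<open>ph\<close> is claimed.\<close>

lemma df_sat_struct:
 assumes "df M (%e. e 0 : carr A)" "df M (%e. (e 0, e 1):mem A)" "carr A <= carr M" "carr M ~= {}"
 shows "df M (%e. sat A e ph)"
proof (induction ph)
 case (Mem i j)
 thus ?case using df_rel2[where R = "%x y. (x, y):mem A", OF assms(2) dft_var dft_var] assms(4) by simp
next
 case (Equ i j)
 thus ?case using df_eq[OF dft_var dft_var] assms(4) by simp
next
 case (All v ph)
 define f where "f n = (if n = v then 0 else Suc n)" for n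
 have "inj f" by (auto simp: f_def inj_def)
 from df_ren[OF All this] have "df M (%e. sat A (%n. e (f n)) ph)" .
 moreover have "(%n. e (f n)) = (%n. e (Suc n))(v := e 0)" for e :: "nat => 'a" by (auto simp: f_def)
 ultimately have "df M (%e. sat A ((%n. e (Suc n))(v := e 0)) ph)" by (simp only:)
 hence "df M (%e. e 0 : carr A --> sat A ((%n. e (Suc n))(v := e 0)) ph)"
  by (rule df_imp[OF assms(1)])
 hence "df M (%e. ALL x:carr M. x:carr A --> sat A (e(v := x)) ph)" by (rule df_Ball)
 thus ?case by (rule back_subst[of "df M"]) (use assms(3) in auto)
qed (auto intro: dfi)

lemma df_sat_terms:
 assumes "df M (%e. e 0 : carr A)" "df M (%e. (e 0, e 1):mem A)" "carr A <= carr M" "carr M ~= {}"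
  and "!!i. dft M (t i)"
 shows "df M (%e. sat A (%i. t i e) ph)"
proof -
 obtain N where N: "fv ph <= {..<N}" using fv_bound by blast
 show ?thesis
  by (rule df_multi[where P = "%e. sat A e ph" and N = N, OF df_sat_struct[OF assms(1-4)] assms(5)])
   (use N in "auto intro!: sat_cong")
qed

context zfc_model
begin

text \<open>Application made total. \<open>dft\<close> demands a value in the carrier for all
  arguments, whereas \<open>app_in\<close> is a description that may fail.\<close>

definition apt :: "'a => 'a => 'a => 'a" where
 "apt X f x = (if fun_in M X f & x:E X then app_in M f x else x)"

lemma dft_apt [dfi]: "dft M f ==> dft M g ==> dft M h ==> dft M (%e. apt (f e) (g e) (h e))"
proof (rule dft_descr[where P = "%x e. (fun_in M (f e) (g e) & h e : E (f e) & (h e, x) : rel_in M (g e)) |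
  (~(fun_in M (f e) (g e) & h e : E (f e)) & x = h e)"])
 assume *: "dft M f" "dft M g" "dft M h"
 show "apt (f e) (g e) (h e) : V" if "range e <= V" for e
  using * that by (auto simp: apt_def app_in_V dft_in)
 show "x = apt (f e) (g e) (h e) <-> (fun_in M (f e) (g e) & h e : E (f e) & (h e, x) : rel_in M (g e)) |
  (~(fun_in M (f e) (g e) & h e : E (f e)) & x = h e)" for e x
  by (auto simp: apt_def fun_in_app)
 show "df M (%e. (fun_in M (f (%n. e (Suc n))) (g (%n. e (Suc n))) & h (%n. e (Suc n)) : E (f (%n. e (Suc n))) &
   (h (%n. e (Suc n)), e 0) : rel_in M (g (%n. e (Suc n)))) |
  (~(fun_in M (f (%n. e (Suc n))) (g (%n. e (Suc n))) & h (%n. e (Suc n)) : E (f (%n. e (Suc n)))) &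
   e 0 = h (%n. e (Suc n))))"
  by (intro dfi dft_weaken[OF *(1)] dft_weaken[OF *(2)] dft_weaken[OF *(3)])
qed

end

subsection \<open>Internal ultrapowers\<close>

locale internal_ultrafilter = zfc_model M for M :: "'a struct" +
 fixes X U :: 'a
 assumes uf: "ultrafilter_in M X U"
begin

lemma XU: "X:V" "U:V"
 and uf_X: "X:E U"
 and uf_ne: "u:E U ==> E u ~= {}"
 and uf_Int: "u:E U ==> v:E U ==> w:V ==> E w = E u Int E v ==> w:E U"
 and uf_up: "u:E U ==> v:V ==> E u <= E v ==> E v <= E X ==> v:E U"
 and uf_ultra: "u:V ==> v:V ==> E u <= E X ==> E v = E X - E u ==> u:E U | v:E U"
 using uf unfolding ultrafilter_in_def by blast+

definition big :: "('a => bool) => bool" where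
 "big P <-> (EX u : E U. E u = {x:E X. P x})"

definition funs :: "'a set => 'a set" where
 "funs A = {f. fun_in M X f & (ALL x : E X. app_in M f x : A)}"

lemma isset_X: "df M (%e. P (e 0)) ==> isset {x:E X. P x}"
 by (intro isset_sep isset_E XU)

lemma big_cong: "(!!x. x:E X ==> P x <-> Q x) ==> big P <-> big Q"
 by (simp add: big_def cong: conj_cong)

lemma big_True: "big (%x. True)"
 using uf_X by (auto simp: big_def)

lemma big_False: "~big (%x. False)"
 using uf_ne by (auto simp: big_def)

lemma big_mono: "big P ==> (!!x. x:E X ==> P x ==> Q x) ==> df M (%e. Q (e 0)) ==> big Q"
proof -
 assume P: "big P" "!!x. x:E X ==> P x ==> Q x" and Q: "df M (%e. Q (e 0))"
 obtain u where u: "u:E U" "E u = {x:E X. P x}" using P by (auto simp: big_def)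
 obtain v where v: "v:V" "E v = {x:E X. Q x}" using isset_X[OF Q] by (auto simp: isset_def)
 have "E u <= E v" "E v <= E X" using u v P by auto
 hence "v:E U" using uf_up u(1) v(1) by blast
 thus ?thesis using v by (auto simp: big_def)
qed

lemma big_conj:
 assumes "big P" "big Q" "df M (%e. P (e 0) & Q (e 0))"
 shows "big (%x. P x & Q x)"
proof -
 obtain u v where u: "u:E U" "E u = {x:E X. P x}" and v: "v:E U" "E v = {x:E X. Q x}" using assms by (auto simp: big_def)
 obtain w where w: "w:V" "E w = {x:E X. P x & Q x}" using isset_X[OF assms(3)] by (auto simp: isset_def)
 have "E w = E u Int E v" using u v w by auto
 hence "w:E U" using uf_Int u(1) v(1) w(1) by blast
 thus ?thesis using w by (auto simp: big_def)
qed

lemma big_transfer: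
 assumes "big (%x. R (apt X f x) (apt X g x))" "big (%x. apt X f x = apt X f' x)" "big (%x. apt X g x = apt X g' x)"
  and V: "f:V" "g:V" "f':V" "g':V" and R: "df M (%e. R (e 0) (e 1))"
 shows "big (%x. R (apt X f' x) (apt X g' x))"
proof -
 note R' = df_rel2[where R = R, OF R]
 have "big (%x. R (apt X f x) (apt X g x) & apt X f x = apt X f' x)"
  using assms by (intro big_conj dfi R' XU) auto
 hence "big (%x. (R (apt X f x) (apt X g x) & apt X f x = apt X f' x) & apt X g x = apt X g' x)"
  using assms by (intro big_conj[where P = "%x. R (apt X f x) (apt X g x) & apt X f x = apt X f' x"] dfi R' XU) auto
 thus ?thesis by (rule big_mono) (auto intro!: dfi R' XU V)
qed

lemma big_not:
 assumes "df M (%e. P (e 0))"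
 shows "big (%x. ~P x) <-> ~big P"
proof
 assume "big (%x. ~P x)"
 thus "~big P"
  using big_conj[of "%x. ~P x" P] df_const[OF nonempty, of False] big_False by auto
next
 assume "~big P"
 obtain u where u: "u:V" "E u = {x:E X. P x}" using isset_X[OF assms] by (auto simp: isset_def)
 obtain v where v: "v:V" "E v = {x:E X. ~P x}" using isset_X[OF df_Not[OF assms]] by (auto simp: isset_def)
 have "E u <= E X" "E v = E X - E u" using u v by auto
 hence "u:E U | v:E U" using uf_ultra u(1) v(1) by blast
 thus "big (%x. ~P x)" using u v `~big P` by (auto simp: big_def)
qed

lemma df_big:
 assumes "df M (%e. P (e 0) (e 1) (e 2))"
 shows "df M (%e. big (P (e 0) (e 1)))"
proof -
 have "df M (%e. EX u:E U. ALL x:V. x:E u <-> x:E X & P (e 0) (e 1) x)"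
  by (intro dfi XU df_rel3[where R = P, OF assms])
 moreover have "(EX u:E U. ALL x:V. x:E u <-> x:E X & Q x) <-> big Q" for Q
 proof -
  have "(ALL x:V. x:E u <-> x:E X & Q x) <-> E u = {x:E X. Q x}" for u using E_in by blast
  thus ?thesis by (simp add: big_def)
 qed
 ultimately show ?thesis by simp
qed

end

text \<open>\<open>B\<close> is any structure that represents the ultrapower of \<open>A\<close> along the map \<open>io\<close>.\<close>

locale internal_ultrapower = internal_ultrafilter M X U for M :: "'a struct" and X U +
 fixes A :: "'a struct" and B :: "'b struct" and io :: "'a => 'b"
 assumes A: "is_struct A" "carr A <= V" "df M (%e. e 0 : carr A)" "df M (%e. (e 0, e 1):mem A)"
  and B: "io ` funs (carr A) = carr B"
   "!!f g. f:funs (carr A) ==> g:funs (carr A) ==> io f = io g <-> big (%x. app_in M f x = app_in M g x)"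
   "!!f g. f : funs (carr A) ==> g : funs (carr A) ==>
    (io f, io g) : mem B <-> big (%x. (app_in M f x, app_in M g x) : mem A)"
begin

abbreviation FA :: "'a set" where "FA == funs (carr A)"

lemma FA_V: "f:FA ==> f:V"
 by (auto simp: funs_def fun_in_def)

lemma df_app_sat: "range e <= FA ==> df M (%e'. sat A (%i. apt X (e i) (e' 0)) ph)"
 using FA_V XU by (intro df_sat_terms A nonempty dfi) auto

lemma apt_app: "f:FA ==> x:E X ==> apt X f x = app_in M f x"
 by (auto simp: funs_def apt_def)

theorem los: "range e <= FA ==> sat B (io o e) ph <-> big (%x. sat A (%i. apt X (e i) x) ph)"
proof (induction ph arbitrary: e)
 case (Mem i j)
 hence "e i : FA" "e j : FA" by auto
 thus ?case unfolding sat.simps comp_apply B(3)[OF `e i : FA` `e j : FA`] by (intro big_cong) (simp add: apt_app)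
next
 case (Equ i j)
 hence "e i : FA" "e j : FA" by auto
 thus ?case unfolding sat.simps comp_apply B(2)[OF `e i : FA` `e j : FA`] by (intro big_cong) (simp add: apt_app)
next
 case (Neg ph)
 have "big (%x. ~sat A (%i. apt X (e i) x) ph) <-> ~big (%x. sat A (%i. apt X (e i) x) ph)"
  by (rule big_not) (rule df_app_sat[OF Neg.prems])
 thus ?case using Neg.IH[OF Neg.prems] by (simp only: sat.simps)
next
 case (Imp ph psi)
 let ?p = "%x. sat A (%i. apt X (e i) x) ph" and ?q = "%x. sat A (%i. apt X (e i) x) psi"
 have df: "df M (%e. ?p (e 0))" "df M (%e. ?q (e 0))" by (intro df_app_sat Imp.prems)+
 have "big (%x. ?p x --> ?q x) <-> (big ?p --> big ?q)"
 proof
  assume pq: "big (%x. ?p x --> ?q x)"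
  show "big ?p --> big ?q"
  proof
   assume "big ?p"
   with pq have "big (%x. (?p x --> ?q x) & ?p x)" by (rule big_conj) (intro dfi df)
   thus "big ?q" by (rule big_mono) (use df in auto)
  qed
 next
  assume "big ?p --> big ?q"
  then consider "big (%x. ~?p x)" | "big ?q" using big_not[of ?p] df by blast
  thus "big (%x. ?p x --> ?q x)"
   by cases (erule big_mono, use df in "auto intro!: dfi")+
 qed
 thus ?case using Imp.IH[OF Imp.prems] by (simp only: sat.simps)
next
 case (All v ph)
 let ?s = "%x y. sat A ((%i. apt X (e i) x)(v := y)) ph"
 have df_s: "df M (%e'. ?s (e' 0) (e' 1))"
 proof -
  have "df M (%e'. sat A (%i. if i = v then e' 1 else apt X (e i) (e' 0)) ph)"
  proof (intro df_sat_terms A nonempty)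
   show "dft M (%e'. if i = v then e' 1 else apt X (e i) (e' 0))" for i
    using All.prems FA_V XU by (cases "i = v") (auto intro!: dfi)
  qed
  thus ?thesis by (rule back_subst[of "df M"]) (auto simp: fun_eq_iff intro!: arg_cong[of _ _ "%f. sat A f ph"])
 qed
 have df_all: "df M (%e'. ALL y:carr A. ?s (e' 0) y)"
 proof -
  have "df M (%e'. ALL y:V. y:carr A --> ?s (e' 0) y)"
   by (intro dfi df_rel2[where R = ?s, OF df_s] df_rel1[OF A(3)])
  thus ?thesis by (rule back_subst[of "df M"]) (use A(2) in auto)
 qed
 have step: "sat B ((io o e)(v := io f)) ph <-> big (%x. ?s x (app_in M f x))" if "f:FA" for f
 proof -
  have "sat B (io o e(v := f)) ph <-> big (%x. sat A (%i. apt X ((e(v := f)) i) x) ph)"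
   using All.prems that by (intro All.IH) auto
  also have "... <-> big (%x. ?s x (app_in M f x))"
   using apt_app[OF that] by (intro big_cong arg_cong[of _ _ "%f. sat A f ph"]) (auto simp: fun_eq_iff)
  finally show ?thesis by (simp add: fun_upd_comp)
 qed
 have "(ALL f:FA. big (%x. ?s x (app_in M f x))) <-> big (%x. ALL y:carr A. ?s x y)"
 proof
  assume "big (%x. ALL y:carr A. ?s x y)"
  show "ALL f:FA. big (%x. ?s x (app_in M f x))"
  proof
   fix f assume f: "f:FA"
   have "big (%x. ?s x (apt X f x))"
    using `big (%x. ALL y:carr A. ?s x y)`
   proof (rule big_mono)
    show "?s x (apt X f x)" if "x:E X" "ALL y:carr A. ?s x y" for x
     using that f apt_app[OF f that(1)] by (auto simp: funs_def)
    show "df M (%e'. ?s (e' 0) (apt X f (e' 0)))"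
     using FA_V[OF f] XU by (intro df_rel2[where R = ?s, OF df_s] dfi)
   qed
   thus "big (%x. ?s x (app_in M f x))" by (rule big_cong[THEN iffD1, rotated]) (simp add: apt_app[OF f])
  qed
 next
  assume *: "ALL f:FA. big (%x. ?s x (app_in M f x))"
  obtain a0 where a0: "a0:carr A" using A(1) by (auto simp: is_struct_def)
  \<comment> \<open>The only use of Choice in the induction: \<open>f\<close> picks a counterexample
    at each index that has one, so truth at \<open>f\<close> on a big set yields truth of the
    universal formula there.\<close>
  have "df M (%e'. e' 1 : carr A & ((ALL y:carr A. ?s (e' 0) y) | ~?s (e' 0) (e' 1)))"
   by (intro dfi df_rel1[OF A(3)] df_all df_s)
  moreover have "EX y:V. y:carr A & ((ALL y:carr A. ?s x y) | ~?s x y)" for x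
   using a0 A(2) by (cases "ALL y:carr A. ?s x y") auto
  ultimately obtain f where f: "fun_in M X f"
   "!!x. x:E X ==> app_in M f x : carr A & ((ALL y:carr A. ?s x y) | ~?s x (app_in M f x))"
   using choice_fun[OF XU(1), of "%x y. y:carr A & ((ALL y:carr A. ?s x y) | ~?s x y)"] by blast
  have fFA: "f:FA" using f by (auto simp: funs_def)
  with * have "big (%x. ?s x (app_in M f x))" by blast
  thus "big (%x. ALL y:carr A. ?s x y)" by (rule big_mono) (use f(2) df_all in auto)
 qed
 hence "(ALL b:carr B. sat B ((io o e)(v := b)) ph) <-> big (%x. ALL y:carr A. ?s x y)"
  unfolding B(1)[symmetric] using step by auto
 thus ?case by (simp only: sat.simps)
qed

lemma const_FA:
 assumes "a:carr A"
 shows "const_in M X a : FA" "x:E X ==> app_in M (const_in M X a) x = a"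
proof -
 have "a:V" using assms A(2) by blast
 then obtain f where f: "fun_in M X f" "!!x. x:E X ==> app_in M f x = a"
  using fun_of_term[OF XU(1), of "%x. a"] dft_const by metis
 have "const_in M X a = f"
  unfolding const_in_def
 proof (rule the_equality)
  show "g = f" if "fun_in M X g & (ALL x:E X. app_in M g x = a)" for g
   by (rule fun_in_eq[of X]) (use that f in auto)
 qed (use f in auto)
 thus "const_in M X a : FA" "x:E X ==> app_in M (const_in M X a) x = a"
  using f assms by (auto simp: funs_def)
qed

lemma los_const:
 assumes "!!i. i:fv ph ==> e i : carr A"
 shows "sat B (%i. io (const_in M X (e i))) ph <-> sat A e ph"
proof -
 obtain e' where e': "range e' <= carr A" "sat A e' ph <-> sat A e ph" "!!i. i:fv ph ==> e' i = e i"
  using env_restrict[of A ph e] assms A(1) by (auto simp: is_struct_def)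
 have "sat B (%i. io (const_in M X (e i))) ph <-> sat B (io o (%i. const_in M X (e' i))) ph"
  by (rule sat_cong) (simp add: e')
 also have "... <-> big (%x. sat A (%i. apt X (const_in M X (e' i)) x) ph)"
  by (rule los) (use e' const_FA in auto)
 also have "... <-> big (%x. sat A e' ph)"
  using e'(1) const_FA by (intro big_cong arg_cong[of _ _ "%f. sat A f ph"] ext) (simp add: apt_app image_subset_iff)
 also have "... <-> sat A e' ph" using big_True big_False by (cases "sat A e' ph") auto
 finally show ?thesis using e'(2) by simp
qed

lemma FA_nonempty: "FA ~= {}"
 using const_FA(1) A(1) by (auto simp: is_struct_def)

lemma df_FA [dfi]: "dft M f ==> df M (%e. f e : FA)"
proof (rule df_rel1[where R = "%f. f:FA"])
 have "df M (%e. fun_in M X (e 0) & (ALL x:E X. apt X (e 0) x : carr A))"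
  by (intro dfi XU df_rel1[where R = "%x. x:carr A", OF A(3)])
 thus "df M (%e. e 0 : FA)"
  by (rule back_subst[of "df M"]) (auto simp: funs_def apt_def fun_eq_iff)
qed

lemma interp: "interp M FA {(f, g). f : FA & g : FA & big (%x. (apt X f x, apt X g x) : mem A)}
  {(f, g). f : FA & g : FA & big (%x. apt X f x = apt X g x)} io B"
proof -
 have "big (%x. (apt X f x, apt X g x):mem A) <-> big (%x. (app_in M f x, app_in M g x):mem A)"
  "big (%x. apt X f x = apt X g x) <-> big (%x. app_in M f x = app_in M g x)" if "f:FA" "g:FA" for f g
  using that by (intro big_cong; simp add: apt_app)+
 moreover have "df M (%e. e 0 : FA & e 1 : FA & big (%x. (apt X (e 0) x, apt X (e 1) x) : mem A))"
  "df M (%e. e 0 : FA & e 1 : FA & big (%x. apt X (e 0) x = apt X (e 1) x))"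
  by (intro dfi df_big XU df_rel2[where R = "%x y. (x, y):mem A", OF A(4)])+
 ultimately show ?thesis
  unfolding interp_def using struct FA_V FA_nonempty B df_FA[OF dft_var] by (simp add: subset_iff)
qed

end

context zfc_model
begin

text \<open>Over a countable computably saturated model, every internal ultrapower is isomorphic to the
 model, by an isomorphism that moves the images of finitely many elements back.\<close>

theorem ultrapower_iso:
 assumes U: "ultrafilter_in M X U" and sat: "computably_saturated M" and cnt: "countable V"
 obtains h where "struct_iso h (ultrapower M X U) M" "h (ult_emb M X U U) = U"
proof -
 interpret internal_ultrafilter M X U by unfold_locales (rule U)
 have FA: "funs V = {f. fun_in M X f}" using app_in_V by (auto simp: funs_def)
 let ?io = "%f. ult_eq M X U `` {f}"
 have ult_eq: "ult_eq M X U = {(f, g). f:funs V & g:funs V & big (%x. app_in M f x = app_in M g x)}"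
  unfolding FA ult_eq_def big_def by auto
 have aa: "apt X f x = app_in M f x" if "f:funs V" "x:E X" for f x
  using that by (auto simp: apt_def funs_def)
 have bigR: "big (%x. R (app_in M f x) (app_in M g x)) <-> big (%x. R (apt X f x) (apt X g x))"
  if "f:funs V" "g:funs V" for f g R
  by (rule big_cong) (use aa that in auto)
 have VV: "f:V" if "f:funs V" for f using that by (auto simp: funs_def fun_in_def)
 have memR: "(f, g):ult_eq M X U <-> f:funs V & g:funs V & big (%x. apt X f x = apt X g x)" for f g
  unfolding ult_eq using bigR[of f g "(=)"] by auto
 have transfer: "big (%x. R (apt X f' x) (apt X g' x))"
  if "big (%x. R (apt X f x) (apt X g x))" "(f, f'):ult_eq M X U" "(g, g'):ult_eq M X U"
   and R: "df M (%e. R (e 0) (e 1))" for f g f' g' R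
  by (rule big_transfer[where R = R, OF that(1) _ _ _ _ _ _ R]) (use that VV in "auto simp: memR")
 have eq: "equiv (funs V) (ult_eq M X U)"
 proof (rule equivI)
  show "ult_eq M X U <= funs V \<times> funs V" by (auto simp: memR)
  show "refl_on (funs V) (ult_eq M X U)" using big_True by (auto simp: refl_on_def memR)
  show "sym (ult_eq M X U)" by (auto simp: sym_def memR eq_commute)
  show "trans (ult_eq M X U)"
  proof (rule transI)
   fix f g h assume fg: "(f, g):ult_eq M X U" and gh: "(g, h):ult_eq M X U"
   have "(f, f):ult_eq M X U" using fg big_True by (auto simp: memR)
   from transfer[where R = "(=)", OF _ this gh df_eq[OF dft_var dft_var]] fg gh show "(f, h):ult_eq M X U"
    by (auto simp: memR intro!: dfi)
  qed
 qed
 interpret internal_ultrapower M X U M "ultrapower M X U" ?io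
 proof
  show "df M (%e. e 0 : V)" by (rule df_cong[THEN iffD1, OF _ df_const[OF nonempty, of True]]) auto
  show "?io ` funs V = carr (ultrapower M X U)" by (auto simp: ultrapower_def FA quotient_def)
  fix f g assume fg: "f:funs V" "g:funs V"
  show "?io f = ?io g <-> big (%x. app_in M f x = app_in M g x)"
   using eq_equiv_class_iff[OF eq fg] fg by (simp add: ult_eq)
  have "(?io f, ?io g) : mem (ultrapower M X U) <->
   (EX f' g'. ?io f = ?io f' & ?io g = ?io g' & f' : funs V & g' : funs V & big (%x. (app_in M f' x, app_in M g' x) : mem M))"
   by (simp add: ultrapower_def FA big_def)
  also have "... <-> big (%x. (app_in M f x, app_in M g x):mem M)"
  proof
   assume "EX f' g'. ?io f = ?io f' & ?io g = ?io g' & f':funs V & g':funs V & big (%x. (app_in M f' x, app_in M g' x):mem M)"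
   then obtain f' g' where *: "?io f = ?io f'" "?io g = ?io g'" "f':funs V" "g':funs V"
    "big (%x. (app_in M f' x, app_in M g' x):mem M)" by blast
   hence "(f', f):ult_eq M X U" "(g', g):ult_eq M X U"
    using eq_equiv_class_iff[OF eq] fg by metis+
   from transfer[where R = "%x y. (x, y):mem M", OF _ this df_mem[OF dft_var dft_var]] *
   show "big (%x. (app_in M f x, app_in M g x):mem M)"
    using bigR[of _ _ "%x y. (x, y):mem M"] fg by (auto intro!: dfi)
  qed (use fg in blast)
  finally show "(?io f, ?io g) : mem (ultrapower M X U) <-> big (%x. (app_in M f x, app_in M g x):mem M)" .
 qed (use struct in "auto intro!: dfi")
 have UV: "U:V" using XU by simp
 \<comment> \<open>The back-and-forth starts with \<open>U\<close> matched to the constant function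
   at \<open>U\<close>; \<open>los_const\<close> says that this pair is similar. The resulting
   isomorphism thus sends the image of \<open>U\<close> to \<open>U\<close>.\<close>
 have "similar M ?io (ultrapower M X U) [(U, const_in M X U)]"
  unfolding similar_def
 proof (intro allI impI)
  fix ph assume fv: "fv ph <= {..<length [(U, const_in M X U)]}"
  have "sat (ultrapower M X U) (%i. ?io (snd ([(U, const_in M X U)] ! i))) ph <->
    sat (ultrapower M X U) (%i. ?io (const_in M X U)) ph"
   by (rule sat_cong) (use fv in auto)
  also have "... <-> sat M (%_. U) ph" by (rule los_const) (simp add: UV)
  also have "... <-> sat M (%i. fst ([(U, const_in M X U)] ! i)) ph" by (rule sat_cong) (use fv in auto)
  finally show "sat M (%i. fst ([(U, const_in M X U)] ! i)) ph <->
    sat (ultrapower M X U) (%i. ?io (snd ([(U, const_in M X U)] ! i))) ph" by simp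
 qed
 moreover have "set [(U, const_in M X U)] <= V \<times> funs V" using UV const_FA(1) by simp
 ultimately have "EX h. struct_iso h (ultrapower M X U) M & h (?io (const_in M X U)) = U"
  using back_and_forth[OF interp sat cnt, of "[(U, const_in M X U)]"] by (metis list.set_intros(1))
 thus ?thesis using that by (auto simp: ult_emb_def)
qed

end

subsection \<open>Definable embeddings\<close>

lemma sat_mrg_even: "sat M (mrg b a) (ren (%n. 2 * n) ph) <-> sat M b ph"
 and sat_mrg_odd: "sat M (mrg b a) (ren (%n. Suc (2 * n)) ph) <-> sat M a ph"
proof -
 have "mrg b a o (%n. 2 * n) = b" "mrg b a o (%n. Suc (2 * n)) = a" by (auto simp: fun_eq_iff)
 thus "sat M (mrg b a) (ren (%n. 2 * n) ph) <-> sat M b ph"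
  "sat M (mrg b a) (ren (%n. Suc (2 * n)) ph) <-> sat M a ph"
  by (simp_all add: sat_ren inj_def)
qed

lemma mrg_upd: "(mrg b a)(2 * n := x) = mrg (b(n := x)) a" "(mrg b a)(Suc (2 * n) := x) = mrg b (a(n := x))"
 by (auto simp: fun_eq_iff mrg_def elim!: evenE oddE)

lemma mrg_comp: "h o mrg b a = mrg (h o b) (h o a)"
 by (auto simp: fun_eq_iff mrg_def)

text \<open>That two definitions yield the same relation is a single formula \<open>Th\<close> about
  both parameter sequences, kept apart at even and odd variables. Each argument therefore occurs as
  two variables, which are quantified and equated.\<close>

lemma elementary_def2:
 assumes h: "elementary h M M" and a: "range a <= carr M" "range b <= carr M" and "def2 M psi b = def2 M ph a"
 shows "def2 M psi (h o b) = def2 M ph (h o a)"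
proof -
 define Th where "Th = All (2 * 0) (All (2 * 1) (All (Suc (2 * 0)) (All (Suc (2 * 1)) (Imp (Equ (2 * 0) (Suc (2 * 0)))
  (Imp (Equ (2 * 1) (Suc (2 * 1))) (Iff (ren (%n. 2 * n) psi) (ren (%n. Suc (2 * n)) ph)))))))"
 have "sat M (mrg b a) Th <-> (ALL x:carr M. ALL y:carr M. sat M (b(0 := x, 1 := y)) psi <-> sat M (a(0 := x, 1 := y)) ph)" for a b
  unfolding Th_def sat_Iff sat.simps(2,4,5) mrg_upd sat_mrg_even sat_mrg_odd mrg_simps(1,2)[of _ _ 0] mrg_simps(1,2)[of _ _ 1]
  by auto
 moreover have "sat M (mrg b a) Th <-> sat M (mrg (h o b) (h o a)) Th"
  using h range_mrg[OF a(2,1)] unfolding elementary_def by (simp flip: mrg_comp)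
 ultimately show ?thesis using assms(4) by (auto simp: def2_def set_eq_iff)
qed

lemma elementary_def1:
 assumes h: "elementary h M M" and a: "range a <= carr M" "range b <= carr M" and "def1 M psi b = def1 M ph a"
 shows "def1 M psi (h o b) = def1 M ph (h o a)"
proof -
 define Th where "Th = All (2 * 0) (All (Suc (2 * 0)) (Imp (Equ (2 * 0) (Suc (2 * 0)))
  (Iff (ren (%n. 2 * n) psi) (ren (%n. Suc (2 * n)) ph))))"
 have "sat M (mrg b a) Th <-> (ALL x:carr M. sat M (b(0 := x)) psi <-> sat M (a(0 := x)) ph)" for a b
  unfolding Th_def sat_Iff sat.simps(2,4,5) mrg_upd sat_mrg_even sat_mrg_odd mrg_simps(1,2)[of _ _ 0] by auto
 moreover have "sat M (mrg b a) Th <-> sat M (mrg (h o b) (h o a)) Th"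
  using h range_mrg[OF a(2,1)] unfolding elementary_def by (simp flip: mrg_comp)
 ultimately show ?thesis using assms(4) by (auto simp: def1_def set_eq_iff)
qed

lemma def_fix:
 assumes "!!i. i:fv ph ==> h (a i) = a i"
 shows "def1 M ph (h o a) = def1 M ph a" "def2 M ph (h o a) = def2 M ph a"
proof -
 have "sat M ((h o a)(0 := x)) ph <-> sat M (a(0 := x)) ph" "sat M ((h o a)(0 := x, 1 := y)) ph <-> sat M (a(0 := x, 1 := y)) ph" for x y
  by (intro sat_cong; use assms in auto)+
 thus "def1 M ph (h o a) = def1 M ph a" "def2 M ph (h o a) = def2 M ph a"
  by (simp_all add: def1_def def2_def)
qed

lemma interp_definable_struct:
 assumes "definable_struct M N" "is_struct M"
 shows "interp M (carr N) (mem N) (Id_on (carr N)) id N"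
proof -
 have sub: "carr N <= carr M" "mem N <= carr N \<times> carr N" "carr N ~= {}"
  using assms by (auto simp: definable_struct_def definable1_def def1_def is_struct_def)
 have ne: "carr M ~= {}" using assms by (simp add: is_struct_def)
 have d: "df M (%e. e 0 : carr N)" "df M (%e. (e 0, e 1):mem N)"
  using assms dft_var[OF ne] by (auto simp: definable_struct_def intro: df_definable1 df_definable2)
 have "df M (%e. e 0 : carr N & e 0 = e 1)" by (intro df_conj d df_eq dft_var ne)
 hence "df M (%e. (e 0, e 1):Id_on (carr N))" by (rule back_subst[of "df M"]) auto
 thus ?thesis unfolding interp_def using assms(2) sub d by auto
qed

text \<open>Some definitions of the graph, of the target and of its membership mention finitely many
  parameters \<open>ps\<close>. With \<open>pi\<close> sending \<open>j z\<close> back to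
  \<open>z\<close> for these, \<open>h = pi o j\<close> is an elementary map of \<open>M\<close>
  into itself that fixes \<open>ps\<close> and so preserves these definitions. Any other definition
  of the same classes is equivalent to them, and \<open>h\<close> preserves the equivalence.\<close>

theorem reverse_embedding:
 assumes M: "is_struct M" "computably_saturated M" "countable (carr M)" and j: "definable_embedding M j N"
 obtains pi where "struct_iso pi N M" "sends_embedding (pi o j) M j N M j N"
proof -
 have el: "elementary j M N" and str: "definable_struct M N" using j by (auto simp: definable_embedding_def)
 have "definable2 M (graph_on M j)" "definable1 M (carr N)" "definable2 M (mem N)"
  using j by (auto simp: definable_embedding_def definable_struct_def)
 then obtain ph a ph1 a1 ph2 a2 where a: "range a <= carr M" "graph_on M j = def2 M ph a"
  "range a1 <= carr M" "carr N = def1 M ph1 a1" "range a2 <= carr M" "mem N = def2 M ph2 a2"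
  unfolding definable1_def definable2_def by (elim exE conjE)
 obtain ps where ps: "set ps = a ` fv ph Un a1 ` fv ph1 Un a2 ` fv ph2"
  using finite_list[of "a ` fv ph Un a1 ` fv ph1 Un a2 ` fv ph2"] by auto
 have psV: "set ps <= carr M" using a ps by auto
 let ?zs = "map (%z. (z, j z)) ps"
 have j': "j x : carr N" if "x:carr M" for x using el that by (auto simp: elementary_def)
 have "similar M id N ?zs"
  unfolding similar_def
 proof (intro allI impI)
  fix psi assume fv: "fv psi <= {..<length ?zs}"
  hence "!!i. i:fv psi ==> ps ! i : carr M" using psV nth_mem[of _ ps] by (auto simp: subset_iff)
  then obtain e where e: "range e <= carr M" "sat M e psi <-> sat M ((!) ps) psi" "!!i. i:fv psi ==> e i = ps ! i"
   using env_restrict[of M psi "(!) ps"] M(1) by (auto simp: is_struct_def)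
  have "sat M (%i. fst (?zs ! i)) psi <-> sat M ((!) ps) psi" by (rule sat_cong) (use fv in auto)
  also have "... <-> sat N (j o e) psi" using el e(1,2) by (auto simp: elementary_def)
  also have "... <-> sat N (%i. id (snd (?zs ! i))) psi" by (rule sat_cong) (use fv e(3) in auto)
  finally show "sat M (%i. fst (?zs ! i)) psi <-> sat N (%i. id (snd (?zs ! i))) psi" .
 qed
 moreover have "set ?zs <= carr M \<times> carr N" using psV j' by auto
 ultimately have "EX pi. struct_iso pi N M & (ALL (u, v):set ?zs. pi (id v) = u)"
  using back_and_forth[OF interp_definable_struct[OF str M(1)] M(2,3), of ?zs] by (metis (mono_tags, lifting) case_prodI2)
 then obtain pi where pi: "struct_iso pi N M" "!!u v. (u, v):set ?zs ==> pi (id v) = u" by blast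
 define h where "h = pi o j"
 have fix_h: "h z = z" if "z:set ps" for z using pi(2)[of z "j z"] that by (auto simp: h_def)
 have "elementary h M M"
  unfolding elementary_def
 proof (intro conjI allI impI)
  show "h ` carr M <= carr M" using j' pi(1) by (auto simp: h_def struct_iso_def bij_betw_def)
  fix psi and e :: "nat => 'a" assume e: "range e <= carr M"
  hence "sat M e psi <-> sat N (j o e) psi" using el by (simp add: elementary_def)
  also have "... <-> sat M (pi o (j o e)) psi" by (rule sat_iso[OF pi(1)]) (use e j' in auto)
  finally show "sat M e psi <-> sat M (h o e) psi" by (simp add: h_def comp_assoc)
 qed
 note el2 = elementary_def2[OF this] and el1 = elementary_def1[OF this]
 have "sends_embedding h M j N M j N"
  unfolding sends_embedding_def
 proof (intro allI impI conjI)
  fix psi and b :: "nat => 'a" assume b: "range b <= carr M"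
  show "def2 M psi (h o b) = graph_on M j" if "def2 M psi b = graph_on M j"
   using el2[OF a(1) b, of psi ph] def_fix(2)[of ph h a] fix_h ps that a(2) by auto
  show "def1 M psi (h o b) = carr N" if "def1 M psi b = carr N"
   using el1[OF a(3) b, of psi ph1] def_fix(1)[of ph1 h a1] fix_h ps that a(4) by auto
  show "def2 M psi (h o b) = mem N" if "def2 M psi b = mem N"
   using el2[OF a(5) b, of psi ph2] def_fix(2)[of ph2 h a2] fix_h ps that a(6) by auto
 qed
 thus ?thesis using pi(1) that by (simp add: h_def)
qed

section \<open>The three reverse axioms\<close>

lemma zfc_model_multiverse: "M:CSM ==> zfc_model M"
 by (simp add: countable_saturated_models_def zfc_model_def)

theorem reverse_embedding_saturated: "reverse_embedding_axiom (CSM :: 'a struct set)"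
 unfolding reverse_embedding_axiom_def
proof (intro ballI allI impI)
 fix M N :: "'a struct" and j
 assume M: "M:CSM" and j: "definable_embedding M j N"
 then obtain pi where "struct_iso pi N M" "sends_embedding (pi o j) M j N M j N"
  using reverse_embedding[of M j N] by (auto simp: countable_saturated_models_def is_model_def)
 thus "EX M0:CSM :: 'a struct set. EX N0 k pi. definable_embedding M0 k N0 & struct_iso pi N0 M & sends_embedding (pi o k) M0 k N0 M j N"
  by - (rule bexI[OF _ M], intro exI conjI, rule j)
qed

theorem strong_reverse_ultrapower_saturated:
 "strong_reverse_ultrapower_axiom (CSM :: 'a struct set)"
 unfolding strong_reverse_ultrapower_axiom_def
proof (intro ballI allI impI)
 fix M :: "'a struct" and X U
 assume M: "M:CSM" and U: "ultrafilter_in M X U"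
 interpret zfc_model M using M by (rule zfc_model_multiverse)
 obtain h where "struct_iso h (ultrapower M X U) M" "h (ult_emb M X U U) = U"
  using ultrapower_iso[OF U] M by (auto simp: countable_saturated_models_def)
 thus "EX M0:CSM :: 'a struct set. EX X0 U0 h. ultrafilter_in M0 X0 U0 &
   struct_iso h (ultrapower M0 X0 U0) M & h (ult_emb M0 X0 U0 U0) = U"
  by - (rule bexI[OF _ M], intro exI conjI, rule U)
qed

text \<open>Supplies an ultrafilter on \<open>omega_in M\<close> for
  \<open>reverse_ultrapower_saturated\<close>; the isomorphism of \<open>ultrapower_iso\<close>
  exists whichever ultrafilter is taken.\<close>

lemma (in zfc_model) principal_ultrafilter:
 assumes "X:V" "x:E X"
 shows "EX U. ultrafilter_in M X U"
proof -
 have "isset {y:{y:V. E y <= E X}. x:E y}"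
  using assms by (intro isset_sep isset_Pow isset_E dfi) (auto intro: E_in)
 then obtain U where U: "U:V" "E U = {y:{y:V. E y <= E X}. x:E y}" by (auto simp: isset_def)
 have "ultrafilter_in M X U" unfolding ultrafilter_in_def U(2) using U(1) assms by auto
 thus ?thesis by blast
qed

theorem reverse_ultrapower_saturated: "reverse_ultrapower_axiom (CSM :: 'a struct set)"
 unfolding reverse_ultrapower_axiom_def
proof
 fix M :: "'a struct" assume M: "M:CSM"
 interpret zfc_model M using M by (rule zfc_model_multiverse)
 obtain U where U: "ultrafilter_in M (omega_in M) U"
  using principal_ultrafilter[OF omega_in_V empty_in_W] by blast
 obtain h where "struct_iso h (ultrapower M (omega_in M) U) M"
  using ultrapower_iso[OF U] M by (auto simp: countable_saturated_models_def)
 thus "EX N:CSM :: 'a struct set. EX U. ultrafilter_in N (omega_in N) U & isomorphic (ultrapower N (omega_in N) U) M"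
  unfolding isomorphic_def by - (rule bexI[OF _ M], intro exI conjI, rule U)
qed

subsection \<open>Set models as seen from inside\<close>

context zfc_model
begin

abbreviation num :: "nat => 'a" where "num == num_in M"

lemma num_W [simp]: "num n : W" and num_V [simp]: "num n : V"
proof -
 show "num n : W" by (induction n) simp_all
 thus "num n : V" by (rule W_sub)
qed

lemma num_inj: "num m = num n <-> m = n"
proof (induction m arbitrary: n)
 case 0
 thus ?case by (cases n) (use succ_not_empty in "auto dest: sym")
next
 case (Suc m)
 thus ?case
  by (cases n) (use succ_not_empty succ_inj[OF num_V num_V] in auto)
qed

lemma quote_V [simp]: "quote_in M ph : V"
 by (induction ph) (auto simp: mem_code_def equ_code_def neg_code_def imp_code_def all_code_def)

definition fm_node :: "'a set => 'a => bool" where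
 "fm_node T d <-> (EX i : W. EX j : W. d = mem_code M i j | d = equ_code M i j) | (EX a : T. d = neg_code M a) |
   (EX a : T. EX b : T. d = imp_code M a b) | (EX u : W. EX a : T. d = all_code M u a)"

definition nfree_node :: "'a => 'a set => 'a => bool" where
 "nfree_node v T d <-> (EX i : W. EX j : W. i ~= v & j ~= v & (d = mem_code M i j | d = equ_code M i j)) |
   (EX a : T. d = neg_code M a) | (EX a : T. EX b : T. d = imp_code M a b) |
   (EX u : W. EX a : T. d = all_code M u a) | (EX a. fm_in M a & d = all_code M v a)"

lemma fm_in_iff: "fm_in M c <-> (EX T. isset T & c:T & (ALL d:T. fm_node T d))"
 unfolding fm_in_def fm_node_def isset_def by blast

lemma not_free_in_iff: "not_free_in M v c <-> (EX T. isset T & c:T & (ALL d:T. nfree_node v T d))"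
 unfolding not_free_in_def nfree_node_def isset_def by blast

text \<open>Both notions are instances of the existence of a set closed under a monotone node condition.\<close>

lemma closed_node:
 assumes mono: "!!T T' d. node T d ==> T <= T' ==> node T' d" and c: "c:V" "finite D" "node D c"
  and D: "!!d. d:D ==> EX T. isset T & d:T & (ALL d:T. node T d)"
 shows "EX T. isset T & c:T & (ALL d:T. node T d)"
proof -
 have "EX T. isset T & D <= T & (ALL d:T. node T d)"
  using c(2) D
 proof (induction rule: finite_induct)
  case (insert d D)
  then obtain T T' where "isset T" "D <= T" "ALL d:T. node T d" "isset T'" "d:T'" "ALL d:T'. node T' d"
   by (metis insertCI)
  thus ?case
   using isset_Un[of T T'] mono[of T _ "T Un T'"] mono[of T' _ "T Un T'"]
   by (intro exI[of _ "T Un T'"]) (auto)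
 qed (auto intro!: exI[of _ "{}"])
 then obtain T where T: "isset T" "D <= T" "ALL d:T. node T d" by blast
 thus ?thesis
  using isset_insert[OF c(1) T(1)] mono[of T _ "insert c T"] mono[OF c(3), of "insert c T"]
  by (intro exI[of _ "insert c T"]) auto
qed

lemma fm_node_mono: "fm_node T d ==> T <= T' ==> fm_node T' d"
 unfolding fm_node_def by (elim disjE) blast+

lemma nfree_node_mono: "nfree_node v T d ==> T <= T' ==> nfree_node v T' d"
 unfolding nfree_node_def by (elim disjE) blast+

lemma fm_inI: "fm_node D c ==> finite D ==> c:V ==> (!!d. d:D ==> fm_in M d) ==> fm_in M c"
 unfolding fm_in_iff by (rule closed_node[OF fm_node_mono])

lemma not_free_inI:
 "nfree_node v D c ==> finite D ==> c:V ==> (!!d. d:D ==> not_free_in M v d) ==> not_free_in M v c"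
 unfolding not_free_in_iff by (rule closed_node[OF nfree_node_mono])

lemma fm_in_quote: "fm_in M (quote_in M ph)"
proof (induction ph)
 case (Mem i j)
 have "fm_node {} (quote_in M (Mem i j))" unfolding fm_node_def quote_in.simps using num_W[of i] num_W[of j] by blast
 thus ?case by (rule fm_inI) (simp_all del: quote_in.simps)
next
 case (Equ i j)
 have "fm_node {} (quote_in M (Equ i j))" unfolding fm_node_def quote_in.simps using num_W[of i] num_W[of j] by blast
 thus ?case by (rule fm_inI) (simp_all del: quote_in.simps)
next
 case (Neg ph)
 have "fm_node {quote_in M ph} (quote_in M (Neg ph))" unfolding fm_node_def by auto
 thus ?case by (rule fm_inI) (use Neg in "auto simp del: quote_in.simps")
next
 case (Imp ph psi)
 have "fm_node {quote_in M ph, quote_in M psi} (quote_in M (Imp ph psi))" unfolding fm_node_def by auto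
 thus ?case by (rule fm_inI) (use Imp in "auto simp del: quote_in.simps")
next
 case (All v ph)
 have "fm_node {quote_in M ph} (quote_in M (All v ph))" unfolding fm_node_def using num_W by auto
 thus ?case by (rule fm_inI) (use All in "auto simp del: quote_in.simps")
qed

lemma not_free_in_quote: "v ~: fv ph ==> not_free_in M (num v) (quote_in M ph)"
proof (induction ph)
 case (Mem i j)
 hence "num i ~= num v" "num j ~= num v" by (auto simp: num_inj)
 hence "nfree_node (num v) {} (quote_in M (Mem i j))"
  unfolding nfree_node_def quote_in.simps using num_W[of i] num_W[of j] by blast
 thus ?case by (rule not_free_inI) (simp_all del: quote_in.simps)
next
 case (Equ i j)
 hence "num i ~= num v" "num j ~= num v" by (auto simp: num_inj)
 hence "nfree_node (num v) {} (quote_in M (Equ i j))"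
  unfolding nfree_node_def quote_in.simps using num_W[of i] num_W[of j] by blast
 thus ?case by (rule not_free_inI) (simp_all del: quote_in.simps)
next
 case (Neg ph)
 have "nfree_node (num v) {quote_in M ph} (quote_in M (Neg ph))" unfolding nfree_node_def by auto
 thus ?case by (rule not_free_inI) (use Neg in "auto simp del: quote_in.simps")
next
 case (Imp ph psi)
 have "nfree_node (num v) {quote_in M ph, quote_in M psi} (quote_in M (Imp ph psi))" unfolding nfree_node_def by auto
 thus ?case by (rule not_free_inI) (use Imp in "auto simp del: quote_in.simps")
next
 case (All u ph)
 show ?case
 proof (cases "u = v")
  case True
  hence "nfree_node (num v) {} (quote_in M (All u ph))" unfolding nfree_node_def using fm_in_quote by auto
  thus ?thesis by (rule not_free_inI) (simp_all del: quote_in.simps)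
 next
  case False
  have "nfree_node (num v) {quote_in M ph} (quote_in M (All u ph))" unfolding nfree_node_def using num_W by auto
  thus ?thesis by (rule not_free_inI) (use All False in "auto simp del: quote_in.simps")
 qed
qed

lemma quote_zfc:
 assumes "ph:zfc"
 shows "quote_in M ph : zfc_in M"
proof -
 consider "ph:single_axioms" | psi where "2 ~: fv psi" "ph = separation psi" | psi where "3 ~: fv psi" "ph = replacement psi"
  using assms by (auto simp: zfc_def)
 thus ?thesis
 proof cases
  case 2
  have "quote_in M ph = separation_code M (quote_in M psi)"
   by (simp add: 2 separation_def separation_code_def exi_code_def iff_code_def con_code_def)
  thus ?thesis unfolding zfc_in_def using fm_in_quote not_free_in_quote[OF 2(1)] by blast
 next
  case 3
  have "quote_in M ph = replacement_code M (quote_in M psi)"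
   by (simp add: 3 replacement_def replacement_code_def exi_code_def iff_code_def con_code_def)
  thus ?thesis unfolding zfc_in_def using fm_in_quote not_free_in_quote[OF 3(1)] by blast
 qed (simp add: zfc_in_def)
qed

lemma maps_in_update:
 assumes "maps_in M (om) m s" "n:W" "x:E m"
 obtains s' where "maps_in M (om) m s'" "app_in M s' n = x" "!!i. i:W ==> i ~= n ==> app_in M s' i = app_in M s i"
proof -
 have s: "fun_in M (om) s" "s:V" using assms(1) by (auto simp: maps_in_def fun_in_def)
 define g where "g i = (if i = n then x else app_in M s i)" for i
 have "df M (%e. (e 0 = n & e 1 = x) | (e 0 ~= n & (e 0, e 1):rel_in M s))"
  using assms(2,3) s W_sub by (intro dfi) (auto intro: E_in)
 moreover have "g i : V" if "i:W" for i using that assms(3) app_in_V[OF s(1)] E_in by (auto simp: g_def)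
 moreover have "(i = n & y = x) | (i ~= n & (i, y):rel_in M s) <-> y = g i" if "i:W" "y:V" for i y
  using fun_in_app[OF s(1) that(1)] by (auto simp: g_def)
 ultimately obtain s' where s': "fun_in M (om) s'" "!!i. i:W ==> app_in M s' i = g i"
  using fun_ex[OF omega_in_V, of "%i y. (i = n & y = x) | (i ~= n & (i, y):rel_in M s)" g] by blast
 show ?thesis
  by (rule that[of s']) (use assms s' in "auto simp: maps_in_def g_def")
qed

lemma maps_in_ex:
 assumes "!!i. i < n ==> e i : E m" "E m ~= {}"
 shows "EX s. maps_in M (om) m s & (ALL i<n. app_in M s (num i) = e i)"
 using assms(1)
proof (induction n)
 case 0
 obtain x where x: "x:E m" using assms(2) by blast
 hence "x:V" by (rule E_in)
 then obtain s where s: "fun_in M (om) s" "!!i. i:W ==> app_in M s i = x"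
  using fun_of_term[OF omega_in_V, of "%_. x"] dft_const by metis
 hence "maps_in M (om) m s" using x by (simp add: maps_in_def)
 thus ?case by blast
next
 case (Suc n)
 then obtain s where s: "maps_in M (om) m s" "ALL i<n. app_in M s (num i) = e i" by auto
 obtain s' where "maps_in M (om) m s'" "app_in M s' (num n) = e n"
  "!!i. i:W ==> i ~= num n ==> app_in M s' i = app_in M s i"
  using maps_in_update[OF s(1) num_W[of n] Suc.prems[OF lessI]] by metis
 thus ?case using s(2) num_inj by (intro exI[of _ s']) (auto simp: less_Suc_eq)
qed

text \<open>The internal relation also judges nonstandard formulas. On quotations it obeys the
  recursion clauses of external satisfaction, so an external induction identifies the two.\<close>

lemma sat_rel_in_sat:
 assumes S: "sat_rel_in M m r T" and "maps_in M (om) m s"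
 shows "(quote_in M ph, s):rel_in M T <-> sat (coded M m r) (%i. app_in M s (num i)) ph"
 using assms(2)
proof (induction ph arbitrary: s)
 case (Mem i j)
 thus ?case using S num_W[of i] num_W[of j] unfolding sat_rel_in_def by (simp add: coded_def)
next
 case (Equ i j)
 thus ?case using S num_W[of i] num_W[of j] unfolding sat_rel_in_def by (simp add: coded_def)
next
 case (Neg ph)
 thus ?case using S fm_in_quote[of ph] unfolding sat_rel_in_def by simp
next
 case (Imp ph psi)
 thus ?case using S fm_in_quote[of ph] fm_in_quote[of psi] unfolding sat_rel_in_def by simp
next
 case (All v ph)
 have step: "(quote_in M (All v ph), s) : rel_in M T <-> (ALL s'. maps_in M (om) m s' &
   (ALL i : W. i ~= num v --> app_in M s' i = app_in M s i) --> (quote_in M ph, s') : rel_in M T)"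
  using S fm_in_quote[of ph] num_W[of v] All.prems unfolding sat_rel_in_def by simp
 have eq: "(%i. app_in M s' (num i)) = (%i. app_in M s (num i))(v := app_in M s' (num v))"
  if "ALL i : W. i ~= num v --> app_in M s' i = app_in M s i" for s'
  using that num_inj by (auto simp: fun_eq_iff)
 show ?case
  unfolding step
 proof (intro iffI allI impI)
  assume *: "ALL s'. maps_in M (om) m s' & (ALL i : W. i ~= num v --> app_in M s' i = app_in M s i) -->
   (quote_in M ph, s') : rel_in M T"
  show "sat (coded M m r) (%i. app_in M s (num i)) (All v ph)"
   unfolding sat.simps
  proof
   fix x assume "x:carr (coded M m r)"
   hence "x:E m" by (simp add: coded_def)
   then obtain s' where s': "maps_in M (om) m s'" "app_in M s' (num v) = x"
    "!!i. i:W ==> i ~= num v ==> app_in M s' i = app_in M s i"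
    using maps_in_update[OF All.prems num_W] by metis
   hence "sat (coded M m r) (%i. app_in M s' (num i)) ph" using * All.IH by blast
   moreover have "(%i. app_in M s' (num i)) = (%i. app_in M s (num i))(v := x)"
    using eq[of s'] s' by simp
   ultimately show "sat (coded M m r) ((%i. app_in M s (num i))(v := x)) ph" by simp
  qed
 next
  fix s' assume a: "sat (coded M m r) (%i. app_in M s (num i)) (All v ph)"
   and s': "maps_in M (om) m s' & (ALL i : W. i ~= num v --> app_in M s' i = app_in M s i)"
  have "app_in M s' (num v) : carr (coded M m r)" using s' num_W by (auto simp: maps_in_def coded_def)
  hence "sat (coded M m r) (%i. app_in M s' (num i)) ph" using a eq[of s'] s' by (metis sat.simps(5))
  thus "(quote_in M ph, s'):rel_in M T" using All.IH s' by blast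
 qed
qed

text \<open>The ZFC of \<open>M\<close> contains the quotation of every actual axiom. An external
  environment need not be an assignment of \<open>M\<close>, but it can be matched at finitely many
  numerals, enough for one formula.\<close>

theorem thinks_set_model:
 assumes "thinks_set_model_zfc M m r"
 shows "is_model (coded M m r) zfc"
proof -
 obtain T where T: "sat_rel_in M m r T" "!!c s. c:zfc_in M ==> maps_in M (om) m s ==> (c, s):rel_in M T"
  and mr: "binrel_in M m r" "E m ~= {}"
  using assms by (auto simp: thinks_set_model_zfc_def)
 have "rel_in M r <= E m \<times> E m"
 proof
  fix z assume "z:rel_in M r"
  then obtain x y where z: "z = (x, y)" "x:V" "y:V" "pr x y : E r" by (auto simp: rel_in_def)
  then obtain x' y' where "x':E m" "y':E m" "pr x y = pr x' y'" using mr(1) by (auto simp: binrel_in_def)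
  thus "z:E m \<times> E m" using z pr_inj E_in by blast
 qed
 hence "is_struct (coded M m r)" using mr(2) by (simp add: is_struct_def coded_def)
 moreover have "sat (coded M m r) e ph" if "ph:zfc" "range e <= carr (coded M m r)" for ph e
 proof -
  obtain n where n: "fv ph <= {..<n}" using fv_bound by blast
  have "!!i. e i : E m" using that(2) by (auto simp: coded_def)
  then obtain s where s: "maps_in M (om) m s" "ALL i<n. app_in M s (num i) = e i"
   using maps_in_ex[of n e m] mr(2) by blast
  have "sat (coded M m r) e ph <-> sat (coded M m r) (%i. app_in M s (num i)) ph"
   by (rule sat_cong) (use n s in auto)
  thus ?thesis using sat_rel_in_sat[OF T(1) s(1)] T(2)[OF quote_zfc[OF that(1)] s(1)] by simp
 qed
 ultimately show ?thesis by (simp add: is_model_def)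
qed

end

theorem realizability_saturated: "realizability_axiom (CSM :: 'a struct set)"
 unfolding realizability_axiom_def
proof (intro ballI allI impI; elim conjE)
 fix M N :: "'a struct"
 assume M: "M:CSM" and N: "definable_struct M N" "thinks_model_zfc M N"
 interpret zfc_model M using M by (rule zfc_model_multiverse)
 have "is_model N zfc"
  using N(2) thinks_set_model by (auto simp: thinks_model_zfc_def split: if_splits)
 moreover have "computably_saturated N"
  using computably_saturated_interp[OF interp_definable_struct[OF N(1) struct]] M
  by (simp add: countable_saturated_models_def)
 moreover have "carr N <= carr M" using N(1) by (auto simp: definable_struct_def definable1_def def1_def)
 hence "countable (carr N)" using M by (auto simp: countable_saturated_models_def intro: countable_subset)
 ultimately show "N:CSM" by (simp add: countable_saturated_models_def)
qed

context zfc_model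
begin

subsection \<open>Countable sets\<close>

lemma W_trans: "n:W ==> x:E n ==> E x <= E n"
proof -
 have "ALL x:E n. E x <= E n" if "n:W" for n
  using that
 proof (rule W_induct[rotated -1])
  show "df M (%e. ALL x:E (e 0). E x <= E (e 0))" by (intro dfi)
 qed (auto simp: E_succ W_sub)
 thus "n:W ==> x:E n ==> E x <= E n" by blast
qed

lemma W_zero_le: "n:W ==> n = emp | emp : E n"
proof (rule W_induct[where P = "%n. n = emp | emp : E n"])
 show "df M (%e. e 0 = emp | emp : E (e 0))" by (intro dfi empty_in_V)
qed (auto simp: E_succ W_sub)

lemma W_succ_mono: "n:W ==> m:E n ==> sc m : E (sc n)"
proof -
 have "ALL m:E n. sc m : E (sc n)" if "n:W" for n
  using that
 proof (rule W_induct[rotated -1])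
  show "df M (%e. ALL m:E (e 0). sc m : E (sc (e 0)))" by (intro dfi)
 qed (auto simp: E_succ W_sub)
 thus "n:W ==> m:E n ==> sc m : E (sc n)" by blast
qed

lemma W_linear: "m:W ==> n:W ==> m:E n | m = n | n:E m"
proof (rule W_induct[where P = "%m. m:E n | m = n | n:E m"])
 assume n: "n:W"
 show "df M (%e. e 0 : E n | e 0 = n | n:E (e 0))" using n W_sub by (intro dfi) auto
 show "emp : E n | emp = n | n:E (emp)" using W_zero_le[OF n] by auto
 show "sc m : E n | sc m = n | n:E (sc m)" if m: "m:W" "m:E n | m = n | n:E m" for m
  using m(2) W_succ_mono[OF n, of m] E_succ[OF W_sub[OF m(1)]] E_succ[OF W_sub[OF n]] by auto
qed

lemma W_irrefl: "n:V ==> n ~: E n"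
 using no_cycle by blast

lemma dft_the:
 assumes "df M (%e. R (e 0) (e 1))" "!!y. y:V ==> EX! x. x:V & R y x"
 obtains F where "dft M (%e. F (e 0))" "!!y. y:V ==> F y : V & R y (F y)"
proof -
 define F where "F y = (THE x. x:V & R y x)" for y
 have F: "F y : V & R y (F y)" if "y:V" for y unfolding F_def by (rule theI'[OF assms(2)[OF that]])
 have "dft M (%e. F (e 0))"
 proof (rule dft_descr[where P = "%x e. R (e 0) x"])
  show "x = F (e 0) <-> R (e 0) x" if "range e <= V" "x:V" for e x
   using F[of "e 0"] assms(2)[of "e 0"] that by blast
  show "F (e 0) : V" if "range e <= V" for e using F that by blast
 qed (intro df_rel2[where R = R, OF assms(1)] dfi)
 thus ?thesis using F that by blast
qed

text \<open>Covering by the values of a function on \<open>W\<close>, rather than injecting into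
  \<open>W\<close>: this passes to images and subsets at once, and the injection of
  \<open>countable_in\<close> is recovered by Choice.\<close>

definition enumerable :: "'a set => bool" where
 "enumerable A <-> (EX f : V. ALL a : A. EX n : W. apt (om) f n = a)"

text \<open>A walk through all pairs of numbers: below the diagonal point \<open>(n, n)\<close> it alternates
 \<open>(0, n), (n, 0), (1, n), (n, 1), \<dots>\<close>. Only the order of \<open>\<omega>\<close> is needed.\<close>

lemma enumerable_WW: "enumerable (prs W W)"
proof -
 define R where "R y x <-> (EX i:W. EX j:W. y = pr i j & ((i : E j & x = pr j i) | (j : E i & x = pr (sc j) i) |
   (i = j & x = pr (emp) (sc i)))) | (~(EX i:W. EX j:W. y = pr i j) & x = y)" for y x
 have "df M (%e. R (e 0) (e 1))" unfolding R_def by (intro dfi omega_in_V empty_in_V)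
 moreover have "EX! x. x:V & R y x" if "y:V" for y
 proof (cases "EX i:W. EX j:W. y = pr i j")
  case True
  then obtain i j where ij: "i:W" "j:W" "y = pr i j" by blast
  have eq: "pr i j = pr i' j' <-> i = i' & j = j'" if "i':W" "j':W" for i' j'
   using ij that W_sub by (simp add: pr_inj)
  have ex: "(EX i':W. EX j':W. y = pr i' j' & P i' j') <-> P i j" for P
   unfolding ij(3) using ij(1,2) eq by metis
  have Ry: "R y x <-> (i:E j & x = pr j i) | (j:E i & x = pr (sc j) i) | (i = j & x = pr (emp) (sc i))" for x
   unfolding R_def ex using True by simp
  have "i:E j & j ~: E i & i ~= j | j:E i & i ~: E j & i ~= j | i = j & i ~: E j"
   using W_linear[OF ij(1,2)] no_cycle[of i j] W_irrefl[of i] W_sub ij by auto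
  thus ?thesis unfolding Ry using ij W_sub by (elim disjE) auto
 next
  case False
  thus ?thesis using that by (auto simp: R_def)
 qed
 ultimately obtain F where F: "dft M (%e. F (e 0))" "!!y. y:V ==> F y : V & R y (F y)" using dft_the by blast
 have F_eq: "F (pr i j) = x" if iW: "i:W" and jW: "j:W" and st: "(i : E j & x = pr j i) | (j : E i & x = pr (sc j) i) |
   (i = j & x = pr (emp) (sc i))" for i j x
 proof -
  have ij: "i:V" "j:V" using iW jW W_sub by auto
  have "R (pr i j) (F (pr i j))" using F(2) ij by simp
  then obtain i' j' where "i':W" "j':W" "pr i j = pr i' j'" "(i' : E j' & F (pr i j) = pr j' i') |
   (j' : E i' & F (pr i j) = pr (sc j') i') | (i' = j' & F (pr i j) = pr (emp) (sc i'))"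
   unfolding R_def using iW jW by blast
  moreover from this have "i' = i" "j' = j" using ij W_sub by (auto simp: pr_inj)
  ultimately show ?thesis using st no_cycle[OF ij] W_irrefl[OF ij(1)] W_irrefl[OF ij(2)] by auto
 qed
 let ?o = "emp"
 have "pr ?o ?o : V" by simp
 then obtain s where s: "fun_in M (om) s" "app_in M s ?o = pr ?o ?o"
  "!!n. n:W ==> app_in M s (sc n) = F (app_in M s n)"
  using recursion[OF _ F(1)] by blast
 define Q where "Q y <-> (EX n:W. (n, y):rel_in M s)" for y
 have sV: "s:V" using s(1) by (simp add: fun_in_def)
 have "df M (%e. Q (e 0))" unfolding Q_def by (intro dfi omega_in_V sV)
 note df_Q = df_rel1[where R = Q, OF this]
 have Q_iff: "Q y <-> (EX n:W. y = app_in M s n)" for y unfolding Q_def using fun_in_app[OF s(1)] by blast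
 have Q0: "Q (pr ?o ?o)" unfolding Q_iff using s(2) empty_in_W by metis
 have QF: "Q (F y)" if "Q y" for y using that s(3) succ_in_W unfolding Q_iff by metis
 have step1: "Q (pr j i)" if "Q (pr i j)" "i:W" "j:W" "i:E j" for i j
  using QF[OF that(1)] F_eq[OF that(2,3), of "pr j i"] that(4) by simp
 have step2: "Q (pr (sc i) j)" if "Q (pr j i)" "i:W" "j:W" "i:E j" for i j
  using QF[OF that(1)] F_eq[OF that(3,2), of "pr (sc i) j"] that(4) by simp
 have step3: "Q (pr ?o (sc i))" if "Q (pr i i)" "i:W" for i
  using QF[OF that(1)] F_eq[OF that(2,2), of "pr ?o (sc i)"] by simp
 \<comment> \<open>\<open>i : E (sc j)\<close> means that \<open>i\<close> is at most
   \<open>j\<close>. From \<open>(i, j)\<close> with \<open>i < j\<close> two steps of the walk lead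
   through \<open>(j, i)\<close> to \<open>(i + 1, j)\<close>; from \<open>(j, j)\<close> the walk
   goes on to \<open>(0, j + 1)\<close>.\<close>
 have row: "Q (pr i j)" if "Q (pr ?o j)" "j:W" "i:W" "i:E (sc j)" for i j
 proof -
  have "i:E (sc j) --> Q (pr i j)"
  proof (rule W_induct[where P = "%i. i:E (sc j) --> Q (pr i j)", OF _ _ _ that(3)])
   show "df M (%e. e 0 : E (sc j) --> Q (pr (e 0) j))"
    using that W_sub by (intro dfi df_Q) auto
   show "sc i : E (sc j) --> Q (pr (sc i) j)" if i: "i:W" "i:E (sc j) --> Q (pr i j)" for i
   proof
    assume "sc i : E (sc j)"
    hence ij: "i:E j"
     using W_trans[OF `j : W`, of "sc i"] i W_sub `j : W` E_succ[of i] E_succ[of j] by auto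
    hence "Q (pr i j)" using i(2) E_succ[of j] `j : W` W_sub by auto
    thus "Q (pr (sc i) j)" using step1 step2 i(1) `j : W` ij by blast
   qed
  qed (use that in auto)
  thus ?thesis using that by blast
 qed
 have col: "Q (pr ?o j)" if "j:W" for j
 proof (rule W_induct[where P = "%j. Q (pr ?o j)", OF _ Q0 _ that])
  show "df M (%e. Q (pr ?o (e 0)))" by (intro df_Q dfi empty_in_V)
  show "Q (pr ?o (sc n))" if "n:W" "Q (pr ?o n)" for n
   using row[OF that(2,1,1)] step3 that E_succ[of n] W_sub by auto
 qed
 have le: "Q (pr i j)" if "i:W" "j:W" "i:E j | i = j" for i j
  using row[OF col] that E_succ[of j] W_sub by auto
 have all: "Q (pr i j)" if "i:W" "j:W" for i j
  using W_linear[OF that] le[of i j] le[of j i] step1[of j i] that by auto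
 have ap: "apt (om) s n = app_in M s n" if "n:W" for n using that s(1) by (simp add: apt_def)
 show ?thesis
  unfolding enumerable_def
 proof (intro bexI[OF _ sV] ballI)
  fix a assume "a:prs W W"
  then obtain n where "n:W" "a = app_in M s n" using all by (auto simp: Q_iff)
  thus "EX n:W. apt (om) s n = a" using ap by auto
 qed
qed

lemma enumerable_image:
 assumes "enumerable A" "dft M (%e. F (e 0))" "B <= F ` A"
 shows "enumerable B"
proof -
 obtain f where f: "f:V" "!!a. a:A ==> EX n : W. apt (om) f n = a"
  using assms(1) by (auto simp: enumerable_def)
 have "dft M (%e. F (apt (om) f (e 0)))"
  by (intro dft_fun1[where F = F, OF assms(2)] dfi omega_in_V f)
 then obtain g where g: "fun_in M (om) g" "!!n. n:W ==> app_in M g n = F (apt (om) f n)"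
  using fun_of_term[OF omega_in_V, of "%n. F (apt (om) f n)"] by blast
 have ap: "apt (om) g n = F (apt (om) f n)" if "n:W" for n using g that by (simp add: apt_def)
 have "EX n:W. apt (om) g n = b" if b: "b:B" for b
 proof -
  obtain a where "a:A" "b = F a" using assms(3) b by blast
  thus ?thesis using f(2)[of a] ap by auto
 qed
 thus ?thesis unfolding enumerable_def using g(1) by (auto simp: fun_in_def)
qed

text \<open>Projections, with junk values off the pairs.\<close>

lemma projections:
 obtains p q where "dft M (%e. p (e 0))" "dft M (%e. q (e 0))"
  "!!x y. x:V ==> y:V ==> p (pr x y) = x & q (pr x y) = y"
proof -
 define R1 where "R1 z x <-> (EX y:V. z = pr x y) | (~(EX u:V. EX v:V. z = pr u v) & x = z)" for z x
 define R2 where "R2 z y <-> (EX x:V. z = pr x y) | (~(EX u:V. EX v:V. z = pr u v) & y = z)" for z y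
 have d: "df M (%e. R1 (e 0) (e 1))" "df M (%e. R2 (e 0) (e 1))" unfolding R1_def R2_def by (intro dfi)+
 have u: "EX! x. x:V & R1 z x" "EX! x. x:V & R2 z x" if "z:V" for z
  using that unfolding R1_def R2_def by (cases "EX u:V. EX v:V. z = pr u v"; force simp: pr_inj)+
 obtain p where p: "dft M (%e. p (e 0))" "!!z. z:V ==> p z : V & R1 z (p z)" using dft_the[OF d(1) u(1)] by blast
 obtain q where q: "dft M (%e. q (e 0))" "!!z. z:V ==> q z : V & R2 z (q z)" using dft_the[OF d(2) u(2)] by blast
 have "p (pr x y) = x & q (pr x y) = y" if "x:V" "y:V" for x y
  using p(2)[of "pr x y"] q(2)[of "pr x y"] that unfolding R1_def R2_def by (auto simp: pr_inj)
 thus ?thesis using p(1) q(1) that by blast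
qed

end

section \<open>Countable submodels, elementary for given formulas\<close>

abbreviation substruct :: "'a struct => 'a set => 'a struct" where
 "substruct M A == (|carr = A, mem = mem M Int A \<times> A|)"

text \<open>The Tarski-Vaught test concerns these subformulas only, so a finite list of formulas
  causes finitely many closure conditions.\<close>

primrec universals :: "fm => (nat \<times> fm) list" where
 "universals (Mem i j) = []"
| "universals (Equ i j) = []"
| "universals (Neg ph) = universals ph"
| "universals (Imp ph psi) = universals ph @ universals psi"
| "universals (All v ph) = (v, ph) # universals ph"

lemma tarski_vaught:
 assumes "A <= carr M"
  "!!v psi e. (v, psi) : set (universals ph) ==> range e <= A ==> EX x:carr M. ~sat M (e(v := x)) psi ==>
   EX x:A. ~sat M (e(v := x)) psi"
  "range e <= A"
 shows "sat (substruct M A) e ph <-> sat M e ph"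
 using assms(2,3)
proof (induction ph arbitrary: e)
 case (All v ph)
 have "sat (substruct M A) (e(v := x)) ph <-> sat M (e(v := x)) ph" if "x:A" for x
 proof (rule All.IH)
  show "range (e(v := x)) <= A" using All.prems(2) that by (auto simp: image_subset_iff)
 qed (use All.prems(1) in auto)
 moreover have "EX x:carr M. ~sat M (e(v := x)) ph ==> EX x:A. ~sat M (e(v := x)) ph"
  using All.prems(1)[of v ph e] All.prems(2) by fastforce
 ultimately show ?case using assms(1) by auto
next
 case (Imp ph psi)
 thus ?case by (auto simp: image_subset_iff)
qed (auto simp: image_subset_iff)

context zfc_model
begin

lemma dft_If [dfi]:
 assumes "df M P" "dft M f" "dft M g"
 shows "dft M (%e. if P e then f e else g e)"
proof (rule dft_descr[where P = "%x e. P e & x = f e | ~P e & x = g e"])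
 show "(if P e then f e else g e):V" if "range e <= V" for e using assms dft_in that by auto
qed (auto intro!: dfi df_weaken[OF assms(1)] dft_weaken[OF assms(2)] dft_weaken[OF assms(3)])

lemma increasing_iteration:
 assumes a: "a:V" and F: "dft M (%e. F (e 0))" and inc: "!!x. x:V ==> E x <= E (F x)"
 obtains s where "dft M (%e. s (e 0))" "s (emp) = a" "ALL n:W. s (sc n) = F (s n)"
  "ALL n:W. s n : V" "isset (UN n:W. E (s n))"
  "ALL m:W. ALL n:W. EX k:W. E (s m) <= E (s k) & E (s n) <= E (s k)"
proof -
 obtain f where f: "fun_in M (om) f" "app_in M f (emp) = a"
  "!!n. n:W ==> app_in M f (sc n) = F (app_in M f n)"
  using recursion[OF a F] by blast
 define s where "s n = apt (om) f n" for n
 have fV: "f:V" using f(1) by (simp add: fun_in_def)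
 have s: "dft M (%e. s (e 0))" unfolding s_def using fV by (intro dfi omega_in_V)
 have sf: "s n = app_in M f n" if "n:W" for n using f(1) that by (simp add: s_def apt_def)
 have sS: "s (sc n) = F (s n)" if "n:W" for n using f(3) sf that by simp
 have sV: "s n : V" if "n:W" for n using dft_closed[OF s W_sub[OF that]] .
 have mono: "ALL k:E n. E (s k) <= E (s n)" if "n:W" for n
  using that
 proof (rule W_induct[rotated -1])
  show "df M (%e. ALL k:E (e 0). E (s k) <= E (s (e 0)))"
   by (intro dfi dft_fun1[where F = s, OF s])
  show "ALL k:E (sc n). E (s k) <= E (s (sc n))" if "n:W" "ALL k:E n. E (s k) <= E (s n)" for n
   using that inc[OF sV[OF that(1)]] by (auto simp: E_succ W_sub sS)
 qed simp
 have "isset (UN n:W. E (s n))"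
  by (rule isset_UN) (auto intro!: isset_E sV dfi dft_fun1[where F = s, OF s])
 moreover have "EX k:W. E (s m) <= E (s k) & E (s n) <= E (s k)" if "m:W" "n:W" for m n
  using W_linear[OF that] mono[OF that(1)] mono[OF that(2)] that by blast
 ultimately show ?thesis using that[of s] s sS sV f(2) sf by simp
qed

lemma enumerable_Un:
 assumes "enumerable A" "enumerable B"
 shows "enumerable (A Un B)"
proof -
 obtain f g where f: "f:V" "!!a. a:A ==> EX n : W. apt (om) f n = a"
  and g: "g:V" "!!a. a:B ==> EX n : W. apt (om) g n = a"
  using assms unfolding enumerable_def by metis
 obtain p q where pq: "dft M (%e. p (e 0))" "dft M (%e. q (e 0))"
  "!!x y. x:V ==> y:V ==> p (pr x y) = x & q (pr x y) = y"
  using projections by metis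
 define F where "F z = (if p z = emp then apt (om) f (q z) else apt (om) g (q z))" for z
 have "dft M (%e. F (e 0))" unfolding F_def using f g by (intro dfi omega_in_V empty_in_V pq)
 moreover have "A Un B <= F ` prs W W"
 proof
  fix x assume "x:A Un B"
  hence "EX n:W. x = F (pr (emp) n) | x = F (pr (sc (emp)) n)"
   using f(2)[of x] g(2)[of x] pq(3) by (auto simp: F_def W_sub succ_not_empty)
  thus "x:F ` prs W W" using empty_in_W succ_in_W by blast
 qed
 ultimately show ?thesis by (rule enumerable_image[OF enumerable_WW])
qed

lemma enumerable_prs:
 assumes "enumerable A"
 shows "enumerable (prs A A)"
proof -
 obtain f where f: "f:V" "!!a. a:A ==> EX n : W. apt (om) f n = a"
  using assms unfolding enumerable_def by metis
 obtain p q where pq: "dft M (%e. p (e 0))" "dft M (%e. q (e 0))"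
  "!!x y. x:V ==> y:V ==> p (pr x y) = x & q (pr x y) = y"
  using projections by metis
 define F where "F z = pr (apt (om) f (p z)) (apt (om) f (q z))" for z
 have "dft M (%e. F (e 0))" unfolding F_def using f by (intro dfi omega_in_V pq)
 moreover have "prs A A <= F ` prs W W"
 proof
  fix x assume "x:prs A A"
  then obtain a b where ab: "x = pr a b" "a:A" "b:A" by blast
  then obtain i j where ij: "i:W" "j:W" "apt (om) f i = a" "apt (om) f j = b"
   using f(2) by metis
  hence "x = F (pr i j)" using ab pq(3) by (simp add: F_def W_sub)
  thus "x:F ` prs W W" using ij by blast
 qed
 ultimately show ?thesis by (rule enumerable_image[OF enumerable_WW])
qed

lemma enumerable_UN:
 assumes s: "dft M (%e. s (e 0))" and en: "!!n. n:W ==> enumerable (E (s n))"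
 shows "enumerable (UN n:W. E (s n))"
proof -
 have "df M (%e. ALL a:E (s (e 0)). EX n:W. apt (om) (e 1) n = a)"
  by (intro dfi dft_fun1[where F = s, OF s] omega_in_V)
 then obtain G where G: "dft M (%e. G (e 0))" "!!n. n:W ==> ALL a:E (s n). EX k:W. apt (om) (G n) k = a"
  using choice[OF isset_E[OF omega_in_V], of "%n f. ALL a:E (s n). EX k:W. apt (om) f k = a"] en
  unfolding enumerable_def by blast
 obtain p q where pq: "dft M (%e. p (e 0))" "dft M (%e. q (e 0))"
  "!!x y. x:V ==> y:V ==> p (pr x y) = x & q (pr x y) = y"
  using projections by metis
 define F where "F z = apt (om) (G (p z)) (q z)" for z
 have "dft M (%e. F (e 0))" unfolding F_def by (intro dfi omega_in_V pq dft_fun1[where F = G, OF G(1)])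
 moreover have "(UN n:W. E (s n)) <= F ` prs W W"
 proof
  fix x assume "x:(UN n:W. E (s n))"
  then obtain n k where nk: "n:W" "k:W" "apt (om) (G n) k = x" using G(2) by blast
  hence "x = F (pr n k)" using pq(3) by (simp add: F_def W_sub)
  thus "x:F ` prs W W" using nk by blast
 qed
 ultimately show ?thesis by (rule enumerable_image[OF enumerable_WW])
qed

lemma enumerable_W: "enumerable W"
proof -
 obtain p q where pq: "dft M (%e. p (e 0))" "!!x y. x:V ==> y:V ==> p (pr x y) = x & q (pr x y) = y"
  using projections by metis
 have "W <= p ` prs W W"
 proof
  fix n assume n: "n:W"
  hence "n = p (pr n n)" using pq(2) W_sub by simp
  thus "n:p ` prs W W" using n by blast
 qed
 thus ?thesis using enumerable_image[OF enumerable_WW pq(1)] by blast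
qed

text \<open>A set closed under pairs and containing the numerals has an element for each finite
  tuple tagged with a number, so that one binary closure condition covers several formulas with any
  number of parameters.\<close>

lemma pair_closure:
 assumes K: "!!x. x:V ==> isset (K x)" and dK: "df M (%e. e 0 : K (e (Suc 0)))"
  and sub: "!!x. E x Un prs (E x) (E x) <= K x"
 obtains s T where "dft M (%e. s (e 0))" "s (emp) = om" "ALL n:W. E (s (sc n)) = K (s n)"
  "T = (UN n:W. E (s n))" "isset T" "W <= T" "ALL n:W. K (s n) <= T" "ALL x:T. ALL y:T. pr x y : T"
proof -
 define F where "F x = S (K x)" for x
 have F: "dft M (%e. F (e 0))" unfolding F_def by (rule dft_S) (use K dK in auto)
 have EF: "E (F x) = K x" if "x:V" for x unfolding F_def by (rule E_S[OF K[OF that]])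
 have "E x <= E (F x)" if "x:V" for x using EF[OF that] sub by blast
 note increasing_iteration[OF omega_in_V F this]
 then obtain s where s: "dft M (%e. s (e 0))" "s (emp) = om"
  "ALL n:W. s (sc n) = F (s n)" "ALL n:W. s n : V" "isset (UN n:W. E (s n))"
  "ALL m:W. ALL n:W. EX k:W. E (s m) <= E (s k) & E (s n) <= E (s k)" by blast
 have sS: "E (s (sc n)) = K (s n)" if "n:W" for n using EF s(3,4) that by simp
 define T where "T = (UN n:W. E (s n))"
 have KT: "K (s n) <= T" if "n:W" for n
  using sS[OF that] UN_upper[OF succ_in_W[OF that], of "%n. E (s n)"] by (simp add: T_def)
 have "pr x y : T" if xy: "x:T" "y:T" for x y
 proof -
  obtain m n where "m:W" "n:W" "x:E (s m)" "y:E (s n)" using xy unfolding T_def by blast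
  then obtain k where "k:W" "x:E (s k)" "y:E (s k)" using s(6) by blast
  thus ?thesis using KT[of k] sub[of "s k"] by blast
 qed
 moreover have "W <= T" using UN_upper[OF empty_in_W, of "%n. E (s n)"] unfolding s(2) T_def .
 ultimately show ?thesis using that[OF s(1,2) _ T_def s(5)[folded T_def]] sS KT by blast
qed

lemma closed_set:
 assumes C: "df M (%e. C (e 0) (e 1))"
 obtains T where "isset T" "W <= T" "!!x y. x:T ==> y:T ==> pr x y : T"
  "!!y. y:T ==> EX x:V. C y x ==> EX x:T. C y x"
proof -
 define K where "K x = E x Un prs (E x) (E x) Un (UN y:E x. lrank (C y))" for x
 have lr: "isset (lrank (C y))" if "y:V" for y by (rule isset_least_rank[OF df_fix1[OF C that]])
 have K: "isset (K x)" if "x:V" for x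
  unfolding K_def using that
  by (intro isset_Un isset_prs isset_E isset_UN df_least_rank[OF C] lr
    df_rel2[where R = "%y x. x:lrank (C y)", OF df_least_rank[OF C]] dfi) (auto intro: E_in)
 have "df M (%e. e 0 : E (e (Suc 0)) | (EX x:E (e (Suc 0)). EX y:E (e (Suc 0)). e 0 = pr x y) |
   (EX y:E (e (Suc 0)). e 0 : lrank (C y)))"
  by (intro dfi df_rel2[where R = "%y x. x:lrank (C y)", OF df_least_rank[OF C]])
 moreover have "e 0 : K (e (Suc 0)) <-> e 0 : E (e (Suc 0)) | (EX x:E (e (Suc 0)). EX y:E (e (Suc 0)). e 0 = pr x y) |
   (EX y:E (e (Suc 0)). e 0 : lrank (C y))" for e unfolding K_def by blast
 ultimately have dK: "df M (%e. e 0 : K (e (Suc 0)))" by simp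
 have sub: "E x Un prs (E x) (E x) <= K x" for x unfolding K_def by blast
 obtain s T where "dft M (%e. s (e 0))" "s (emp) = om" "ALL n:W. E (s (sc n)) = K (s n)"
  and s: "T = (UN n:W. E (s n))" "isset T" "W <= T" "ALL n:W. K (s n) <= T" "ALL x:T. ALL y:T. pr x y : T"
  by (rule pair_closure[OF K dK sub])
 show ?thesis
 proof (rule that[OF s(2,3)])
  show "EX x:T. C y x" if y: "y:T" "EX x:V. C y x" for y
  proof -
   obtain n where n: "n:W" "y:E (s n)" using y s(1) by blast
   hence yV: "y:V" using E_in by blast
   have "lrank (C y) ~= {}" using lrank_ex[OF df_fix1[OF C yV]] y(2) by blast
   then obtain x where "x:lrank (C y)" by blast
   hence "C y x" "x:K (s n)" using n unfolding K_def lrank_def by blast+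
   thus ?thesis using s(4) n(1) by blast
  qed
 qed (use s(5) in blast)
qed

text \<open>Two closures. The first one, \<open>R\<close>, adds all witnesses of least rank, which
  makes it a set but possibly an uncountable one. Over the set \<open>R\<close> Choice provides a
  single witness function \<open>G\<close>, and the closure under \<open>G\<close> inside
  \<open>R\<close> stays countable.\<close>

lemma countable_hull:
 assumes C: "df M (%e. C (e 0) (e 1))"
 obtains T where "isset T" "enumerable T" "W <= T" "!!x y. x:T ==> y:T ==> pr x y : T"
  "!!y. y:T ==> EX x:V. C y x ==> EX x:T. C y x"
proof -
 obtain R where R: "isset R" "W <= R" "!!x y. x:R ==> y:R ==> pr x y : R"
  "!!y. y:R ==> EX x:V. C y x ==> EX x:R. C y x" using closed_set[OF C] by metis
 have "df M (%e. e 1 : R & (C (e 0) (e 1) | ~(EX u:V. C (e 0) u)))"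
  by (intro dfi df_isset[OF R(1)] df_rel2[where R = C, OF C])
 then obtain G where G: "dft M (%e. G (e 0))" "!!y. y:R ==> G y : R & (C y (G y) | ~(EX u:V. C y u))"
  using choice[OF R(1), of "%y x. x:R & (C y x | ~(EX u:V. C y u))"] R(4) isset_sub[OF R(1)] by blast
 define K where "K x = E x Un prs (E x) (E x) Un G ` E x" for x
 have K: "isset (K x)" if "x:V" for x
  unfolding K_def using that by (intro isset_Un isset_prs isset_E isset_image G)
 have "df M (%e. e 0 : E (e (Suc 0)) | (EX x:E (e (Suc 0)). EX y:E (e (Suc 0)). e 0 = pr x y) |
   (EX y:E (e (Suc 0)). e 0 = G y))"
  by (intro dfi dft_fun1[where F = G, OF G(1)])
 moreover have "e 0 : K (e (Suc 0)) <-> e 0 : E (e (Suc 0)) | (EX x:E (e (Suc 0)). EX y:E (e (Suc 0)). e 0 = pr x y) |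
   (EX y:E (e (Suc 0)). e 0 = G y)" for e unfolding K_def by blast
 ultimately have dK: "df M (%e. e 0 : K (e (Suc 0)))" by simp
 have sub: "E x Un prs (E x) (E x) <= K x" for x unfolding K_def by blast
 obtain s T where s: "dft M (%e. s (e 0))" "s (emp) = om" "ALL n:W. E (s (sc n)) = K (s n)"
  "T = (UN n:W. E (s n))" "isset T" "W <= T" "ALL n:W. K (s n) <= T" "ALL x:T. ALL y:T. pr x y : T"
  by (rule pair_closure[OF K dK sub])
 have stage: "E (s n) <= R & enumerable (E (s n))" if "n:W" for n
 proof (rule W_induct[where P = "%n. E (s n) <= R & enumerable (E (s n))", OF _ _ _ that])
  have "df M (%e. (ALL x:E (s (e 0)). x:R) & (EX f:V. ALL a:E (s (e 0)). EX n:W. apt (om) f n = a))"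
   by (intro dfi df_isset[OF R(1)] dft_fun1[where F = s, OF s(1)] omega_in_V)
  thus "df M (%e. E (s (e 0)) <= R & enumerable (E (s (e 0))))" by (simp add: enumerable_def subset_eq)
  show "E (s (sc n)) <= R & enumerable (E (s (sc n)))"
   if n: "n:W" "E (s n) <= R & enumerable (E (s n))" for n
  proof -
   have "enumerable (K (s n))" unfolding K_def
    using n(2) by (intro enumerable_Un enumerable_prs enumerable_image[OF _ G(1) order_refl]) auto
   moreover have "K (s n) <= R" unfolding K_def using n(2) R(3) G(2) by blast
   ultimately show ?thesis using s(3) n(1) by simp
  qed
 qed (simp add: s(2) R(2) enumerable_W)
 show ?thesis
 proof (rule that[OF s(5) _ s(6)])
  show "enumerable T" unfolding s(4) using enumerable_UN[OF s(1)] stage by blast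
  show "EX x:T. C y x" if y: "y:T" "EX x:V. C y x" for y
  proof -
   obtain n where n: "n:W" "y:E (s n)" using y s(4) by blast
   hence "C y (G y)" "G y : K (s n)" using G(2)[of y] stage[of n] y(2) unfolding K_def by blast+
   thus ?thesis using s(7) n(1) by blast
  qed
 qed (use s(8) in blast)
qed

theorem lowenheim_skolem:
 fixes Ph :: "fm list"
 obtains m where "m:V" "enumerable (E m)" "E m ~= {}"
  "!!ph e. ph:set Ph ==> range e <= E m ==> sat (substruct M (E m)) e ph <-> sat M e ph"
proof -
 obtain p q where pq: "dft M (%e. p (e 0))" "dft M (%e. q (e 0))"
  "!!x y. x:V ==> y:V ==> p (pr x y) = x & q (pr x y) = y"
  using projections by metis
 define Ps where "Ps = concat (map universals Ph)"
 \<comment> \<open>An environment is coded as a list of nested pairs, entry \<open>j\<close> being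
   \<open>p\<close> after \<open>j\<close> times \<open>q\<close>. In \<open>C\<close> a numeral in
   front selects the formula for which a counterexample is wanted.\<close>
 define fl where "fl i y x <-> ~sat M ((%j. p ((q ^^ j) y))(fst (Ps ! i) := x)) (snd (Ps ! i))" for i y x
 define C where "C z x <-> (EX i<length Ps. p z = num i & fl i (q z) x)" for z x
 have dq: "dft M (%e. (q ^^ j) (e 0))" for j
  by (induction j) (auto intro!: dfi dft_fun1[where F = q, OF pq(2)])
 have dfl: "df M (%e. fl i (e 0) (e 1))" for i
 proof -
  have "df M (%e. sat M (%j. if j = fst (Ps ! i) then e 1 else p ((q ^^ j) (e 0))) (snd (Ps ! i)))"
  proof (rule df_sat_terms)
   show "dft M (%e. if j = fst (Ps ! i) then e 1 else p ((q ^^ j) (e 0)))" for j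
    by (cases "j = fst (Ps ! i)") (auto intro!: dfi dft_fun1[where F = p, OF pq(1)] dq)
   show "df M (%e. e 0 : V)" by (rule df_cong[THEN iffD1, OF _ df_const[OF nonempty, of True]]) auto
  qed (auto intro!: dfi)
  thus ?thesis unfolding fl_def fun_upd_def by (rule df_Not)
 qed
 have "df M (%e. EX i<n. p (e 0) = num i & fl i (q (e 0)) (e 1))" for n
 proof (induction n)
  case (Suc n)
  have "df M (%e. (EX i<n. p (e 0) = num i & fl i (q (e 0)) (e 1)) | (p (e 0) = num n & fl n (q (e 0)) (e 1)))"
   by (intro df_disj df_conj Suc df_rel2[where R = "fl n", OF dfl] df_eq pq num_V dfi)
  thus ?case by (simp add: less_Suc_eq ex_disj_distrib conj_disj_distribR disj_commute cong: disj_cong)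
 qed (auto intro: dfi)
 hence "df M (%e. C (e 0) (e 1))" unfolding C_def .
 then obtain T where T: "isset T" "enumerable T" "W <= T" "!!x y. x:T ==> y:T ==> pr x y : T"
  "!!y. y:T ==> EX x:V. C y x ==> EX x:T. C y x" by (rule countable_hull) blast
 have TV: "T <= V" by (rule isset_sub[OF T(1)])
 have env: "EX y:T. ALL j<n. p ((q ^^ j) y) = e j" if "range e <= T" for n and e :: "nat => 'a"
  using that
 proof (induction n arbitrary: e)
  case 0
  thus ?case by auto
 next
  case (Suc n)
  have "range (%j. e (Suc j)) <= T" using Suc.prems by auto
  then obtain y where y: "y:T" "!!j. j < n ==> p ((q ^^ j) y) = e (Suc j)" using Suc.IH by blast
  have e0: "e 0 : T" using Suc.prems by auto
  have "p ((q ^^ j) (pr (e 0) y)) = e j" if "j < Suc n" for j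
   using that e0 y subsetD[OF TV e0] subsetD[OF TV y(1)] pq(3)[of "e 0" y] by (cases j) (auto simp: funpow_Suc_right simp del: funpow.simps)
  thus ?case using T(4)[OF e0 y(1)] by blast
 qed
 show ?thesis
 proof (rule that[of "S T"])
  show "S T : V" "enumerable (E (S T))" "E (S T) ~= {}"
   using T(1,2) subsetD[OF T(3) empty_in_W] by (auto simp: S_in E_S)
  fix ph and e :: "nat => 'a" assume ph: "ph:set Ph" and e: "range e <= E (S T)"
  show "sat (substruct M (E (S T))) e ph <-> sat M e ph"
   using e unfolding E_S[OF T(1)]
  proof (rule tarski_vaught[OF TV, rotated])
   fix v psi and e :: "nat => 'a" assume v: "(v, psi):set (universals ph)" "range e <= T" and ex: "EX x:V. ~sat M (e(v := x)) psi"
   have "(v, psi):set Ps" using v(1) ph by (auto simp: Ps_def)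
   then obtain i where i: "i < length Ps" "Ps ! i = (v, psi)" by (metis in_set_conv_nth)
   obtain n where n: "fv psi <= {..<n}" using fv_bound by blast
   obtain y where y: "y:T" "!!j. j < n ==> p ((q ^^ j) y) = e j" using env[OF v(2), of n] by blast
   have "sat M ((%j. p ((q ^^ j) y))(v := x)) psi <-> sat M (e(v := x)) psi" for x
    by (rule sat_cong) (use n y(2) in auto)
   moreover have "num i : T" using T(3) num_W by blast
   moreover have "C (pr (num i) y) x <-> fl i y x" for x
    using i y(1) TV pq(3)[of "num i" y] by (auto simp: C_def num_inj)
   ultimately show "EX x:T. ~sat M (e(v := x)) psi"
    using T(5)[OF T(4)[OF _ y(1)], of "num i"] ex i by (simp add: fl_def)
  qed
 qed
qed

lemma df_V: "df M (%e. e 0 : V)"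
 by (rule df_cong[THEN iffD1, OF _ df_const[OF nonempty, of True]]) auto

lemma interp_isset:
 assumes "isset A" "A ~= {}" "df M (%e. (e 0, e 1):R)"
 shows "interp M A R (Id_on A) id (|carr = A, mem = R|)"
proof -
 have "df M (%e. e 0 : A & e 0 = e 1)" by (intro dfi df_isset[OF assms(1)])
 hence "df M (%e. (e 0, e 1):Id_on A)" by (rule df_cong[THEN iffD1, rotated]) auto
 moreover have "df M (%e. e 0 : A)" by (intro df_isset[OF assms(1)] dfi)
 ultimately show ?thesis using assms isset_sub struct by (auto simp: interp_def)
qed

text \<open>The type of a countable set \<open>m\<close> such that \<open>(m, \<in>)\<close> has the theory of the universe is finitely
 realized by Loewenheim--Skolem.\<close>

lemma elementary_countable_set:
 assumes sat: "computably_saturated M"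
 obtains m where "m:V" "enumerable (E m)" "E m ~= {}"
  "!!ph e e'. fv ph = {} ==> sat (substruct M (E m)) e ph <-> sat M e' ph"
proof -
 have "df M (%e. (EX f:V. ALL a:E (e 0). EX n:W. apt (om) f n = a) & (EX x:V. x:E (e 0)))"
  by (intro dfi omega_in_V)
 from dfD[OF this] obtain ch a where a: "range a <= V" and ch: "ALL e. range e <= V -->
   ((EX f:V. ALL a:E (e 0). EX n:W. apt (om) f n = a) & (EX x:V. x : E (e 0)) <-> sat M (mrg e a) ch)"
  by (elim exE conjE)
 obtain n where n: "fv ch <= {..<n}" using fv_bound by blast
 \<comment> \<open>The set to be found sits at \<open>v\<close>. This number is odd, hence a
   parameter place of the translation, and lies beyond the variables of \<open>ch\<close>;
   \<open>c\<close> is taken beyond \<open>v\<close>. As \<open>k\<close> varies,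
   \<open>dec_below 0 k\<close> covers all sentences up to equivalence.\<close>
 define v where "v = Suc (n + n)"
 define c where "c = Suc (Suc v)"
 define G where "G k = Con (Exi 0 (Con (Equ 0 v) ch))
  (Iff (ren (dbl c) (dec_below 0 k)) (transl c (Mem 0 v) (Mem 0 2) (Equ 0 2) (dec_below 0 k)))" for k
 obtain u where u: "u:V" using nonempty by blast
 define e where "e = mrg (%_. u) a"
 have e: "range e <= V" unfolding e_def by (rule range_mrg) (use u a in auto)
 have fv_c: "fv (Mem 0 v) <= {..<c}" "fv (Mem 0 2) <= {..<c}" "fv (Equ 0 2) <= {..<c}"
  by (auto simp: c_def v_def)
 have vodd: "odd v" by (simp add: v_def)
 have main: "sat M e' (G k) <-> (enumerable (E (e' v)) & E (e' v) ~= {}) &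
   (sat M e' (dec_below 0 k) <-> sat (substruct M (E (e' v))) e' (dec_below 0 k))"
  if e': "range e' <= V" "!!i. i ~= v ==> e' i = e i" for e' k
 proof -
  have fv0: "fv (dec_below 0 k) = {}" using fv_dec_below[of 0 k] by simp
  have e'v: "e' v : V" using e' by auto
  have "sat M e' (Exi 0 (Con (Equ 0 v) ch)) <-> sat M (e'(0 := e' v)) ch"
   unfolding sat_Exi sat_Con using e'v by (auto simp: v_def)
  also have "... <-> sat M (mrg ((%_. u)(0 := e' v)) a) ch"
   by (rule sat_cong) (use n e'(2) in "auto simp: e_def mrg_def v_def")
  also have "... <-> enumerable (E (e' v)) & E (e' v) ~= {}"
   using ch[THEN spec, of "(%_. u)(0 := e' v)"] u e'v E_in by (auto simp: enumerable_def image_subset_iff)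
  finally have 1: "sat M e' (Exi 0 (Con (Equ 0 v) ch)) <-> enumerable (E (e' v)) & E (e' v) ~= {}" .
  have 2: "sat M e' (ren (dbl c) (dec_below 0 k)) <-> sat M e' (dec_below 0 k)"
   unfolding sat_ren[OF inj_double_sum] by (rule sat_cong) (simp add: fv0)
  have "sat M e' (transl c (Mem 0 v) (Mem 0 2) (Equ 0 2) (dec_below 0 k)) <->
    sat (substruct M (E (e' v))) (id o e') (dec_below 0 k)"
  proof (rule sat_transl[where a = "%j. e' (Suc (2 * j))" and D = "E (e' v)" and io = id])
   show "sat M F (Mem 0 v) <-> x:E (e' v)" if "!!i. i < c ==> odd i ==> F i = e' (Suc (2 * (i div 2)))" "x:V" "F 0 = x" for F x
    using that(1)[of v] that(2,3) vodd by (simp add: c_def mem_iff_E)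
  qed (auto simp: c_def E_in fv0 v_def)
  thus ?thesis unfolding G_def sat_Con[of M e' "Exi 0 (Con (Equ 0 v) ch)"] sat_Iff 1 2 by simp
 qed
 have fin: "EX e'. range e' <= V & (ALL i. i ~: {v} --> e' i = e i) & (ALL k:F. sat M e' (G k))" if F: "finite F" for F
 proof -
  obtain ks where ks: "set ks = F" using finite_list[OF F] by blast
  obtain m where m: "m:V" "enumerable (E m)" "E m ~= {}"
   "!!ph e. ph:set (map (dec_below 0) ks) ==> range e <= E m ==> sat (substruct M (E m)) e ph <-> sat M e ph"
   using lowenheim_skolem[of "map (dec_below 0) ks"] by metis
  obtain x where x: "x:E m" using m(3) by blast
  have range: "range (e(v := m)) <= V" using e m(1) by auto
  have "sat M (e(v := m)) (G k)" if k: "k:F" for k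
  proof -
   have fv0: "fv (dec_below 0 k) = {}" using fv_dec_below[of 0 k] by simp
   have "sat (substruct M (E m)) (%_. x) (dec_below 0 k) <-> sat M (%_. x) (dec_below 0 k)"
    by (rule m(4)) (use x k ks in auto)
   moreover have "sat (substruct M (E m)) (%_. x) (dec_below 0 k) <-> sat (substruct M (E m)) (e(v := m)) (dec_below 0 k)"
    "sat M (%_. x) (dec_below 0 k) <-> sat M (e(v := m)) (dec_below 0 k)"
    by (rule sat_cong; simp add: fv0)+
   ultimately show ?thesis using m(2,3) by (subst main[OF range]) auto
  qed
  thus ?thesis using range by (intro exI[of _ "e(v := m)"]) auto
 qed
 have rec: "Rec 1 (%xs. godel (G (xs ! 0)))"
  unfolding G_def ren_fold
  by (intro Rec_godel_Con Rec_godel_Iff Rec_const)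
   (use Rec_ren_double_sum[of 1 "%xs. godel (dec_below 0 (xs ! 0))" c]
    Rec_transl[of 1 "%xs. godel (dec_below 0 (xs ! 0))" c "Mem 0 v" "Mem 0 2" "Equ 0 2"]
    Rec_dec_below[of 1 "%xs. xs ! 0" 0] Rec_proj[of 0 1] in "simp_all add: ren_fold")
 have fvG: "fv (G k) <= {..<n + c}" for k
 proof -
  have fv0: "fv (dec_below 0 k) <= {..<0}" using fv_dec_below[of 0 k] .
  show ?thesis
   using n fv_ren_below[OF fv0, of c] fv_transl_below[OF fv_c fv0] unfolding G_def
   by (simp only: fv.simps dbl_def) (auto simp: c_def)
 qed
 obtain e' where e': "range e' <= V" "ALL i. i ~: {v} --> e' i = e i" "ALL k. sat M e' (G k)"
  by (rule saturated_env[OF sat rec computable_UNIV fvG e fin]) auto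
 have *: "(enumerable (E (e' v)) & E (e' v) ~= {}) &
   (sat M e' (dec_below 0 k) <-> sat (substruct M (E (e' v))) e' (dec_below 0 k))" for k
  using main[OF e'(1), of k] e'(2,3) by blast
 show ?thesis
 proof (rule that[of "e' v"])
  show "e' v : V" using e'(1) by blast
  show "enumerable (E (e' v))" "E (e' v) ~= {}" using * by blast+
  fix ph and f f' :: "nat => 'a" assume fv: "fv ph = {}"
  have "sat M e' ph <-> sat (substruct M (E (e' v))) e' ph"
   using *[of "godel ph"] sat_dec_below[of M ph 0] sat_dec_below[of "substruct M (E (e' v))" ph 0] fv by simp
  moreover have "sat M e' ph <-> sat M f' ph"
   "sat (substruct M (E (e' v))) e' ph <-> sat (substruct M (E (e' v))) f ph"
   by (rule sat_cong; simp add: fv)+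
  ultimately show "sat (substruct M (E (e' v))) f ph <-> sat M f' ph" by simp
 qed
qed

lemma countable_in_enumerable:
 assumes m: "m:V" "enumerable (E m)"
 shows "countable_in M m"
proof -
 obtain f where f: "f:V" "!!a. a:E m ==> EX n : W. apt (om) f n = a"
  using m(2) unfolding enumerable_def by metis
 have "df M (%e. e 1 : W & apt (om) f (e 1) = e 0)" using f by (intro dfi omega_in_V)
 moreover have "EX n:V. n:W & apt (om) f n = a" if "a:E m" for a using f(2)[OF that] W_sub by blast
 ultimately obtain g where g: "fun_in M m g" "ALL a:E m. app_in M g a : W & apt (om) f (app_in M g a) = a"
  by (rule choice_fun[OF m(1)]) blast+
 have "inj_on (app_in M g) (E m)" by (rule inj_onI) (use g(2) in metis)
 thus ?thesis unfolding countable_in_def maps_in_def using g by blast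
qed

theorem codes_itself:
 assumes sat: "computably_saturated M" and cnt: "countable V"
 obtains m r where "codes_set_in M m r M" "countable_in M m" "E m ~= {}"
proof -
 obtain m where m: "m:V" "enumerable (E m)" "E m ~= {}"
  and el: "!!ph e e'. fv ph = {} ==> sat (substruct M (E m)) e ph <-> sat M e' ph"
  using elementary_countable_set[OF sat] by metis
 obtain r where r: "r:V" "E r = {pr x y | x y. x:E m & y:E m & x:E y}"
  "rel_in M r = {(x, y). x:E m & y:E m & x:E y}"
  by (rule rel_ex[OF isset_E[OF m(1)] isset_E[OF m(1)], of "%x y. x:E y"]) (auto intro!: dfi)
 have c: "coded M m r = substruct M (E m)" unfolding coded_def r(3) by (auto simp: mem_iff_E)
 have "df M (%e. e 0 : E m & e 1 : E m & (e 0, e 1):mem M)" using m(1) by (intro dfi)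
 hence "df M (%e. (e 0, e 1):mem M Int E m \<times> E m)" by (rule df_cong[THEN iffD1, rotated]) auto
 hence "interp M (E m) (mem M Int E m \<times> E m) (Id_on (E m)) id (substruct M (E m))"
  by (rule interp_isset[OF isset_E[OF m(1)] m(3)])
 moreover have "similar M id (substruct M (E m)) []"
  unfolding similar_def by (intro allI impI el[symmetric]) simp
 ultimately obtain h where "struct_iso h (substruct M (E m)) M"
  using back_and_forth[OF _ sat cnt, of "E m" _ _ id "substruct M (E m)" "[]"] by auto
 hence "codes_set_in M m r M"
  unfolding codes_set_in_def isomorphic_def c binrel_in_def using r m(1) by (auto simp: r(2))
 thus ?thesis using that countable_in_enumerable m by blast
qed

section \<open>Ultrafilters from chains of sets, ultrapowers of set structures\<close>

lemma ultrafilter_extends: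
 assumes X: "X:V" and b: "b:V" "E b ~= {}" "!!u. u:E b ==> E u <= E X & E u ~= {}"
  and chain: "!!u v. u:E b ==> v:E b ==> E u <= E v | E v <= E u"
 obtains U where "ultrafilter_in M X U" "E b <= E U"
proof -
 define P where "P = {x:V. E x <= E X}"
 have P: "isset P" unfolding P_def by (rule isset_Pow[OF isset_E[OF X]])
 define flt where "flt x <-> (ALL u:E x. EX z:V. z : E u) & (ALL u:E x. ALL v:E x. ALL w:V. (ALL z:V. z : E w <-> z : E u & z : E v) --> w : E x) &
  (ALL u:E x. ALL v:V. E u <= E v & E v <= E X --> v : E x) & E b <= E x" for x
 define Q where "Q = {x:{x:V. E x <= P}. flt x}"
 have Q: "isset Q" unfolding Q_def flt_def by (intro isset_sep isset_Pow P dfi X b(1))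
 \<comment> \<open>The filter generated by a base \<open>D\<close> and one further set
   \<open>Y\<close>. It is used with \<open>Y\<close> the whole index set, to start, and with
   \<open>Y\<close> a set to be adjoined to the maximal filter.\<close>
 have flt_S: "S F : Q"
  if F: "F = {w:P. EX t:D. E t Int Y <= E w}" "isset D" "isset Y" "D <= P" "E b <= F"
   "!!t. t:D ==> E t Int Y ~= {}" "!!s t. s:D ==> t:D ==> EX u:D. E u <= E s Int E t" for D Y F
 proof -
  have "df M (%e. EX t:E (S D). ALL z:E t. z:Y --> z:E (e 0))"
   using F(2) by (intro dfi df_isset[OF F(3)] S_in)
  hence "df M (%e. EX t:D. E t Int Y <= E (e 0))"
   unfolding E_S[OF F(2)] by (rule df_cong[THEN iffD1, rotated]) blast
  hence "isset F" unfolding F(1) by (rule isset_sep[OF P])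
  note F' = S_in[OF this] E_S[OF this]
  have "flt (S F)" unfolding flt_def F'(2)
  proof (intro conjI ballI impI F(5))
   fix u assume "u:F"
   thus "EX z:V. z:E u" using F(1,6) E_in by fastforce
  next
   fix u v w assume *: "u:F" "v:F" "w:V" "ALL z:V. z:E w <-> z:E u & z:E v"
   have "E w = E u Int E v" using *(4) E_in by blast
   moreover obtain s t where "s:D" "t:D" "E s Int Y <= E u" "E t Int Y <= E v" using * F(1) by blast
   moreover from this obtain r where "r:D" "E r <= E s Int E t" using F(7)[of s t] by blast
   moreover have "E u <= E X" using *(1) F(1) by (auto simp: P_def)
   ultimately show "w:F" using *(3) unfolding F(1) P_def by blast
  next
   fix u v assume "u:F" "v:V" "E u <= E v & E v <= E X"
   thus "v:F" unfolding F(1) P_def by blast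
  qed
  thus ?thesis using F' F(1) by (auto simp: Q_def)
 qed
 have bP: "E b <= P" using b(3) E_in by (auto simp: P_def)
 have x0: "S {w:P. EX t:E b. E t Int E X <= E w} : Q"
 proof (rule flt_S[OF refl isset_E[OF b(1)] isset_E[OF X] bP])
  show "E b <= {w:P. EX t:E b. E t Int E X <= E w}" using bP by blast
  show "E t Int E X ~= {}" if "t:E b" for t using b(3)[OF that] by blast
  show "EX u:E b. E u <= E s Int E t" if "s:E b" "t:E b" for s t using chain[OF that] that by blast
 qed
 have "S (UN y:c. E y) : Q" if c: "isset c" "c <= Q" "c ~= {}"
  "!!x y. x:c ==> y:c ==> E x <= E y | E y <= E x" for c
 proof -
  note ES = E_S[OF isset_Union[OF c(1)]]
  have fl: "flt y" "E y <= P" if "y:c" for y using c(2) that by (auto simp: Q_def)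
  have "flt (S (UN y:c. E y))" unfolding flt_def ES
  proof (intro conjI ballI impI)
   fix u v w assume *: "u:(UN y:c. E y)" "v:(UN y:c. E y)" "w:V" "ALL z:V. z:E w <-> z:E u & z:E v"
   then obtain y where "y:c" "u:E y" "v:E y" using c(4) by blast
   thus "w:(UN y:c. E y)" using fl(1)[of y] *(3,4) unfolding flt_def by blast
  next
   fix u assume "u:(UN y:c. E y)"
   thus "EX z:V. z:E u" using fl(1) unfolding flt_def by blast
  next
   fix u v assume "u:(UN y:c. E y)" "v:V" "E u <= E v & E v <= E X"
   thus "v:(UN y:c. E y)" using fl(1) unfolding flt_def by blast
  next
   show "E b <= (UN y:c. E y)" using c(3) fl(1) unfolding flt_def by blast
  qed
  thus ?thesis using ES S_in[OF isset_Union[OF c(1)]] fl(2) by (auto simp: Q_def)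
 qed
 from zorn[OF Q x0 this] obtain U where U: "U:Q" "!!y. y:Q ==> E U <= E y ==> y = U" by blast
 have UV: "U:V" "E U <= P" and fl: "flt U" using U(1) by (auto simp: Q_def)
 note fl' = fl[unfolded flt_def]
 have up: "v:E U" if "u:E U" "v:V" "E u <= E v" "E v <= E X" for u v
  using fl'[THEN conjunct2, THEN conjunct2, THEN conjunct1] that by blast
 have ne: "E u ~= {}" if "u:E U" for u using fl'[THEN conjunct1] that by blast
 have cap: "w:E U" if "u:E U" "v:E U" "w:V" "E w = E u Int E v" for u v w
  using fl'[THEN conjunct2, THEN conjunct1] that by blast
 have bU: "E b <= E U" using fl' by (elim conjE)
 have int: "EX w:E U. E w = E u Int E v" if "u:E U" "v:E U" for u v
 proof -
  have "isset (E u Int E v)" using that UV(2) by (intro isset_Int isset_E) (auto simp: P_def)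
  note w = S_in[OF this] E_S[OF this]
  have "S (E u Int E v) : E U" using cap that w by blast
  thus ?thesis using w(2) by blast
 qed
 obtain t0 where t0: "t0:E U" using b(2) bU by blast
 have ultra: "u:E U | v:E U" if uv: "u:V" "v:V" "E u <= E X" "E v = E X - E u" for u v
 proof (cases "ALL t:E U. E t Int E u ~= {}")
  case True
  let ?F = "{w:P. EX t:E U. E t Int E u <= E w}"
  have F: "S ?F : Q"
  proof (rule flt_S[OF refl isset_E[OF UV(1)] isset_E[OF uv(1)] UV(2)])
   show "E b <= ?F" using bU UV(2) by blast
   show "E t Int E u ~= {}" if "t:E U" for t using True that by blast
   show "EX w:E U. E w <= E s Int E t" if "s:E U" "t:E U" for s t using int[OF that] by blast
  qed
  have "isset ?F"
  proof -
   have "df M (%e. EX t:E U. ALL z:E t. z:E u --> z:E (e 0))" using UV uv by (intro dfi)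
   hence "df M (%e. EX t:E U. E t Int E u <= E (e 0))" by (rule df_cong[THEN iffD1, rotated]) blast
   thus ?thesis by (rule isset_sep[OF P])
  qed
  hence ES: "E (S ?F) = ?F" by (rule E_S)
  have "S ?F = U" by (rule U(2)[OF F]) (use UV(2) in "auto simp: ES")
  with ES have "E U = ?F" by simp
  moreover have "u:?F" using uv t0 by (auto simp: P_def)
  ultimately show ?thesis by blast
 next
  case False
  then obtain t where t: "t:E U" "E t Int E u = {}" by blast
  moreover have "E t <= E X" using t(1) UV(2) by (auto simp: P_def)
  ultimately have "v:E U" using up[OF t(1) uv(2)] uv(4) by blast
  thus ?thesis by blast
 qed
 have "ultrafilter_in M X U"
  unfolding ultrafilter_in_def
 proof (intro conjI ballI impI)
  show "X:E U" using up[OF t0 X] t0 UV(2) by (auto simp: P_def)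
  show "E u ~= {}" if "u:E U" for u by (rule ne[OF that])
  show "E u <= E X" if "u:E U" for u using that UV(2) by (auto simp: P_def)
  show "w:E U" if "u:E U" "v:E U" "w:V" "E w = E u Int E v" for u v w by (rule cap[OF that])
  show "v:E U" if "u:E U" "v:V" "E u <= E v & E v <= E X" for u v using up that by blast
  show "u:E U | v:E U" if "u:V" "v:V" "E u <= E X & E v = E X - E u" for u v using ultra that by blast
 qed (rule X UV(1))+
 thus ?thesis using bU that by blast
qed

end

context internal_ultrafilter
begin

text \<open>The functions into \<open>m\<close> form a set of \<open>M\<close>, so their equivalence
  classes can be elements of \<open>M\<close>, and the whole ultrapower becomes a structure coded in
  \<open>M\<close>.\<close>

theorem ultrapower_set:
 assumes m: "m:V" "r:V" "is_struct (coded M m r)"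
 obtains m' r' io where "internal_ultrapower M X U (coded M m r) (coded M m' r') io" "binrel_in M m' r'"
  "dft M (%e. io (e 0))"
proof -
 have FV: "funs (E m) <= V" by (auto simp: funs_def fun_in_def)
 have aa: "apt X f x = app_in M f x" if "f:funs (E m)" "x:E X" for f x
  using that by (auto simp: apt_def funs_def)
 have "df M (%e. fun_in M X (e 0) & (ALL x:E X. apt X (e 0) x : E m))" using m(1) XU by (intro dfi)
 hence df_F: "df M (%e. e 0 : funs (E m))"
  by (rule df_cong[THEN iffD1, rotated]) (auto simp: funs_def apt_def)
 note df_F' = df_rel1[where R = "%f. f:funs (E m)", OF df_F]
 have "E f <= prs (E X) (E m)" if f: "f:funs (E m)" for f
 proof
  fix z assume z: "z:E f"
  then obtain x y where xy: "x:E X" "y:V" "z = pr x y" using f by (auto simp: funs_def fun_in_def)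
  hence "(x, y):rel_in M f" using z E_in by (simp add: rel_in_iff)
  hence "y = app_in M f x" using fun_in_app[of X f x y] f xy(1) by (auto simp: funs_def)
  thus "z:prs (E X) (E m)" using xy f by (auto simp: funs_def)
 qed
 hence "isset (funs (E m))"
  using FV by (intro isset_subset[OF isset_Pow[OF isset_prs[OF isset_E[OF XU(1)] isset_E[OF m(1)]]] df_F]) auto
 note isF = this
 define K where "K f = {g:funs (E m). big (%x. apt X f x = apt X g x)}" for f
 have dfb: "df M (%e. big (%x. apt X (e 0) x = apt X (e 1) x))"
  by (rule df_big) (intro dfi XU)
 note dfb' = df_rel2[where R = "%f g. big (%x. apt X f x = apt X g x)", OF dfb]
 have K: "isset (K f)" if "f:V" for f
  unfolding K_def using that by (intro isset_sep isF dfb' dfi)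
 have "df M (%e. e 0 : K (e (Suc 0)))"
  unfolding K_def mem_Collect_eq by (intro df_conj df_F' dfb' dfi)
 hence io: "dft M (%e. S (K (e 0)))" by (intro dft_S) (use K in auto)
 have refl: "big (%x. apt X f x = apt X f x)" for f using big_True by simp
 have sym: "big (%x. apt X f x = apt X g x) <-> big (%x. apt X g x = apt X f x)" for f g
  by (rule big_cong) auto
 have trans: "big (%x. apt X f x = apt X h x)"
  if "big (%x. apt X f x = apt X g x)" "big (%x. apt X g x = apt X h x)" "f:V" "g:V" "h:V" for f g h
  by (rule big_transfer[where R = "(=)" and f = f and g = g, OF that(1) refl that(2)]) (use that in "auto intro!: dfi")
 have eq: "S (K f) = S (K g) <-> big (%x. apt X f x = apt X g x)" if fg: "f:funs (E m)" "g:funs (E m)" for f g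
 proof
  assume "S (K f) = S (K g)"
  hence "K f = K g" using E_S[OF K] fg FV by (metis subsetD)
  moreover have "g:K g" unfolding K_def using fg(2) refl by blast
  ultimately have "g:K f" by simp
  thus "big (%x. apt X f x = apt X g x)" unfolding K_def by blast
 next
  assume "big (%x. apt X f x = apt X g x)"
  hence "K f = K g" using trans sym fg FV unfolding K_def by blast
  thus "S (K f) = S (K g)" by simp
 qed
 define R where "R f g <-> big (%x. (apt X f x, apt X g x):rel_in M r)" for f g
 have dfR0: "df M (%e. (e 0, e 1):rel_in M r)" using m(2) by (intro dfi)
 have dfR: "df M (%e. R (e 0) (e 1))"
  unfolding R_def by (rule df_big) (intro dfi XU m(2))
 note dfR' = df_rel2[where R = R, OF dfR]
 have m': "isset ((%f. S (K f)) ` funs (E m))" by (rule isset_image[OF isF io])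
 note m'' = S_in[OF m'] E_S[OF m']
 have "df M (%e. EX f:E (S (funs (E m))). EX g:E (S (funs (E m))). e 0 = S (K f) & e 1 = S (K g) & R f g)"
  by (intro dfi dfR' S_in isF dft_fun1[where F = "%f. S (K f)", OF io])
 then obtain r' where r': "r':V" "E r' = {pr x y | x y. x : E (S ((%f. S (K f)) ` funs (E m))) & y : E (S ((%f. S (K f)) ` funs (E m))) &
   (EX f:funs (E m). EX g:funs (E m). x = S (K f) & y = S (K g) & R f g)}"
  "rel_in M r' = {(x, y). x : E (S ((%f. S (K f)) ` funs (E m))) & y : E (S ((%f. S (K f)) ` funs (E m))) &
   (EX f:funs (E m). EX g:funs (E m). x = S (K f) & y = S (K g) & R f g)}"
  unfolding E_S[OF isF] by (rule rel_ex[OF isset_E[OF m''(1)] isset_E[OF m''(1)]]) blast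
 show ?thesis
 proof (rule that)
  show "binrel_in M (S ((%f. S (K f)) ` funs (E m))) r'"
   unfolding binrel_in_def using r'(1,2) m''(1) by auto
  show "dft M (%e. S (K (e 0)))" by (rule io)
  show "internal_ultrapower M X U (coded M m r) (coded M (S ((%f. S (K f)) ` funs (E m))) r') (%f. S (K f))"
  proof
   show "is_struct (coded M m r)" by (rule m(3))
   show "carr (coded M m r) <= V" by (auto simp: coded_def E_in)
   show "df M (%e. e 0 : carr (coded M m r))" "df M (%e. (e 0, e 1):mem (coded M m r))"
    unfolding coded_def struct.simps by (intro dfi m(1,2))+
   show "(%f. S (K f)) ` funs (carr (coded M m r)) = carr (coded M (S ((%f. S (K f)) ` funs (E m))) r')"
    by (simp add: coded_def m'')
   fix f g assume "f:funs (carr (coded M m r))" "g:funs (carr (coded M m r))"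
   hence fg: "f:funs (E m)" "g:funs (E m)" by (simp_all add: coded_def)
   show "S (K f) = S (K g) <-> big (%x. app_in M f x = app_in M g x)"
    unfolding eq[OF fg] by (rule big_cong) (simp add: aa fg)
   have "(S (K f), S (K g)) : rel_in M r' <-> R f g"
   proof
    assume "(S (K f), S (K g)) : rel_in M r'"
    then obtain f' g' where *: "f':funs (E m)" "g':funs (E m)" "S (K f) = S (K f')" "S (K g) = S (K g')" "R f' g'"
     unfolding r'(3) by blast
    hence "big (%x. apt X f' x = apt X f x)" "big (%x. apt X g' x = apt X g x)"
     using eq fg sym by blast+
    from big_transfer[OF *(5)[unfolded R_def] this _ _ _ _ dfR0] show "R f g"
     using * fg FV unfolding R_def by blast
   qed (use fg in "auto simp: r'(3) m''")
   also have "... <-> big (%x. (app_in M f x, app_in M g x):mem (coded M m r))"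
    unfolding R_def by (rule big_cong) (simp add: aa fg coded_def)
   finally show "(S (K f), S (K g)) : mem (coded M (S ((%f. S (K f)) ` funs (E m))) r') <->
     big (%x. (app_in M f x, app_in M g x) : mem (coded M m r))" by (simp add: coded_def)
  qed
 qed
qed

end

context zfc_model
begin

lemma binrel_in_sub: "binrel_in M m r ==> rel_in M r <= E m \<times> E m"
proof
 fix z assume br: "binrel_in M m r" and z: "z:rel_in M r"
 obtain x y where xy: "z = (x, y)" "x:V" "y:V" "pr x y : E r" using z by (cases z) (auto simp: rel_in_iff)
 then obtain x' y' where "x':E m" "y':E m" "pr x y = pr x' y'" using br unfolding binrel_in_def by blast
 thus "z:E m \<times> E m" using xy pr_inj[of x y x' y'] E_in by auto
qed

text \<open>In the ultrapower of a copy of \<open>M\<close> by an ultrafilter containing the final segments of its \<open>\<omega>\<close>,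
 the functions exceeding every constant have no least element.\<close>

theorem codes_itself_ill_founded:
 assumes sat: "computably_saturated M" and cnt: "countable V"
 obtains m r s where "codes_set_in M m r M" "s:V" "E s ~= {}"
  "E s <= ext (coded M m r) (omega_in (coded M m r))" "!!x. x:E s ==> EX y:E s. (y, x):rel_in M r"
proof -
 obtain m r where mr: "codes_set_in M m r M" "E m ~= {}" using codes_itself[OF sat cnt] by metis
 let ?A = "coded M m r"
 have mV: "m:V" "r:V" and relA: "rel_in M r <= E m \<times> E m"
  using mr(1) binrel_in_sub[of m r] by (auto simp: codes_set_in_def binrel_in_def)
 obtain hA where hA: "struct_iso hA ?A M" using mr(1) by (auto simp: codes_set_in_def isomorphic_def)
 have stA: "is_struct ?A" using mr(2) relA by (auto simp: is_struct_def coded_def)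
 have "is_model ?A zfc"
  by (rule is_model_iso[OF struct_iso_sym[OF hA] model]) (use relA in "simp add: coded_def")
 then interpret A: zfc_model ?A by unfold_locales
 have extA: "A.E y = {x:E m. (x, y):rel_in M r}" for y by (auto simp: ext_def coded_def)
 have carA: "carr ?A = E m" by (simp add: coded_def)
 note df_A = df_rel_in[OF _ _ dft_const[OF mV(2)]]
 have wA: "omega_in ?A : E m" using A.omega_in_V by (simp add: carA)
 have isA: "isset (A.E y)" if "y:E m" for y
  unfolding extA using that E_in mV by (intro isset_sep isset_E dfi) blast+
 \<comment> \<open>The \<open>omega\<close> of the copy, possibly nonstandard, is a set of
   \<open>M\<close> and serves as the index set.\<close>
 define X where "X = S A.W"
 have X: "X:V" "E X = A.W" using isA[OF wA] by (simp_all add: X_def S_in E_S)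
 define seg where "seg n = {k:E X. (n, k):rel_in M r}" for n
 have seg: "isset (seg n)" if "n:V" for n
  unfolding seg_def using that mV X by (intro isset_sep isset_E dfi)
 have dft_seg: "dft M (%e. S (seg (e 0)))"
 proof (rule dft_S)
  show "df M (%e. e 0 : seg (e (Suc 0)))" unfolding seg_def mem_Collect_eq by (intro dfi X mV)
 qed (use seg in auto)
 obtain b where b: "b:V" "E b = (%n. S (seg n)) ` E X"
  using isset_image[OF isset_E[OF X(1)] dft_seg] by (auto simp: isset_def)
 have XV: "n:V" "n:E m" if "n:E X" for n using that E_in mV A.W_sub unfolding X(2) carA by blast+
 have lt: "(n, k):rel_in M r <-> n:A.E k" for n k using relA by (auto simp: extA)
 have chain: "seg i <= seg j" if ij: "i:E X" "j:E X" "j:A.E i | i = j" for i j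
  using ij(3)
 proof
  assume "j:A.E i"
  thus ?thesis using A.W_trans unfolding seg_def lt X(2) by blast
 qed simp
 obtain U where U: "ultrafilter_in M X U" "E b <= E U"
 proof (rule ultrafilter_extends[OF X(1) b(1)])
  show "E b ~= {}" unfolding b(2) X(2) using A.empty_in_W by blast
  show "E u <= E X & E u ~= {}" if "u:E b" for u
  proof -
   obtain n where n: "n:E X" "u = S (seg n)" using `u : E b` unfolding b(2) by blast
   have "succ_in ?A n : seg n" using n(1) A.succ_in_W A.E_succ A.W_sub unfolding seg_def lt X(2) by auto
   thus ?thesis using n E_S[OF seg[OF XV(1)[OF n(1)]]] by (auto simp: seg_def)
  qed
  show "E u <= E v | E v <= E u" if uv: "u:E b" "v:E b" for u v
  proof -
   obtain i j where ij: "i:E X" "j:E X" "u = S (seg i)" "v = S (seg j)" using uv unfolding b(2) by blast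
   hence "E u = seg i" "E v = seg j" using E_S[OF seg] XV by auto
   thus ?thesis using chain ij A.W_linear[of i j] unfolding X(2) by blast
  qed
 qed
 interpret internal_ultrafilter M X U by unfold_locales (rule U)
 obtain m' r' io where ip: "internal_ultrapower M X U ?A (coded M m' r') io" and m'r': "binrel_in M m' r'"
  and io: "dft M (%e. io (e 0))" using ultrapower_set[OF mV stA] by metis
 let ?B = "coded M m' r'"
 interpret internal_ultrapower M X U ?A ?B io by (rule ip)
 obtain a where a: "a:E m" using mr(2) by blast
 have "similar M io ?B []"
  unfolding similar_def
 proof (intro allI impI)
  fix ph assume "fv ph <= {..<length ([] :: ('a \<times> 'a) list)}"
  hence fv: "fv ph = {}" by simp
  have "sat M (%i. fst ([] ! i)) ph <-> sat M (hA o (%_. a)) ph" by (rule sat_cong) (simp add: fv)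
  also have "... <-> sat ?A (%_. a) ph" by (rule sat_iso[OF hA, symmetric]) (simp add: fv)
  also have "... <-> sat ?B (%i. io (const_in M X a)) ph" by (rule los_const[symmetric]) (simp add: fv)
  also have "... <-> sat ?B (%i. io (snd ([] ! i))) ph" by (rule sat_cong) (simp add: fv)
  finally show "sat M (%i. fst ([] ! i)) ph <-> sat ?B (%i. io (snd ([] ! i))) ph" .
 qed
 then obtain hB where hB: "struct_iso hB ?B M" using back_and_forth[OF interp sat cnt, of "[]"] by auto
 have relB: "rel_in M r' <= E m' \<times> E m'"
  by (rule binrel_in_sub[OF m'r'])
 have "is_model ?B zfc"
  by (rule is_model_iso[OF struct_iso_sym[OF hB] model]) (use relB in "simp add: coded_def")
 then interpret B: zfc_model ?B by unfold_locales
 have codes: "codes_set_in M m' r' M" using m'r' hB by (auto simp: codes_set_in_def isomorphic_def)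
 define Z where "Z f <-> f:FA & (ALL n:E X. apt X f n : E X) & (ALL k:E X. big (%n. (k, apt X f n):rel_in M r))" for f
 have df_big1: "df M (%e. big (%n. (e 0, apt X (e 1) n) : rel_in M r))"
  by (rule df_big) (intro dfi XU mV)
 have df_Z: "df M (%e. Z (e 0))"
  unfolding Z_def by (intro dfi XU df_rel2[where R = "%k f. big (%n. (k, apt X f n):rel_in M r)", OF df_big1])
 have m'V: "m':V" "r':V" using m'r' by (auto simp: binrel_in_def)
 have "df M (%e. EX f:V. Z f & e 0 = io f)"
  by (intro dfi df_rel1[where R = Z, OF df_Z] dft_fun1[where F = io, OF io])
 from isset_sep[OF isset_E[OF m'V(1)] this]
 obtain s where s: "s:V" "E s = {x:E m'. EX f:V. Z f & x = io f}" by (auto simp: isset_def)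
 have Z: "f:FA" "f:V" "io f : E m'" if "Z f" for f
  using that FA_V B(1) by (auto simp: Z_def coded_def)
 have sI: "io f : E s" if "Z f" for f using Z[OF that] that s(2) by auto
 have FAX: "f:FA" if "fun_in M X f" "!!n. n:E X ==> app_in M f n : E X" for f
  using that XV by (auto simp: funs_def carA)
 have ne: "E s ~= {}"
 proof -
  \<comment> \<open>The identity exceeds the constant \<open>k\<close> on the final segment of
    \<open>k\<close>, and this segment was put into the ultrafilter.\<close>
  obtain f where f: "fun_in M X f" "ALL n:E X. app_in M f n = n"
   by (rule fun_of_term[OF X(1), of "%n. n"]) (auto intro: dfi)
  have fFA: "f:FA" using FAX f by simp
  have ap: "apt X f n = n" if "n:E X" for n using f that apt_app[OF fFA] by simp
  have "big (%n. (k, apt X f n):rel_in M r)" if k: "k:E X" for k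
  proof -
   have "S (seg k) : E U" using U(2) b(2) k by blast
   moreover have "E (S (seg k)) = {n:E X. (k, n):rel_in M r}" using E_S[OF seg[OF XV(1)[OF k]]] by (simp add: seg_def)
   ultimately have "big (%n. (k, n):rel_in M r)" by (auto simp: big_def)
   thus ?thesis by (rule big_cong[THEN iffD1, rotated]) (simp add: ap)
  qed
  hence "Z f" using fFA ap by (simp add: Z_def)
  from sI[OF this] show ?thesis by blast
 qed
 have sub: "E s <= ext ?B (omega_in ?B)"
 proof
  fix x assume "x:E s"
  then obtain f where f: "Z f" "x = io f" using s(2) by blast
  \<comment> \<open>An inductive set of the ultrapower is represented by \<open>g\<close>. By the
    theorem of Los \<open>g n\<close> is inductive in the copy for most \<open>n\<close>, hence it
    contains \<open>f n\<close>, a number of the copy.\<close>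
  have "x:B.E w" if w: "inductive_in ?B w" for w
  proof -
   have "w:io ` FA" using w B(1) by (simp add: inductive_in_def)
   then obtain g where g: "g:FA" "w = io g" by blast
   have "sat ?B (io o (%_. g)) inductive_fm"
    using B.sat_inductive_fm[of "io o (%_. g)"] w g(2) by (auto simp: inductive_in_def)
   hence "big (%n. sat ?A (%i. apt X g n) inductive_fm)" using los[of "%_. g"] g(1) by (auto simp: comp_def)
   hence "big (%n. (apt X f n, apt X g n):rel_in M r)"
   proof (rule big_mono)
    fix n assume n: "n:E X" "sat ?A (%i. apt X g n) inductive_fm"
    have "apt X g n : carr ?A" using apt_app[OF g(1) n(1)] g(1) n(1) by (auto simp: funs_def)
    hence "inductive_in ?A (apt X g n)" using n(2) A.sat_inductive_fm[of "%_. apt X g n"] by simp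
    moreover have "apt X f n : A.W" using f(1) n(1) X(2) by (auto simp: Z_def)
    ultimately show "(apt X f n, apt X g n):rel_in M r" unfolding A.W_def by (auto simp: lt)
   qed (use XU mV FA_V[OF g(1)] Z(2)[OF f(1)] in "intro dfi")
   hence "big (%n. (app_in M f n, app_in M g n):mem ?A)"
    by (rule big_cong[THEN iffD1, rotated]) (simp add: apt_app[OF g(1)] apt_app[OF Z(1)[OF f(1)]] coded_def)
   hence "(io f, io g):mem ?B" using B(3)[OF Z(1)[OF f(1)] g(1)] by simp
   thus ?thesis using f(2) g(2) by (simp add: B.mem_iff_E)
  qed
  thus "x:ext ?B (omega_in ?B)" unfolding B.W_def using Z[OF f(1)] f(2) by (auto simp: coded_def)
 qed
 have desc: "EX y:E s. (y, x):rel_in M r'" if x: "x:E s" for x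
 proof -
  obtain f where f: "Z f" "x = io f" using s(2) x by blast
  have fV: "f:V" using Z f(1) by blast
  \<comment> \<open>The choice describes a predecessor of \<open>f n\<close>, arbitrary where
    \<open>f n\<close> is zero. Since \<open>f\<close> exceeds \<open>k + 1\<close> on a big set,
    the predecessor exceeds \<open>k\<close> there.\<close>
  have "df M (%e. e 1 : E X & (ALL k:E X. (k, apt X f (e 0)) : rel_in M r --> (k, e 1) : rel_in M r | k = e 1) &
   ((e 1, apt X f (e 0)) : rel_in M r | ~(EX k:E X. (k, apt X f (e 0)) : rel_in M r)))"
   using XU fV mV by (intro dfi)
  moreover have "EX y:V. y : E X & (ALL k:E X. (k, apt X f n) : rel_in M r --> (k, y) : rel_in M r | k = y) &
   ((y, apt X f n) : rel_in M r | ~(EX k:E X. (k, apt X f n) : rel_in M r))" if n: "n : E X" for n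
  proof -
   have "apt X f n : A.W" using f(1) n X(2) by (auto simp: Z_def)
   from A.W_cases[OF this] show ?thesis
   proof
    assume "apt X f n = empty_in ?A"
    thus ?thesis using A.empty_in_W XV(1) unfolding lt X(2)[symmetric] by (intro bexI[of _ "empty_in ?A"]) auto
   next
    assume "EX k:A.W. apt X f n = succ_in ?A k"
    then obtain k where "k:E X" "apt X f n = succ_in ?A k" unfolding X(2) by blast
    thus ?thesis using XV A.E_succ[of k] unfolding lt carA by (intro bexI[of _ k]) auto
   qed
  qed
  ultimately obtain g where g: "fun_in M X g" "ALL n:E X. app_in M g n : E X &
   (ALL k:E X. (k, apt X f n) : rel_in M r --> (k, app_in M g n) : rel_in M r | k = app_in M g n) &
   ((app_in M g n, apt X f n) : rel_in M r | ~(EX k:E X. (k, apt X f n) : rel_in M r))"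
   by (rule choice_fun[OF X(1)]) blast+
  have gFA: "g:FA" using FAX g by blast
  have gV: "g:V" by (rule FA_V[OF gFA])
  have ag: "apt X g n = app_in M g n" if "n:E X" for n by (rule apt_app[OF gFA that])
  have bf: "big (%n. (k, apt X f n):rel_in M r)" if "k:E X" for k using f(1) that by (simp add: Z_def)
  have "big (%n. (k, apt X g n):rel_in M r)" if k: "k:E X" for k
  proof -
   have k': "succ_in ?A k : E X" using k A.succ_in_W unfolding X(2) by simp
   show ?thesis
   proof (rule big_mono[OF bf[OF k']])
    fix n assume n: "n:E X" "(succ_in ?A k, apt X f n) : rel_in M r"
    hence "(succ_in ?A k, app_in M g n) : rel_in M r | succ_in ?A k = app_in M g n" using g(2) k' by blast
    moreover have "k:A.E (succ_in ?A k)" using A.E_succ[of k] XV(2)[OF k] by (simp add: carA)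
    moreover have "app_in M g n : A.W" using g(2) n(1) X(2) by blast
    ultimately show "(k, apt X g n):rel_in M r" using A.W_trans[of "app_in M g n" "succ_in ?A k"] unfolding ag[OF n(1)] lt by auto
   qed (use XU mV gV XV[OF k] in "intro dfi")
  qed
  hence Zg: "Z g" using gFA g(2) ag by (simp add: Z_def)
  have o: "empty_in ?A : E X" using A.empty_in_W X(2) by simp
  have "big (%n. (apt X g n, apt X f n):rel_in M r)"
   by (rule big_mono[OF bf[OF o]]) (use g(2) o ag XU mV fV gV in "auto intro!: dfi")
  hence "big (%n. (app_in M g n, app_in M f n):mem ?A)"
   by (rule big_cong[THEN iffD1, rotated]) (simp add: ag apt_app[OF Z(1)[OF f(1)]] coded_def)
  hence "(io g, x):rel_in M r'" using B(3)[OF gFA Z(1)[OF f(1)]] f(2) by (simp add: coded_def)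
  thus ?thesis using sI[OF Zg] by blast
 qed
 show ?thesis by (rule that[OF codes s(1) ne sub desc])
qed

end

section \<open>Wellfoundedness Mirage and Countability\<close>

theorem wellfoundedness_mirage_saturated:
 "wellfoundedness_mirage_axiom (CSM :: 'a struct set)"
 unfolding wellfoundedness_mirage_axiom_def
proof
 fix M :: "'a struct" assume M: "M:CSM"
 interpret zfc_model M using M by (rule zfc_model_multiverse)
 obtain m r s where *: "codes_set_in M m r M" "s:V" "E s ~= {}"
  "E s <= ext (coded M m r) (omega_in (coded M m r))" "ALL x:E s. EX y:E s. (y, x):rel_in M r"
  by (rule codes_itself_ill_founded) (use M in "auto simp: countable_saturated_models_def")
 thus "EX N:CSM :: 'a struct set. EX m r. codes_set_in N m r M &
    (EX s : carr N. ext N s ~= {} & ext N s <= ext (coded N m r) (omega_in (coded N m r)) &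
      (ALL x : ext N s. EX y : ext N s. (y, x) : rel_in N r))"
  using M by blast
qed

text \<open>Exchanging two sets gives an isomorphic copy of \<open>M\<close> different from \<open>M\<close>.\<close>

theorem countability_saturated: "countability_axiom (CSM :: 'a struct set)"
 unfolding countability_axiom_def
proof
 fix M :: "'a struct" assume M: "M:CSM"
 interpret zfc_model M using M by (rule zfc_model_multiverse)
 define ta where "ta = id(empty_in M := succ_in M (empty_in M), succ_in M (empty_in M) := empty_in M)"
 define N where "N = (|carr = V, mem = {(ta x, ta y) | x y. (x, y):mem M}|)"
 have ne: "succ_in M (empty_in M) ~= empty_in M" by (rule succ_not_empty[OF empty_in_V])
 have tata: "ta (ta x) = x" for x using ne by (auto simp: ta_def)
 have taV: "ta x : V" if "x:V" for x using that by (auto simp: ta_def)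
 have iso: "struct_iso ta M N"
  unfolding struct_iso_def N_def
  by (auto intro!: bij_betw_byWitness[where f' = ta] tata taV) (metis tata)
 have "mem N <= carr N \<times> carr N" using mem_sub taV by (auto simp: N_def)
 hence N: "N:CSM"
  using M is_model_iso[OF iso] computably_saturated_iso[OF iso] by (auto simp: countable_saturated_models_def N_def)
 have "(empty_in M, succ_in M (empty_in M)) : mem M" by (simp add: mem_iff_E E_succ)
 hence "(ta (empty_in M), ta (succ_in M (empty_in M))) : mem N" unfolding N_def by auto
 hence "(succ_in M (empty_in M), empty_in M) : mem N" using ne by (simp add: ta_def)
 hence "N ~= M" by (auto simp: mem_iff_E)
 interpret N: zfc_model N using N by (rule zfc_model_multiverse)
 obtain m r where mr: "codes_set_in N m r N" "countable_in N m"
  using N.codes_itself N unfolding countable_saturated_models_def by blast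
 have "isomorphic N M" using struct_iso_sym[OF iso] by (auto simp: isomorphic_def)
 hence "codes_set_in N m r M" using mr(1) isomorphic_trans by (auto simp: codes_set_in_def)
 thus "EX N:CSM :: 'a struct set. N ~= M & (EX m r. codes_set_in N m r M & countable_in N m)"
  using N `N ~= M` mr(2) by blast
qed

section \<open>Ranks of elements and of names\<close>

context zfc_model
begin

lemma rank_le_mem:
 assumes "x:V" "y:E x"
 shows "rank_le y x"
proof -
 have "ALL y:E x. rank_le y x"
 proof (rule E_induct[OF _ _ assms(1)])
  show "df M (%e. ALL y:E (e 0). rank_le y (e 0))" by (intro dfi)
  show "ALL y:E x. rank_le y x" if x: "x:V" and IH: "!!y. y:E x ==> ALL z:E y. rank_le z y" for x
  proof
   fix y assume y: "y:E x"
   thus "rank_le y x" using rank_le_iff[OF E_in[OF y] x] IH[OF y] by blast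
  qed
 qed
 thus ?thesis using assms(2) by blast
qed

lemma not_rank_le_mem:
 assumes "x:V" "y:E x"
 shows "~rank_le x y"
proof -
 have "ALL x:V. y:E x --> ~rank_le x y"
 proof (rule E_induct[OF _ _ E_in[OF assms(2)]])
  show "df M (%e. ALL x:V. e 0 : E x --> ~rank_le x (e 0))" by (intro dfi)
  show "ALL x:V. y:E x --> ~rank_le x y" if "y:V" "!!z. z:E y ==> ALL x:V. z:E x --> ~rank_le x z" for y
   using that rank_le_iff by blast
 qed
 thus ?thesis using assms by blast
qed

lemma rank_le_linear: "x:V ==> y:V ==> rank_le x y | rank_le y x"
 using rank_le_or_less[of x y] rank_le_mem[of x] rank_le_trans[of y _ x] E_in by blast

lemma rank_le_pr:
 assumes "ro:V" "r:V"
 shows "rank_le ro (pr ro r)"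
proof -
 have "ro:E (S {ro})" "S {ro} : E (pr ro r)" "S {ro} : V"
  using assms isset_pair[of ro ro] isset_pair[OF assms] isset_pair[OF S_in S_in, of "{ro}" "{ro, r}"]
  by (auto simp: pair_in_def E_S S_in)
 thus ?thesis using rank_le_trans[OF assms(1) _ pr_in[OF assms] rank_le_mem rank_le_mem] assms by auto
qed

text \<open>The descent for inductions over names: from a bound \<open>x\<close> for a name to an
  element of \<open>x\<close> that bounds a name occurring in it.\<close>

lemma pr_rank_less:
 assumes "pr ro r : E si" "rank_le si x" "ro:V" "r:V" "si:V" "x:V"
 shows "EX y:E x. rank_le ro y"
proof -
 obtain y where y: "y:E x" "rank_le (pr ro r) y" using rank_le_iff[of si x] assms by blast
 hence "rank_le ro y" using rank_le_trans[OF _ _ _ rank_le_pr y(2)] assms E_in by auto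
 thus ?thesis using y by blast
qed

end

section \<open>Forcing\<close>

locale poset_in_model = zfc_model M for M :: "'a struct" +
 fixes P :: "'a set" and le :: "('a \<times> 'a) set"
 assumes P: "definable1 M P" and le: "definable2 M le" and fn: "forcing_notion P le"
begin

abbreviation N :: "'a set" where "N == names M P"

lemma P_V: "p:P ==> p:V" using P by (auto simp: definable1_def def1_def)

lemma le_refl: "p:P ==> (p, p):le"
 and le_trans: "(r, q):le ==> (q, p):le ==> (r, p):le"
 and le_P: "(q, p):le ==> q:P" "(q, p):le ==> p:P"
 using fn by (auto simp: forcing_notion_def refl_on_def dest: transD)

lemma names_V: "si:N ==> si:V" by (auto simp: names_def E_in)

lemma names_elem: "si:N ==> z:E si ==> EX ro:N. EX p:P. z = pr ro p"
 unfolding names_def by blast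

lemma names_closed:
 assumes "si:N" "pr ro p : E si" "ro:V" "p:V"
 shows "ro:N" "p:P"
 using names_elem[OF assms(1,2)] assms(3,4) by (auto simp: pr_inj names_V P_V)

lemma df_names [dfi]: "dft M f ==> df M (%e. f e : N)"
proof (rule df_rel1[where R = "%si. si:N"])
 have "df M (%e. EX t:V. e 0 : E t & (ALL y:E t. ALL z:E y. EX ro:E t. EX p:V. p:P & z = pr ro p))"
  by (intro dfi P)
 thus "df M (%e. e 0 : N)"
  by (rule df_cong[THEN iffD1, rotated]) (use P_V in "auto simp: names_def", (meson P_V)+)
qed

text \<open>\<open>names\<close> asks for one set that is closed under passing to subnames. Each
  pair in \<open>si\<close> comes with such a set of its own, and Collection gathers enough of them
  into a set.\<close>

lemma nameI:
 assumes "si:V" and el: "!!z. z:E si ==> EX ro:N. EX p:P. z = pr ro p"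
 shows "si:N"
proof -
 define closed where "closed t <-> (ALL y:E t. ALL z:E y. EX ro:E t. EX p:V. p:P & z = pr ro p)" for t
 have cl: "closed t <-> (ALL y:E t. ALL z:E y. EX ro:E t. EX p:P. z = pr ro p)" for t
  unfolding closed_def using P_V by blast
 define C where "C z t <-> closed t & (EX ro:E t. EX p:V. p:P & z = pr ro p)" for z t
 have "df M (%e. C (e 0) (e 1))" unfolding C_def closed_def by (intro dfi P)
 then obtain B where B: "isset B" "ALL z:E si. (EX t:V. C z t) --> (EX t:B. C z t)" "ALL t:B. EX z:E si. C z t"
  by (rule collection[OF isset_E[OF assms(1)]]) blast
 have ex: "EX t:V. C z t" if z: "z:E si" for z
 proof -
  obtain ro p where "ro:N" "p:P" "z = pr ro p" using el[OF z] by blast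
  thus ?thesis unfolding C_def cl using P_V by (auto simp: names_def)
 qed
 have T: "isset (insert si (UN t:B. E t))" using assms(1) B(1) by (intro isset_insert isset_Union)
 note T' = S_in[OF T] E_S[OF T]
 have "ALL y:insert si (UN t:B. E t). ALL z:E y. EX ro:insert si (UN t:B. E t). EX p:P. z = pr ro p"
 proof (intro ballI)
  fix y z assume y: "y:insert si (UN t:B. E t)" and z: "z:E y"
  show "EX ro:insert si (UN t:B. E t). EX p:P. z = pr ro p"
  proof (cases "y = si")
   case True
   then obtain t where "t:B" "C z t" using B(2) ex z by blast
   thus ?thesis unfolding C_def by blast
  next
   case False
   then obtain t where "t:B" "y:E t" using y by blast
   moreover hence "closed t" using B(3) by (auto simp: C_def)
   ultimately show ?thesis using z unfolding cl by blast
  qed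
 qed
 thus ?thesis unfolding names_def mem_Collect_eq by (intro bexI[OF _ T'(1)]) (unfold T'(2), blast)
qed

lemma name_S:
 assumes "isset A" "!!z. z:A ==> EX ro:N. EX p:P. z = pr ro p"
 shows "S A : N"
 by (rule nameI) (use assms in "simp_all add: S_in E_S")

end

locale forcing = poset_in_model +
 fixes Feq Fmem :: "('a \<times> 'a \<times> 'a) set"
 assumes af: "atomic_forcing M P le Feq Fmem"
begin

lemmas af' = af[unfolded atomic_forcing_def]

lemma Feq_def3: "definable3 M Feq" and Fmem_def3: "definable3 M Fmem"
 by (rule af'[THEN conjunct1], rule af'[THEN conjunct2, THEN conjunct1])

lemma Feq_sub: "(p, si, ta):Feq ==> p:P & si:N & ta:N"
 using af'[THEN conjunct2, THEN conjunct2, THEN conjunct1] by blast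

lemma Fmem_sub: "(p, si, ta):Fmem ==> p:P & si:N & ta:N"
 using af'[THEN conjunct2, THEN conjunct2, THEN conjunct2, THEN conjunct1] by blast

lemmas af_iff = af'[THEN conjunct2, THEN conjunct2, THEN conjunct2, THEN conjunct2, THEN bspec, THEN bspec, THEN bspec]

lemma Feq_iff: "p : P ==> si : N ==> ta : N ==> (p, si, ta) : Feq <->
  (ALL ro:N. ALL r:P. pr ro r : E si Un E ta --> (ALL q. (q, p) : le --> ((q, ro, si) : Fmem <-> (q, ro, ta) : Fmem)))"
 and Fmem_iff: "p : P ==> si : N ==> ta : N ==> (p, si, ta) : Fmem <->
  (ALL p'. (p', p) : le --> (EX q. (q, p') : le &
   (EX ro:N. EX r:P. pr ro r : E ta & (q, r) : le & (q, si, ro) : Feq)))"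
 by (rule af_iff[THEN conjunct1], assumption+, rule af_iff[THEN conjunct2], assumption+)

lemma Feq_mono: "(p, si, ta):Feq ==> (q, p):le ==> (q, si, ta):Feq"
proof -
 assume *: "(p, si, ta):Feq" "(q, p):le"
 hence pN: "p:P" "q:P" "si:N" "ta:N" using Feq_sub le_P by blast+
 show ?thesis unfolding Feq_iff[OF pN(2-4)]
  using *(1)[unfolded Feq_iff[OF pN(1,3,4)]] le_trans[OF _ *(2)] by (intro ballI allI impI) blast
qed

lemma Fmem_mono: "(p, si, ta):Fmem ==> (q, p):le ==> (q, si, ta):Fmem"
proof -
 assume *: "(p, si, ta):Fmem" "(q, p):le"
 hence "p:P" "q:P" "si:N" "ta:N" using Fmem_sub le_P by blast+
 with * show ?thesis using le_trans by (simp add: Fmem_iff)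
qed

text \<open>The clause for membership in \<open>atomic_forcing\<close> is itself a density
  statement, and density can be iterated.\<close>

lemma Fmem_dense:
 assumes "p:P" "si:N" "ta:N" "!!q. (q, p):le ==> EX r. (r, q):le & (r, si, ta):Fmem"
 shows "(p, si, ta):Fmem"
 unfolding Fmem_iff[OF assms(1-3)]
proof (intro allI impI)
 fix p' assume "(p', p):le"
 then obtain r where r: "(r, p'):le" "(r, si, ta):Fmem" using assms(4) by blast
 hence rP: "r:P" using le_P by blast
 with r obtain q where "(q, r):le" "EX ro:N. EX s:P. pr ro s : E ta & (q, s):le & (q, si, ro):Feq"
  unfolding Fmem_iff[OF rP assms(2,3)] using le_refl by blast
 thus "EX q. (q, p'):le & (EX ro:N. EX r:P. pr ro r : E ta & (q, r):le & (q, si, ro):Feq)"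
  using le_trans r(1) by blast
qed

lemma Feq_dense:
 assumes "p:P" "si:N" "ta:N" and d: "!!q. (q, p):le ==> EX r. (r, q):le & (r, si, ta):Feq"
 shows "(p, si, ta):Feq"
 unfolding Feq_iff[OF assms(1-3)]
proof (intro ballI allI impI)
 fix ro r q assume ro: "ro:N" "r:P" "pr ro r : E si Un E ta" and q: "(q, p):le"
 have qP: "q:P" using q le_P by blast
 have step: "EX s. (s, q'):le & ((s, ro, si):Fmem <-> (s, ro, ta):Fmem)" if q': "(q', q):le" for q'
 proof -
  obtain s where s: "(s, q'):le" "(s, si, ta):Feq" using d le_trans[OF q' q] by blast
  hence sP: "s:P" using le_P by blast
  thus ?thesis using s Feq_iff[OF sP assms(2,3)] ro le_refl by blast
 qed
 show "(q, ro, si):Fmem <-> (q, ro, ta):Fmem"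
  using step Fmem_mono le_trans by (intro iffI Fmem_dense qP ro(1) assms(2,3)) blast+
qed

lemma Feq_refl: "p:P ==> si:N ==> (p, si, si):Feq"
 by (simp add: Feq_iff)

lemma Feq_sym: "(p, si, ta):Feq ==> (p, ta, si):Feq"
 using Feq_sub[of p si ta] by (simp add: Feq_iff Un_commute)

lemma Fmem_elem:
 assumes "pr ro r : E si" "(q, r):le" "si:N" "ro:N"
 shows "(q, ro, si):Fmem"
proof -
 have qr: "q:P" "r:P" using le_P assms(2) by blast+
 show ?thesis unfolding Fmem_iff[OF qr(1) assms(4,3)]
  using assms qr le_refl le_trans Feq_refl le_P by blast
qed

lemma FmemE:
 assumes "(p, si, ta):Fmem" "(p', p):le"
 obtains q ro r where "(q, p'):le" "ro:N" "pr ro r : E ta" "(q, r):le" "(q, si, ro):Feq"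
 using Fmem_iff[of p si ta] Fmem_sub[OF assms(1)] assms by blast

lemma Feq_Fmem:
 assumes "(p, si, ta):Feq" "ro:N" "r:V" "pr ro r : E si" "(q, p):le" "(q, ro, si):Fmem"
 shows "(q, ro, ta):Fmem"
 using Feq_iff[of p si ta] Feq_sub[OF assms(1)] assms names_closed[of si ro r] names_V by blast

text \<open>By induction on a common bound of the ranks, since the three names change their roles.\<close>

lemma Feq_trans:
 assumes "(p, si, ta):Feq" "(p, ta, us):Feq"
 shows "(p, si, us):Feq"
proof -
 define T where "T x <-> (ALL p:V. ALL si:V. ALL ta:V. ALL us:V. rank_le si x & rank_le ta x & rank_le us x &
  (p, si, ta) : Feq & (p, ta, us) : Feq --> (p, si, us) : Feq)" for x
 have T: "T x" if "x:V" for x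
 proof (rule E_induct[OF _ _ that])
  show "df M (%e. T (e 0))" unfolding T_def by (intro dfi Feq_def3)
  fix x assume x: "x:V" and IH: "!!y. y:E x ==> T y"
  have IH': "(p, ro, mu):Feq"
   if h: "pr ro r1 : E a1" "pr pi r2 : E a2" "pr mu r3 : E a3" "rank_le a1 x" "rank_le a2 x" "rank_le a3 x"
    "a1:V" "a2:V" "a3:V" "r1:V" "r2:V" "r3:V" and F: "(p, ro, pi):Feq" "(p, pi, mu):Feq"
   for p ro pi mu r1 r2 r3 a1 a2 a3
  proof -
   have V: "p:V" "ro:V" "pi:V" "mu:V" using F Feq_sub names_V P_V by blast+
   obtain y1 y2 y3 where y: "y1:E x" "rank_le ro y1" "y2:E x" "rank_le pi y2" "y3:E x" "rank_le mu y3"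
    using pr_rank_less[OF h(1,4)] pr_rank_less[OF h(2,5)] pr_rank_less[OF h(3,6)] h(7-12) V x by metis
   have "EX y:E x. rank_le y1 y & rank_le y2 y & rank_le y3 y"
    using rank_le_linear[of y1 y2] rank_le_linear[of y2 y3] rank_le_linear[of y1 y3] rank_le_refl y(1,3,5) E_in
     rank_le_trans[of y1 y2 y3] rank_le_trans[of y2 y1 y3] by metis
   then obtain y where "y:E x" "rank_le ro y" "rank_le pi y" "rank_le mu y"
    using y V rank_le_trans E_in by metis
   thus ?thesis using IH[of y] V F unfolding T_def by blast
  qed
  show "T x" unfolding T_def
  proof (intro ballI impI, elim conjE)
   fix p si ta us assume rk: "rank_le si x" "rank_le ta x" "rank_le us x" and F: "(p, si, ta):Feq" "(p, ta, us):Feq"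
   have pN: "p:P" "si:N" "ta:N" "us:N" using F Feq_sub by blast+
   \<comment> \<open>A member \<open>ro\<close> of \<open>a\<close> is forced into \<open>b\<close>,
     so it densely equals a member \<open>pi\<close> of \<open>b\<close>, which in turn densely
     equals a member \<open>mu\<close> of \<open>c\<close>. The induction hypothesis composes the
     two equalities.\<close>
   have half: "(q, ro, c):Fmem"
    if ro: "pr ro r : E a" "ro:N" "r:V" and q: "(q, p):le" "(q, ro, a):Fmem"
     and ab: "(p, a, b):Feq" "(p, b, c):Feq" "rank_le a x" "rank_le b x" "rank_le c x" for ro r q a b c
   proof (rule Fmem_dense)
    show "q:P" using q le_P by blast
    show "ro:N" "c:N" using ro ab Feq_sub by blast+
    fix q' assume q': "(q', q):le"
    have "(q, ro, b):Fmem" by (rule Feq_Fmem[OF ab(1) ro(2,3,1) q])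
    then obtain q1 pi s where q1: "(q1, q'):le" "pi:N" "pr pi s : E b" "(q1, s):le" "(q1, ro, pi):Feq"
     using q' by (rule FmemE)
    have q1p: "(q1, p):le" using q1 q' q le_trans by blast
    have "(q1, pi, b):Fmem" using Fmem_elem[OF q1(3,4)] ab Feq_sub q1(2) by blast
    hence "(q1, pi, c):Fmem" using Feq_Fmem[OF ab(2) q1(2) _ q1(3) q1p] le_P q1(4) P_V by blast
    then obtain q2 mu t where q2: "(q2, q1):le" "mu:N" "pr mu t : E c" "(q2, t):le" "(q2, pi, mu):Feq"
     using le_refl q1(1) le_P by (metis FmemE)
    have "(q2, ro, mu):Feq"
     by (rule IH'[OF ro(1) q1(3) q2(3)])
      (use ab ro(3) q1(4) q2(4) le_P P_V names_V Feq_sub Feq_mono[OF q1(5) q2(1)] q2(5) in blast)+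
    moreover have "(q2, mu, c):Fmem" using Fmem_elem[OF q2(3,4)] ab Feq_sub q2(2) by blast
    ultimately have "EX ro':N. EX r:P. pr ro' r : E c & (q2, r):le & (q2, ro, ro'):Feq" using q2 le_P by blast
    hence "(q2, ro, c):Fmem"
     using Fmem_iff[of q2 ro c] Feq_mono le_trans le_refl le_P ro(2) ab Feq_sub q2(1) by (smt (verit, ccfv_SIG))
    thus "EX r. (r, q'):le & (r, ro, c):Fmem" using q2(1) q1(1) le_trans by blast
   qed
   text \<open>If \<open>q\<close> forces \<open>ro = mu\<close> with \<open>mu\<close> an element of \<open>c\<close>, then also \<open>mu = pi\<close> for an element \<open>pi\<close> of \<open>a\<close>, and
    the induction hypothesis applies to \<open>ro, mu, pi\<close>.\<close>
   have bwd: "(q, ro, a):Fmem"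
    if ro: "pr ro r : E a" "ro:N" "r:V" and q: "(q, p):le" "(q, ro, c):Fmem"
     and ab: "(p, c, b):Feq" "(p, b, a):Feq" "rank_le a x" "rank_le b x" "rank_le c x" for ro r q a b c
   proof (rule Fmem_dense)
    show "q:P" using q le_P by blast
    show "ro:N" "a:N" using ro ab Feq_sub by blast+
    fix q' assume q': "(q', q):le"
    obtain q1 mu t where q1: "(q1, q'):le" "mu:N" "pr mu t : E c" "(q1, t):le" "(q1, ro, mu):Feq"
     using q(2) q' by (rule FmemE)
    have q1p: "(q1, p):le" using q1 q' q le_trans by blast
    have "(q1, mu, c):Fmem" using Fmem_elem[OF q1(3,4)] ab Feq_sub q1(2) by blast
    hence "(q1, mu, a):Fmem" using half[OF q1(3,2) _ q1p _ ab(1,2,5,4,3)] le_P q1(4) P_V by blast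
    then obtain q2 pi s where q2: "(q2, q1):le" "pi:N" "pr pi s : E a" "(q2, s):le" "(q2, mu, pi):Feq"
     using le_refl q1(1) le_P by (metis FmemE)
    have "(q2, ro, pi):Feq"
     by (rule IH'[OF ro(1) q1(3) q2(3)])
      (use ab ro(3) q1(4) q2(4) le_P P_V names_V Feq_sub Feq_mono[OF q1(5) q2(1)] q2(5) in blast)+
    hence "EX ro':N. EX r:P. pr ro' r : E a & (q2, r):le & (q2, ro, ro'):Feq" using q2 le_P by blast
    hence "(q2, ro, a):Fmem"
     using Fmem_iff[of q2 ro a] Feq_mono le_trans le_refl le_P ro(2) ab Feq_sub q2(1) by (smt (verit, ccfv_SIG))
    thus "EX r. (r, q'):le & (r, ro, a):Fmem" using q2(1) q1(1) le_trans by blast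
   qed
   note sym = F[THEN Feq_sym]
   show "(p, si, us):Feq"
    unfolding Feq_iff[OF pN(1,2,4)]
   proof (intro ballI allI impI)
    fix ro r q assume ro: "ro:N" "r:P" "pr ro r : E si Un E us" and q: "(q, p):le"
    have "(q, ro, si):Fmem <-> (q, ro, us):Fmem" if "pr ro r : E si"
     using half[OF that ro(1) P_V[OF ro(2)] q _ F rk] bwd[OF that ro(1) P_V[OF ro(2)] q _ sym(2,1) rk] by blast
    moreover have "(q, ro, si):Fmem <-> (q, ro, us):Fmem" if "pr ro r : E us"
     using half[OF that ro(1) P_V[OF ro(2)] q _ sym(2,1) rk(3,2,1)] bwd[OF that ro(1) P_V[OF ro(2)] q _ F rk(3,2,1)] by blast
    ultimately show "(q, ro, si):Fmem <-> (q, ro, us):Fmem" using ro(3) by blast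
   qed
  qed
 qed
 have V: "p:V" "si:V" "ta:V" "us:V" using assms Feq_sub names_V P_V by blast+
 have "EX x:V. rank_le si x & rank_le ta x & rank_le us x"
  using rank_le_linear[of si ta] rank_le_linear[of ta us] rank_le_linear[of si us] rank_le_refl V
   rank_le_trans[of si ta us] rank_le_trans[of ta si us] by metis
 thus ?thesis using T V assms unfolding T_def by blast
qed

lemma Fmem_Feq1:
 assumes "(p, si, ta):Fmem" "(p, si, si'):Feq"
 shows "(p, si', ta):Fmem"
proof -
 have pN: "p:P" "si':N" "ta:N" using assms Feq_sub Fmem_sub by blast+
 show ?thesis unfolding Fmem_iff[OF pN]
 proof (intro allI impI)
  fix p' assume p': "(p', p):le"
  obtain q ro r where q: "(q, p'):le" "ro:N" "pr ro r : E ta" "(q, r):le" "(q, si, ro):Feq"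
   using assms(1) p' by (rule FmemE)
  have "(q, si', ro):Feq" using Feq_trans[OF Feq_sym q(5)] Feq_mono[OF assms(2)] le_trans[OF q(1) p'] by blast
  thus "EX q. (q, p'):le & (EX ro:N. EX r:P. pr ro r : E ta & (q, r):le & (q, si', ro):Feq)" using q le_P by blast
 qed
qed

lemma Fmem_Feq2:
 assumes "(p, si, ta):Fmem" "(p, ta, ta'):Feq"
 shows "(p, si, ta'):Fmem"
proof (rule Fmem_dense)
 show pN: "p:P" "si:N" "ta':N" using assms Feq_sub Fmem_sub by blast+
 fix p' assume p': "(p', p):le"
 obtain q ro r where q: "(q, p'):le" "ro:N" "pr ro r : E ta" "(q, r):le" "(q, si, ro):Feq"
  using assms(1) p' by (rule FmemE)
 have "(q, ro, ta):Fmem" using Fmem_elem[OF q(3,4)] q(2) assms Fmem_sub by blast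
 hence "(q, ro, ta'):Fmem" using Feq_Fmem[OF assms(2) q(2) _ q(3)] le_trans[OF q(1) p'] q(4) le_P P_V by blast
 thus "EX r. (r, p'):le & (r, si, ta'):Fmem" using Fmem_Feq1 Feq_sym[OF q(5)] q(1) by blast
qed

end

section \<open>The forcing relation for arbitrary formulas and its definability\<close>

text \<open>The condition is the variable \<open>4\<close>; the condition below it introduced by a negation or an
 implication is first bound to \<open>6\<close>, where \<open>tht\<close> expresses that \<open>6\<close> is below \<open>4\<close>.\<close>

definition below :: "fm => fm => fm" where
 "below tht ph = All 6 (Imp tht (All 4 (Imp (Equ 4 6) ph)))"

definition frc_fm :: "nat => fm => fm => fm => fm => fm => fm" where
 "frc_fm c de tht ep et = fold_fm (at2 c ep) (at2 c et) (%ph. below tht (Neg ph)) (%ph psi. below tht (Imp ph psi))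
  (%v ph. All (Suc (dbl c v)) (Imp (at1 c de v) ph))"

lemma Rec_frc_fm: "Rec n F ==> Rec n (%xs. godel (frc_fm c de tht ep et (dec (F xs))))"
proof -
 let ?below = "%x. prod_encode (4, prod_encode (6, prod_encode (3, prod_encode (godel tht,
  prod_encode (4, prod_encode (4, prod_encode (3, prod_encode (godel (Equ 4 6), x))))))))"
 show "Rec n F ==> Rec n (%xs. godel (frc_fm c de tht ep et (dec (F xs))))"
  unfolding frc_fm_def
  by (rule Rec_fold_fm[where t' = "%x. ?below (prod_encode (2, x))" and u' = "%x y. ?below (prod_encode (3, prod_encode (x, y)))"
    and w' = "%x y. prod_encode (4, prod_encode (Suc (dbl c x), prod_encode (3, prod_encode (godel (at1 c de x), y))))"])
   (simp_all add: at1_def at2_def below_def, (intro Rec_intros Rec_double_sum; simp)+)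
qed

lemma fv_frc_fm:
 assumes "6 < c" "fv de <= {..<c}" "fv tht <= {..<c}" "fv ep <= {..<c}" "fv et <= {..<c}" "fv ph <= {..<m}"
 shows "fv (frc_fm c de tht ep et ph) <= {..<dbl c m}"
proof
 have "fv (frc_fm c de tht ep et ph) <= {..<c} Un (%i. Suc (dbl c i)) ` fv ph"
  using assms(1-5) by (induction ph) (auto simp: frc_fm_def below_def at1_def at2_def)
 thus "x:{..<dbl c m}" if "x:fv (frc_fm c de tht ep et ph)" for x
  using that assms(6) by (fastforce simp: dbl_def)
qed

context forcing
begin

text \<open>The clauses of Kripke models. They describe classical forcing because the atomic
  relations are closed under density, a property that \<open>frc_dense\<close> extends to all
  formulas.\<close>

primrec frc :: "'a => (nat => 'a) => fm => bool" where
 "frc p e (Mem i j) <-> (p, e i, e j):Fmem"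
| "frc p e (Equ i j) <-> (p, e i, e j):Feq"
| "frc p e (Neg ph) <-> (ALL q. (q, p):le --> ~frc q e ph)"
| "frc p e (Imp ph psi) <-> (ALL q. (q, p):le --> frc q e ph --> frc q e psi)"
| "frc p e (All v ph) <-> (ALL x:N. frc p (e(v := x)) ph)"

lemma frc_cong: "(!!i. i:fv ph ==> e i = e' i) ==> frc p e ph <-> frc p e' ph"
proof (induction ph arbitrary: p e e')
 case (All v ph)
 have "frc p (e(v := x)) ph <-> frc p (e'(v := x)) ph" for x by (rule All.IH) (use All.prems in auto)
 thus ?case by simp
next
 case (Neg ph)
 have "frc q e ph <-> frc q e' ph" for q by (rule Neg.IH) (use Neg.prems in auto)
 thus ?case by simp
next
 case (Imp ph psi)
 have "frc q e ph <-> frc q e' ph" for q by (rule Imp.IH(1)) (use Imp.prems in auto)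
 moreover have "frc q e psi <-> frc q e' psi" for q by (rule Imp.IH(2)) (use Imp.prems in auto)
 ultimately show ?case by simp
qed auto

lemma frc_mono: "frc p e ph ==> (q, p):le ==> frc q e ph"
proof (induction ph arbitrary: e)
 case (Neg ph)
 thus ?case using le_trans by (metis frc.simps(3))
next
 case (Imp ph psi)
 thus ?case using le_trans by (metis frc.simps(4))
qed (auto intro: Feq_mono Fmem_mono)

lemma frc_dense:
 assumes "p:P" "!!i. i:fv ph ==> e i : N" "!!q. (q, p):le ==> EX r. (r, q):le & frc r e ph"
 shows "frc p e ph"
 using assms
proof (induction ph arbitrary: e p)
 case (Mem i j)
 thus ?case by (auto intro: Fmem_dense)
next
 case (Equ i j)
 thus ?case by (auto intro: Feq_dense)
next
 case (Neg ph)
 have "~frc q e ph" if "(q, p):le" for q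
  using Neg.prems(3)[OF that] frc_mono[of q e ph] le_refl le_P by (metis frc.simps(3))
 thus ?case by simp
next
 case (Imp ph psi)
 have "frc q e psi" if q: "(q, p):le" "frc q e ph" for q
 proof (rule Imp.IH(2))
  show "EX r. (r, q'):le & frc r e psi" if q': "(q', q):le" for q'
  proof -
   obtain r where r: "(r, q'):le" "frc r e (Imp ph psi)" using Imp.prems(3) le_trans[OF q' q(1)] by blast
   moreover have "frc r e ph" using frc_mono[OF q(2)] le_trans[OF r(1) q'] by blast
   ultimately show ?thesis using le_refl le_P by (metis frc.simps(4))
  qed
 qed (use q Imp.prems le_P in auto)
 thus ?case by simp
next
 case (All v ph)
 have "frc p (e(v := x)) ph" if x: "x:N" for x
 proof (rule All.IH[OF All.prems(1)])
  show "(e(v := x)) i : N" if "i:fv ph" for i using All.prems(2)[of i] x that by auto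
  show "EX r. (r, q):le & frc r (e(v := x)) ph" if "(q, p):le" for q using All.prems(3)[OF that] x by auto
 qed
 thus ?case by simp
qed

lemma frc_NegE:
 assumes "p:P" "!!i. i:fv ph ==> e i : N" "~frc p e ph"
 obtains q where "(q, p):le" "frc q e (Neg ph)"
 using frc_dense[of p ph e] assms by auto

text \<open>The indices \<open>0, \<dots>, 4\<close> are those of the relations: being a name, the order (with its arguments
 at \<open>6, 4\<close> and at \<open>4, 6\<close>), and the two forcing relations.\<close>

lemma frc_formulas:
 obtains b c de tht ka ep et where "range b <= V" "6 < c" "fv de <= {..<c}" "fv tht <= {..<c}" "fv ka <= {..<c}"
  "fv ep <= {..<c}" "fv et <= {..<c}"
  "ALL F. (ALL i<c. odd i --> F i = b (i div 2)) --> F 0 : V --> (sat M F de <-> F 0 : N)"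
  "ALL F. (ALL i<c. odd i --> F i = b (i div 2)) --> F 4 : V --> F 6 : V --> (sat M F ka <-> (F 4, F 6):le)"
  "ALL F ph e. (ALL i<c. odd i --> F i = b (i div 2)) --> F 4 : V -->
   (ALL i:fv ph. F (Suc (dbl c i)) = e i & e i : N) --> (sat M F (frc_fm c de tht ep et ph) <-> frc (F 4) e ph)"
proof -
 define R where "R k e = (if k = 0 then e 0 : N else if k = 1 then (e 3, e 2) : le else if k = 2 then (e 2, e 3) : le
  else if k = 3 then (e 2, e 0, e 1) : Fmem else (e 2, e 0, e 1) : Feq)" for k :: nat and e :: "nat => 'a"
 define I :: "nat => nat set" where "I k = (if k = 0 then {0} else if k <= 2 then {4, 6} else {0, 2, 4})" for k
 have dfR: "df M (R k)" for k
  unfolding R_def by (cases "k = 0"; cases "k = 1"; cases "k = 2"; cases "k = 3") (simp_all, (intro dfi le Fmem_def3 Feq_def3)+)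
 have I: "even n" if "n:I k" for n k using that by (auto simp: I_def split: if_splits)
 have dep: "R k e <-> R k e'" if "!!n. 2 * n : I k ==> e n = e' n" for k e e'
  using that[of 0] that[of 1] that[of 2] that[of 3] by (auto simp: R_def I_def split: if_splits)
 obtain b c ch where b: "range b <= V" "6 < c" "ALL k:{..<5}. fv (ch k) <= {..<c}"
  "ALL k:{..<5}. ALL F. (ALL i<c. odd i --> F i = b (i div 2)) & (ALL i:I k. F i : V) -->
   (sat M F (ch k) <-> R k (%n. F (2 * n)))"
  by (rule df_templates[of "{..<5}" M R I, OF _ dfR nonempty I dep]) auto
 have ch: "sat M F (ch k) <-> R k (%n. F (2 * n))" if "ALL i<c. odd i --> F i = b (i div 2)" "ALL i:I k. F i : V" "k < 5" for F k
  using b(4) that by auto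
 have main: "sat M F (frc_fm c (ch 0) (ch 1) (ch 3) (ch 4) ph) <-> frc (F 4) e ph"
  if "ALL i<c. odd i --> F i = b (i div 2)" "F 4 : V" "ALL i:fv ph. F (Suc (dbl c i)) = e i & e i : N" for F ph e
  using that
 proof (induction ph arbitrary: F e)
  case (Mem i j)
  have "sat M F (at2 c (ch 3) i j) <-> sat M (F(0 := e i, 2 := e j)) (ch 3)"
   using Mem(3) b(2) names_V by (auto simp: at2_def)
  also have "... <-> (F 4, e i, e j):Fmem" using Mem names_V by (subst ch) (auto simp: I_def R_def)
  finally show ?case by (simp add: frc_fm_def)
 next
  case (Equ i j)
  have "sat M F (at2 c (ch 4) i j) <-> sat M (F(0 := e i, 2 := e j)) (ch 4)"
   using Equ(3) b(2) names_V by (auto simp: at2_def)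
  also have "... <-> (F 4, e i, e j):Feq" using Equ names_V by (subst ch) (auto simp: I_def R_def)
  finally show ?case by (simp add: frc_fm_def)
 next
  case (All v ph)
  let ?v = "Suc (dbl c v)"
  have 1: "sat M (F(?v := x)) (at1 c (ch 0) v) <-> x:N" if "x:V" for x
  proof -
   have "sat M (F(?v := x)) (at1 c (ch 0) v) <-> sat M (F(?v := x, 0 := x)) (ch 0)"
    using that by (simp add: at1_def)
   also have "... <-> x:N" using that All.prems by (subst ch) (auto simp: I_def R_def)
   finally show ?thesis .
  qed
  have 2: "sat M (F(?v := x)) (frc_fm c (ch 0) (ch 1) (ch 3) (ch 4) ph) <-> frc (F 4) (e(v := x)) ph" if "x:N" for x
  proof -
   have "sat M (F(?v := x)) (frc_fm c (ch 0) (ch 1) (ch 3) (ch 4) ph) <-> frc ((F(?v := x)) 4) (e(v := x)) ph"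
    by (rule All.IH) (use that All.prems b(2) in auto)
   thus ?thesis using b(2) by simp
  qed
  have "sat M F (frc_fm c (ch 0) (ch 1) (ch 3) (ch 4) (All v ph)) <->
    (ALL x:N. sat M (F(?v := x)) (frc_fm c (ch 0) (ch 1) (ch 3) (ch 4) ph))"
   using 1 names_V by (auto simp: frc_fm_def)
  thus ?case using 2 by simp
 next
  case (Neg ph)
  have "sat M (F(6 := q, 4 := q)) (frc_fm c (ch 0) (ch 1) (ch 3) (ch 4) ph) <-> frc q e ph" if "q:V" for q
  proof -
   have "sat M (F(6 := q, 4 := q)) (frc_fm c (ch 0) (ch 1) (ch 3) (ch 4) ph) <-> frc ((F(6 := q, 4 := q)) 4) e ph"
    by (rule Neg.IH) (use Neg.prems that b(2) in auto)
   thus ?thesis by simp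
  qed
  moreover have "sat M (F(6 := q)) (ch 1) <-> (q, F 4):le" if "q:V" for q
   using Neg.prems that by (subst ch) (auto simp: I_def R_def)
  ultimately show ?case using le_P P_V by (auto simp: frc_fm_def below_def)
 next
  case (Imp ph psi)
  have "sat M (F(6 := q, 4 := q)) (frc_fm c (ch 0) (ch 1) (ch 3) (ch 4) ph) <-> frc q e ph"
   "sat M (F(6 := q, 4 := q)) (frc_fm c (ch 0) (ch 1) (ch 3) (ch 4) psi) <-> frc q e psi" if "q:V" for q
  proof -
   have "sat M (F(6 := q, 4 := q)) (frc_fm c (ch 0) (ch 1) (ch 3) (ch 4) ph) <-> frc ((F(6 := q, 4 := q)) 4) e ph"
    by (rule Imp.IH(1)) (use Imp.prems that b(2) in auto)
   moreover have "sat M (F(6 := q, 4 := q)) (frc_fm c (ch 0) (ch 1) (ch 3) (ch 4) psi) <-> frc ((F(6 := q, 4 := q)) 4) e psi"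
    by (rule Imp.IH(2)) (use Imp.prems that b(2) in auto)
   ultimately show "sat M (F(6 := q, 4 := q)) (frc_fm c (ch 0) (ch 1) (ch 3) (ch 4) ph) <-> frc q e ph"
    "sat M (F(6 := q, 4 := q)) (frc_fm c (ch 0) (ch 1) (ch 3) (ch 4) psi) <-> frc q e psi" by simp_all
  qed
  moreover have "sat M (F(6 := q)) (ch 1) <-> (q, F 4):le" if "q:V" for q
   using Imp.prems that by (subst ch) (auto simp: I_def R_def)
  ultimately show ?case using le_P P_V by (auto simp: frc_fm_def below_def)
 qed
 show ?thesis
 proof (rule that[of b c "ch 0" "ch 1" "ch 2" "ch 3" "ch 4"])
  show "ALL F. (ALL i<c. odd i --> F i = b (i div 2)) --> F 0 : V --> (sat M F (ch 0) <-> F 0 : N)"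
   "ALL F. (ALL i<c. odd i --> F i = b (i div 2)) --> F 4 : V --> F 6 : V --> (sat M F (ch 2) <-> (F 4, F 6):le)"
   using ch[of _ 0] ch[of _ 2] by (simp_all add: I_def R_def)
 qed (use b main in auto)
qed

lemma names_nonempty: "emp : N"
 by (rule nameI) auto

text \<open>Sends everything that is not a name to the empty name, so that forcing with arbitrary
  definable terms is definable without side conditions.\<close>

definition nm :: "'a => 'a" where "nm x = (if x : N then x else emp)"

lemma nm: "x:N ==> nm x = x" "nm x : N" "dft M f ==> dft M (%e. nm (f e))"
 using names_nonempty unfolding nm_def by (simp, simp, intro dfi empty_in_V)

lemma df_frc_terms:
 assumes u: "dft M u" and t: "!!i. dft M (t i)"
 shows "df M (%f. frc (u f) (%i. nm (t i f)) ph)"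
proof -
 obtain b c de tht ka ep et where b: "range b <= V" "6 < c" and main: "ALL F ph e. (ALL i<c. odd i --> F i = b (i div 2)) --> F 4 : V -->
   (ALL i:fv ph. F (Suc (dbl c i)) = e i & e i : N) --> (sat M F (frc_fm c de tht ep et ph) <-> frc (F 4) e ph)"
  by (rule frc_formulas) blast
 define F where "F i f = (if i = 4 then u f else if i < c then b (i div 2) else nm (t ((i - c) div 2) f))" for i and f :: "nat => 'a"
 have "dft M (F i)" for i
  unfolding F_def using b(1) by (cases "i = 4"; cases "i < c") (auto intro!: dfi u nm t)
 hence "df M (%f. sat M (%i. F i f) (frc_fm c de tht ep et ph))"
  by (intro df_sat_terms df_V nonempty) (auto intro!: dfi)
 moreover have "sat M (%i. F i f) (frc_fm c de tht ep et ph) <-> frc (u f) (%i. nm (t i f)) ph" if "range f <= V" for f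
 proof -
  have "ALL i<c. odd i --> F i f = b (i div 2)" by (auto simp: F_def)
  moreover have "F (Suc (dbl c i)) f = nm (t i f)" for i using b(2) by (simp add: F_def dbl_def)
  moreover have "F 4 f = u f" by (simp add: F_def)
  ultimately show ?thesis using main[THEN spec, of "%i. F i f"] dft_in[OF u that] nm(2) by simp
 qed
 ultimately show ?thesis by (rule df_cong[THEN iffD1, rotated]) blast
qed

lemma df_frc:
 assumes "!!i. i:fv ph ==> e i : N"
 shows "df M (%f. frc (f 0) e ph)"
proof -
 have "df M (%f. frc (f 0) (%i. nm (nm (e i))) ph)"
  using nm(2) names_V by (intro df_frc_terms dfi) blast
 moreover have "frc p (%i. nm (nm (e i))) ph <-> frc p e ph" for p by (rule frc_cong) (simp add: assms nm(1))
 ultimately show ?thesis by simp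
qed

lemma df_frc_upd:
 assumes "!!i. i:fv ph ==> i ~= v ==> e i : N"
 shows "df M (%f. f 1 : N & frc (f 0) (e(v := f 1)) ph)"
proof -
 have "dft M (%f. if i = v then f 1 else nm (e i))" for i
  using nm(2) names_V by (cases "i = v") (auto intro!: dfi)
 hence "df M (%f. frc (f 0) (%i. nm (if i = v then f 1 else nm (e i))) ph)"
  by (rule df_frc_terms[OF dft_var[OF nonempty]])
 hence "df M (%f. f 1 : N & frc (f 0) (%i. nm (if i = v then f 1 else nm (e i))) ph)"
  by (rule df_conj[OF df_names[OF dft_var[OF nonempty]]])
 moreover have "frc p (%i. nm (if i = v then x else nm (e i))) ph <-> frc p (e(v := x)) ph" if "x:N" for p x
  by (rule frc_cong) (use assms that in "auto simp: nm(1)")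
 ultimately show ?thesis by (auto elim!: df_cong[THEN iffD1, rotated])
qed

end

section \<open>Generic filters and the truth theorem\<close>

locale generic = forcing +
 fixes G :: "'a set"
 assumes G: "generic_filter P le (classes_of M) G"
begin

lemma G_P: "p:G ==> p:P"
 and G_up: "p:G ==> (p, q):le ==> q:G"
 and G_ne: "G ~= {}"
 and G_dir: "p:G ==> q:G ==> EX r:G. (r, p):le & (r, q):le"
 by (use G[unfolded generic_filter_def, THEN conjunct1] in blast,
   use G[unfolded generic_filter_def, THEN conjunct2, THEN conjunct2, THEN conjunct1] le_P in blast,
   rule G[unfolded generic_filter_def, THEN conjunct2, THEN conjunct1],
   use G[unfolded generic_filter_def, THEN conjunct2, THEN conjunct2, THEN conjunct2, THEN conjunct1] in blast)

text \<open>Density below a condition \<open>p\<close> of \<open>G\<close> is enough: adding the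
  conditions incompatible with \<open>p\<close> makes the class dense, and none of these can belong
  to \<open>G\<close>.\<close>

lemma G_meets:
 assumes "df M (%e. D (e 0))" "p:G" "!!q. (q, p):le ==> EX r. (r, q):le & D r"
 obtains r where "r:G" "(r, p):le" "D r"
proof -
 define D' where "D' = {r:P. (D r & (r, p):le) | ~(EX s:V. (s, r):le & (s, p):le)}"
 have pV: "p:V" using assms(2) G_P P_V by blast
 have "df M (%e. e 0 : P & ((D (e 0) & (e 0, p):le) | ~(EX s:V. (s, e 0):le & (s, p):le)))"
  by (intro dfi assms(1) P le pV)
 hence "definable1 M D'" using P_V by (subst definable1_df) (auto simp: D'_def)
 moreover have "dense_in P le D'" unfolding dense_in_def
 proof (intro conjI ballI)
  fix q assume q: "q:P"
  show "EX d:D'. (d, q):le"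
  proof (cases "EX s:V. (s, q):le & (s, p):le")
   case True
   then obtain s where s: "(s, q):le" "(s, p):le" by blast
   then obtain r where r: "(r, s):le" "D r" using assms(3) by blast
   hence "r:D'" using le_P(1)[OF r(1)] le_trans[OF r(1) s(2)] by (simp add: D'_def)
   thus ?thesis using le_trans[OF r(1) s(1)] by blast
  next
   case False
   thus ?thesis using q le_refl by (intro bexI[of _ q]) (auto simp: D'_def)
  qed
 qed (auto simp: D'_def)
 ultimately have "D' Int G ~= {}" using G unfolding generic_filter_def classes_of_def by blast
 then obtain r where r: "r:D'" "r:G" by blast
 obtain s where "s:G" "(s, r):le" "(s, p):le" using G_dir[OF r(2) assms(2)] by blast
 hence "D r & (r, p):le" using r(1) G_P P_V by (auto simp: D'_def)
 thus ?thesis using that r by blast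
qed

abbreviation Q :: "'a set struct" where "Q == generic_ext M P Feq Fmem G"

definition cls :: "'a => 'a set" where "cls si = name_eq M P Feq G `` {si}"

lemma name_eq_equiv: "equiv N (name_eq M P Feq G)"
proof (rule equivI)
 show "refl_on N (name_eq M P Feq G)" using G_ne Feq_refl G_P by (auto simp: refl_on_def name_eq_def)
 show "sym (name_eq M P Feq G)" using Feq_sym by (auto simp: sym_def name_eq_def)
 show "trans (name_eq M P Feq G)"
 proof (rule transI)
  fix x y z assume "(x, y):name_eq M P Feq G" "(y, z):name_eq M P Feq G"
  then obtain p q where *: "p:G" "q:G" "(p, x, y):Feq" "(q, y, z):Feq" "x:N" "z:N" by (auto simp: name_eq_def)
  then obtain r where r: "r:G" "(r, p):le" "(r, q):le" using G_dir by blast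
  have "(r, x, z):Feq" using Feq_trans[OF Feq_mono[OF *(3) r(2)] Feq_mono[OF *(4) r(3)]] .
  thus "(x, z):name_eq M P Feq G" using * r(1) unfolding name_eq_def by blast
 qed
qed (auto simp: name_eq_def)

lemma carr_Q: "carr Q = cls ` N"
 by (auto simp: generic_ext_def quotient_def cls_def)

lemma cls_eq: "si:N ==> ta:N ==> cls si = cls ta <-> (EX p:G. (p, si, ta):Feq)"
 unfolding cls_def by (subst eq_equiv_class_iff[OF name_eq_equiv]) (auto simp: name_eq_def)

lemma cls_mem:
 assumes "si:N" "ta:N"
 shows "(cls si, cls ta):mem Q <-> (EX p:G. (p, si, ta):Fmem)"
proof
 assume "(cls si, cls ta):mem Q"
 then obtain si' ta' p where *: "cls si = cls si'" "cls ta = cls ta'" "si':N" "ta':N" "p:G" "(p, si', ta'):Fmem"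
  by (auto simp: generic_ext_def cls_def)
 then obtain q q' where q: "q:G" "(q, si', si):Feq" "q':G" "(q', ta', ta):Feq"
  using assms by (metis cls_eq)
 obtain r0 where "r0:G" "(r0, q):le" "(r0, q'):le" using G_dir q by blast
 moreover then obtain r where "r:G" "(r, r0):le" "(r, p):le" using G_dir *(5) by blast
 ultimately show "EX p:G. (p, si, ta):Fmem"
  using Fmem_Feq1 Fmem_Feq2 Feq_mono Fmem_mono *(6) q(2,4) le_trans by meson
qed (use assms in "auto simp: generic_ext_def cls_def")

lemma struct_Q: "is_struct Q"
 using names_nonempty by (auto simp: is_struct_def carr_Q) (auto simp: generic_ext_def cls_def)

lemma decide:
 assumes "!!i. i:fv ph ==> e i : N"
 shows "EX p:G. frc p e ph | frc p e (Neg ph)"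
proof -
 obtain p where p: "p:G" using G_ne by blast
 have "df M (%f. frc (f 0) e ph | frc (f 0) e (Neg ph))" using assms by (intro df_disj df_frc) auto
 then obtain r where "r:G" "frc r e ph | frc r e (Neg ph)"
 proof (rule G_meets[where D = "%r. frc r e ph | frc r e (Neg ph)", OF _ p])
  show "EX r. (r, q):le & (frc r e ph | frc r e (Neg ph))" if "(q, p):le" for q
   using le_P(1)[OF that] le_refl assms by (metis frc_NegE)
 qed blast
 thus ?thesis by blast
qed

lemma frc_compatible:
 assumes "p:G" "q:G" "frc p e ph" "frc q e (Neg ph)"
 shows False
 using G_dir[OF assms(1,2)] assms(3,4) frc_mono by auto

theorem truth:
 assumes "!!i. i:fv ph ==> e i : N"
 shows "sat Q (%i. cls (e i)) ph <-> (EX p:G. frc p e ph)"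
 using assms
proof (induction ph arbitrary: e)
 case (Mem i j)
 thus ?case using cls_mem by simp
next
 case (Equ i j)
 thus ?case using cls_eq by simp
next
 case (Neg ph)
 hence "sat Q (%i. cls (e i)) (Neg ph) <-> ~(EX p:G. frc p e ph)" by simp
 also have "... <-> (EX p:G. frc p e (Neg ph))" using decide[of ph e] Neg.prems frc_compatible by (metis fv.simps(3))
 finally show ?case .
next
 case (Imp ph psi)
 have ph: "i:fv ph ==> e i : N" and psi: "i:fv psi ==> e i : N" for i using Imp.prems by auto
 have "sat Q (%i. cls (e i)) (Imp ph psi) <-> ((EX p:G. frc p e ph) --> (EX p:G. frc p e psi))"
  using Imp.IH ph psi by simp
 also have "... <-> (EX p:G. frc p e (Imp ph psi))"
 proof
  assume *: "(EX p:G. frc p e ph) --> (EX p:G. frc p e psi)"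
  consider "EX p:G. frc p e (Neg ph)" | "EX p:G. frc p e psi" using decide[of ph e] ph * by blast
  thus "EX p:G. frc p e (Imp ph psi)" by cases (use frc_mono in "force intro: frc_mono")+
 next
  assume "EX p:G. frc p e (Imp ph psi)"
  thus "(EX p:G. frc p e ph) --> (EX p:G. frc p e psi)" using G_dir frc_mono by (metis frc.simps(4))
 qed
 finally show ?case .
next
 case (All v ph)
 have e: "i:fv ph ==> (e(v := x)) i : N" if "x:N" for x i using All.prems that by auto
 have upd: "(%i. cls (e i))(v := cls x) = (%i. cls ((e(v := x)) i))" for x by (rule HOL.ext) simp
 have "sat Q (%i. cls (e i)) (All v ph) <-> (ALL x:N. EX p:G. frc p (e(v := x)) ph)"
 proof -
  have "sat Q (%i. cls ((e(v := x)) i)) ph <-> (EX p:G. frc p (e(v := x)) ph)" if "x:N" for x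
   by (rule All.IH) (rule e[OF that])
  thus ?thesis unfolding sat.simps carr_Q by (simp add: upd del: fun_upd_apply)
 qed
 also have "... <-> (EX p:G. frc p e (All v ph))"
 proof
  assume *: "ALL x:N. EX p:G. frc p (e(v := x)) ph"
  show "EX p:G. frc p e (All v ph)"
  proof (rule ccontr)
   assume "~(EX p:G. frc p e (All v ph))"
   \<comment> \<open>Below a condition forcing the negated universal formula, the conditions that
     refute one particular name are dense. By \<open>df_frc_upd\<close> they form a definable class,
     so \<open>G\<close> contains one, against the truth of all instances.\<close>
   then obtain p where p: "p:G" "frc p e (Neg (All v ph))" using decide[of "All v ph" e] All.prems by blast
   have "df M (%f. f 1 : N & frc (f 0) (e(v := f 1)) (Neg ph))" using All.prems by (intro df_frc_upd) auto
   hence "df M (%f. f 0 : N & frc (f (Suc 0)) (e(v := f 0)) (Neg ph))"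
    by (rule df_rel2[where R = "%r x. x:N & frc r (e(v := x)) (Neg ph)", OF _ dft_var[OF nonempty] dft_var[OF nonempty]])
   hence "df M (%f. EX x:V. x:N & frc (f 0) (e(v := x)) (Neg ph))"
    by (rule df_Bex[where P = "%x f. x:N & frc (f 0) (e(v := x)) (Neg ph)"])
   then obtain r where r: "r:G" "EX x:V. x:N & frc r (e(v := x)) (Neg ph)"
   proof (rule G_meets[where D = "%r. EX x:V. x:N & frc r (e(v := x)) (Neg ph)", OF _ p(1)])
    fix q assume q: "(q, p):le"
    then obtain x where x: "x:N" "~frc q (e(v := x)) ph" using p(2) by auto
    obtain r where "(r, q):le" "frc r (e(v := x)) (Neg ph)"
     using frc_NegE[OF le_P(1)[OF q] e[OF x(1)] x(2)] by blast
    thus "EX r. (r, q):le & (EX x:V. x:N & frc r (e(v := x)) (Neg ph))" using x(1) names_V by blast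
   qed blast
   thus False using * frc_compatible by blast
  qed
 next
  assume "EX p:G. frc p e (All v ph)"
  thus "ALL x:N. EX p:G. frc p (e(v := x)) ph" by auto
 qed
 finally show ?case .
qed

end

section \<open>Countably many programs, and filters meeting countably many dense sets\<close>

datatype prog = Zero | Succ | Proj nat | Comp prog "prog list" | PrimRec prog prog | Minim prog

instance prog :: countable by countable_datatype
instance fm :: countable by countable_datatype

primrec run :: "prog => nat list => nat" where
 "run Zero xs = 0"
| "run Succ xs = Suc (xs ! 0)"
| "run (Proj i) xs = xs ! i"
| "run (Comp f gs) xs = run f (map (%g. g xs) (map run gs))"
| "run (PrimRec f g) xs = rec_nat (run f (tl xs)) (%k r. run g (k # r # tl xs)) (hd xs)"
| "run (Minim f) xs = (LEAST y. run f (y # xs) = 0)"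

text \<open>\<open>run\<close> interprets programs without checking arities; what matters is that
  every recursive function has a program, which bounds the number of such functions.\<close>

lemma recursive_fun_run: "recursive_fun n f ==> EX c. f = run c"
proof (induction rule: recursive_fun.induct)
 case (zero n)
 show ?case by (rule exI[of _ Zero]) auto
next
 case succ
 show ?case by (rule exI[of _ Succ]) auto
next
 case (proj i n)
 show ?case by (rule exI[of _ "Proj i"]) auto
next
 case (comp gs f n)
 obtain c where c: "f = run c" using comp by blast
 have "ALL g:set gs. EX d. g = run d" using comp by blast
 then obtain D where "ALL g:set gs. g = run (D g)" by metis
 hence "map run (map D gs) = gs" by (auto intro: map_idI)
 thus ?case using c by (intro exI[of _ "Comp c (map D gs)"]) (auto simp: fun_eq_iff simp del: map_map)
next
 case (prim_rec n f g)
 then obtain c d where "f = run c" "g = run d" by blast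
 thus ?case by (intro exI[of _ "PrimRec c d"]) auto
next
 case (minimize n f)
 then obtain c where "f = run c" by blast
 thus ?case by (intro exI[of _ "Minim c"]) auto
qed

lemma countable_computable: "countable {A. computable_set A}"
proof (rule countable_subset)
 show "{A. computable_set A} <= range (%c. {x. run c [x] = 1})"
 proof
  fix A assume "A:{A. computable_set A}"
  then obtain f where f: "recursive_fun 1 f" "!!x. f [x] = (if x : A then 1 else 0)" by (auto simp: computable_set_def)
  then obtain c where "f = run c" using recursive_fun_run by blast
  hence "A = {x. run c [x] = 1}" using f(2) by (auto split: if_splits)
  thus "A:range (%c. {x. run c [x] = 1})" by blast
 qed
qed simp

lemma countable_computable_types: "countable {p :: fm set. computable_set (godel ` p)}"
proof (rule countable_subset)
 show "{p :: fm set. computable_set (godel ` p)} <= (%A. {ph. godel ph : A}) ` {A. computable_set A}"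
 proof
  fix p :: "fm set" assume "p:{p. computable_set (godel ` p)}"
  moreover have "p = {ph. godel ph : godel ` p}" by (auto dest: arg_cong[of _ _ dec])
  ultimately show "p:(%A. {ph. godel ph : A}) ` {A. computable_set A}" by blast
 qed
qed (use countable_computable in auto)

lemma rasiowa_sikorski:
 assumes fn: "forcing_notion P le" and cnt: "countable F" and dense: "!!D. D:F ==> dense_in P le D" and p: "p:P"
 obtains G where "generic_filter P le F G" "p:G"
proof -
 have refl: "q:P ==> (q, q):le" and trans: "(r, q):le ==> (q, s):le ==> (r, s):le"
  and leP: "(q, r):le ==> q:P & r:P" for q r s
  using fn unfolding forcing_notion_def by (auto simp: refl_on_def dest: transD)
 have dP: "dense_in P le P" using refl by (auto simp: dense_in_def)
 \<comment> \<open>\<open>P\<close> itself is dense and is inserted so that the enumerated family is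
   nonempty.\<close>
 define D where "D n = from_nat_into (insert P F) n" for n
 have D: "dense_in P le (D n)" for n
  using from_nat_into[of "insert P F" n] dense dP by (auto simp: D_def)
 obtain s where s: "s 0 = p" "!!n. s n : P" "!!n. (s (Suc n), s n) : le & s (Suc n) : D n"
 proof -
  have "EX y. y:P & (y, q):le & y:D n" if "q:P" for q n
   using D[of n] that unfolding dense_in_def by blast
  hence "EX s. ALL n. (s n : P & (n = 0 --> s n = p)) & ((s (Suc n), s n) : le & s (Suc n) : D n)"
   using p by (intro dependent_nat_choice) auto
  thus ?thesis using that by blast
 qed
 have dec: "m <= n ==> (s n, s m):le" for m n
  by (induction n rule: dec_induct) (use s refl trans in blast)+
 define G where "G = {q:P. EX n. (s n, q):le}"
 have sG: "s n : G" for n using s(2) refl by (auto simp: G_def)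
 have "EX r:G. (r, q1):le & (r, q2):le" if q: "q1:G" "q2:G" for q1 q2
 proof -
  obtain m n where "(s m, q1):le" "(s n, q2):le" using q by (auto simp: G_def)
  thus ?thesis using sG[of "max m n"] dec[of m "max m n"] dec[of n "max m n"] trans by (metis max.cobounded1 max.cobounded2)
 qed
 moreover have "A Int G ~= {}" if A: "A:F" for A
 proof -
  obtain n where "A = D n" using from_nat_into_surj[of "insert P F" A] cnt A by (auto simp: D_def)
  thus ?thesis using s(3) sG by blast
 qed
 moreover have "q:G" if "r:G" "q:P" "(r, q):le" for r q using that trans unfolding G_def by blast
 moreover have "G <= P" "G ~= {}" using sG[of 0] by (auto simp: G_def)
 ultimately have "generic_filter P le F G" unfolding generic_filter_def by blast
 thus ?thesis using that sG[of 0] s(1) by simp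
qed

lemma countable_classes_of:
 assumes "countable (carr M)" "carr M ~= {}"
 shows "countable (classes_of M)"
proof -
 obtain z where z: "z:carr M" using assms by blast
 let ?f = "%(ph, l). def1 M ph (%i. if i < length l then l ! i else z)"
 have "classes_of M <= ?f ` (UNIV \<times> lists (carr M))"
 proof
  fix D assume "D:classes_of M"
  then obtain ph a where a: "range a <= carr M" "D = def1 M ph a" by (auto simp: classes_of_def definable1_def)
  obtain n where n: "fv ph <= {..<n}" using fv_bound by blast
  define l where "l = map a [0..<n]"
  have "D = def1 M ph (%i. if i < length l then l ! i else z)"
   unfolding a(2) def1_def by (intro Collect_cong conj_cong refl sat_cong) (use n in "auto simp: l_def")
  moreover have "set l <= carr M" using a(1) unfolding l_def by fastforce
  ultimately show "D:?f ` (UNIV \<times> lists (carr M))" by (intro image_eqI[of _ _ "(ph, l)"]) auto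
 qed
 thus ?thesis by (rule countable_subset) (use assms in auto)
qed

section \<open>Saturation of generic extensions\<close>

context forcing
begin

text \<open>A condition in this set either forces a tuple of names to realize the type or excludes some
 finite part of it.\<close>

definition type_cond :: "fm set => nat => 'a list => 'a set" where
 "type_cond p k as = {q : P. (EX xs. length xs = k & set xs <= N & (ALL ph:p. frc q ((!) (xs @ as)) ph)) |
   (EX t<=p. finite t & (ALL r xs. (r, q) : le & length xs = k & set xs <= N --> ~(ALL ph:t. frc r ((!) (xs @ as)) ph)))}"

text \<open>Suppose that no finite part of \<open>p\<close> is excluded at \<open>q0\<close>. Then
  "\<open>u\<close> is below \<open>q0\<close> and forces \<open>p\<close> of the names
  \<open>xs\<close>" is a finitely realized computable type of \<open>M\<close> in the unknowns
  \<open>u\<close> and \<open>xs\<close>, and saturation of \<open>M\<close> yields the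
  condition.\<close>

lemma type_cond_dense:
 assumes sat: "computably_saturated M" and comp: "computable_set (godel ` p)"
  and p: "ALL ph:p. fv ph <= {..<k + length as}" and as: "set as <= N"
 shows "dense_in P le (type_cond p k as)"
 unfolding dense_in_def
proof (intro conjI ballI)
 fix q0 assume q0: "q0:P"
 show "EX d:type_cond p k as. (d, q0):le"
 proof (cases "EX t<=p. finite t & (ALL r xs. (r, q0):le & length xs = k & set xs <= N --> ~(ALL ph:t. frc r ((!) (xs @ as)) ph))")
  case True
  thus ?thesis using q0 le_refl by (intro bexI[of _ q0]) (auto simp: type_cond_def)
 next
  case False
  hence fin: "EX r xs. (r, q0):le & length xs = k & set xs <= N & (ALL ph:t. frc r ((!) (xs @ as)) ph)"
   if "t <= p" "finite t" for t using that by meson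
  obtain b c de tht ka ep et where b: "range b <= V" "6 < c" and fvs: "fv de <= {..<c}" "fv tht <= {..<c}" "fv ka <= {..<c}"
   "fv ep <= {..<c}" "fv et <= {..<c}"
   and de: "ALL F. (ALL i<c. odd i --> F i = b (i div 2)) --> F 0 : V --> (sat M F de <-> F 0 : N)"
   and ka: "ALL F. (ALL i<c. odd i --> F i = b (i div 2)) --> F 4 : V --> F 6 : V --> (sat M F ka <-> (F 4, F 6):le)"
   and main: "ALL F ph e. (ALL i<c. odd i --> F i = b (i div 2)) --> F 4 : V -->
    (ALL i:fv ph. F (Suc (dbl c i)) = e i & e i : N) --> (sat M F (frc_fm c de tht ep et ph) <-> frc (F 4) e ph)"
   by (rule frc_formulas) blast
  define T where "T ph = Con ka (frc_fm c de tht ep et ph)" for ph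
  have q0V: "q0:V" using q0 P_V by blast
  have NV: "N <= V" using names_V by blast
  have "EX u:V. EX xs. length xs = k & set xs <= N & (ALL ph:p. (u, q0):le & frc u ((!) (xs @ as)) ph)"
  proof (rule saturated_translation[OF sat q0V NV names_nonempty b, where TT = T and de = de])
   show "Rec n (%xs. godel (T (dec (F xs))))" if "Rec n F" for n F
    unfolding T_def using that by (intro Rec_godel_Con Rec_const Rec_frc_fm)
   show "fv (T ph) <= {..<dbl c m}" if "fv ph <= {..<m}" for ph m
    using fv_frc_fm[OF b(2) fvs(1,2,4,5) that] fvs(3) by (auto simp: T_def dbl_def)
   show "sat M F (at1 c de i) <-> F (Suc (dbl c i)) : N"
    if "!!i. i < c ==> odd i ==> F i = b (i div 2)" "F (Suc (dbl c i)) : V" for F i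
   proof -
    have "sat M F (at1 c de i) <-> sat M (F(0 := F (Suc (dbl c i)))) de" using that(2) by (simp add: at1_def)
    also have "... <-> F (Suc (dbl c i)) : N" using de that by simp
    finally show ?thesis .
   qed
   show "sat M F (T ph) <-> (F 4, q0):le & frc (F 4) e ph"
    if "!!i. i < c ==> odd i ==> F i = b (i div 2)" "F 4 : V" "F 6 = q0"
     "!!i. i:fv ph ==> F (Suc (dbl c i)) = e i & e i : N" for F ph e
   proof -
    have "sat M F (frc_fm c de tht ep et ph) <-> frc (F 4) e ph" using main that by blast
    thus ?thesis unfolding T_def sat_Con using ka[THEN spec, of F] that q0V by simp
   qed
   fix t assume t: "t <= p" "finite t"
   obtain r xs where "(r, q0):le" "length xs = k" "set xs <= N" "ALL ph:t. frc r ((!) (xs @ as)) ph"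
    using fin[OF t] by blast
   thus "EX u:V. EX xs. length xs = k & set xs <= N & (ALL ph:t. (u, q0):le & frc u ((!) (xs @ as)) ph)"
    using le_P P_V by blast
  qed (use fvs as p comp in auto)
  then obtain u xs where u: "u:V" "length xs = k" "set xs <= N" "ALL ph:p. (u, q0):le & frc u ((!) (xs @ as)) ph" by blast
  \<comment> \<open>For empty \<open>p\<close> the translated type has no formula that would place
    \<open>u\<close> below \<open>q0\<close>.\<close>
  show ?thesis
  proof (cases "p = {}")
   case True
   hence "q0:type_cond p k as" using fin[of "{}"] q0 by (auto simp: type_cond_def)
   thus ?thesis using q0 le_refl by blast
  next
   case False
   hence "(u, q0):le" using u(4) by blast
   moreover have "u:type_cond p k as" unfolding type_cond_def using u le_P calculation by blast
   ultimately show ?thesis by blast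
  qed
 qed
qed (auto simp: type_cond_def)

theorem generic_saturated:
 assumes sat: "computably_saturated M" and cnt: "countable V" and p0: "p0:P"
 obtains G where "generic_filter P le (classes_of M) G" "p0:G" "computably_saturated (generic_ext M P Feq Fmem G)"
proof -
 define types where "types = {(p, k, as). computable_set (godel ` p) & set as <= N & (ALL ph:p. fv ph <= {..<k + length as})}"
 have "types <= {p. computable_set (godel ` p)} \<times> UNIV \<times> lists V" using names_V by (auto simp: types_def)
 hence cnt_t: "countable types"
  by (rule countable_subset) (auto intro!: countable_SIGMA countable_computable_types cnt)
 define F where "F = {D:classes_of M. dense_in P le D} Un (%(p, k, as). type_cond p k as) ` types"
 have cF: "countable F"
  using countable_classes_of[OF cnt nonempty] cnt_t by (auto simp: F_def intro: countable_subset[of _ "classes_of M"])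
 have dF: "dense_in P le D" if D: "D:F" for D
 proof (cases "dense_in P le D")
  case False
  then obtain p k as where "(p, k, as):types" "D = type_cond p k as" using D by (auto simp: F_def)
  thus ?thesis using type_cond_dense[OF sat, of p k as] by (auto simp: types_def)
 qed
 obtain G where filter: "generic_filter P le F G" "p0:G" by (rule rasiowa_sikorski[OF fn cF dF p0])
 have meets: "D Int G ~= {}" if "D:F" for D
  using filter(1) dF[OF that] that unfolding generic_filter_def by (elim conjE) (drule bspec[where x = D], assumption, blast)
 have gen: "generic_filter P le (classes_of M) G"
  using filter(1) unfolding generic_filter_def by (elim conjE, intro conjI) (assumption+, use meets in "auto simp: F_def")
 interpret generic M P le Feq Fmem G by unfold_locales (rule gen)
 have "computably_saturated Q"
  unfolding computably_saturated_def
 proof (intro allI impI; elim conjE)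
  fix as k p
  assume as: "set as <= carr Q" and p: "ALL ph:p. fv ph <= {..<k + length as}" and comp: "computable_set (godel ` p)"
   and fin: "ALL q<=p. finite q --> (EX xs. length xs = k & set xs <= carr Q & realizes Q as xs q)"
  have "ALL x:carr Q. EX si:N. cls si = x" by (auto simp: carr_Q)
  then obtain rep where rep: "ALL x:carr Q. rep x : N & cls (rep x) = x" by metis
  define as' where "as' = map rep as"
  have as': "set as' <= N" "map cls as' = as" "length as' = length as"
   using rep as by (auto simp: as'_def intro!: map_idI)
  have real: "(ALL ph:t. sat Q ((!) (map cls xs @ as)) ph) <-> (ALL ph:t. EX r:G. frc r ((!) (xs @ as')) ph)"
   if t: "t <= p" "length xs = k" "set xs <= N" for t xs
  proof (rule ball_cong[OF refl])
   fix ph assume "ph:t"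
   hence fv: "fv ph <= {..<k + length as}" using p t by blast
   have "sat Q ((!) (map cls xs @ as)) ph <-> sat Q (%i. cls ((xs @ as') ! i)) ph"
   proof (rule sat_cong)
    fix i assume "i:fv ph"
    hence "i < length (xs @ as')" using fv t as'(3) by auto
    thus "(map cls xs @ as) ! i = cls ((xs @ as') ! i)" using as'(2) by (metis map_append nth_map)
   qed
   also have "... <-> (EX r:G. frc r ((!) (xs @ as')) ph)"
   proof (rule truth)
    fix i assume "i:fv ph"
    hence "i < length (xs @ as')" using fv t as'(3) by auto
    thus "(xs @ as') ! i : N" using t(3) as'(1) nth_mem[of i "xs @ as'"] by auto
   qed
   finally show "sat Q ((!) (map cls xs @ as)) ph <-> (EX r:G. frc r ((!) (xs @ as')) ph)" .
  qed
  have "(p, k, as'):types"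
   unfolding types_def using comp as' p by simp
  hence "type_cond p k as' : F" by (force simp: F_def)
  then obtain q where q: "q:G" "q:type_cond p k as'" using meets[of "type_cond p k as'"] by blast
  from q(2) consider xs where "length xs = k" "set xs <= N" "ALL ph:p. frc q ((!) (xs @ as')) ph"
   | t where "t <= p" "finite t" "ALL r xs. (r, q):le & length xs = k & set xs <= N --> ~(ALL ph:t. frc r ((!) (xs @ as')) ph)"
   unfolding type_cond_def by blast
  thus "EX xs. length xs = k & set xs <= carr Q & realizes Q as xs p"
  proof cases
   case 1
   thus ?thesis using real[of p xs] q(1) by (intro exI[of _ "map cls xs"]) (auto simp: realizes_def carr_Q)
  next
   \<comment> \<open>The finite part \<open>t\<close> is realized in the extension, so each of its
     formulas is forced by some condition in \<open>G\<close>. A common extension below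
     \<open>q\<close> contradicts the exclusion.\<close>
   case 2
   then obtain ys where ys: "length ys = k" "set ys <= carr Q" "realizes Q as ys t" using fin by blast
   have xs: "map cls (map rep ys) = ys" "set (map rep ys) <= N" using rep ys(2) by (auto intro!: map_idI)
   have "EX r:G. (r, q):le & (ALL ph:t'. frc r ((!) (map rep ys @ as')) ph)" if "finite t'" "t' <= t" for t'
    using that
   proof (induction t')
    case empty
    thus ?case using q(1) le_refl G_P by blast
   next
    case (insert ph t')
    then obtain r where r: "r:G" "(r, q):le" "ALL ph:t'. frc r ((!) (map rep ys @ as')) ph" by auto
    obtain s where s: "s:G" "frc s ((!) (map rep ys @ as')) ph"
     using real[of t "map rep ys"] 2(1) ys xs insert.prems by (auto simp: realizes_def simp del: map_map)
    obtain u where "u:G" "(u, r):le" "(u, s):le" using G_dir r(1) s(1) by blast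
    thus ?case using r s frc_mono le_trans by (intro bexI[of _ u]) blast+
   qed
   then obtain r where "(r, q):le" "ALL ph:t. frc r ((!) (map rep ys @ as')) ph" using 2(2) by blast
   thus ?thesis using 2(3) ys(1) xs(2) by (metis length_map)
  qed
 qed
 thus ?thesis using that gen filter(2) by blast
qed

lemma generic_copy:
 assumes inf: "infinite (UNIV :: 'a set)" and cnt: "countable V"
  and G: "generic_filter P le (classes_of M) G" and sat: "computably_saturated (generic_ext M P Feq Fmem G)"
  and zfc: "is_model (generic_ext M P Feq Fmem G) zfc"
 shows "EX B:(CSM :: 'a struct set). is_generic_ext M P le G B"
proof -
 interpret generic M P le Feq Fmem G by unfold_locales (rule G)
 have "countable N" using names_V by (intro countable_subset[OF _ cnt]) auto
 hence "countable (carr Q)" by (simp add: carr_Q)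
 then obtain h and B :: "'a struct" where B: "struct_iso h Q B" "mem B <= carr B \<times> carr B" "countable (carr B)"
  using countable_copy[OF inf] by blast
 hence "B:CSM"
  using is_model_iso[OF B(1) zfc] computably_saturated_iso[OF B(1) sat] by (simp add: countable_saturated_models_def)
 moreover have "is_generic_ext M P le G B" using af B(1) unfolding is_generic_ext_def isomorphic_def by blast
 ultimately show ?thesis by blast
qed

end

theorem class_forcing_extension_saturated:
 assumes inf: "infinite (UNIV :: 'a set)"
 shows "class_forcing_extension_axiom (CSM :: 'a struct set)"
 unfolding class_forcing_extension_axiom_def
proof (intro ballI allI impI, elim conjE)
 fix M :: "'a struct" and P le
 assume M: "M:CSM" and cf: "class_forcing_notion M P le" and pres: "zfc_preserving M P le"
 interpret zfc_model M using M by (rule zfc_model_multiverse)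
 obtain Feq Fmem where af: "atomic_forcing M P le Feq Fmem" using cf by (auto simp: class_forcing_notion_def)
 interpret forcing M P le Feq Fmem
  using cf af by unfold_locales (simp_all add: class_forcing_notion_def)
 have sat: "computably_saturated M" and cnt: "countable V" using M by (auto simp: countable_saturated_models_def)
 obtain p0 where "p0:P" using fn by (auto simp: forcing_notion_def)
 then obtain G where G: "generic_filter P le (classes_of M) G" "computably_saturated (generic_ext M P Feq Fmem G)"
  by (rule generic_saturated[OF sat cnt])
 have "is_model (generic_ext M P Feq Fmem G) zfc" using pres G(1) af by (auto simp: zfc_preserving_def)
 thus "EX N:(CSM :: 'a struct set). EX G. generic_filter P le (classes_of M) G & is_generic_ext M P le G N"
  using generic_copy[OF inf cnt G] G(1) by blast
qed

section \<open>Set forcing: construction of the atomic forcing relations\<close>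

locale set_poset = poset_in_model +
 assumes isset_P: "isset P"
begin

text \<open>For a set of conditions, forced equality is the largest relation \<open>R\<close> such that \<open>R p si ta\<close> implies
 \<open>bis R p si ta\<close>; it is obtained inside \<open>M\<close> as the union of all sets with this property.\<close>

definition memb :: "('a => 'a => 'a => bool) => 'a => 'a => 'a => bool" where
 "memb R p ro ta <-> (ALL p':V. (p', p) : le --> (EX q:V. (q, p') : le &
   (EX pi:V. EX s:V. pr pi s : E ta & (q, s) : le & R q ro pi)))"

definition half :: "('a => 'a => 'a => bool) => 'a => 'a => 'a => bool" where
 "half R p si ta <-> (ALL ro:V. ALL r:V. ALL q:V. pr ro r : E si --> (q, p):le --> (q, r):le --> memb R q ro ta)"

definition bis :: "('a => 'a => 'a => bool) => 'a => 'a => 'a => bool" where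
 "bis R p si ta <-> half R p si ta & half (%q x y. R q y x) p ta si"

definition coded_in :: "'a => 'a => 'a => 'a => bool" where
 "coded_in X p si ta <-> pr p (pr si ta) : E X"

definition eqv :: "'a => 'a => 'a => bool" where
 "eqv p si ta <-> (EX X:V. coded_in X p si ta & (ALL p:V. ALL si:V. ALL ta:V. coded_in X p si ta --> bis (coded_in X) p si ta))"

lemma half_mono:
 assumes "half R p si ta"
  "!!q ro pi r s. q:P ==> ro:V ==> r:V ==> pr ro r : E si ==> pi:V ==> s:V ==> pr pi s : E ta ==> R q ro pi ==> R' q ro pi"
 shows "half R' p si ta"
 unfolding half_def memb_def
proof (intro ballI impI)
 fix ro r q p' assume *: "ro:V" "r:V" "q:V" "pr ro r : E si" "(q, p):le" "(q, r):le" "p':V" "(p', q):le"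
 then obtain q' pi s where "q':V" "(q', p'):le" "pi:V" "s:V" "pr pi s : E ta" "(q', s):le" "R q' ro pi"
  using assms(1) unfolding half_def memb_def by blast
 thus "EX q:V. (q, p'):le & (EX pi:V. EX s:V. pr pi s : E ta & (q, s):le & R' q ro pi)"
  using assms(2)[of q' ro r pi s] le_P * by blast
qed

lemma bis_mono:
 assumes "bis R p si ta"
  "!!q ro pi r s. q:P ==> ro:V ==> r:V ==> pr ro r : E si ==> pi:V ==> s:V ==> pr pi s : E ta ==> R q ro pi ==> R' q ro pi"
 shows "bis R' p si ta"
 using assms(1) half_mono[of R p si ta R'] half_mono[of "%q x y. R q y x" p ta si "%q x y. R' q y x"] assms(2)
 unfolding bis_def by blast

lemma df_bis:
 assumes "df M (%e. R (e 0) (e 1) (e 2))"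
 shows "df M (%e. bis R (e 0) (e 1) (e 2))"
 unfolding bis_def half_def memb_def by (intro dfi le df_rel3[where R = R, OF assms])

lemma df_eqv: "df M (%e. eqv (e 0) (e 1) (e 2))"
 unfolding eqv_def coded_in_def bis_def half_def memb_def by (intro dfi le)

lemma pr_chain:
 assumes "ro:V" "r:V" "transitive T" "si:T" "pr ro r : E si"
 shows "ro:T"
proof -
 have "ro:E (S {ro})" "S {ro} : E (pr ro r)"
  using assms isset_pair[of ro ro] isset_pair[OF assms(1,2)] isset_pair[OF S_in S_in, of "{ro}" "{ro, r}"]
  by (auto simp: pair_in_def E_S S_in)
 thus ?thesis using assms(3-5) unfolding transitive_def by blast
qed

text \<open>\<open>R\<close> may be a proper class, while \<open>eqv\<close> wants a set. The
  property \<open>bis\<close> looks only at names inside the given ones, so \<open>R\<close> may be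
  restricted to the names in a transitive set around them.\<close>

lemma coinduct:
 assumes R: "df M (%e. R (e 0) (e 1) (e 2))"
  and step: "!!p si ta. p:P ==> si:N ==> ta:N ==> R p si ta ==> bis R p si ta"
  and pst: "p:P" "si:N" "ta:N" "R p si ta"
 shows "eqv p si ta"
proof -
 have "isset {si, ta}" using pst names_V by (intro isset_pair) auto
 then obtain T where T: "isset T" "si:T" "ta:T" "transitive T" by (metis transitive_closure insert_subset)
 define Y where "Y p si ta <-> p:P & si:T & si:N & ta:T & ta:N & R p si ta" for p si ta
 have "df M (%e. EX p:V. EX si:V. EX ta:V. e 0 = pr p (pr si ta) & Y p si ta)"
  unfolding Y_def by (intro dfi df_isset[OF T(1)] P df_rel3[where R = R, OF R])
 hence "isset {z:prs P (prs T T). EX p:V. EX si:V. EX ta:V. z = pr p (pr si ta) & Y p si ta}"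
  by (intro isset_sep isset_prs T(1) isset_P)
 then obtain X where X: "X:V" "E X = {z:prs P (prs T T). EX p:V. EX si:V. EX ta:V. z = pr p (pr si ta) & Y p si ta}"
  by (auto simp: isset_def)
 have YV: "p:V & si:V & ta:V" if "Y p si ta" for p si ta using that names_V P_V by (auto simp: Y_def)
 have cod: "coded_in X p si ta <-> Y p si ta" if V: "p:V" "si:V" "ta:V" for p si ta
 proof
  assume "coded_in X p si ta"
  then obtain p' si' ta' where "pr p (pr si ta) = pr p' (pr si' ta')" "Y p' si' ta'" unfolding coded_in_def X(2) by blast
  thus "Y p si ta" using V YV by (auto simp: pr_inj)
 qed (use V in "auto simp: coded_in_def X(2) Y_def")
 have "bis (coded_in X) p si ta" if V: "p:V" "si:V" "ta:V" and c: "coded_in X p si ta" for p si ta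
 proof (rule bis_mono)
  have Y: "Y p si ta" using cod V c by blast
  thus "bis R p si ta" using step by (simp add: Y_def)
  fix q ro pi r s assume *: "q:P" "ro:V" "r:V" "pr ro r : E si" "pi:V" "s:V" "pr pi s : E ta" "R q ro pi"
  have "ro:T" "pi:T" using pr_chain[OF *(2,3) T(4) _ *(4)] pr_chain[OF *(5,6) T(4) _ *(7)] Y by (auto simp: Y_def)
  moreover have "ro:N" "pi:N" using names_closed(1)[OF _ *(4,2,3)] names_closed(1)[OF _ *(7,5,6)] Y by (auto simp: Y_def)
  ultimately have "Y q ro pi" using * by (simp add: Y_def)
  thus "coded_in X q ro pi" using cod * P_V by blast
 qed
 moreover have "Y p si ta" using pst T by (simp add: Y_def)
 hence "coded_in X p si ta" using cod YV by blast
 ultimately show ?thesis unfolding eqv_def using X(1) by blast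
qed

lemma eqv_unfold: "p:V ==> si:V ==> ta:V ==> eqv p si ta ==> bis eqv p si ta"
proof -
 assume V: "p:V" "si:V" "ta:V" and "eqv p si ta"
 then obtain X where X: "X:V" "coded_in X p si ta" "ALL p:V. ALL si:V. ALL ta:V. coded_in X p si ta --> bis (coded_in X) p si ta"
  unfolding eqv_def by blast
 hence "bis (coded_in X) p si ta" using V by blast
 thus ?thesis by (rule bis_mono) (use X in "auto simp: eqv_def")
qed

text \<open>The argument of Knaster and Tarski: by monotonicity \<open>bis eqv\<close> satisfies the
  defining property of the relations whose union is \<open>eqv\<close>, so it is contained in
  \<open>eqv\<close>.\<close>

lemma eqv_iff: "p:P ==> si:N ==> ta:N ==> eqv p si ta <-> bis eqv p si ta"
proof
 show "eqv p si ta" if "p:P" "si:N" "ta:N" "bis eqv p si ta"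
 proof (rule coinduct[where R = "bis eqv", OF df_bis[OF df_eqv] _ that])
  fix p si ta assume "bis eqv p si ta"
  thus "bis (bis eqv) p si ta" by (rule bis_mono) (use eqv_unfold P_V in blast)
 qed
qed (use eqv_unfold P_V names_V in blast)

lemma eqv_mono:
 assumes "p:P" "si:N" "ta:N" "eqv p si ta" "(q, p):le"
 shows "eqv q si ta"
proof -
 have "half R q a b" if "half R p a b" for R a b using that le_trans[OF _ assms(5)] unfolding half_def by blast
 thus ?thesis using assms le_P eqv_iff unfolding bis_def by metis
qed

lemma eqv_refl: "p:P ==> si:N ==> eqv p si si"
proof (rule coinduct[where R = "%p. (=)"])
 show "df M (%e. e 1 = e 2)" by (intro dfi)
 fix p si ta :: 'a assume "si = ta"
 moreover have "memb (%p. (=)) q ro si" "memb (%p x y. y = x) q ro si" if "ro:V" "r:V" "pr ro r : E si" "(q, r):le" for q ro r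
  unfolding memb_def using that le_trans[OF _ that(4)] le_refl le_P(1) by blast+
 ultimately show "bis (%p. (=)) p si ta" unfolding bis_def half_def by blast
qed auto

lemma eqv_sym:
 assumes "p:P" "si:N" "ta:N" "eqv p si ta"
 shows "eqv p ta si"
proof (rule coinduct[where R = "%p si ta. eqv p ta si"])
 show "df M (%e. eqv (e 0) (e 2) (e 1))" by (intro df_rel3[where R = eqv, OF df_eqv] dfi)
 fix p si ta assume "p:P" "si:N" "ta:N" "eqv p ta si"
 thus "bis (%p si ta. eqv p ta si) p si ta" using eqv_iff by (auto simp: bis_def)
qed (use assms in auto)

lemma eqv_half: "p:P ==> si:N ==> ta:N ==> eqv p si ta ==> half eqv p si ta"
 using eqv_iff by (simp add: bis_def)

lemma half_trans:
 assumes "p:P" "a:N" "b:N" "c:N" "half eqv p a b" "half eqv p b c"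
 shows "half (%q x z. EX y:N. eqv q x y & eqv q y z) p a c"
 unfolding half_def
proof (intro ballI impI)
 fix ro r q assume *: "ro:V" "r:V" "q:V" "pr ro r : E a" "(q, p):le" "(q, r):le"
 show "memb (%q x z. EX y:N. eqv q x y & eqv q y z) q ro c" unfolding memb_def
 proof (intro ballI impI)
  fix p' assume p': "p':V" "(p', q):le"
  obtain q1 pi s where 1: "q1:V" "(q1, p'):le" "pi:V" "s:V" "pr pi s : E b" "(q1, s):le" "eqv q1 ro pi"
   using assms(5) * p' unfolding half_def memb_def by blast
  have "(q1, p):le" "(q1, q1):le" 
   by (rule le_trans[OF 1(2) le_trans[OF p'(2) *(5)]], rule le_refl[OF le_P(1)[OF 1(2)]])
  then obtain q2 mu t where 2: "q2:V" "(q2, q1):le" "mu:V" "t:V" "pr mu t : E c" "(q2, t):le" "eqv q2 pi mu"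
   using assms(6) 1 unfolding half_def memb_def by blast
  have "ro:N" "pi:N" using names_closed(1) assms(2,3) * 1 by blast+
  hence "eqv q2 ro pi" using eqv_mono[OF _ _ _ 1(7) 2(2)] le_P 2(2) by blast
  thus "EX q:V. (q, p'):le & (EX pi:V. EX s:V. pr pi s : E c & (q, s):le & (EX y:N. eqv q ro y & eqv q y pi))"
   using 2 `pi : N` le_trans[OF 2(2) 1(2)] by blast
 qed
qed

text \<open>The composition of \<open>eqv\<close> with itself passes the test of
  \<open>coinduct\<close>; no induction on ranks is involved.\<close>

lemma eqv_trans:
 assumes "p:P" "si:N" "ta:N" "us:N" "eqv p si ta" "eqv p ta us"
 shows "eqv p si us"
proof (rule coinduct[where R = "%q x z. EX y:N. eqv q x y & eqv q y z"])
 have "df M (%e. EX y:V. y:N & eqv (e 0) (e 1) y & eqv (e 0) y (e 2))"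
  by (intro df_Bex df_conj df_names df_rel3[where R = eqv, OF df_eqv] dft_var nonempty)
 thus "df M (%e. EX y:N. eqv (e 0) (e 1) y & eqv (e 0) y (e 2))"
  by (rule df_cong[THEN iffD1, rotated]) (use names_V in blast)
 fix p si us assume *: "p:P" "si:N" "us:N" "EX ta:N. eqv p si ta & eqv p ta us"
 then obtain ta where ta: "ta:N" "eqv p si ta" "eqv p ta us" by blast
 have "half (%q x z. EX y:N. eqv q x y & eqv q y z) p si us"
  using * ta by (intro half_trans[of _ _ ta] eqv_half)
 moreover have "half (%q x z. EX y:N. eqv q x y & eqv q y z) p us si"
  using * ta by (intro half_trans[of _ _ ta] eqv_half) (auto intro: eqv_sym)
 hence "half (%q z x. EX y:N. eqv q x y & eqv q y z) p us si"
 proof (rule half_mono)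
  fix q ro pi r s assume q: "q:P" "ro:V" "r:V" "pr ro r : E us" "pi:V" "s:V" "pr pi s : E si" "EX y:N. eqv q ro y & eqv q y pi"
  hence "ro:N" "pi:N" using names_closed(1) * by blast+
  thus "EX y:N. eqv q pi y & eqv q y ro" using q(1,8) eqv_sym by blast
 qed
 ultimately show "bis (%q x z. EX y:N. eqv q x y & eqv q y z) p si us" unfolding bis_def by blast
qed (use assms in auto)

text \<open>\<open>bis\<close> compares members of a name at conditions below those attached to
  them, whereas \<open>atomic_forcing\<close> asks for equivalent membership at all conditions below
  \<open>p\<close>. The facts \<open>self\<close> and \<open>fwd\<close>, resting on reflexivity and
  transitivity of \<open>eqv\<close>, lead from one to the other.\<close>

theorem atomic_forcing_set: "EX Feq Fmem. atomic_forcing M P le Feq Fmem"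
proof -
 define Feq where "Feq = {(p, si, ta). p:P & si:N & ta:N & eqv p si ta}"
 define Fmem where "Fmem = {(p, si, ta). p:P & si:N & ta:N & memb eqv p si ta}"
 have sub: "Feq <= V \<times> V \<times> V" "Fmem <= V \<times> V \<times> V" using P_V names_V by (auto simp: Feq_def Fmem_def)
 have d: "df M (%e. e 0 : P & e 1 : N & e 2 : N & eqv (e 0) (e 1) (e 2))"
  by (intro df_conj df_names df_definable1[OF P] df_eqv dft_var nonempty)
 have "df M (%e. memb eqv (e 0) (e 1) (e 2))"
  unfolding memb_def by (intro dfi le df_rel3[where R = eqv, OF df_eqv])
 hence d': "df M (%e. e 0 : P & e 1 : N & e 2 : N & memb eqv (e 0) (e 1) (e 2))"
  by (intro df_conj df_names df_definable1[OF P] dft_var nonempty)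
 have def3: "definable3 M Feq" "definable3 M Fmem"
  unfolding definable3_df[OF sub(1) nonempty] definable3_df[OF sub(2) nonempty] using d d' by (simp_all add: Feq_def Fmem_def)
 have el: "pi:N & s:P" if "ta:N" "pr pi s : E ta" "pi:V" "s:V" for pi s ta
  using names_closed[OF that] by blast
 have mem: "(p, si, ta) : Fmem <-> (ALL p'. (p', p) : le --> (EX q. (q, p') : le &
   (EX ro:N. EX r:P. pr ro r : E ta & (q, r) : le & (q, si, ro) : Feq)))" if *: "p : P" "si : N" "ta : N" for p si ta
 proof -
  have "(EX q:V. (q, p') : le & (EX pi:V. EX s:V. pr pi s : E ta & (q, s) : le & eqv q si pi)) <->
    (EX q. (q, p') : le & (EX ro:N. EX r:P. pr ro r : E ta & (q, r) : le & (q, si, ro) : Feq))" for p'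
   using el[OF *(3)] names_V P_V le_P *(2) unfolding Feq_def by blast
  thus ?thesis using * le_P P_V unfolding Fmem_def memb_def by auto
 qed
 have half: "half eqv p si ta <-> (ALL ro:N. ALL r:P. ALL q. pr ro r : E si & (q, p):le & (q, r):le --> (q, ro, ta):Fmem)"
  if *: "p:P" "si:N" "ta:N" for p si ta
 proof
  assume h: "half eqv p si ta"
  show "ALL ro:N. ALL r:P. ALL q. pr ro r : E si & (q, p):le & (q, r):le --> (q, ro, ta):Fmem"
  proof (intro ballI allI impI, elim conjE)
   fix ro r q assume 1: "ro:N" "r:P" "pr ro r : E si" "(q, p):le" "(q, r):le"
   hence "memb eqv q ro ta" using h names_V P_V le_P unfolding half_def by blast
   thus "(q, ro, ta):Fmem" using 1 le_P *(3) unfolding Fmem_def by blast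
  qed
 next
  assume h: "ALL ro:N. ALL r:P. ALL q. pr ro r : E si & (q, p):le & (q, r):le --> (q, ro, ta):Fmem"
  show "half eqv p si ta" unfolding half_def
  proof (intro ballI impI)
   fix ro r q assume 1: "ro:V" "r:V" "pr ro r : E si" "(q, p):le" "(q, r):le"
   hence "(q, ro, ta):Fmem" using h el[OF *(2) 1(3,1,2)] by blast
   thus "memb eqv q ro ta" by (simp add: Fmem_def)
  qed
 qed
 have mono: "(q, ro, si):Fmem ==> (q', q):le ==> (q', ro, si):Fmem" for q q' ro si
  using le_trans le_P unfolding Fmem_def memb_def by blast
 \<comment> \<open>What is forced into \<open>si\<close> densely equals a member \<open>pi\<close>
   of \<open>si\<close>; \<open>half\<close> puts \<open>pi\<close> into \<open>ta\<close>, so it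
   densely equals a member of \<open>ta\<close>, and transitivity concludes.\<close>
 have fwd: "(q, ro, ta):Fmem"
  if *: "p:P" "si:N" "ta:N" "half eqv p si ta" and q: "(q, p):le" "(q, ro, si):Fmem" for p si ta q ro
 proof -
  have qP: "q:P" "ro:N" using q by (auto simp: Fmem_def)
  show ?thesis unfolding mem[OF qP *(3)]
  proof (intro allI impI)
   fix p' assume p': "(p', q):le"
   obtain q1 pi s where 1: "(q1, p'):le" "pi:N" "s:P" "pr pi s : E si" "(q1, s):le" "(q1, ro, pi):Feq"
    using q(2) p' unfolding mem[OF qP *(2)] by blast
   have "(q1, p):le" using 1 p' q le_trans by blast
   hence "(q1, pi, ta):Fmem" using *(4) 1 unfolding half[OF *(1-3)] by blast
   then obtain q2 mu t where 2: "(q2, q1):le" "mu:N" "t:P" "pr mu t : E ta" "(q2, t):le" "(q2, pi, mu):Feq"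
    using mem[of q1 pi ta] 1 le_refl le_P *(3) by blast
   have "eqv q2 ro pi" using eqv_mono[OF _ _ _ _ 2(1)] 1(6) by (auto simp: Feq_def)
   hence "(q2, ro, mu):Feq" using 2 qP 1(2) eqv_trans unfolding Feq_def by blast
   thus "EX q. (q, p'):le & (EX ro':N. EX r:P. pr ro' r : E ta & (q, r):le & (q, ro, ro'):Feq)"
    using 2 le_trans[OF 2(1) 1(1)] by blast
  qed
 qed
 have self: "(q, ro, si):Fmem" if "pr ro r : E si" "(q, r):le" "ro:N" "si:N" for q ro si r
 proof -
  have qr: "q:P" "r:P" using that(2) le_P by blast+
  show ?thesis unfolding mem[OF qr(1) that(3,4)]
   using that qr le_refl le_trans le_P eqv_refl unfolding Feq_def by blast
 qed
 have eq: "(p, si, ta) : Feq <-> (ALL ro:N. ALL r:P. pr ro r : E si Un E ta -->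
   (ALL q. (q, p) : le --> ((q, ro, si) : Fmem <-> (q, ro, ta) : Fmem)))" (is "_ <-> ?R")
  if *: "p:P" "si:N" "ta:N" for p si ta
 proof
  assume "(p, si, ta):Feq"
  hence "half eqv p si ta" "half eqv p ta si" using * eqv_half eqv_sym by (auto simp: Feq_def)
  thus ?R using fwd * by blast
 next
  assume R: ?R
  have "half eqv p si ta" "half eqv p ta si" using R self * unfolding half[OF *] half[OF *(1,3,2)] by blast+
  moreover from this(2) have "half (%q x y. eqv q y x) p ta si"
  proof (rule half_mono)
   fix q ro pi r s assume q: "q:P" "ro:V" "r:V" "pr ro r : E ta" "pi:V" "s:V" "pr pi s : E si" "eqv q ro pi"
   thus "eqv q pi ro" using el * eqv_sym by blast
  qed
  ultimately have "eqv p si ta" using eqv_iff[OF *] by (simp add: bis_def)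
  thus "(p, si, ta):Feq" using * by (simp add: Feq_def)
 qed
 have "atomic_forcing M P le Feq Fmem"
  unfolding atomic_forcing_def
  by (intro conjI def3 ballI eq mem) (auto simp: Feq_def Fmem_def)
 thus ?thesis by blast
qed

end

lemma (in zfc_model) ex_pr_iff:
 "ro:V ==> r:V ==> (EX ro':V. EX q:V. pr ro r = pr ro' q & X ro' q) <-> X ro r"
 by (auto simp: pr_inj)

lemma (in forcing) generic_exists:
 assumes "countable V" "p:P"
 obtains H where "generic M P le Feq Fmem H" "p:H"
proof -
 have "countable {D:classes_of M. dense_in P le D}"
  using countable_classes_of[OF assms(1) nonempty] by (rule countable_subset[rotated]) auto
 then obtain H where H: "generic_filter P le {D:classes_of M. dense_in P le D} H" "p:H"
  using rasiowa_sikorski[OF fn _ _ assms(2)] by blast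
 hence "generic_filter P le (classes_of M) H" unfolding generic_filter_def by blast
 hence "generic M P le Feq Fmem H" by unfold_locales
 thus ?thesis using that H(2) by blast
qed

section \<open>The axioms of ZFC in generic extensions\<close>

context generic
begin

abbreviation inQ :: "'a set => 'a set => bool" (infix "in'_Q" 50) where "x in_Q y == (x, y) : mem Q"

text \<open>The recursive clause of the usual evaluation of names by \<open>G\<close>, recovered for
  names modulo forced equality.\<close>

lemma mem_iff:
 assumes "si:N" "ta:N"
 shows "cls si in_Q cls ta <-> (EX ro:N. EX r:G. pr ro r : E ta & cls si = cls ro)"
proof
 assume "cls si in_Q cls ta"
 then obtain p where p: "p:G" "(p, si, ta):Fmem" using cls_mem[OF assms] by blast
 have "df M (%e. EX ro:V. EX r:V. pr ro r : E ta & (e 0, r):le & (e 0, si, ro):Feq)"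
  using assms names_V by (intro dfi le Feq_def3) auto
 then obtain q where "q:G" "(q, p):le" "EX ro:V. EX r:V. pr ro r : E ta & (q, r):le & (q, si, ro):Feq"
 proof (rule G_meets[where D = "%q. EX ro:V. EX r:V. pr ro r : E ta & (q, r):le & (q, si, ro):Feq", OF _ p(1)])
  fix q assume "(q, p):le"
  with p(2) obtain q' ro r where "(q', q):le" "ro:N" "pr ro r : E ta" "(q', r):le" "(q', si, ro):Feq" by (rule FmemE)
  thus "EX r. (r, q):le & (EX ro:V. EX s:V. pr ro s : E ta & (r, s):le & (r, si, ro):Feq)"
   using names_V le_P P_V by blast
 qed blast
 thus "EX ro:N. EX r:G. pr ro r : E ta & cls si = cls ro"
  using Feq_sub G_up cls_eq assms(1) by blast
next
 assume "EX ro:N. EX r:G. pr ro r : E ta & cls si = cls ro"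
 then obtain ro r where *: "ro:N" "r:G" "pr ro r : E ta" "cls si = cls ro" by blast
 have "(r, ro, ta):Fmem" by (rule Fmem_elem[OF *(3) le_refl[OF G_P[OF *(2)]] assms(2) *(1)])
 thus "cls si in_Q cls ta" unfolding *(4) cls_mem[OF *(1) assms(2)] using *(2) by blast
qed

lemma mem_name:
 assumes "isset A" "A <= prs B P" "B <= N" "si:N"
 shows "S A : N" "cls si in_Q cls (S A) <-> (EX ro:B. EX r:G. pr ro r : A & cls si = cls ro)"
proof -
 show N: "S A : N" by (rule name_S[OF assms(1)]) (use assms(2,3) in blast)
 have "ro:B" if *: "ro:N" "r:G" "pr ro r : A" for ro r
 proof -
  obtain ro' r' where "ro':B" "r':P" "pr ro r = pr ro' r'" using *(3) assms(2) by blast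
  thus ?thesis using pr_inj[of ro r ro' r'] * assms(3) names_V G_P P_V by blast
 qed
 thus "cls si in_Q cls (S A) <-> (EX ro:B. EX r:G. pr ro r : A & cls si = cls ro)"
  unfolding mem_iff[OF assms(4) N] E_S[OF assms(1)] using assms(3) by blast
qed

lemma Q_extensional:
 assumes "si:N" "ta:N" "!!ro. ro:N ==> cls ro in_Q cls si <-> cls ro in_Q cls ta"
 shows "cls si = cls ta"
proof -
 \<comment> \<open>\<open>q\<close> forces a name into \<open>si\<close> that no extension of
   \<open>q\<close> forces into \<open>ta\<close>. Conditions that force equality or separate the
   names in one direction are dense, and under the hypothesis no condition in \<open>G\<close>
   separates.\<close>
 define sep where "sep q si ta <-> (EX ro:V. ro:N & (q, ro, si):Fmem & ~(EX r:V. (r, q):le & (r, ro, ta):Fmem))" for q si ta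
 have no: "~sep q si ta" if q: "q:G" and N: "si:N" "ta:N" and eq: "!!ro. ro:N ==> cls ro in_Q cls si <-> cls ro in_Q cls ta" for q si ta
 proof
  assume "sep q si ta"
  then obtain ro where ro: "ro:N" "(q, ro, si):Fmem" "~(EX r:V. (r, q):le & (r, ro, ta):Fmem)" unfolding sep_def by blast
  then obtain s where s: "s:G" "(s, ro, ta):Fmem" using eq[OF ro(1)] cls_mem N q by blast
  then obtain r where "r:G" "(r, q):le" "(r, s):le" using G_dir q by blast
  thus False using ro(3) s(2) Fmem_mono G_P P_V by blast
 qed
 have sepI: "EX r. (r, q):le & sep r si ta" if h: "(q, ro, si):Fmem" "(q, ro, ta) ~: Fmem" "ta:N" for q ro si ta
 proof -
  have N: "q:P" "ro:N" using Fmem_sub h by blast+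
  obtain r where r: "(r, q):le" "~(EX s. (s, r):le & (s, ro, ta):Fmem)"
   using Fmem_dense[OF N h(3)] h(2) by blast
  thus ?thesis using Fmem_mono[OF h(1) r(1)] N names_V unfolding sep_def by blast
 qed
 obtain p where p: "p:G" using G_ne by blast
 have "df M (%e. (e 0, si, ta):Feq | sep (e 0) si ta | sep (e 0) ta si)"
  unfolding sep_def using assms(1,2) names_V by (intro dfi Feq_def3 Fmem_def3 le) auto
 then obtain q where "q:G" "(q, si, ta):Feq | sep q si ta | sep q ta si"
 proof (rule G_meets[where D = "%q. (q, si, ta):Feq | sep q si ta | sep q ta si", OF _ p])
  fix q assume "(q, p):le"
  hence qP: "q:P" using le_P by blast
  show "EX r. (r, q):le & ((r, si, ta):Feq | sep r si ta | sep r ta si)"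
  proof (cases "(q, si, ta):Feq")
   case False
   then obtain ro r where r: "(r, q):le" "~((r, ro, si):Fmem <-> (r, ro, ta):Fmem)"
    using Feq_iff[OF qP assms(1,2)] by blast
   thus ?thesis using sepI[of r ro si ta] sepI[of r ro ta si] assms(1,2) le_trans by blast
  qed (use qP le_refl in blast)
 qed blast
 hence "(q, si, ta):Feq" using no[of q si ta] no[of q ta si] assms by blast
 thus ?thesis using cls_eq[OF assms(1,2)] `q : G` by blast
qed

lemma Q_env:
 fixes e :: "nat => 'a set"
 assumes "range e <= carr Q"
 obtains et where "!!i. et i : N" "e = (%i. cls (et i))"
proof -
 have "ALL i. EX si:N. e i = cls si" using assms by (auto simp: carr_Q)
 then obtain et where "ALL i. et i : N & e i = cls (et i)" by metis
 thus ?thesis using that[of et] by auto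
qed

lemma Q_truth_upd:
 assumes "!!i. et i : N" "ro:N"
 shows "sat Q ((%i. cls (et i))(v := cls ro)) ph <-> (EX q:G. frc q (et(v := ro)) ph)"
proof -
 have "(%i. cls (et i))(v := cls ro) = (%i. cls ((et(v := ro)) i))" by (rule HOL.ext) simp
 moreover have "sat Q (%i. cls ((et(v := ro)) i)) ph <-> (EX q:G. frc q (et(v := ro)) ph)"
  by (rule truth) (use assms in auto)
 ultimately show ?thesis by metis
qed

end

locale set_generic = generic + set_poset
begin

text \<open>The common part of Pairing, Union, Power Set, Separation and Replacement. Once the
  solutions of \<open>ph\<close> are known to have names in a set \<open>B\<close>, the pairs of a
  name in \<open>B\<close> and a condition forcing \<open>ph\<close> of it make up a name for their
  set.\<close>

lemma comprehension:
 fixes e :: "nat => 'a set"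
 assumes e: "range e <= carr Q" and uv: "u ~: fv ph" "u ~= v" and B: "isset B" "B <= N"
  and bound: "!!z. z:carr Q ==> sat Q (e(v := z)) ph ==> z:cls ` B"
 shows "sat Q e (Exi u (All v (Iff (Mem v u) ph)))"
proof -
 obtain et where et: "!!i. et i : N" "e = (%i. cls (et i))" using Q_env[OF e] by blast
 have etV: "et i : V" for i using et(1) names_V by blast
 define A where "A = {z:prs B P. EX ro:V. EX q:V. z = pr ro q & frc q (%i. nm (if i = v then ro else et i)) ph}"
 have A: "isset A" unfolding A_def by (intro isset_sep isset_prs B isset_P dfi df_frc_terms etV)
 have AB: "A <= prs B P" by (auto simp: A_def)
 have inA: "pr ro r : A <-> frc r (et(v := ro)) ph" if ror: "ro:B" "r:G" for ro r
 proof -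
  have "ro:V" "r:V" "pr ro r : prs B P" using ror B(2) names_V G_P P_V by blast+
  moreover have "(%i. nm (if i = v then ro else et i)) = et(v := ro)"
   by (rule HOL.ext) (simp add: nm(1) et(1) subsetD[OF B(2) ror(1)])
  ultimately show ?thesis unfolding A_def mem_Collect_eq using ex_pr_iff[of ro r "%ro q. frc q (%i. nm (if i = v then ro else et i)) ph"] by auto
 qed
 have "z in_Q cls (S A) <-> sat Q (e(v := z)) ph" if z: "z:carr Q" for z
 proof -
  obtain si where si: "si:N" "z = cls si" using z by (auto simp: carr_Q)
  have "z in_Q cls (S A) <-> (EX ro:B. EX r:G. pr ro r : A & z = cls ro)"
   using mem_name(2)[OF A AB B(2) si(1)] si(2) by simp
  also have "... <-> (EX ro:B. z = cls ro & sat Q (e(v := cls ro)) ph)"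
  proof -
   have "(EX r:G. pr ro r : A) <-> sat Q (e(v := cls ro)) ph" if "ro:B" for ro
    unfolding et(2) Q_truth_upd[OF et(1) subsetD[OF B(2) that]] using inA[OF that] by blast
   thus ?thesis by blast
  qed
  also have "... <-> sat Q (e(v := z)) ph" using bound[OF z] by auto
  finally show ?thesis .
 qed
 moreover have "sat Q (e(u := y, v := z)) ph <-> sat Q (e(v := z)) ph" for y z
  by (rule sat_cong) (use uv in auto)
 moreover have "cls (S A) : carr Q" using mem_name(1)[OF A AB B(2) et(1)] by (auto simp: carr_Q)
 ultimately show ?thesis unfolding sat_Exi sat.simps(5) sat_Iff
  using uv(2) by (intro bexI[of _ "cls (S A)"]) auto
qed

text \<open>The names in a transitive set around \<open>si\<close>. The closure is hereditary
  because Union needs names for elements of elements.\<close>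

lemma bound_elems:
 assumes "si:N"
 obtains B where "isset B" "B <= N" "si:B" "!!ro r. pr ro r : E ta ==> ta:B ==> ro:V ==> r:V ==> ro:B"
  "!!z ro. z:carr Q ==> ro:B ==> z in_Q cls ro ==> z:cls ` B"
proof -
 obtain T where T: "isset T" "si:T" "transitive T"
  using transitive_closure[of "{si, si}"] isset_pair[of si si] names_V[OF assms] by auto
 have "isset {si:T. si:N}" by (intro isset_sep T dfi)
 moreover have cl: "ro:{si:T. si:N}" if "pr ro r : E ta" "ta:{si:T. si:N}" "ro:V" "r:V" for ro r ta
  using pr_chain[OF that(3,4) T(3) _ that(1)] names_closed(1)[OF _ that(1,3,4)] that(2) by simp
 moreover have "z:cls ` {si:T. si:N}" if z: "z:carr Q" "ro:{si:T. si:N}" "z in_Q cls ro" for z ro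
 proof -
  obtain ta where ta: "ta:N" "z = cls ta" using z(1) by (auto simp: carr_Q)
  then obtain pi r where *: "pi:N" "r:G" "pr pi r : E ro" "z = cls pi" using mem_iff[of ta ro] z(2,3) by auto
  hence "pi:{si:T. si:N}" using cl[OF *(3) z(2)] names_V G_P P_V by blast
  thus ?thesis using *(4) by blast
 qed
 ultimately show ?thesis using that[of "{si:T. si:N}"] T(2) assms by blast
qed

lemma Q_pairing:
 assumes "range e <= carr Q"
 shows "sat Q e ax_pairing"
 unfolding ax_pairing_def sat.simps(5)
proof (intro ballI)
 fix x y assume "x:carr Q" "y:carr Q"
 then obtain si ta where *: "si:N" "x = cls si" "ta:N" "y = cls ta" by (auto simp: carr_Q)
 show "sat Q (e(0 := x, 1 := y)) (Exi 2 (All 3 (Iff (Mem 3 2) (Dis (Equ 3 0) (Equ 3 1)))))"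
  by (rule comprehension[where B = "{si, ta}"])
   (use assms * names_V in "auto simp: carr_Q image_subset_iff intro!: isset_pair")
qed

lemma Q_union:
 assumes "range e <= carr Q"
 shows "sat Q e ax_union"
 unfolding ax_union_def sat.simps(5)
proof (intro ballI)
 fix x assume "x:carr Q"
 then obtain si where *: "si:N" "x = cls si" by (auto simp: carr_Q)
 obtain B where B: "isset B" "B <= N" "si:B" "!!z ro. z:carr Q ==> ro:B ==> z in_Q cls ro ==> z:cls ` B"
  using bound_elems[OF *(1)] by metis
 show "sat Q (e(0 := x)) (Exi 1 (All 2 (Iff (Mem 2 1) (Exi 3 (Con (Mem 2 3) (Mem 3 0))))))"
 proof (rule comprehension[where B = B])
  fix z assume "z:carr Q" "sat Q ((e(0 := x))(2 := z)) (Exi 3 (Con (Mem 2 3) (Mem 3 0)))"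
  then obtain w where "w:carr Q" "z in_Q w" "w in_Q cls si" unfolding sat_Exi sat_Con by (auto simp: *(2))
  thus "z:cls ` B" using B(3,4) `z : carr Q` by blast
 qed (use assms `x : carr Q` B in "auto simp: image_subset_iff")
qed

lemma Q_power:
 assumes "range e <= carr Q"
 shows "sat Q e ax_power"
 unfolding ax_power_def sat.simps(5)[of Q e 0]
proof (intro ballI)
 fix x assume x: "x:carr Q"
 then obtain si where *: "si:N" "x = cls si" by (auto simp: carr_Q)
 obtain B where B: "isset B" "B <= N" "si:B" "!!z ro. z:carr Q ==> ro:B ==> z in_Q cls ro ==> z:cls ` B"
  using bound_elems[OF *(1)] by metis
 let ?B = "{ta:{ta:V. E ta <= prs B P}. ta:N}"
 show "sat Q (e(0 := x)) (Exi 1 (All 2 (Iff (Mem 2 1) (All 3 (Imp (Mem 3 2) (Mem 3 0))))))"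
 proof (rule comprehension[where B = ?B])
  show "isset ?B" by (intro isset_sep isset_Pow isset_prs B(1) isset_P dfi)
  fix z assume z: "z:carr Q" and "sat Q ((e(0 := x))(2 := z)) (All 3 (Imp (Mem 3 2) (Mem 3 0)))"
  hence zx: "w in_Q z ==> w in_Q cls si" if "w:carr Q" for w using that by (simp add: *(2))
  obtain us where us: "us:N" "z = cls us" using z by (auto simp: carr_Q)
  \<comment> \<open>The given name \<open>us\<close> of the subset may be arbitrarily large. It is
    replaced by a bounded one, built from the names in \<open>B\<close> and the conditions that
    force them into \<open>us\<close>.\<close>
  define A where "A = {w:prs B P. EX ro:V. EX q:V. w = pr ro q & (q, ro, us):Fmem}"
  have A: "isset A" unfolding A_def using us names_V by (intro isset_sep isset_prs B(1) isset_P dfi Fmem_def3) auto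
  have AB: "A <= prs B P" by (auto simp: A_def)
  have inA: "pr ro q : A <-> (q, ro, us):Fmem" if roq: "ro:B" "q:G" for ro q
  proof -
   have "ro:V" "q:V" "pr ro q : prs B P" using roq B(2) names_V G_P P_V by blast+
   thus ?thesis unfolding A_def mem_Collect_eq using ex_pr_iff[of ro q "%ro q. (q, ro, us):Fmem"] by blast
  qed
  have SN: "S A : N" by (rule mem_name(1)[OF A AB B(2) us(1)])
  have "cls us = cls (S A)"
  proof (rule Q_extensional[OF us(1) SN])
   fix mu assume mu: "mu:N"
   have "cls mu in_Q cls us <-> (EX ro:B. cls mu = cls ro & cls ro in_Q cls us)"
   proof -
    have "cls mu : carr Q" using mu by (simp add: carr_Q)
    hence "EX ro:B. cls mu = cls ro" if "cls mu in_Q z" using zx[OF _ that] B(4)[OF _ B(3)] by blast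
    thus ?thesis unfolding us(2) by metis
   qed
   also have "... <-> cls mu in_Q cls (S A)"
    unfolding mem_name(2)[OF A AB B(2) mu] using inA cls_mem[OF _ us(1)] B(2) by blast
   finally show "cls mu in_Q cls us <-> cls mu in_Q cls (S A)" .
  qed
  thus "z:cls ` ?B" using us(2) SN AB S_in[OF A] E_S[OF A] by auto
 qed (use assms x in "auto simp: image_subset_iff")
qed

lemma Q_separation:
 assumes "range e <= carr Q" "2 ~: fv ph"
 shows "sat Q e (separation ph)"
 unfolding separation_def sat.simps(5)[of Q e 1]
proof (intro ballI)
 fix x assume x: "x:carr Q"
 then obtain si where *: "si:N" "x = cls si" by (auto simp: carr_Q)
 obtain B where B: "isset B" "B <= N" "si:B" "!!z ro. z:carr Q ==> ro:B ==> z in_Q cls ro ==> z:cls ` B"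
  using bound_elems[OF *(1)] by metis
 show "sat Q (e(1 := x)) (Exi 2 (All 0 (Iff (Mem 0 2) (Con (Mem 0 1) ph))))"
 proof (rule comprehension[where B = B])
  fix z assume "z:carr Q" "sat Q ((e(1 := x))(0 := z)) (Con (Mem 0 1) ph)"
  thus "z:cls ` B" using B(3,4) unfolding sat_Con by (auto simp: *(2))
 qed (use assms x B in "auto simp: image_subset_iff")
qed

lemma Q_replacement:
 assumes e: "range e <= carr Q" and fv: "3 ~: fv ph"
 shows "sat Q e (replacement ph)"
 unfolding replacement_def sat.simps(5)[of Q e 2] sat.simps(4)[of Q "e(2 := x)" for x]
proof (intro ballI impI)
 fix x assume x: "x:carr Q"
 assume "sat Q (e(2 := x)) (All 0 (Imp (Mem 0 2) (Exi 3 (All 1 (Iff ph (Equ 1 3))))))"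
 hence "ALL z:carr Q. z in_Q x --> (EX u:carr Q. ALL y:carr Q. sat Q (e(2 := x, 0 := z, 3 := u, 1 := y)) ph <-> y = u)"
  unfolding sat.simps(4,5) sat_Exi sat_Iff by simp
 moreover have "sat Q (e(2 := x, 0 := z, 3 := u, 1 := y)) ph <-> sat Q (e(2 := x, 0 := z, 1 := y)) ph" for z u y
  by (rule sat_cong) (use fv in auto)
 ultimately have fn: "EX u:carr Q. ALL y:carr Q. sat Q (e(2 := x, 0 := z, 1 := y)) ph <-> y = u" if "z:carr Q" "z in_Q x" for z
  using that by auto
 obtain si where *: "si:N" "x = cls si" using x by (auto simp: carr_Q)
 obtain B where B: "isset B" "B <= N" "si:B" "!!z ro. z:carr Q ==> ro:B ==> z in_Q cls ro ==> z:cls ` B"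
  using bound_elems[OF *(1)] by metis
 have e2: "range (e(2 := x)) <= carr Q" using e x by (auto simp: image_subset_iff)
 obtain et where et: "!!i. et i : N" "e(2 := x) = (%i. cls (et i))" using Q_env[OF e2] by blast
 \<comment> \<open>A pair \<open>w\<close> of a name and a condition is related to the names that
   the condition forces to be the value. Collection over \<open>prs B P\<close> bounds such names;
   the collected name may differ from the given one, but both denote the unique value.\<close>
 define C where "C w ta <-> ta : N & (EX ro:V. EX q:V. w = pr ro q & ro : N &
  frc q (%i. nm (if i = 1 then ta else if i = 0 then ro else et i)) ph)" for w ta
 have etV: "et i : V" for i using et(1) names_V by blast
 have "df M (%e. C (e 0) (e 1))" unfolding C_def by (intro dfi df_frc_terms etV)
 then obtain B' where B': "isset B'" "ALL w:prs B P. (EX ta:V. C w ta) --> (EX ta:B'. C w ta)" "ALL ta:B'. EX w:prs B P. C w ta"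
  by (rule collection[OF isset_prs[OF B(1) isset_P]]) blast
 have B'N: "B' <= N" using B'(3) by (auto simp: C_def)
 have frc_sat: "sat Q (e(2 := x, 0 := cls ro, 1 := cls ta)) ph <->
   (EX q:G. frc q (%i. nm (if i = 1 then ta else if i = 0 then ro else et i)) ph)" if "ro : N" "ta : N" for ro ta
 proof -
  have "e(2 := x, 0 := cls ro, 1 := cls ta) = (%i. cls (nm (if i = 1 then ta else if i = 0 then ro else et i)))"
   unfolding et(2) by (rule HOL.ext) (simp add: nm(1) et(1) that)
  thus ?thesis using truth[of ph "%i. nm (if i = 1 then ta else if i = 0 then ro else et i)"] nm(2) by simp
 qed
 show "sat Q (e(2 := x)) (Exi 3 (All 1 (Iff (Mem 1 3) (Exi 0 (Con (Mem 0 2) ph)))))"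
 proof (rule comprehension[OF e2 _ _ B'(1) B'N])
  fix y assume y: "y:carr Q" "sat Q ((e(2 := x))(1 := y)) (Exi 0 (Con (Mem 0 2) ph))"
  then obtain z where z: "z:carr Q" "z in_Q x" "sat Q (e(2 := x, 1 := y, 0 := z)) ph" unfolding sat_Exi sat_Con by auto
  hence sat: "sat Q (e(2 := x, 0 := z, 1 := y)) ph" by (simp add: fun_upd_twist)
  obtain ro where ro: "ro:B" "z = cls ro" using B(3,4) z(1,2) *(2) by blast
  obtain us where us: "us:N" "y = cls us" using y by (auto simp: carr_Q)
  have roN: "ro:N" using ro B(2) by blast
  obtain q where q: "q:G" "frc q (%i. nm (if i = 1 then us else if i = 0 then ro else et i)) ph"
   using sat frc_sat[OF roN us(1)] ro(2) us(2) by blast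
  have "C (pr ro q) us" unfolding C_def using us roN q names_V P_V G_P by blast
  moreover have "pr ro q : prs B P" using ro(1) G_P[OF q(1)] by blast
  ultimately obtain ta where ta: "ta:B'" "C (pr ro q) ta" using B'(2) us(1) names_V by blast
  then obtain ro' q' where "ro':V" "q':V" "pr ro q = pr ro' q'" "frc q' (%i. nm (if i = 1 then ta else if i = 0 then ro' else et i)) ph"
   unfolding C_def by blast
  moreover from this have "ro' = ro" "q' = q" using pr_inj[of ro q ro' q'] roN q(1) names_V P_V G_P by auto
  ultimately have "frc q (%i. nm (if i = 1 then ta else if i = 0 then ro else et i)) ph" by metis
  hence "sat Q (e(2 := x, 0 := z, 1 := cls ta)) ph" using frc_sat[OF roN, of ta] q(1) ta(1) B'N ro(2) by blast
  moreover have "cls ta : carr Q" using ta(1) B'N by (auto simp: carr_Q)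
  ultimately have "y = cls ta" using fn[OF z(1,2)] sat y(1) by metis
  thus "y:cls ` B'" using ta(1) by blast
 qed (use fv in auto)
qed

lemma Q_extensionality:
 assumes "range e <= carr Q"
 shows "sat Q e ax_extensionality"
proof -
 have "x = y" if "x:carr Q" "y:carr Q" "ALL z:carr Q. z in_Q x <-> z in_Q y" for x y
  using that Q_extensional by (auto simp: carr_Q)
 thus ?thesis unfolding ax_extensionality_def sat.simps(4,5) sat_Iff by simp
qed

lemma Q_foundation:
 assumes "range e <= carr Q"
 shows "sat Q e ax_foundation"
proof -
 have "EX y:carr Q. y in_Q x & ~(EX z:carr Q. z in_Q y & z in_Q x)" if x: "x:carr Q" "y0:carr Q" "y0 in_Q x" for x y0
 proof (rule ccontr)
  assume neg: "~?thesis"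
  obtain si ro0 where si: "si:N" "x = cls si" "ro0:N" "y0 = cls ro0" using x by (auto simp: carr_Q)
  let ?psi = "All 1 (Imp (Mem 1 0) (Neg (All 2 (Imp (Mem 2 1) (Neg (Mem 2 0))))))"
  have "sat Q (%i. cls si) ?psi" using neg si(2) by auto
  then obtain p0 where p0: "p0:G" "frc p0 (%i. si) ?psi" using truth[of ?psi "%i. si"] si(1) by blast
  obtain q0 where q0: "q0:G" "(q0, ro0, si):Fmem" using x(3) cls_mem si by blast
  obtain p where p: "(p, p0):le" "(p, q0):le" using G_dir p0(1) q0(1) by blast
  \<comment> \<open>The minimal element is sought among all names that some condition below
    \<open>p0\<close> forces into \<open>si\<close>, whether or not that condition is in
    \<open>G\<close>: this class is definable in \<open>M\<close>, where ranks have a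
    minimum.\<close>
  define C where "C ro <-> (EX q:V. (q, p0):le & (q, ro, si):Fmem)" for ro
  have "df M (%e. C (e 0))" unfolding C_def using p0(1) si(1) G_P P_V names_V by (intro dfi le Fmem_def3) auto
  moreover have "C ro0" unfolding C_def using p q0(2) Fmem_mono le_P P_V by blast
  ultimately obtain ro where ro: "ro:V" "C ro" "ALL y:V. C y --> rank_le ro y"
   using rank_minimal[of C ro0] si(3) names_V by blast
  then obtain q where q: "(q, p0):le" "(q, ro, si):Fmem" by (auto simp: C_def)
  have roN: "ro:N" using Fmem_sub q(2) by blast
  have "frc q ((%i. si)(1 := ro)) (Neg (All 2 (Imp (Mem 2 1) (Neg (Mem 2 0)))))"
   using p0(2) roN q by simp
  moreover have "(q, q):le" using q(1) le_refl le_P by blast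
  ultimately have "~frc q ((%i. si)(1 := ro)) (All 2 (Imp (Mem 2 1) (Neg (Mem 2 0))))" unfolding frc.simps(3) by blast
  then obtain pi t u where pi: "pi:N" "(t, q):le" "(t, pi, ro):Fmem" "(u, t):le" "(u, pi, si):Fmem" by auto
  obtain v mu s where v: "(v, u):le" "mu:N" "pr mu s : E ro" "(v, s):le" "(v, pi, mu):Feq"
   using FmemE[OF pi(3), of u] pi(4) le_refl le_P by metis
  have "(v, mu, si):Fmem" by (rule Fmem_Feq1[OF Fmem_mono[OF pi(5) v(1)] v(5)])
  moreover have "(v, p0):le" using v(1) pi(2,4) q(1) le_trans by blast
  ultimately have "C mu" unfolding C_def using le_P P_V by blast
  hence "rank_le ro mu" using ro(3) v(2) names_V by blast
  then obtain y where "y:E mu" "rank_le mu y"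
   using pr_rank_less[OF v(3)] v(2,4) ro(1) names_V le_P P_V by blast
  thus False using not_rank_le_mem v(2) names_V by blast
 qed
 thus ?thesis unfolding ax_foundation_def sat_Exi sat_Con sat.simps by (simp, blast)
qed

lemma Q_infinity:
 assumes "range e <= carr Q"
 shows "sat Q e ax_infinity"
proof -
 \<comment> \<open>A name for the successor. The new element carries all conditions, since a weakest
   condition is not assumed.\<close>
 define F where "F ro = S (E ro Un prs {ro} P)" for ro
 have isF: "isset (E ro Un prs {ro} P)" if "ro:V" for ro
  using isset_pair[OF that that] by (intro isset_Un isset_E that isset_prs isset_P) simp
 have "df M (%e. e 0 : E (e 1) | (EX p:V. p:P & e 0 = pr (e 1) p))" by (intro dfi P)
 hence "df M (%e. e 0 : E (e (Suc 0)) Un prs {e (Suc 0)} P)"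
  by (rule df_cong[THEN iffD1, rotated]) (use P_V in auto)
 hence "dft M (%e. F (e 0))" unfolding F_def using isF by (intro dft_S) auto
 then obtain A where A: "isset A" "emp : A" "ALL x:A. F x : A"
  "ALL x:A. x:N"
 proof (rule iteration[OF empty_in_V])
  fix A assume A: "isset A" "emp : A" "!!x. x:A ==> F x : A"
   "!!P x. df M (%e. P (e 0)) ==> P (emp) ==> (!!x. x:A ==> P x ==> P (F x)) ==> x:A ==> P x"
  have "x:N" if x: "x:A" for x
  proof (rule A(4)[of "%x. x:N", OF _ names_nonempty _ x])
   fix x assume x: "x:N"
   show "F x : N" unfolding F_def by (rule name_S[OF isF[OF names_V[OF x]]]) (use x names_elem in blast)
  qed (intro dfi)
  thus thesis using that A by blast
 qed
 have F: "cls si in_Q cls (F ro) <-> cls si in_Q cls ro | cls si = cls ro" if ro: "ro:A" and si: "si:N" for ro si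
 proof -
  have N: "ro:N" "F ro : N" using ro A by auto
  have "E (F ro) = E ro Un prs {ro} P" unfolding F_def by (rule E_S[OF isF[OF names_V[OF N(1)]]])
  moreover have "pr ro' r : prs {ro} P <-> ro' = ro" if "ro':N" "r:G" for ro' r
   using that N(1) G_P P_V names_V by (auto simp: pr_inj)
  ultimately show ?thesis unfolding mem_iff[OF si N(1)] mem_iff[OF si N(2)] using G_ne N(1) by auto
 qed
 have AN: "A <= N" using A(4) by blast
 define w where "w = cls (S (prs A P))"
 note mn = mem_name[OF isset_prs[OF A(1) isset_P] order_refl AN]
 have w: "w:carr Q" using mn(1)[OF names_nonempty] by (simp add: w_def carr_Q)
 have w2: "cls si in_Q w <-> (EX ro:A. cls si = cls ro)" if "si:N" for si
  unfolding w_def mn(2)[OF that] using G_ne G_P by blast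
 have "~z in_Q cls (emp)" if "z:carr Q" for z
  using that mem_iff[OF _ names_nonempty] by (auto simp: carr_Q)
 moreover have "cls (emp) in_Q w" "w:carr Q" "cls (emp) : carr Q" using w w2 names_nonempty A(2) by (auto simp: carr_Q)
 moreover have "EX y:carr Q. y in_Q w & (ALL z:carr Q. z in_Q y <-> z in_Q x | z = x)" if x: "x:carr Q" "x in_Q w" for x
 proof -
  obtain ro where ro: "ro:A" "x = cls ro" using x w2 by (auto simp: carr_Q)
  hence "F ro : A" "F ro : N" using A by auto
  hence "cls (F ro) in_Q w" "cls (F ro) : carr Q" using w2 by (auto simp: carr_Q)
  thus ?thesis using F[OF ro(1)] ro(2) by (intro bexI[of _ "cls (F ro)"]) (auto simp: carr_Q)
 qed
 ultimately have "EX w:carr Q. (EX x:carr Q. x in_Q w & (ALL z:carr Q. ~z in_Q x)) &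
   (ALL x:carr Q. x in_Q w --> (EX y:carr Q. y in_Q w & (ALL z:carr Q. z in_Q y <-> z in_Q x | z = x)))"
  by blast
 thus ?thesis
  unfolding ax_infinity_def sat.simps by (simp add: iff_conv_conj_imp disj_imp)
qed

end

text \<open>\<open>same_fm\<close> says that any two of \<open>1\<close>, \<open>2\<close> in a common element of \<open>0\<close> are equal.\<close>

definition same_fm :: fm where
 "same_fm = All 3 (Imp (Mem 3 0) (Imp (Mem 1 3) (Imp (Mem 2 3) (Equ 1 2))))"

text \<open>The situation to be refuted for a maximal partial transversal \<open>3\<close> of the
  disjoint family \<open>0\<close>: its member \<open>1\<close> is missed, although it has an
  element \<open>2\<close> that could be added.\<close>

definition miss_fm :: fm where
 "miss_fm = Con (All 4 (All 5 (Imp (Mem 4 0) (Imp (Mem 5 0) (Imp (Exi 6 (Con (Mem 6 4) (Mem 6 5))) (Equ 4 5))))))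
   (Con (Mem 1 0) (Con (Mem 2 1) (All 4 (Imp (Mem 4 1) (Neg (Mem 4 3))))))"

abbreviation env4 :: "'a => 'a => 'a => 'a => nat => 'a" where
 "env4 x0 x1 x2 x3 i == if i = 0 then x0 else if i = 1 then x1 else if i = 2 then x2 else x3"

lemma (in generic) sat_same_fm:
 "sat Q (%i. cls (env4 x0 x1 x2 x3 i)) same_fm <->
   (ALL y:carr Q. y in_Q cls x0 --> cls x1 in_Q y --> cls x2 in_Q y --> cls x1 = cls x2)"
 by (simp add: same_fm_def)

lemma (in generic) sat_miss_fm:
 "sat Q (%i. cls (env4 x0 x1 x2 x3 i)) miss_fm <->
   (ALL y:carr Q. ALL z:carr Q. y in_Q cls x0 --> z in_Q cls x0 --> (EX u:carr Q. u in_Q y & u in_Q z) --> y = z) &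
   cls x1 in_Q cls x0 & cls x2 in_Q cls x1 & (ALL u:carr Q. u in_Q cls x1 --> ~u in_Q cls x3)"
 unfolding miss_fm_def sat_Con by simp

context set_generic
begin

text \<open>Every condition lies in a generic filter because the ground model is countable. Hence
  what holds in all extensions by filters through \<open>q\<close> is forced by \<open>q\<close>,
  and calculations in the forcing relation can be replaced by reasoning in extensions.\<close>

lemma semantic_forcing:
 assumes "countable V" "q:P" "!!i. e i : N"
  "!!H. generic M P le Feq Fmem H ==> q:H ==> sat (generic_ext M P Feq Fmem H) (%i. generic.cls M P Feq H (e i)) ph"
 shows "frc q e ph"
proof (rule ccontr)
 assume "~frc q e ph"
 then obtain r where r: "(r, q):le" "frc r e (Neg ph)" using frc_NegE[OF assms(2)] assms(3) by blast
 obtain H where H: "generic M P le Feq Fmem H" "r:H" using generic_exists[OF assms(1) le_P(1)[OF r(1)]] .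
 interpret H: generic M P le Feq Fmem H by (rule H(1))
 have "sat H.Q (%i. H.cls (e i)) (Neg ph)" using H.truth[of "Neg ph" e] assms(3) r(2) H(2) by blast
 moreover have "sat H.Q (%i. H.cls (e i)) ph" by (rule assms(4)[OF H(1)]) (use H.G_up[OF H(2) r(1)] in simp)
 ultimately show False by simp
qed

text \<open>A name for a transversal of \<open>si\<close>: a maximal set of pairs \<open>(ro, p)\<close> such that common extensions of
 \<open>p\<close> and \<open>p'\<close> do not force \<open>ro\<close> and \<open>ro'\<close> to be different elements of an element of \<open>si\<close>. If it missed the
 element \<open>us\<close> of \<open>si\<close> then some \<open>(ro, p)\<close> with \<open>ro\<close> in \<open>us\<close> could be added.\<close>

lemma Q_transversal:
 assumes cnt: "countable V" and si: "si:N"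
  and ne: "!!y. y:carr Q ==> y in_Q cls si ==> EX z:carr Q. z in_Q y"
  and disj: "!!y z u. y:carr Q ==> z:carr Q ==> u:carr Q ==> y in_Q cls si ==> z in_Q cls si ==> u in_Q y ==> u in_Q z ==> y = z"
 shows "EX c:carr Q. ALL y:carr Q. y in_Q cls si --> (EX w:carr Q. ALL u:carr Q. u in_Q y & u in_Q c <-> u = w)"
proof -
 obtain B where B: "isset B" "B <= N" "si:B" "!!z ro. z:carr Q ==> ro:B ==> z in_Q cls ro ==> z:cls ` B"
  using bound_elems[OF si] by metis
 have BV: "ro:V" if "ro:B" for ro using that B(2) names_V by blast
 define cpt where "cpt z z' <-> (ALL ro:V. ALL p:V. ALL ro':V. ALL p':V. z = pr ro p --> z' = pr ro' p' -->
  (ALL q:V. (q, p) : le --> (q, p') : le --> frc q (%i. nm (env4 si ro ro' si i)) same_fm))" for z z'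
 have env: "(%i. nm (env4 si ro ro' ta i)) = env4 si ro ro' ta" if "ro:N" "ro':N" "ta:N" for ro ro' ta
  using that si by (intro HOL.ext) (simp add: nm(1))
 have cptD: "frc q (env4 si ro ro' si) same_fm"
  if "cpt (pr ro p) (pr ro' p')" "ro:B" "ro':B" "(q, p):le" "(q, p'):le" for ro p ro' p' q
 proof -
  have "frc q (%i. nm (env4 si ro ro' si i)) same_fm"
   using that(1)[unfolded cpt_def] that(2-5) BV le_P P_V by blast
  moreover have "(%i. nm (env4 si ro ro' si i)) = env4 si ro ro' si" using that(2,3) B(2) si by (intro env) auto
  ultimately show ?thesis by metis
 qed
 have cptI: "cpt (pr ro p) (pr ro' p')"
  if *: "ro:B" "p:P" "ro':B" "p':P" "!!q. (q, p):le ==> (q, p'):le ==> frc q (env4 si ro ro' si) same_fm" for ro p ro' p'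
  unfolding cpt_def
 proof (intro ballI impI)
  fix ro1 p1 ro2 p2 q assume 1: "ro1:V" "p1:V" "ro2:V" "p2:V" "pr ro p = pr ro1 p1" "pr ro' p' = pr ro2 p2"
   and q: "(q, p1):le" "(q, p2):le"
  have eq: "ro1 = ro" "p1 = p" "ro2 = ro'" "p2 = p'" using 1 * BV P_V by (auto simp: pr_inj)
  have env': "(%i. nm (env4 si ro ro' si i)) = env4 si ro ro' si" using *(1,3) B(2) si by (intro env) auto
  show "frc q (%i. nm (env4 si ro1 ro2 si i)) same_fm"
   unfolding eq(1,3) env' by (rule *(5)) (use q eq in auto)
 qed
 have siV: "si:V" using si names_V by blast
 have "df M (%e. cpt (e 0) (e 1))" unfolding cpt_def by (intro dfi le df_frc_terms siV)
 note df_cpt = df_rel2[where R = cpt, OF this]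
 define K where "K = {C:{C:V. E C <= prs B P}. ALL z:E C. ALL z':E C. cpt z z'}"
 have isK: "isset K" unfolding K_def by (intro isset_sep isset_Pow isset_prs B(1) isset_P dfi df_cpt)
 have "emp : K" by (simp add: K_def)
 moreover have "S (UN y:c. E y) : K" if c: "isset c" "c <= K" "!!x y. x:c ==> y:c ==> E x <= E y | E y <= E x" for c
 proof -
  have "cpt z z'" if z: "z:(UN y:c. E y)" "z':(UN y:c. E y)" for z z'
  proof -
   obtain y where "y:c" "z:E y" "z':E y" using z c(3) by blast
   thus ?thesis using c(2) unfolding K_def by blast
  qed
  moreover have "(UN y:c. E y) <= prs B P" using c(2) unfolding K_def by blast
  ultimately show ?thesis unfolding K_def using isset_Union[OF c(1)] by (simp add: S_in E_S)
 qed
 ultimately obtain C where C: "C:K" "!!D. D:K ==> E C <= E D ==> D = C" using zorn[OF isK] by metis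
 have CV: "C:V" "E C <= prs B P" and Ccpt: "!!z z'. z:E C ==> z':E C ==> cpt z z'" using C(1) by (auto simp: K_def)
 have CN: "C:N" by (rule nameI[OF CV(1)]) (use CV(2) B(2) in blast)
 have elC: "EX ro:B. EX p:G. pr ro p : E C & u = cls ro" if u: "u:carr Q" "u in_Q cls C" for u
 proof -
  obtain ta where ta: "ta:N" "u = cls ta" using u by (auto simp: carr_Q)
  thus ?thesis using mem_name(2)[OF isset_E[OF CV(1)] CV(2) B(2) ta(1)] u(2) S_E[OF CV(1)] by auto
 qed
 show ?thesis
 proof (rule bexI[of _ "cls C"], intro ballI impI)
  show "cls C : carr Q" using CN by (simp add: carr_Q)
  fix y assume y: "y:carr Q" "y in_Q cls si"
  have unique: "u = u'" if u: "u:carr Q" "u in_Q y" "u in_Q cls C" "u':carr Q" "u' in_Q y" "u' in_Q cls C" for u u'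
  proof -
   obtain ro p ro' p' where *: "ro:B" "p:G" "pr ro p : E C" "u = cls ro" "ro':B" "p':G" "pr ro' p' : E C" "u' = cls ro'"
    using elC u by metis
   obtain q where q: "q:G" "(q, p):le" "(q, p'):le" using G_dir *(2,6) by blast
   have "frc q (env4 si ro ro' si) same_fm" by (rule cptD[OF Ccpt[OF *(3,7)] *(1,5) q(2,3)])
   moreover have "env4 si ro ro' si i : N" for i using *(1,5) B(2) si by auto
   ultimately have "sat Q (%i. cls (env4 si ro ro' si i)) same_fm" using truth[of same_fm "env4 si ro ro' si"] q(1) by blast
   thus ?thesis unfolding sat_same_fm using y u(2,5) *(4,8) by blast
  qed
  have "EX u:carr Q. u in_Q y & u in_Q cls C"
  proof (rule ccontr)
   assume no: "~(EX u:carr Q. u in_Q y & u in_Q cls C)"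
   obtain us where us: "us:B" "y = cls us" using B(3,4) y by blast
   obtain z where z: "z:carr Q" "z in_Q y" using ne y by blast
   then obtain ro where ro: "ro:B" "z = cls ro" using B(4) us by blast
   let ?e = "env4 si us ro C"
   have eN: "?e i : N" for i using us(1) ro(1) B(2) si CN by auto
   have "sat Q (%i. cls (?e i)) miss_fm"
    unfolding sat_miss_fm using y z disj no us(2) ro(2) by blast
   then obtain p where p: "p:G" "frc p ?e miss_fm" using truth[of miss_fm ?e] eN by blast
   have pP: "p:P" using p(1) G_P by blast
   text \<open>In an extension containing both conditions \<open>ro\<close> and \<open>ro'\<close> are not in the same element of \<open>si\<close>.\<close>
   have apart: "frc q (env4 si ro ro' si) same_fm & frc q (env4 si ro' ro si) same_fm"
    if *: "pr ro' p' : E C" "ro':B" "p':P" "(q, p):le" "(q, p'):le" for ro' p' q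
   proof -
    have N4: "env4 si ro ro' si i : N" "env4 si ro' ro si i : N" for i using ro(1) *(2) B(2) si by auto
    have *: "sat (generic_ext M P Feq Fmem H) (%i. generic.cls M P Feq H (env4 si ro ro' si i)) same_fm &
      sat (generic_ext M P Feq Fmem H) (%i. generic.cls M P Feq H (env4 si ro' ro si i)) same_fm"
     if H: "generic M P le Feq Fmem H" "q:H" for H
    proof -
     interpret H: generic M P le Feq Fmem H by (rule H(1))
     have "p:H" "p':H" using H.G_up[OF H(2)] * by blast+
     hence miss: "sat H.Q (%i. H.cls (?e i)) miss_fm" using H.truth[of miss_fm ?e] eN p(2) by blast
     have ro'N: "ro':N" using *(2) B(2) by blast
     have "H.inQ (H.cls ro') (H.cls C)" unfolding H.mem_iff[OF ro'N CN] using *(1) `p' : H` ro'N by blast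
     moreover have "H.cls ro' : carr H.Q" "H.cls ro : carr H.Q" "H.cls us : carr H.Q"
      using ro'N ro(1) us(1) B(2) by (auto simp: H.carr_Q)
     ultimately show ?thesis using miss unfolding H.sat_miss_fm H.sat_same_fm by blast
    qed
    have qP: "q:P" using that le_P by blast
    show ?thesis 
     using semantic_forcing[where e = "env4 si ro ro' si", OF cnt qP N4(1)]
      semantic_forcing[where e = "env4 si ro' ro si", OF cnt qP N4(2)] * by blast
   qed
   have self: "frc q (env4 si ro ro si) same_fm" if "(q, p):le" for q
   proof (rule semantic_forcing[OF cnt])
    show "q:P" using that le_P by blast
    show "env4 si ro ro si i : N" for i using ro(1) B(2) si by auto
    fix H assume "generic M P le Feq Fmem H"
    then interpret H: generic M P le Feq Fmem H .
    show "sat H.Q (%i. H.cls (env4 si ro ro si i)) same_fm" unfolding H.sat_same_fm by simp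
   qed
   have ins: "isset (insert (pr ro p) (E C))" using CV(1) BV[OF ro(1)] P_V[OF pP] by (intro isset_insert isset_E) auto
   note D = S_in[OF ins] E_S[OF ins]
   have "cpt z z'" if z: "z:insert (pr ro p) (E C)" "z':insert (pr ro p) (E C)" for z z'
   proof -
    have "cpt (pr ro p) (pr ro p)" using cptI[OF ro(1) pP ro(1) pP] self by blast
    moreover have "cpt (pr ro p) w & cpt w (pr ro p)" if w: "w:E C" for w
    proof -
     obtain ro' p' where w': "ro':B" "p':P" "w = pr ro' p'" using CV(2) w by blast
     thus ?thesis using cptI[OF ro(1) pP w'(1,2)] cptI[OF w'(1,2) ro(1) pP] apart[of ro' p'] w by blast
    qed
    ultimately show ?thesis using z Ccpt by blast
   qed
   moreover have "insert (pr ro p) (E C) <= prs B P" using CV(2) ro(1) pP by blast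
   ultimately have "S (insert (pr ro p) (E C)) : K" unfolding K_def using D by simp
   hence "S (insert (pr ro p) (E C)) = C" using C(2) D(2) by blast
   hence "pr ro p : E C" using D(2) by (metis insertI1)
   hence "z in_Q cls C" unfolding ro(2) using mem_iff[of ro C] ro(1) B(2) CN p(1) by blast
   thus False using no z by blast
  qed
  thus "EX w:carr Q. ALL u:carr Q. u in_Q y & u in_Q cls C <-> u = w" using unique by metis
 qed
qed

lemma Q_choice:
 assumes "countable V" "range e <= carr Q"
 shows "sat Q e ax_choice"
 unfolding ax_choice_def sat.simps(5)[of Q e 0] sat.simps(4)[of Q "e(0 := x)" for x]
proof (intro ballI impI)
 fix x assume x: "x:carr Q" and "sat Q (e(0 := x)) (Con (All 1 (Imp (Mem 1 0) (Exi 2 (Mem 2 1))))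
   (All 1 (All 2 (Imp (Con (Mem 1 0) (Con (Mem 2 0) (Neg (Equ 1 2)))) (Neg (Exi 3 (Con (Mem 3 1) (Mem 3 2))))))))"
 hence A: "sat Q (e(0 := x)) (All 1 (Imp (Mem 1 0) (Exi 2 (Mem 2 1))))"
  and B: "sat Q (e(0 := x)) (All 1 (All 2 (Imp (Con (Mem 1 0) (Con (Mem 2 0) (Neg (Equ 1 2)))) (Neg (Exi 3 (Con (Mem 3 1) (Mem 3 2)))))))"
  unfolding sat_Con[of Q "e(0 := x)" "All _ _" "All _ _"] by blast+
 obtain si where si: "si:N" "x = cls si" using x(1) by (auto simp: carr_Q)
 have "EX c:carr Q. ALL y:carr Q. y in_Q cls si --> (EX w:carr Q. ALL u:carr Q. u in_Q y & u in_Q c <-> u = w)"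
 proof (rule Q_transversal[OF assms(1) si(1)])
  show "EX z:carr Q. z in_Q y" if "y:carr Q" "y in_Q cls si" for y using A si(2) that by simp
  show "y = z" if "y:carr Q" "z:carr Q" "u:carr Q" "y in_Q cls si" "z in_Q cls si" "u in_Q y" "u in_Q z" for y z u
   using B that unfolding si(2) sat.simps(4,5) sat_Con by auto
 qed
 then obtain c where c: "c:carr Q" "ALL y:carr Q. y in_Q x --> (EX w:carr Q. ALL u:carr Q. u in_Q y & u in_Q c <-> u = w)"
  unfolding si(2) by blast
 show "sat Q (e(0 := x)) (Exi 4 (All 1 (Imp (Mem 1 0) (Exi 2 (All 3 (Iff (Con (Mem 3 1) (Mem 3 4)) (Equ 3 2)))))))"
  unfolding sat_Exi[of Q "e(0 := x)"] sat.simps(5)[of Q "e(0 := x, 4 := c)" for c] sat.simps(4)[of Q "e(0 := x, 4 := c, 1 := y)" for c y]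
 proof (rule bexI[OF _ c(1)], intro ballI impI)
  fix y assume y: "y:carr Q" "sat Q (e(0 := x, 4 := c, 1 := y)) (Mem 1 0)"
  then obtain w where "w:carr Q" "ALL u:carr Q. u in_Q y & u in_Q c <-> u = w" using c(2) by auto
  thus "sat Q (e(0 := x, 4 := c, 1 := y)) (Exi 2 (All 3 (Iff (Con (Mem 3 1) (Mem 3 4)) (Equ 3 2))))"
   unfolding sat_Exi sat.simps(5) sat_Iff sat_Con[of _ _ "Mem _ _"] by (intro bexI[of _ w]) auto
 qed
qed

theorem generic_ext_zfc:
 assumes "countable V"
 shows "is_model Q zfc"
 unfolding is_model_def zfc_def single_axioms_def
 using struct_Q assms Q_extensionality Q_foundation Q_pairing Q_union Q_power Q_infinity Q_choice Q_separation Q_replacement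
 by auto

end

theorem forcing_extension_saturated:
 assumes inf: "infinite (UNIV :: 'a set)"
 shows "forcing_extension_axiom (CSM :: 'a struct set)"
 unfolding forcing_extension_axiom_def
proof (intro ballI allI impI, elim conjE)
 fix M :: "'a struct" and P0 le0
 assume M: "M:CSM" and br: "binrel_in M P0 le0" and fn: "forcing_notion (ext M P0) (rel_in M le0)"
 interpret zfc_model M using M by (rule zfc_model_multiverse)
 have PV: "P0:V" "le0:V" using br by (auto simp: binrel_in_def)
 have "df M (%e. e 0 : E P0)" "df M (%e. (e 0, e 1):rel_in M le0)" by (intro dfi PV)+
 hence "definable1 M (E P0)" "definable2 M (rel_in M le0)"
  using definable1_df[OF E_sub nonempty] definable2_df[of "rel_in M le0" M] nonempty by (auto simp: rel_in_def)
 then interpret set_poset M "E P0" "rel_in M le0" using fn isset_E[OF PV(1)] by unfold_locales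
 obtain Feq Fmem where af: "atomic_forcing M (E P0) (rel_in M le0) Feq Fmem" using atomic_forcing_set by blast
 interpret forcing M "E P0" "rel_in M le0" Feq Fmem by unfold_locales (rule af)
 have sat: "computably_saturated M" and cnt: "countable V" using M by (auto simp: countable_saturated_models_def)
 obtain p0 where "p0:E P0" using fn by (auto simp: forcing_notion_def)
 then obtain G where filter: "generic_filter (E P0) (rel_in M le0) (classes_of M) G"
  "computably_saturated (generic_ext M (E P0) Feq Fmem G)"
  by (rule generic_saturated[OF sat cnt])
 interpret generic M "E P0" "rel_in M le0" Feq Fmem G by unfold_locales (rule filter(1))
 interpret set_generic M "E P0" "rel_in M le0" Feq Fmem G by unfold_locales
 obtain B where B: "B:(CSM :: 'a struct set)" "is_generic_ext M (E P0) (rel_in M le0) G B"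
  using generic_copy[OF inf cnt filter generic_ext_zfc[OF cnt]] by blast
 have "definable1 M (E x)" if "x:V" for x
  unfolding definable1_df[OF E_sub nonempty] by (intro dfi that)
 hence "sets_of M <= classes_of M" by (auto simp: sets_of_def classes_of_def)
 hence "generic_filter (E P0) (rel_in M le0) (sets_of M) G" using filter(1) unfolding generic_filter_def by blast
 thus "EX N:(CSM :: 'a struct set). EX G. generic_filter (E P0) (rel_in M le0) (sets_of M) G &
   is_generic_ext M (E P0) (rel_in M le0) G N" using B by blast
qed

section \<open>Existence of computably saturated models\<close>

text \<open>Generalization in \<open>deriv\<close> also acts on hypotheses, which spoils the
  deduction theorem for open formulas. The assumptions \<open>Ga\<close> are combined by modus
  ponens only, and so the theorem holds for them.\<close>

inductive prv :: "fm set => fm set => fm => bool" for T Ga where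
 ax: "deriv T ph ==> prv T Ga ph"
| asm: "ph:Ga ==> prv T Ga ph"
| mp: "prv T Ga (Imp ph psi) ==> prv T Ga ph ==> prv T Ga psi"

definition con :: "fm set => fm set => bool" where
 "con T Ga <-> ~(EX ph. prv T Ga ph & prv T Ga (Neg ph))"

lemma prv_mono: "prv T Ga ph ==> Ga <= De ==> prv T De ph"
 by (induction rule: prv.induct) (auto intro: prv.intros)

lemma prv_cut: "prv T De ph ==> (!!de. de:De ==> prv T Ga de) ==> prv T Ga ph"
 by (induction rule: prv.induct) (auto intro: prv.intros)

lemma prv_finite: "prv T Ga ph ==> EX De. finite De & De <= Ga & prv T De ph"
proof (induction rule: prv.induct)
 case (ax ph)
 thus ?case by (intro exI[of _ "{}"]) (auto intro: prv.ax)
next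
 case (asm ph)
 thus ?case by (intro exI[of _ "{ph}"]) (auto intro: prv.asm)
next
 case (mp ph psi)
 then obtain De De' where "finite De" "De <= Ga" "prv T De (Imp ph psi)" "finite De'" "De' <= Ga" "prv T De' ph" by blast
 thus ?case by (intro exI[of _ "De Un De'"]) (auto intro: prv.mp prv_mono)
qed

lemma prv_empty: "prv T {} ph ==> deriv T ph"
 by (induction rule: prv.induct) (auto intro: deriv.MP)

lemma imp_refl: "deriv T (Imp ph ph)"
 by (rule deriv.MP[OF deriv.MP[OF deriv.A2 deriv.A1] deriv.A1[of T ph ph]])

lemma weaken: "prv T Ga psi ==> prv T Ga (Imp ph psi)"
 by (rule prv.mp[OF prv.ax[OF deriv.A1]])

lemma deduction: "prv T (insert ph Ga) psi ==> prv T Ga (Imp ph psi)"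
proof (induction rule: prv.induct)
 case (asm psi)
 thus ?case by (auto intro: weaken prv.asm prv.ax imp_refl)
next
 case (mp ch psi)
 thus ?case by (meson deriv.A2 prv.mp prv.ax)
qed (auto intro: weaken prv.ax)

lemma prv_contra: "~con T (insert (Neg ph) Ga) ==> prv T Ga ph"
 unfolding con_def by (meson deduction deriv.A3 prv.mp prv.ax)

lemma not_con_prv: "~con T Ga ==> prv T Ga ph"
 by (rule prv_contra) (auto simp: con_def intro: prv_mono)

lemma prv_Neg:
 assumes "~con T (insert ph Ga)"
 shows "prv T Ga (Neg ph)"
proof (rule prv_contra)
 let ?Ga = "insert (Neg (Neg ph)) Ga"
 have "prv T ?Ga (Imp (Neg ph) (Neg (Neg ph)))" by (auto intro: weaken prv.asm)
 hence "prv T ?Ga ph" by (meson deriv.A3 prv.mp prv.ax imp_refl)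
 hence "prv T ?Ga de" if "de:insert ph Ga" for de using that by (auto intro: prv.asm)
 hence "prv T ?Ga psi" for psi by (rule prv_cut[OF not_con_prv[OF assms]])
 thus "~con T ?Ga" unfolding con_def by blast
qed

lemma All_mp: "deriv T (Imp (All x (Imp ph psi)) (Imp (All x ph) (All x psi)))"
proof -
 have inst: "deriv T (Imp (All x ch) ch)" for ch
 proof -
  have "free_for x x ch" "subst x x ch = ch" by (induction ch) auto
  thus ?thesis using deriv.A4[of x x ch T] by simp
 qed
 let ?A = "All x (Imp ph psi)" and ?B = "All x ph"
 have "prv T {?B, ?A} psi" by (meson inst insertI1 insertI2 prv.intros)
 hence "deriv T (Imp ?A (Imp ?B psi))" by (intro prv_empty deduction)
 hence "deriv T (All x (Imp ?A (Imp ?B psi)))" by (rule deriv.Gen)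
 hence "deriv T (Imp ?A (All x (Imp ?B psi)))" by (rule deriv.MP[OF deriv.A5, rotated]) simp
 hence "prv T {?A} (All x (Imp ?B psi))" by (meson insertI1 prv.intros)
 moreover have "deriv T (Imp (All x (Imp ?B psi)) (Imp ?B (All x psi)))" by (rule deriv.A5) simp
 ultimately show ?thesis by (intro prv_empty deduction[where Ga = "{}"]) (blast intro: prv.intros)
qed

lemma prv_Gen:
 "prv T Ga ph ==> (!!ga. ga:Ga ==> x ~: fv ga) ==> prv T Ga (All x ph)"
proof (induction rule: prv.induct)
 case (ax ph)
 thus ?case by (auto intro: prv.ax deriv.Gen)
next
 case (asm ph)
 hence "deriv T (Imp ph (All x ph))" by (meson deriv.A5 deriv.Gen deriv.MP imp_refl)
 thus ?case using asm by (meson prv.intros)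
next
 case (mp ph psi)
 thus ?case by (meson All_mp prv.mp prv.ax)
qed

text \<open>The assumptions that contain \<open>x\<close> are moved to the right by the deduction
  theorem; then \<open>x\<close> is generalized and instantiated by \<open>y\<close>.\<close>

lemma prv_subst:
 assumes "finite De" "prv T (Ga Un De) ph" "!!ga. ga:Ga ==> x ~: fv ga" "!!de. de:insert ph De ==> free_for y x de"
 shows "prv T (Ga Un subst x y ` De) (subst x y ph)"
 using assms(1,2,4)
proof (induction De arbitrary: ph)
 case empty
 hence "prv T Ga (All x ph)" using assms(3) by (intro prv_Gen) auto
 thus ?case using empty by (auto intro: prv.mp[OF prv.ax[OF deriv.A4]])
next
 case (insert de De)
 have "prv T (Ga Un De) (Imp de ph)" using insert.prems(1) by (intro deduction) simp
 hence "prv T (Ga Un subst x y ` De) (subst x y (Imp de ph))" using insert.prems(2) by (intro insert.IH) auto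
 hence "prv T (Ga Un subst x y ` insert de De) (Imp (subst x y de) (subst x y ph))" by (auto intro: prv_mono)
 thus ?case by (rule prv.mp) (auto intro: prv.asm)
qed

text \<open>The odd variables serve as constants, the even ones are bound.\<close>

abbreviation cn :: "nat => nat" where "cn j == Suc (2 * j)"

text \<open>Bound variables are made even in passing, so that odd variables can be substituted
  without capture.\<close>

primrec sb :: "(nat => nat) => fm => fm" where
 "sb si (Mem i j) = Mem (si i) (si j)"
| "sb si (Equ i j) = Equ (si i) (si j)"
| "sb si (Neg ph) = Neg (sb si ph)"
| "sb si (Imp ph psi) = Imp (sb si ph) (sb si psi)"
| "sb si (All v ph) = All (2 * v) (sb (si(v := 2 * v)) ph)"

lemma sb_cong: "(!!i. i:fv ph ==> si i = ta i) ==> sb si ph = sb ta ph"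
proof (induction ph arbitrary: si ta)
 case (All v ph)
 have "sb (si(v := 2 * v)) ph = sb (ta(v := 2 * v)) ph" by (rule All.IH) (use All.prems in auto)
 thus ?case by simp
next
 case (Imp ph psi)
 have "sb si ph = sb ta ph" by (rule Imp.IH(1)) (use Imp.prems in auto)
 moreover have "sb si psi = sb ta psi" by (rule Imp.IH(2)) (use Imp.prems in auto)
 ultimately show ?case by simp
next
 case (Neg ph)
 have "sb si ph = sb ta ph" by (rule Neg.IH) (use Neg.prems in auto)
 thus ?case by simp
qed simp_all

lemma fv_sb: "fv (sb si ph) <= si ` fv ph"
proof (induction ph arbitrary: si)
 case (All v ph)
 hence "fv (sb (si(v := 2 * v)) ph) <= (si(v := 2 * v)) ` fv ph" .
 thus ?case by (auto split: if_splits)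
qed (simp_all, blast)

lemma subst_sb_const: "subst (cn i) y (sb si ph) = sb (%u. if si u = cn i then y else si u) ph"
proof (induction ph arbitrary: si)
 case (All v ph)
 have "2 * v ~= cn i" by presburger
 hence "(%u. if (si(v := 2 * v)) u = cn i then y else (si(v := 2 * v)) u) = (%u. if si u = cn i then y else si u)(v := 2 * v)"
  by auto
 thus ?case using `2 * v ~= cn i` by (simp only: sb.simps subst.simps All.IH if_False)
qed simp_all

lemma subst_sb:
 "(!!u. si u = 2 * u | odd (si u)) ==> subst (2 * v) y (sb si ph) = sb (%u. if si u = 2 * v then y else si u) ph"
proof (induction ph arbitrary: si)
 case (All w ph)
 show ?case
 proof (cases "w = v")
  case True
  have "sb (si(v := 2 * v)) ph = sb ((%u. if si u = 2 * v then y else si u)(v := 2 * v)) ph"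
   by (rule sb_cong) (use All.prems in "auto, (metis dvd_triv_left mult_cancel1 zero_neq_numeral)+")
  thus ?thesis using True by simp
 next
  case False
  have "subst (2 * v) y (sb (si(w := 2 * w)) ph) = sb (%u. if (si(w := 2 * w)) u = 2 * v then y else (si(w := 2 * w)) u) ph"
   by (rule All.IH) (use All.prems in auto)
  also have "... = sb ((%u. if si u = 2 * v then y else si u)(w := 2 * w)) ph" by (rule sb_cong) (use False in auto)
  finally show ?thesis using False by simp
 qed
qed auto

lemma free_for_const: "free_for (cn j) x (sb si ph)"
 by (induction ph arbitrary: si) (auto, presburger+)

lemma free_for_bound: "(!!u. si u = cn i ==> u = v) ==> free_for (2 * v) (cn i) (sb si ph)"
proof (induction ph arbitrary: si)
 case (All w ph)
 have "cn i ~: fv (sb (si(w := 2 * w)) ph)" if "w = v"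
  proof
  assume "cn i : fv (sb (si(w := 2 * w)) ph)"
  then obtain u where "(si(w := 2 * w)) u = cn i" using fv_sb by fastforce
  moreover have "2 * w ~= cn i" by presburger
  ultimately show False using All.prems[of u] that by (auto split: if_splits)
 qed
 moreover have "free_for (2 * v) (cn i) (sb (si(w := 2 * w)) ph)"
  by (rule All.IH) (use All.prems in "auto split: if_splits, presburger")
 ultimately show ?case by auto
qed auto

definition inst :: "fm set => nat list => fm set" where
 "inst p ys = sb (%i. cn (ys ! i)) ` p"

lemma inst_subst:
 assumes q: "finite q" "!!ph. ph:q ==> fv ph <= {..<length ys}" and Ga: "!!ga. ga:Ga ==> cn i ~: fv ga"
  and inc: "~con T (Ga Un inst q ys)"
 shows "~con T (Ga Un inst q (map (%y. if y = i then j else y) ys))"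
proof -
 have "prv T (Ga Un inst q ys) (Neg (Equ (cn i) (cn i)))" by (rule not_con_prv[OF inc])
 hence "prv T (Ga Un subst (cn i) (cn j) ` inst q ys) (subst (cn i) (cn j) (Neg (Equ (cn i) (cn i))))"
  by (rule prv_subst[rotated]) (use q(1) Ga free_for_const in "auto simp: inst_def")
 moreover have "subst (cn i) (cn j) (sb (%k. cn (ys ! k)) ph) = sb (%k. cn (map (%y. if y = i then j else y) ys ! k)) ph" if "ph:q" for ph
  unfolding subst_sb_const by (rule sb_cong) (use q(2)[OF that] in auto)
 hence "subst (cn i) (cn j) ` inst q ys = inst q (map (%y. if y = i then j else y) ys)"
  unfolding inst_def image_image by (intro image_cong) auto
 ultimately have "prv T (Ga Un inst q (map (%y. if y = i then j else y) ys)) (Neg (Equ (cn j) (cn j)))" by simp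
 thus ?thesis using prv.ax[OF deriv.eq_refl[of T "cn j"]] unfolding con_def by blast
qed

text \<open>What is inconsistent at fresh constants is inconsistent at any constants. The block is
  replaced entry by entry; disjointness ensures that entries already replaced are not touched
  again.\<close>

lemma inst_move:
 assumes q: "finite q" "!!ph. ph:q ==> fv ph <= {..<length xs + length as}"
  and Ga: "!!ga i. ga:Ga ==> B <= i ==> i < B + length xs ==> cn i ~: fv ga"
  and disj: "(set xs Un set as) Int {B..<B + length xs} = {}"
  and inc: "~con T (Ga Un inst q ([B..<B + length xs] @ as))"
 shows "~con T (Ga Un inst q (xs @ as))"
proof -
 have "~con T (Ga Un inst q ((take m xs @ [B + m..<B + length xs]) @ as))" if "m <= length xs" for m
  using that
 proof (induction m)
  case 0
  thus ?case using inc by simp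
 next
  case (Suc m)
  let ?ys = "(take m xs @ [B + m..<B + length xs]) @ as"
  let ?f = "%y. if y = B + m then xs ! m else y"
  have "B + m : {B..<B + length xs}" using Suc.prems by simp
  hence "B + m ~: set xs Un set as" using disj by blast
  hence "map ?f (take m xs) = take m xs" "map ?f as = as"
   by (auto intro!: map_idI dest!: in_set_takeD)
  moreover have "map ?f [B + m..<B + length xs] = xs ! m # [B + Suc m..<B + length xs]"
   using Suc.prems by (subst upt_conv_Cons) (auto intro!: map_idI)
  moreover have "take (Suc m) xs = take m xs @ [xs ! m]" using Suc.prems by (simp add: take_Suc_conv_app_nth)
  ultimately have "(take (Suc m) xs @ [B + Suc m..<B + length xs]) @ as = map ?f ?ys" by simp
  moreover have "length ?ys = length xs + length as" using Suc.prems by simp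
  ultimately show ?case
   using inst_subst[OF q(1), of ?ys Ga "B + m" T "xs ! m"] q(2) Ga[of _ "B + m"] Suc by simp
 qed
 from this[of "length xs"] show ?thesis by simp
qed

text \<open>Inconsistency is demanded for all constants, including those introduced later, and with
  the current \<open>Ga\<close> only; it therefore persists when the theory grows.\<close>

definition handled :: "fm set => fm set => fm set => fm set => nat => nat list => bool" where
 "handled T Ga Ga' p k as <-> (EX xs. length xs = k & inst p (xs @ as) <= Ga') |
   (EX q<=p. finite q & (ALL xs. length xs = k --> ~con T (Ga Un inst q (xs @ as))))"

text \<open>Keeps infinitely many constants fresh and all even variables free for
  quantification.\<close>

definition bounded :: "fm set => bool" where
 "bounded Ga <-> (EX n. ALL ga:Ga. fv ga <= cn ` {..<n})"

text \<open>The type is added at fresh constants if that is consistent. Otherwise a finite part is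
  already inconsistent at fresh constants and hence, by \<open>inst_move\<close>, at all
  constants.\<close>

lemma handle:
 assumes Ga: "con T Ga" "bounded Ga" and p: "!!ph. ph:p ==> fv ph <= {..<k + length as}"
 shows "EX Ga'. con T Ga' & bounded Ga' & Ga <= Ga' & handled T Ga Ga' p k as"
proof -
 obtain n where n: "!!ga. ga:Ga ==> fv ga <= cn ` {..<n}" using Ga(2) by (auto simp: bounded_def)
 obtain N where N: "n < N" "!!x. x:set as ==> x < N"
  using finite_nat_set_iff_bounded[of "insert n (set as)"] by auto
 show ?thesis
 proof (cases "con T (Ga Un inst p ([N..<N + k] @ as))")
  case True
  have "fv ga <= cn ` {..<N + k}" if ga: "ga:Ga Un inst p ([N..<N + k] @ as)" for ga
  proof (cases "ga:Ga")
   case True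
   thus ?thesis using n N(1) by fastforce
  next
   case False
   then obtain ph where ph: "ph:p" "ga = sb (%i. cn (([N..<N + k] @ as) ! i)) ph" using ga by (auto simp: inst_def)
   have "([N..<N + k] @ as) ! i < N + k" if "i < k + length as" for i
    using nth_mem[of i "[N..<N + k] @ as"] that N(2) by fastforce
   hence "(%i. cn (([N..<N + k] @ as) ! i)) ` fv ph <= cn ` {..<N + k}" using p[OF ph(1)] by auto
   thus ?thesis unfolding ph(2) using fv_sb by (rule order_trans[rotated])
  qed
  hence "bounded (Ga Un inst p ([N..<N + k] @ as))" unfolding bounded_def by blast
  moreover have "handled T Ga (Ga Un inst p ([N..<N + k] @ as)) p k as"
   unfolding handled_def by (intro disjI1 exI[of _ "[N..<N + k]"]) simp
  ultimately show ?thesis using True by blast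
 next
  case False
  then obtain De where De: "finite De" "De <= Ga Un inst p ([N..<N + k] @ as)" "prv T De (Neg (Equ 0 0))"
   using prv_finite[OF not_con_prv] by meson
  have "De - Ga <= inst p ([N..<N + k] @ as)" using De(2) by blast
  then obtain q where q: "q <= p" "finite q" "De - Ga = inst q ([N..<N + k] @ as)"
   unfolding inst_def using finite_subset_image[OF finite_Diff[OF De(1)]] by metis
  have "prv T (Ga Un inst q ([N..<N + k] @ as)) (Neg (Equ 0 0))" by (rule prv_mono[OF De(3)]) (use q(3) in blast)
  hence inc: "~con T (Ga Un inst q ([N..<N + k] @ as))"
   using prv.ax[OF deriv.eq_refl[of T 0]] unfolding con_def by blast
  have "~con T (Ga Un inst q (xs @ as))" if xs: "length xs = k" for xs
  proof -
   \<comment> \<open>The target \<open>xs\<close> may overlap the block that starts at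
     \<open>N\<close>, so the constants travel through a second block beyond everything
     else.\<close>
   obtain K where K: "N + k < K" "!!x. x:set xs ==> x < K"
    using finite_nat_set_iff_bounded[of "insert (N + k) (set xs)"] by auto
   have fvq: "fv ph <= {..<length ys + length as}" if "ph:q" "length ys = k" for ph and ys :: "nat list"
    using p that q(1) by blast
   have fresh: "cn i ~: fv ga" if "ga:Ga" "n <= i" for ga i using n[OF that(1)] that(2) by auto
   have inc': "~con T (Ga Un inst q ([K..<K + k] @ as))"
   proof (rule inst_move[OF q(2), where B = N])
    show "(set [K..<K + k] Un set as) Int {N..<N + length [K..<K + k]} = {}" using N(2) K(1) by fastforce
   qed (use fvq[of _ "[K..<K + k]"] fresh N(1) inc in auto)
   show ?thesis
   proof (rule inst_move[OF q(2), where B = K])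
    show "(set xs Un set as) Int {K..<K + length xs} = {}" using N(2) K by fastforce
   qed (use fvq[OF _ xs] fresh N(1) K(1) xs inc' in auto)
  qed
  thus ?thesis using Ga q by (intro exI[of _ Ga]) (auto simp: handled_def)
 qed
qed

text \<open>Every task is handled once. Finite types with \<open>k = 0\<close> make the theory complete, and finite types
 fixing all but one variable up to equality provide witnesses.\<close>

lemma saturated_theory:
 assumes "con T {}"
 obtains Ga where "con T Ga" "!!p k as. computable_set (godel ` p) ==> (!!ph. ph : p ==> fv ph <= {..<k + length as}) ==>
  EX Ga0<=Ga. bounded Ga0 & handled T Ga0 Ga p k as"
proof -
 define tasks where "tasks = {(p, k, as :: nat list). computable_set (godel ` p) & (ALL ph:p. fv ph <= {..<k + length as})}"
 have "tasks <= {p. computable_set (godel ` p)} \<times> UNIV" by (auto simp: tasks_def)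
 hence cnt: "countable tasks" by (rule countable_subset) (auto intro: countable_computable_types)
 have ne: "tasks ~= {}" using computable_finite[of "{}"] by (auto simp: tasks_def intro!: exI[of _ "{}"])
 define tk where "tk n = from_nat_into tasks n" for n
 have tk: "tk n : tasks" for n unfolding tk_def by (rule from_nat_into[OF ne])
 have "EX F. ALL n. (con T (F n) & bounded (F n)) & (F n <= F (Suc n) & (case tk n of (p, k, as) => handled T (F n) (F (Suc n)) p k as))"
 proof (rule dependent_nat_choice)
  show "EX Ga. con T Ga & bounded Ga" using assms by (intro exI[of _ "{}"]) (auto simp: bounded_def)
  show "EX Ga'. (con T Ga' & bounded Ga') & Ga <= Ga' & (case tk n of (p, k, as) => handled T Ga Ga' p k as)" if "con T Ga & bounded Ga" for Ga n
   using tk[of n] handle[of T Ga] that by (fastforce simp: tasks_def split: prod.splits)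
 qed
 then obtain F where "ALL n. (con T (F n) & bounded (F n)) & (F n <= F (Suc n) & (case tk n of (p, k, as) => handled T (F n) (F (Suc n)) p k as))" ..
 hence F: "con T (F n)" "bounded (F n)" "F n <= F (Suc n)" "case tk n of (p, k, as) => handled T (F n) (F (Suc n)) p k as" for n
  by simp_all
 have mono: "m <= n ==> F m <= F n" for m n by (rule lift_Suc_mono_le[of F]) (use F(3) in auto)
 show ?thesis
 proof (rule that[of "UN n. F n"])
  show "con T (UN n. F n)" unfolding con_def
  proof
   assume "EX ph. prv T (UN n. F n) ph & prv T (UN n. F n) (Neg ph)"
   hence "~con T (UN n. F n)" by (simp add: con_def)
   then obtain De where De: "finite De" "De <= (UN n. F n)" "prv T De (Neg (Equ 0 0))" using prv_finite[OF not_con_prv] by metis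
   have "EX n. De <= F n" using De(1,2)
   proof (induction De)
    case (insert de De)
    then obtain m n where "De <= F m" "de:F n" by auto
    thus ?case using mono[of m "max m n"] mono[of n "max m n"] by (intro exI[of _ "max m n"]) auto
   qed simp
   then obtain n where "prv T (F n) (Neg (Equ 0 0))" using prv_mono[OF De(3)] by blast
   thus False using F(1)[of n] prv.ax[OF deriv.eq_refl[of T 0]] unfolding con_def by blast
  qed
  fix p k and as :: "nat list" assume "computable_set (godel ` p)" "!!ph. ph:p ==> fv ph <= {..<k + length as}"
  hence "(p, k, as):tasks" by (auto simp: tasks_def)
  then obtain n where "tk n = (p, k, as)" using from_nat_into_surj[OF cnt] by (metis tk_def)
  hence "handled T (F n) (F (Suc n)) p k as" using F(4)[of n] by simp
  hence "handled T (F n) (UN n. F n) p k as" unfolding handled_def by blast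
  thus "EX Ga0<=(UN n. F n). bounded Ga0 & handled T Ga0 (UN n. F n) p k as" using F(2) by blast
 qed
qed

lemma deriv_mono: "deriv S ph ==> S <= T ==> deriv T ph"
 by (induction rule: deriv.induct) (auto intro: deriv.intros)

lemma deriv_finite: "deriv T ph ==> EX S. finite S & S <= T & deriv S ph"
proof (induction rule: deriv.induct)
 case (hyp ph)
 thus ?case by (intro exI[of _ "{ph}"]) (auto intro: deriv.hyp)
next
 case (MP ph psi)
 then obtain S S' where S: "finite S" "S <= T" "deriv S (Imp ph psi)" "finite S'" "S' <= T" "deriv S' ph" by blast
 have "deriv (S Un S') psi"
  by (rule deriv.MP[OF deriv_mono[OF S(3)] deriv_mono[OF S(6)]]) auto
 thus ?case using S by (intro exI[of _ "S Un S'"]) simp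
next
 case (Gen ph x)
 thus ?case by (meson deriv.Gen)
qed (rule exI[of _ "{}"], simp add: deriv.intros)+

lemma ren_subst: "inj f ==> ren f (subst x y ph) = subst (f x) (f y) (ren f ph)"
 by (induction ph) (auto simp: inj_eq)

lemma free_for_ren: "inj f ==> free_for (f y) (f x) (ren f ph) = free_for y x ph"
 by (induction ph) (auto simp: inj_eq fv_ren inj_image_mem_iff)

lemma deriv_ren: "deriv T ph ==> inj f ==> deriv (ren f ` T) (ren f ph)"
proof (induction rule: deriv.induct)
 case (A4 y x ph)
 thus ?case by (simp add: ren_subst free_for_ren deriv.A4)
next
 case (A5 x ph psi)
 thus ?case by (simp add: fv_ren inj_image_mem_iff deriv.A5)
next
 case (MP ph psi)
 thus ?case by (auto intro: deriv.MP)
qed (auto intro: deriv.intros)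

lemma ren_bound: "EX K. ALL f g. (ALL i<K. f i = g i) --> ren f ph = ren g ph"
proof (induction ph)
 case (Mem i j)
 show ?case by (rule exI[of _ "Suc (max i j)"]) auto
next
 case (Equ i j)
 show ?case by (rule exI[of _ "Suc (max i j)"]) auto
next
 case (Imp ph psi)
 then obtain K L where "ALL f g. (ALL i<K. f i = g i) --> ren f ph = ren g ph" "ALL f g. (ALL i<L. f i = g i) --> ren f psi = ren g psi" by blast
 thus ?case by (intro exI[of _ "max K L"] allI impI) (simp add: less_max_iff_disj)
next
 case (All v ph)
 then obtain K where "ALL f g. (ALL i<K. f i = g i) --> ren f ph = ren g ph" by blast
 thus ?case by (intro exI[of _ "max K (Suc v)"] allI impI) (simp add: less_max_iff_disj)
qed auto

lemma ren_comp: "ren f (ren g ph) = ren (f o g) ph"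
 by (induction ph) auto

lemma ren_id: "ren (%i. i) ph = ph"
 by (induction ph) auto

lemma consistent_double:
 assumes "consistent T"
 shows "con (ren (%i. 2 * i) ` T) {}"
proof -
 have "EX psi. deriv T psi & deriv T (Neg psi)" if d: "deriv (ren (%i. 2 * i) ` T) ph" "deriv (ren (%i. 2 * i) ` T) (Neg ph)" for ph
 proof -
  obtain S S' where S: "finite S" "S <= ren (%i. 2 * i) ` T" "deriv S ph" "finite S'" "S' <= ren (%i. 2 * i) ` T" "deriv S' (Neg ph)"
   using deriv_finite[OF d(1)] deriv_finite[OF d(2)] by blast
  obtain R where R: "R <= T" "finite R" "S Un S' = ren (%i. 2 * i) ` R"
   using finite_subset_image[of "S Un S'" "ren (%i. 2 * i)" T] S by auto
  obtain b where b: "ALL f g. (ALL i<b psi. f i = g i) --> ren f psi = ren g psi" for psi using ren_bound by metis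
  obtain K where K: "!!psi. psi:R ==> b psi < K"
   using finite_nat_set_iff_bounded[of "b ` R"] R(2) by auto
  \<comment> \<open>Doubling has no injective left inverse on all variables. For the finitely many
    axioms in question it is undone below \<open>2 * K\<close> only, and all other variables are
    moved to \<open>K\<close> and beyond.\<close>
  define pi where "pi z = (if even z & z < 2 * K then z div 2 else K + z)" for z
  have pi: "inj pi" unfolding inj_def pi_def by (auto simp: less_mult_imp_div_less mult.commute elim!: evenE)
  have "ren pi (ren (%i. 2 * i) psi) = psi" if "psi:R" for psi
  proof -
   have "ren (pi o (%i. 2 * i)) psi = ren (%i. i) psi" using b[of psi] K[OF that] by (auto simp: pi_def)
   thus ?thesis by (simp add: ren_comp ren_id)
  qed
  hence "ren pi ` (S Un S') <= T" using R(1) unfolding R(3) by auto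
  hence "deriv T (ren pi ph)" "deriv T (ren pi (Neg ph))"
   by (auto intro!: deriv_mono[OF deriv_ren[OF S(3) pi]] deriv_mono[OF deriv_ren[OF S(6) pi]] simp del: ren.simps)
  thus ?thesis by auto
 qed
 thus ?thesis using assms unfolding con_def consistent_def by (blast dest: prv_empty)
qed

lemma sb_double: "sb (%i. 2 * i) ph = ren (%i. 2 * i) ph"
proof (induction ph)
 case (All v ph)
 have "(%i. 2 * i)(v := 2 * v) = (%i. 2 * i :: nat)" by auto
 thus ?case using All by simp
qed auto

lemma instantiate:
 assumes "deriv T (ren (%i. 2 * i) ph)"
 shows "deriv T (sb (%u. cn (et u)) ph)"
proof -
 let ?si = "%m u. if u < m then cn (et u) else 2 * u"
 have "deriv T (sb (?si m) ph)" for m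
 proof (induction m)
  case 0
  thus ?case using assms by (simp add: sb_double)
 next
  case (Suc m)
  have "subst (2 * m) (cn (et m)) (sb (?si m) ph) = sb (%u. if ?si m u = 2 * m then cn (et m) else ?si m u) ph"
   by (rule subst_sb) auto
  also have "... = sb (?si (Suc m)) ph" by (rule sb_cong) (auto simp: less_Suc_eq, presburger+)
  finally show ?case using deriv.MP[OF deriv.A4[OF free_for_const[of "et m" "2 * m"]] deriv.Gen[OF Suc]] by simp
 qed
 moreover obtain m where "ALL i:fv ph. i < m" using finite_nat_set_iff_bounded[of "fv ph"] finite_fv by auto
 hence "sb (?si m) ph = sb (%u. cn (et u)) ph" by (intro sb_cong) auto
 ultimately show ?thesis by metis
qed

section \<open>The term model of a saturated theory\<close>

locale saturated =
 fixes T Ga :: "fm set"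
 assumes con: "con T Ga"
  and task: "computable_set (godel ` p) ==> (!!ph. ph : p ==> fv ph <= {..<k + length as}) ==>
   EX Ga0<=Ga. bounded Ga0 & handled T Ga0 Ga p k as"
begin

text \<open>The least constant provably equal to \<open>i\<close>; with representatives instead of
  equivalence classes the carrier remains a set of numbers.\<close>

definition r :: "nat => nat" where "r i = (LEAST j. prv T Ga (Equ (cn i) (cn j)))"

definition term_model :: "nat struct" where
 "term_model = (|carr = range r, mem = {(r i, r j) | i j. prv T Ga (Mem (cn i) (cn j))}|)"

lemma Equ_refl: "prv T Ga (Equ x x)"
 by (intro prv.ax deriv.eq_refl)

lemma Equ_sym: "prv T Ga (Equ x y) ==> prv T Ga (Equ y x)"
 by (rule prv.mp[OF prv.mp[OF prv.ax[OF deriv.eq_equ[of T x y x]]] Equ_refl])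

lemma Equ_trans: "prv T Ga (Equ x y) ==> prv T Ga (Equ y z) ==> prv T Ga (Equ x z)"
 by (rule prv.mp[OF prv.mp[OF prv.ax[OF deriv.eq_equ[of T y x z]] Equ_sym]])

lemma r_eq: "r i = r j <-> prv T Ga (Equ (cn i) (cn j))"
proof
 have r: "prv T Ga (Equ (cn i) (cn (r i)))" for i unfolding r_def by (rule LeastI[of _ i]) (rule Equ_refl)
 show "prv T Ga (Equ (cn i) (cn j))" if "r i = r j" using r[of i] r[of j] that by (metis Equ_sym Equ_trans)
 assume "prv T Ga (Equ (cn i) (cn j))"
 hence "prv T Ga (Equ (cn i) (cn k)) <-> prv T Ga (Equ (cn j) (cn k))" for k by (meson Equ_sym Equ_trans)
 thus "r i = r j" by (simp add: r_def)
qed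

lemma mem_term_model: "(r i, r j):mem term_model <-> prv T Ga (Mem (cn i) (cn j))"
proof
 assume "(r i, r j):mem term_model"
 then obtain i' j' where "r i = r i'" "r j = r j'" "prv T Ga (Mem (cn i') (cn j'))" by (auto simp: term_model_def)
 hence e: "prv T Ga (Equ (cn i') (cn i))" "prv T Ga (Equ (cn j') (cn j))" and m: "prv T Ga (Mem (cn i') (cn j'))"
  by (simp_all only: r_eq Equ_sym)
 have "prv T Ga (Mem (cn i) (cn j'))" by (rule prv.mp[OF prv.mp[OF prv.ax[OF deriv.eq_mem1] e(1)] m])
 thus "prv T Ga (Mem (cn i) (cn j))" by (rule prv.mp[OF prv.mp[OF prv.ax[OF deriv.eq_mem2] e(2)]])
qed (auto simp: term_model_def)

lemma carr_term_model [simp]: "carr term_model = range r"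
 by (simp add: term_model_def)

lemma complete: "prv T Ga (sb (%u. cn (et u)) ph) | prv T Ga (Neg (sb (%u. cn (et u)) ph))"
proof -
 obtain n where n: "ALL i:fv ph. i < n" using finite_nat_set_iff_bounded[of "fv ph"] finite_fv by auto
 have "computable_set (godel ` {ph})" by (rule computable_finite) simp
 then obtain Ga0 where Ga0: "Ga0 <= Ga" "handled T Ga0 Ga {ph} 0 (map et [0..<n])"
  using task[of "{ph}" 0 "map et [0..<n]"] n by auto
 have "sb (%i. cn (map et [0..<n] ! i)) ph = sb (%u. cn (et u)) ph" using n by (intro sb_cong) auto
 hence inst: "inst {ph} (map et [0..<n]) = {sb (%u. cn (et u)) ph}" by (simp add: inst_def)
 from Ga0(2) consider "inst {ph} (map et [0..<n]) <= Ga" | q where "q <= {ph}" "~con T (Ga0 Un inst q (map et [0..<n]))"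
  unfolding handled_def by auto
 thus ?thesis
 proof cases
  case 2
  have "Ga0 Un inst q (map et [0..<n]) <= insert (sb (%u. cn (et u)) ph) Ga" using inst 2(1) Ga0(1) unfolding inst_def by blast
  hence "~con T (insert (sb (%u. cn (et u)) ph) Ga)" using 2(2) unfolding con_def by (meson prv_mono)
  thus ?thesis using prv_Neg by blast
 qed (auto simp: inst intro: prv.asm)
qed

lemma prv_instances:
 assumes "!!j. prv T Ga (sb (%u. cn ((et(v := j)) u)) ph)" and sat: "!!et. prv T Ga (sb (%u. cn (et u)) ph) <-> sat term_model (r o et) ph"
 shows "prv T Ga (All (2 * v) (sb ((%u. cn (et u))(v := 2 * v)) ph))"
proof -
 obtain n where n: "ALL i:insert v (fv ph). i < n" using finite_nat_set_iff_bounded[of "insert v (fv ph)"] finite_fv by auto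
 define p where "p = insert (Neg ph) ((%i. Equ i (n + i)) ` ({..<n} - {v}))"
 define as where "as = map et [0..<n]"
 have "computable_set (godel ` p)" by (rule computable_finite) (simp add: p_def)
 moreover have "fv psi <= {..<n + length as}" if "psi:p" for psi using that n by (force simp: p_def as_def)
 ultimately obtain Ga0 where Ga0: "Ga0 <= Ga" "bounded Ga0" "handled T Ga0 Ga p n as" using task by metis
 from Ga0(3) consider xs where "length xs = n" "inst p (xs @ as) <= Ga"
  | q where "q <= p" "ALL xs. length xs = n --> ~con T (Ga0 Un inst q (xs @ as))"
  unfolding handled_def by blast
 thus ?thesis
 proof cases
  case 1
  have "r (xs ! i) = r (et i)" if "i < n" "i ~= v" for i
  proof -
   have "sb (%i. cn ((xs @ as) ! i)) (Equ i (n + i)) : inst p (xs @ as)" unfolding inst_def p_def using that by blast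
   thus ?thesis using 1 that unfolding r_eq by (auto simp: nth_append as_def intro: prv.asm)
  qed
  hence "sat term_model (r o (%i. (xs @ as) ! i)) ph <-> sat term_model (r o (et(v := xs ! v))) ph"
   using n 1(1) by (intro sat_cong) (auto simp: nth_append)
  hence "prv T Ga (sb (%i. cn ((xs @ as) ! i)) ph)" using assms by metis
  moreover have "sb (%i. cn ((xs @ as) ! i)) (Neg ph) : inst p (xs @ as)" unfolding inst_def p_def by blast
  hence "prv T Ga (Neg (sb (%i. cn ((xs @ as) ! i)) ph))" using 1(2) by (auto intro: prv.asm)
  ultimately show ?thesis using con unfolding con_def by blast
 next
  case 2
  obtain m where m: "!!ga. ga:Ga0 ==> fv ga <= cn ` {..<m}" using Ga0(2) by (auto simp: bounded_def)
  obtain N where N: "m < N" "!!i. i < n ==> et i < N"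
   using finite_nat_set_iff_bounded[of "insert m (et ` {..<n})"] by auto
  \<comment> \<open>If the type is refuted at all tuples, then also at \<open>et\<close> with a
    fresh constant \<open>N\<close> in place \<open>v\<close>. So \<open>Ga0\<close> proves
    \<open>ph\<close> of \<open>N\<close>; generalizing over \<open>N\<close> and renaming it to the
    bound variable \<open>2 * v\<close> gives the universal formula.\<close>
  define tht where "tht i = (if i = v then N else if i < n then et i else 0)" for i
  let ?psi = "sb (%i. cn (tht i)) ph"
  let ?xs = "map tht [0..<n]"
  have "prv T (insert (Neg ?psi) Ga0) de" if de: "de:Ga0 Un inst q (?xs @ as)" for de
  proof (cases "de:Ga0")
   case False
   then obtain ch where ch: "ch:p" "de = sb (%i. cn ((?xs @ as) ! i)) ch" using de 2(1) by (auto simp: inst_def)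
   show ?thesis
   proof (cases "ch = Neg ph")
    case True
    have "de = Neg ?psi" unfolding ch(2) True using n by (auto simp: nth_append intro!: sb_cong)
    thus ?thesis by (auto intro: prv.asm)
   next
    case False
    then obtain i where "i < n" "i ~= v" "ch = Equ i (n + i)" using ch(1) by (auto simp: p_def)
    hence "de = Equ (cn (et i)) (cn (et i))" unfolding ch(2) by (auto simp: nth_append as_def tht_def)
    thus ?thesis by (auto intro: prv.ax deriv.eq_refl)
   qed
  qed (auto intro: prv.asm)
  moreover have "~con T (Ga0 Un inst q (?xs @ as))" using 2(2) by simp
  ultimately have "prv T (insert (Neg ?psi) Ga0) ch" for ch by (rule prv_cut[OF not_con_prv, rotated])
  hence "prv T Ga0 ?psi" by (intro prv_contra) (auto simp: con_def)
  hence "prv T Ga0 (All (cn N) ?psi)" by (rule prv_Gen) (use m N(1) in fastforce)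
  moreover have "free_for (2 * v) (cn N) ?psi"
   by (rule free_for_bound) (use N(2) N(1) in "auto simp: tht_def split: if_splits")
  ultimately have "prv T Ga0 (subst (cn N) (2 * v) ?psi)" by (rule prv.mp[OF prv.ax[OF deriv.A4], rotated])
  moreover have "subst (cn N) (2 * v) ?psi = sb ((%u. cn (et u))(v := 2 * v)) ph"
   unfolding subst_sb_const using n N(2) by (intro sb_cong) (force simp: tht_def)
  moreover have odd: "2 * v ~: cn ` {..<m}" by (auto, presburger)
  ultimately have "prv T Ga0 (All (2 * v) (sb ((%u. cn (et u))(v := 2 * v)) ph))"
   using m odd by (intro prv_Gen) (simp, blast)
  thus ?thesis using Ga0(1) by (rule prv_mono)
 qed
qed

lemma sat_term_model: "prv T Ga (sb (%u. cn (et u)) ph) <-> sat term_model (r o et) ph"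
proof (induction ph arbitrary: et)
 case (Mem i j)
 show ?case by (simp add: mem_term_model)
next
 case (Equ i j)
 show ?case by (simp add: r_eq)
next
 case (Neg ph)
 have "prv T Ga (Neg (sb (%u. cn (et u)) ph)) <-> ~prv T Ga (sb (%u. cn (et u)) ph)"
  using con complete[of et ph] unfolding con_def by blast
 thus ?case using Neg[of et] by simp
next
 case (Imp ph psi)
 let ?ph = "sb (%u. cn (et u)) ph" and ?psi = "sb (%u. cn (et u)) psi"
 have "prv T Ga (Imp ?ph ?psi)" if "prv T Ga (Neg ?ph)"
 proof (rule deduction[OF not_con_prv])
  have "prv T (insert ?ph Ga) (Neg ?ph)" using that by (rule prv_mono) blast
  thus "~con T (insert ?ph Ga)" unfolding con_def by (blast intro: prv.asm)
 qed
 hence "prv T Ga (Imp ?ph ?psi) <-> (prv T Ga ?ph --> prv T Ga ?psi)"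
  using complete[of et ph] by (blast intro: weaken prv.mp)
 thus ?case using Imp by simp
next
 case (All v ph)
 let ?si = "(%u. cn (et u))(v := 2 * v)"
 have "prv T Ga (sb (%u. cn ((et(v := j)) u)) ph)" if "prv T Ga (All (2 * v) (sb ?si ph))" for j
 proof -
  have "prv T Ga (subst (2 * v) (cn j) (sb ?si ph))" using prv.mp[OF prv.ax[OF deriv.A4[OF free_for_const]] that] .
  moreover have "subst (2 * v) (cn j) (sb ?si ph) = sb (%u. if ?si u = 2 * v then cn j else ?si u) ph"
   by (rule subst_sb) auto
  moreover have "... = sb (%u. cn ((et(v := j)) u)) ph" by (rule sb_cong) (auto, presburger)
  ultimately show ?thesis by simp
 qed
 hence "prv T Ga (All (2 * v) (sb ?si ph)) <-> (ALL j. prv T Ga (sb (%u. cn ((et(v := j)) u)) ph))"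
  using prv_instances[OF _ All.IH, of et v] by blast
 moreover have "r o et(v := j) = (r o et)(v := r j)" for j by auto
 ultimately show ?case by (simp only: sb.simps All.IH sat.simps carr_term_model ball_simps)
qed

lemma computably_saturated_term_model: "computably_saturated term_model"
 unfolding computably_saturated_def
proof (intro allI impI, elim conjE)
 fix bs k p
 assume bs: "set bs <= carr term_model" and fv: "ALL ph:p. fv ph <= {..<k + length bs}" and p: "computable_set (godel ` p)"
  and fin: "ALL q<=p. finite q --> (EX xs. length xs = k & set xs <= carr term_model & realizes term_model bs xs q)"
 obtain as where as: "bs = map r as" using bs by (metis carr_term_model ex_map_conv subsetD imageE)
 have realizes: "realizes term_model bs (map r xs) q <-> (ALL ph:inst q (xs @ as). prv T Ga ph)"
  if "length xs = k" "q <= p" for xs q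
 proof -
  have "sat term_model ((!) (map r xs @ bs)) ph <-> prv T Ga (sb (%i. cn ((xs @ as) ! i)) ph)" if "ph:q" for ph
  proof -
   have "sat term_model ((!) (map r xs @ bs)) ph <-> sat term_model (r o (%i. (xs @ as) ! i)) ph"
    using fv `ph : q` `q <= p` `length xs = k` unfolding as by (intro sat_cong) (fastforce simp flip: map_append)
   thus ?thesis by (simp add: sat_term_model)
  qed
  thus ?thesis by (simp add: realizes_def inst_def)
 qed
 obtain Ga0 where Ga0: "Ga0 <= Ga" "handled T Ga0 Ga p k as" using task[OF p, of k as] fv as by auto
 then consider xs where "length xs = k" "inst p (xs @ as) <= Ga"
  | q where "q <= p" "finite q" "ALL xs. length xs = k --> ~con T (Ga0 Un inst q (xs @ as))"
  unfolding handled_def by blast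
 thus "EX xs. length xs = k & set xs <= carr term_model & realizes term_model bs xs p"
 proof cases
  case 1
  thus ?thesis using realizes[OF 1(1) subset_refl] by (intro exI[of _ "map r xs"]) (auto intro: prv.asm)
 next
  case 2
  then obtain ys where ys: "length ys = k" "set ys <= carr term_model" "realizes term_model bs ys q" using fin by blast
  obtain xs where xs: "ys = map r xs" using ys(2) by (metis carr_term_model ex_map_conv subsetD imageE)
  hence "prv T Ga ph" if "ph:Ga0 Un inst q (xs @ as)" for ph
   using realizes[of xs q] 2(1) ys that Ga0(1) by (auto intro: prv.asm)
  moreover have "~con T (Ga0 Un inst q (xs @ as))" using 2(3) xs ys(1) by simp
  ultimately have "prv T Ga ph" for ph by (rule prv_cut[OF not_con_prv, rotated])
  thus ?thesis using con unfolding con_def by blast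
 qed
qed

lemma term_model_models:
 assumes "!!ph. ph:A ==> deriv T (ren (%i. 2 * i) ph)"
 shows "is_model term_model A"
 unfolding is_model_def
proof (intro conjI ballI allI impI)
 show "is_struct term_model" by (auto simp: is_struct_def term_model_def)
 fix ph and e :: "nat => nat" assume ph: "ph:A" and e: "range e <= carr term_model"
 have "e = r o (inv r o e)" using e by (intro ext) (simp add: f_inv_into_f subset_iff)
 then obtain et where "e = r o et" ..
 thus "sat term_model e ph" using sat_term_model prv.ax[OF instantiate[OF assms[OF ph]]] by metis
qed

end

theorem computably_saturated_model_exists:
 assumes "consistent T"
 obtains M :: "nat struct" where "is_model M T" "computably_saturated M"
proof -
 obtain Ga where "con (ren (%i. 2 * i) ` T) Ga"
  "!!p k as. computable_set (godel ` p) ==> (!!ph. ph : p ==> fv ph <= {..<k + length as}) ==>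
   EX Ga0<=Ga. bounded Ga0 & handled (ren (%i. 2 * i) ` T) Ga0 Ga p k as"
  by (rule saturated_theory[OF consistent_double[OF assms]]) blast
 then interpret saturated "ren (%i. 2 * i) ` T" Ga by (rule saturated.intro)
 show ?thesis
  by (rule that[OF term_model_models computably_saturated_term_model]) (auto intro: deriv.hyp)
qed

theorem theorem2:
  assumes "infinite (UNIV :: 'a set)"
    and "consistent zfc"
  shows "multiverse (countable_saturated_models :: 'a struct set) \<and>
    realizability_axiom (countable_saturated_models :: 'a struct set) \<and>
    forcing_extension_axiom (countable_saturated_models :: 'a struct set) \<and>
    class_forcing_extension_axiom (countable_saturated_models :: 'a struct set) \<and>
    countability_axiom (countable_saturated_models :: 'a struct set) \<and>
    wellfoundedness_mirage_axiom (countable_saturated_models :: 'a struct set) \<and>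
    reverse_ultrapower_axiom (countable_saturated_models :: 'a struct set) \<and>
    strong_reverse_ultrapower_axiom (countable_saturated_models :: 'a struct set) \<and>
    reverse_embedding_axiom (countable_saturated_models :: 'a struct set)"
proof -
 obtain M :: "nat struct" where M: "is_model M zfc" "computably_saturated M"
  using computably_saturated_model_exists[OF assms(2)] by blast
 obtain h :: "nat => 'a" and B where B: "struct_iso h M B" "mem B <= carr B \<times> carr B" "countable (carr B)"
  using countable_copy[OF assms(1), of M] by blast
 hence "B:CSM"
  using M by (simp add: countable_saturated_models_def is_model_iso computably_saturated_iso)
 hence "multiverse (CSM :: 'a struct set)"
  by (auto simp: multiverse_def countable_saturated_models_def)
 thus ?thesis
  by (intro conjI realizability_saturated forcing_extension_saturated class_forcing_extension_saturated
    countability_saturated wellfoundedness_mirage_saturated reverse_ultrapower_saturated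
    strong_reverse_ultrapower_saturated reverse_embedding_saturated assms(1))
qed

end
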